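(* Let $K$ be a $\Sigma\Delta\partial$-field of characteristic zero such that $K^{\Sigma\Delta}$ is an algebraically closed field. Then for every $\Sigma\Delta$-linear system over $K$ there exists a $\partial$-Picard-Vessiot extension.
   Context: All rings are commutative and all fields have characteristic zero. $\Sigma=\{\sigma_i\}$ and $\Delta=\{\delta_i\}$ are arbitrary sets of symbols; one of them may be empty, but not both. A $\Sigma\Delta\partial$-ring is a ring $R$ together with a ring automorphism $\sigma:R\to R$ for every $\sigma\in\Sigma$, a derivation $\delta:R\to R$ for every $\delta\in\Delta$ and a derivation $\partial:R\to R$, such that all these operators commute pairwise. A $\Sigma\Delta\partial$-field is a $\Sigma\Delta\partial$-ring whose underlying ring is a field. Morphisms of $\Sigma\Delta\partial$-rings are ring morphisms commuting with all operators. The $\Sigma\Delta$-constants of $R$ are $R^{\Sigma\Delta}=\{r\in R \mid \sigma(r)=r\ \forall \sigma\in\Sigma,\ \delta(r)=0\ \forall\delta\in\Delta\}$. A $\Sigma\Delta$-linear system over $K$ is a system of equations $$\sigma_i(Y)=A_iY,\quad A_i\in \mathrm{GL}_n(K),\ \sigma_i\in\Sigma;\qquad \delta_i(Y)=B_iY,\quad B_i\in K^{n\times n},\ \delta_i\in\Delta,$$ satisfying the integrability conditions $$\sigma_i(A_j)A_i=\sigma_j(A_i)A_j,\qquad \sigma_i(B_j)A_i=\delta_j(A_i)+A_iB_j,\qquad \delta_i(B_j)+B_jB_i=\delta_j(B_i)+B_iB_j$$ for all $\sigma_i,\sigma_j\in\Sigma$ and all $\delta_i,\delta_j\in\Delta$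 (whenever the symbols involved make sense). A $\Sigma$-ring is a ring with an automorphism for every $\sigma\in\Sigma$; it is $\Sigma$-simple if it is nonzero and its only ideals stable under all $\sigma\in\Sigma$ are $0$ and the whole ring. A $\Sigma$-pseudo field is a Noetherian $\Sigma$-simple $\Sigma$-ring in which every non-zero divisor is invertible. A $\Sigma$-pseudo $\Delta\partial$-field is a $\Sigma\Delta\partial$-ring $L$ such that $(L,\Sigma)$ is a $\Sigma$-pseudo field (if $\Sigma=\emptyset$ this is a field). A $\partial$-Picard-Vessiot extension for a $\Sigma\Delta$-linear system $\sigma_i(Y)=A_iY$ ($\sigma_i\in\Sigma$), $\delta_i(Y)=B_iY$ ($\delta_i\in\Delta$) over $K$, with $A_i\in\mathrm{GL}_n(K)$ and $B_i\in K^{n\times n}$, is a $\Sigma$-pseudo $\Delta\partial$-field extension $L$ of $K$ such that (i) there exists $Z\in\mathrm{GL}_n(L)$ with $\sigma_i(Z)=A_iZ$ for all $\sigma_i\in\Sigma$, $\delta_i(Z)=B_iZ$ for all $\delta_i\in\Delta$, and $L=K\langle Z_{ij};\ 1\le i,j\le n\rangle_\partial$, where the latter denotes the smallest $K$-$\partial$-subalgebra of $L$ (i.e. $K$-subalgebra stable under $\partial$) which contains all $Z_{ij}$ and is closed under taking inverses; (ii) $L^{\Sigma\Delta}=K^{\Sigma\Delta}$. *)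

theory Defs
  imports
    "HOL-Algebra.Algebraic_Closure"
    "HOL-Algebra.Ring_Divisibility"
    "Jordan_Normal_Form.Matrix"
begin

(* The operator symbols are drawn from the sets S :: 's set (automorphisms) and D :: 'd set
   (derivations). Operators attached to symbols outside S and D are never referred to, and all
   operators are relevant only on the carrier. *)

record ('a, 's, 'd) sdp_struct = "'a ring" +
  shift :: "'s \<Rightarrow> 'a \<Rightarrow> 'a"
  deltad :: "'d \<Rightarrow> 'a \<Rightarrow> 'a"
  pard :: "'a \<Rightarrow> 'a"

definition derivation :: "('a, 'm) ring_scheme \<Rightarrow> ('a \<Rightarrow> 'a) \<Rightarrow> bool" where
  "derivation R d \<longleftrightarrow>
     d \<in> carrier R \<rightarrow> carrier R \<and>
     (\<forall>x \<in> carrier R. \<forall>y \<in> carrier R.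
        d (x \<oplus>\<^bsub>R\<^esub> y) = d x \<oplus>\<^bsub>R\<^esub> d y \<and>
        d (x \<otimes>\<^bsub>R\<^esub> y) = (d x \<otimes>\<^bsub>R\<^esub> y) \<oplus>\<^bsub>R\<^esub> (x \<otimes>\<^bsub>R\<^esub> d y))"

locale sdp_ring = cring R
  for S :: "'s set" and D :: "'d set" and R :: "('a, 's, 'd, 'm) sdp_struct_scheme" (structure) +
  assumes shift_auto: "s \<in> S \<Longrightarrow> shift R s \<in> ring_iso R R"
    and deltad_derivation: "d \<in> D \<Longrightarrow> derivation R (deltad R d)"
    and pard_derivation: "derivation R (pard R)"
    and shift_shift: "\<lbrakk>s \<in> S; t \<in> S; x \<in> carrier R\<rbrakk> \<Longrightarrow>
          shift R s (shift R t x) = shift R t (shift R s x)"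
    and shift_deltad: "\<lbrakk>s \<in> S; d \<in> D; x \<in> carrier R\<rbrakk> \<Longrightarrow>
          shift R s (deltad R d x) = deltad R d (shift R s x)"
    and shift_pard: "\<lbrakk>s \<in> S; x \<in> carrier R\<rbrakk> \<Longrightarrow>
          shift R s (pard R x) = pard R (shift R s x)"
    and deltad_deltad: "\<lbrakk>d \<in> D; e \<in> D; x \<in> carrier R\<rbrakk> \<Longrightarrow>
          deltad R d (deltad R e x) = deltad R e (deltad R d x)"
    and deltad_pard: "\<lbrakk>d \<in> D; x \<in> carrier R\<rbrakk> \<Longrightarrow>
          deltad R d (pard R x) = pard R (deltad R d x)"

locale sdp_field = sdp_ring S D R + field R
  for S :: "'s set" and D :: "'d set" and R :: "('a, 's, 'd, 'm) sdp_struct_scheme" (structure)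

definition char_zero :: "('a, 'm) ring_scheme \<Rightarrow> bool" where
  "char_zero R \<longleftrightarrow> (\<forall>n::nat. 0 < n \<longrightarrow> [n] \<cdot>\<^bsub>R\<^esub> \<one>\<^bsub>R\<^esub> \<noteq> \<zero>\<^bsub>R\<^esub>)"

definition sdp_hom ::
  "'s set \<Rightarrow> 'd set \<Rightarrow> ('a, 's, 'd, 'm) sdp_struct_scheme \<Rightarrow> ('b, 's, 'd, 'n) sdp_struct_scheme
     \<Rightarrow> ('a \<Rightarrow> 'b) set" where
  "sdp_hom S D R R' = {h \<in> Ring.ring_hom R R'. \<forall>x \<in> carrier R.
     (\<forall>s \<in> S. h (shift R s x) = shift R' s (h x)) \<and>
     (\<forall>d \<in> D. h (deltad R d x) = deltad R' d (h x)) \<and>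
     h (pard R x) = pard R' (h x)}"

definition sd_constants ::
  "'s set \<Rightarrow> 'd set \<Rightarrow> ('a, 's, 'd, 'm) sdp_struct_scheme \<Rightarrow> 'a set" where
  "sd_constants S D R = {r \<in> carrier R.
     (\<forall>s \<in> S. shift R s r = r) \<and> (\<forall>d \<in> D. deltad R d r = \<zero>\<^bsub>R\<^esub>)}"

definition sigma_simple :: "'s set \<Rightarrow> ('a, 's, 'd, 'm) sdp_struct_scheme \<Rightarrow> bool" where
  "sigma_simple S R \<longleftrightarrow>
     carrier R \<noteq> {\<zero>\<^bsub>R\<^esub>} \<and>
     (\<forall>I. ideal I R \<and> (\<forall>s \<in> S. shift R s ` I \<subseteq> I) \<longrightarrow> I = {\<zero>\<^bsub>R\<^esub>} \<or> I = carrier R)"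

definition pseudo_field :: "'s set \<Rightarrow> 'd set \<Rightarrow> ('a, 's, 'd, 'm) sdp_struct_scheme \<Rightarrow> bool" where
  "pseudo_field S D L \<longleftrightarrow>
     sdp_ring S D L \<and> noetherian_ring L \<and> sigma_simple S L \<and>
     (\<forall>x \<in> carrier L.
        (\<forall>y \<in> carrier L. x \<otimes>\<^bsub>L\<^esub> y = \<zero>\<^bsub>L\<^esub> \<longrightarrow> y = \<zero>\<^bsub>L\<^esub>) \<longrightarrow> x \<in> Units L)"

(* The matrix arithmetic of the Matrix theory is tied to type-class rings; here the entries are
   elements of a ring with an explicit carrier. *)
definition mat_ring :: "('a, 'm) ring_scheme \<Rightarrow> nat \<Rightarrow> 'a mat ring" where
  "mat_ring R n = \<lparr>
     carrier = {M \<in> carrier_mat n n. elements_mat M \<subseteq> carrier R},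
     monoid.mult = (\<lambda>M N. mat n n (\<lambda>(i, j). \<Oplus>\<^bsub>R\<^esub>k \<in> {..<n}. M $$ (i, k) \<otimes>\<^bsub>R\<^esub> N $$ (k, j))),
     one = mat n n (\<lambda>(i, j). if i = j then \<one>\<^bsub>R\<^esub> else \<zero>\<^bsub>R\<^esub>),
     zero = mat n n (\<lambda>_. \<zero>\<^bsub>R\<^esub>),
     add = (\<lambda>M N. mat n n (\<lambda>(i, j). M $$ (i, j) \<oplus>\<^bsub>R\<^esub> N $$ (i, j)))\<rparr>"

abbreviation GL :: "nat \<Rightarrow> ('a, 'm) ring_scheme \<Rightarrow> 'a mat set" where
  "GL n R \<equiv> Units (mat_ring R n)"

(* The system shift s Y = A s Y (s in S), deltad d Y = B d Y (d in D), with its integrability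
   conditions. *)
definition linear_system ::
  "'s set \<Rightarrow> 'd set \<Rightarrow> ('a, 's, 'd, 'm) sdp_struct_scheme \<Rightarrow> nat
     \<Rightarrow> ('s \<Rightarrow> 'a mat) \<Rightarrow> ('d \<Rightarrow> 'a mat) \<Rightarrow> bool" where
  "linear_system S D K n A B \<longleftrightarrow>
     (\<forall>s \<in> S. A s \<in> GL n K) \<and>
     (\<forall>d \<in> D. B d \<in> carrier (mat_ring K n)) \<and>
     (\<forall>s \<in> S. \<forall>t \<in> S.
        map_mat (shift K s) (A t) \<otimes>\<^bsub>mat_ring K n\<^esub> A s =
        map_mat (shift K t) (A s) \<otimes>\<^bsub>mat_ring K n\<^esub> A t) \<and>
     (\<forall>s \<in> S. \<forall>d \<in> D.
        map_mat (shift K s) (B d) \<otimes>\<^bsub>mat_ring K n\<^esub> A s =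
        map_mat (deltad K d) (A s) \<oplus>\<^bsub>mat_ring K n\<^esub> (A s \<otimes>\<^bsub>mat_ring K n\<^esub> B d)) \<and>
     (\<forall>d \<in> D. \<forall>e \<in> D.
        map_mat (deltad K d) (B e) \<oplus>\<^bsub>mat_ring K n\<^esub> (B e \<otimes>\<^bsub>mat_ring K n\<^esub> B d) =
        map_mat (deltad K e) (B d) \<oplus>\<^bsub>mat_ring K n\<^esub> (B d \<otimes>\<^bsub>mat_ring K n\<^esub> B e))"

(* Here h is the structure map of the algebra L over K, and Z a set of generators. *)
definition par_generated ::
  "('a, 's, 'd, 'm) sdp_struct_scheme \<Rightarrow> ('b, 's, 'd, 'n) sdp_struct_scheme \<Rightarrow> ('a \<Rightarrow> 'b)
     \<Rightarrow> 'b set \<Rightarrow> 'b set" where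
  "par_generated K L h Z = \<Inter> {T. subring T L \<and> h ` carrier K \<subseteq> T \<and> pard L ` T \<subseteq> T \<and>
     Z \<subseteq> T \<and> (\<forall>x \<in> T \<inter> Units L. inv\<^bsub>L\<^esub> x \<in> T)}"

(* The extension is given by a morphism h from K to L; it is automatically injective, since K is a
   field and L is nonzero. *)
definition picard_vessiot ::
  "'s set \<Rightarrow> 'd set \<Rightarrow> ('a, 's, 'd, 'm) sdp_struct_scheme \<Rightarrow> nat
     \<Rightarrow> ('s \<Rightarrow> 'a mat) \<Rightarrow> ('d \<Rightarrow> 'a mat)
     \<Rightarrow> ('b, 's, 'd, 'n) sdp_struct_scheme \<Rightarrow> ('a \<Rightarrow> 'b) \<Rightarrow> bool" where
  "picard_vessiot S D K n A B L h \<longleftrightarrow>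
     pseudo_field S D L \<and>
     h \<in> sdp_hom S D K L \<and>
     (\<exists>Z \<in> GL n L.
        (\<forall>s \<in> S. map_mat (shift L s) Z = map_mat h (A s) \<otimes>\<^bsub>mat_ring L n\<^esub> Z) \<and>
        (\<forall>d \<in> D. map_mat (deltad L d) Z = map_mat h (B d) \<otimes>\<^bsub>mat_ring L n\<^esub> Z) \<and>
        carrier L = par_generated K L h (elements_mat Z)) \<and>
     sd_constants S D L = h ` sd_constants S D K"

end

theory Submission
  imports Defs "HOL-Algebra.Algebraic_Closure_Type" "HOL-Library.Poly_Mapping" "HOL-Library.Countable"
    "Jordan_Normal_Form.Determinant"
begin

text \<open>
  Let \<open>R\<close> be the ring of differential polynomials over \<open>K\<close> in the entries of two matrices \<open>X\<close> and \<open>Y\<close>,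
  where \<open>Y\<close> stands for the inverse of \<open>X\<close>, with the operators that make \<open>X\<close> a fundamental matrix; it is
  the union of the subrings \<open>R\<^sub>i\<close> generated by the derivatives of order at most \<open>i\<close>. A maximal invariant
  ideal of \<open>R\<^sub>0\<close> is prolonged to \<open>R\<^sub>1\<close>, \<open>R\<^sub>2\<close>, and so on, compatibly with the derivation: the point
  is that the new entries of \<open>Y \<partial>X\<close> have their \<open>\<sigma>\<close>-differences and \<open>\<delta>\<close>-derivatives in the previous ring,
  so modulo a maximal ideal each of them is either already there or transcendental, while homomorphisms into
  dual numbers show that the ideal generated by the previous one and its derivatives is proper.

  Each quotient is simple, and a specialisation argument shows that its constants are those of \<open>K\<close>. The base
  ring is Noetherian, which gives a prime annihilator, and a finite orthogonal subset of its orbit shows that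
  the total ring of fractions of the union is a pseudo field without new constants. It is generated by a
  fundamental matrix because \<open>det X\<close> is invertible.
\<close>

hide_const (open) Polynomials.degree

section \<open>Subrings and ideals of a ring type\<close>

text \<open>Subrings and ideals are subsets of one ring type and quotients are never formed:
  statements about \<open>A/N\<close> are congruences modulo \<open>N\<close>. The obstacle is that
  the finiteness arguments for constants and for annihilators need finitely many generators, which
  differential polynomials do not have, while the ideal must also be closed under
  \<open>par\<close>, and maximal invariant ideals need not be. Hence the filtration by order. What
  has to be carried along is that an ideal and its derivatives do not generate the unit ideal in the
  next order. A homomorphism into dual numbers is a point with a tangent vector; reading its
  infinitesimal part as the value of the next derivative turns it into a point of the next ring that
  kills both. Characteristic zero enters mainly through the separability of minimal relations, the
  division by a degree when a sum or an integral is solved for, and the stability of the nilradical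
  under derivations. A separate difficulty is one of types: the construction needs the field as a
  type, while the extension must live in the type of the elements of \<open>K\<close>.\<close>

definition is_subring :: "'r::comm_ring_1 set \<Rightarrow> bool" where
  "is_subring A \<longleftrightarrow> 1 \<in> A \<and> (\<forall>x\<in>A. \<forall>y\<in>A. x - y \<in> A \<and> x * y \<in> A)"

definition is_ideal :: "'r::comm_ring_1 set \<Rightarrow> 'r set \<Rightarrow> bool" where
  "is_ideal A N \<longleftrightarrow> N \<subseteq> A \<and> 0 \<in> N \<and> (\<forall>x\<in>N. \<forall>y\<in>N. x + y \<in> N) \<and> (\<forall>a\<in>A. \<forall>x\<in>N. a * x \<in> N)"

definition is_prime :: "'r::comm_ring_1 set \<Rightarrow> 'r set \<Rightarrow> bool" where
  "is_prime A Q \<longleftrightarrow> is_ideal A Q \<and> 1 \<notin> Q \<and> (\<forall>x\<in>A. \<forall>y\<in>A. x * y \<in> Q \<longrightarrow> x \<in> Q \<or> y \<in> Q)"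

text \<open>Only the values on \<open>A\<close> matter; outside \<open>A\<close> the map is
  arbitrary, so restricting to a smaller subring costs nothing.\<close>

definition hom_on :: "'r::comm_ring_1 set \<Rightarrow> ('r \<Rightarrow> 't::comm_ring_1) \<Rightarrow> bool" where
  "hom_on A \<phi> \<longleftrightarrow> \<phi> 1 = 1 \<and> (\<forall>x\<in>A. \<forall>y\<in>A. \<phi> (x + y) = \<phi> x + \<phi> y \<and> \<phi> (x * y) = \<phi> x * \<phi> y)"

definition is_deriv :: "('r::comm_ring_1 \<Rightarrow> 'r) \<Rightarrow> bool" where
  "is_deriv d \<longleftrightarrow> (\<forall>x y. d (x + y) = d x + d y \<and> d (x * y) = d x * y + x * d y)"

definition polys_over :: "'r::comm_ring_1 set \<Rightarrow> 'r poly set" where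
  "polys_over A = {p. \<forall>i. poly.coeff p i \<in> A}"

text \<open>The subring \<open>A[x]\<close> as a set of values: a relation of \<open>x\<close> over
  \<open>A\<close> modulo an ideal is a polynomial over \<open>A\<close> whose value at
  \<open>x\<close> lies in that ideal.\<close>

definition adj :: "'r::comm_ring_1 set \<Rightarrow> 'r \<Rightarrow> 'r set" where
  "adj A x = (\<lambda>p. poly p x) ` polys_over A"

text \<open>Generators are adjoined one at a time, so that statements about finitely generated rings
  follow from the case of one generator by induction on the list.\<close>

definition adjoin :: "'r::comm_ring_1 set \<Rightarrow> 'r list \<Rightarrow> 'r set" where
  "adjoin A xs = foldl adj A xs"

lemma is_subringD:
  assumes "is_subring A"
  shows "0 \<in> A" "1 \<in> A" "x \<in> A \<Longrightarrow> - x \<in> A" "x \<in> A \<Longrightarrow> y \<in> A \<Longrightarrow> x + y \<in> A"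
    "x \<in> A \<Longrightarrow> y \<in> A \<Longrightarrow> x - y \<in> A" "x \<in> A \<Longrightarrow> y \<in> A \<Longrightarrow> x * y \<in> A"
    "x \<in> A \<Longrightarrow> x ^ n \<in> A" "of_nat n \<in> A"
proof -
  show 1: "1 \<in> A" and d: "x \<in> A \<Longrightarrow> y \<in> A \<Longrightarrow> x - y \<in> A" and m: "x \<in> A \<Longrightarrow> y \<in> A \<Longrightarrow> x * y \<in> A" for x y
    using assms by (auto simp: is_subring_def)
  show 0: "0 \<in> A" using d[OF 1 1] by simp
  show u: "x \<in> A \<Longrightarrow> - x \<in> A" for x using d[OF 0] by fastforce
  show a: "x \<in> A \<Longrightarrow> y \<in> A \<Longrightarrow> x + y \<in> A" for x y using d[OF _ u, of x y] by simp
  show "x \<in> A \<Longrightarrow> x ^ n \<in> A" for x by (induction n) (auto intro: 1 m)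
  show "of_nat n \<in> A" by (induction n) (auto intro: 0 1 a)
qed

lemma is_subring_sum: "is_subring A \<Longrightarrow> (\<And>i. i \<in> I \<Longrightarrow> f i \<in> A) \<Longrightarrow> sum f I \<in> A"
  by (induction I rule: infinite_finite_induct) (auto intro: is_subringD)

lemma is_subring_UNIV [simp]: "is_subring UNIV"
  by (simp add: is_subring_def)

lemma is_idealD:
  assumes "is_ideal A N"
  shows "x \<in> N \<Longrightarrow> x \<in> A" "0 \<in> N" "x \<in> N \<Longrightarrow> y \<in> N \<Longrightarrow> x + y \<in> N" "a \<in> A \<Longrightarrow> x \<in> N \<Longrightarrow> a * x \<in> N"
    "a \<in> A \<Longrightarrow> x \<in> N \<Longrightarrow> x * a \<in> N"
  using assms by (auto simp: is_ideal_def mult.commute)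

lemma is_ideal_neg:
  assumes "is_subring A" "is_ideal A N"
  shows "x \<in> N \<Longrightarrow> - x \<in> N" "x \<in> N \<Longrightarrow> y \<in> N \<Longrightarrow> x - y \<in> N"
proof -
  show u: "x \<in> N \<Longrightarrow> - x \<in> N" for x
    using is_idealD(4)[OF assms(2), of "-1" x] is_subringD(2,3)[OF assms(1)] by simp
  show "x \<in> N \<Longrightarrow> y \<in> N \<Longrightarrow> x - y \<in> N"
    using is_idealD(3)[OF assms(2) _ u, of x y] by simp
qed

lemma is_ideal_sum: "is_ideal A N \<Longrightarrow> (\<And>i. i \<in> I \<Longrightarrow> f i \<in> N) \<Longrightarrow> sum f I \<in> N"
  by (induction I rule: infinite_finite_induct) (auto intro: is_idealD)

lemma is_ideal_Int: "is_ideal B N \<Longrightarrow> is_subring A \<Longrightarrow> A \<subseteq> B \<Longrightarrow> is_ideal A (N \<inter> A)"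
  unfolding is_ideal_def by (auto intro: is_subringD)

lemma hom_onD:
  assumes "hom_on A \<phi>"
  shows "\<phi> 1 = 1" "x \<in> A \<Longrightarrow> y \<in> A \<Longrightarrow> \<phi> (x + y) = \<phi> x + \<phi> y" "x \<in> A \<Longrightarrow> y \<in> A \<Longrightarrow> \<phi> (x * y) = \<phi> x * \<phi> y"
  using assms by (auto simp: hom_on_def)

lemma hom_on_more:
  assumes "is_subring A" "hom_on A \<phi>"
  shows "\<phi> 0 = 0" "x \<in> A \<Longrightarrow> \<phi> (- x) = - \<phi> x" "x \<in> A \<Longrightarrow> y \<in> A \<Longrightarrow> \<phi> (x - y) = \<phi> x - \<phi> y"
    "x \<in> A \<Longrightarrow> \<phi> (x ^ n) = \<phi> x ^ n"
proof -
  show 0: "\<phi> 0 = 0" using hom_onD(2)[OF assms(2), of 0 0] is_subringD(1)[OF assms(1)] by simp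
  show u: "x \<in> A \<Longrightarrow> \<phi> (- x) = - \<phi> x" for x
    using hom_onD(2)[OF assms(2), of x "- x"] is_subringD(3)[OF assms(1), of x] 0
    by (simp add: eq_neg_iff_add_eq_0 add.commute)
  show "x \<in> A \<Longrightarrow> y \<in> A \<Longrightarrow> \<phi> (x - y) = \<phi> x - \<phi> y"
    using hom_onD(2)[OF assms(2), of x "- y"] is_subringD(3)[OF assms(1), of y] u by simp
  show "x \<in> A \<Longrightarrow> \<phi> (x ^ n) = \<phi> x ^ n"
    by (induction n) (auto simp: hom_onD[OF assms(2)] is_subringD[OF assms(1)])
qed

lemma hom_on_sum:
  assumes "is_subring A" "hom_on A \<phi>" "\<And>i. i \<in> I \<Longrightarrow> f i \<in> A"
  shows "\<phi> (sum f I) = (\<Sum>i\<in>I. \<phi> (f i))"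
  using assms(3)
  by (induction I rule: infinite_finite_induct)
     (auto simp: hom_on_more[OF assms(1,2)] hom_onD[OF assms(2)] is_subring_sum[OF assms(1)])

lemma hom_on_subset: "hom_on B \<phi> \<Longrightarrow> A \<subseteq> B \<Longrightarrow> hom_on A \<phi>"
  by (auto simp: hom_on_def)

lemma is_derivD:
  assumes "is_deriv d"
  shows "d (x + y) = d x + d y" "d (x * y) = d x * y + x * d y" "d 0 = 0" "d 1 = 0" "d (- x) = - d x"
    "d (x - y) = d x - d y" "d (of_nat n) = 0"
proof -
  show a: "d (x + y) = d x + d y" and m: "d (x * y) = d x * y + x * d y" for x y
    using assms by (auto simp: is_deriv_def)
  show 0: "d 0 = 0" using a[of 0 0] by simp
  show 1: "d 1 = 0" using m[of 1 1] by simp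
  show u: "d (- x) = - d x" for x using a[of x "-x"] 0 by (simp add: eq_neg_iff_add_eq_0 add.commute)
  show "d (x - y) = d x - d y" using a[of x "- y"] u by simp
  show "d (of_nat n) = 0" by (induction n) (auto simp: 0 1 a)
qed

lemma is_deriv_sum: "is_deriv d \<Longrightarrow> d (sum f I) = (\<Sum>i\<in>I. d (f i))"
  by (induction I rule: infinite_finite_induct) (auto simp: is_derivD)

lemma is_deriv_power_Suc: "is_deriv d \<Longrightarrow> d (x ^ Suc n) = of_nat (Suc n) * x ^ n * d x"
proof (induction n)
  case (Suc n)
  have "d (x ^ Suc (Suc n)) = d x * x ^ Suc n + x * d (x ^ Suc n)"
    using is_derivD(2)[OF Suc.prems, of x "x ^ Suc n"] by simp
  then show ?case using Suc by (simp add: algebra_simps)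
qed (simp add: is_derivD)

subsection \<open>Polynomials with coefficients in a subring\<close>

lemma polys_overD: "p \<in> polys_over A \<Longrightarrow> poly.coeff p i \<in> A"
  by (simp add: polys_over_def)

lemma polys_over_mono: "A \<subseteq> B \<Longrightarrow> polys_over A \<subseteq> polys_over B"
  by (auto simp: polys_over_def)

lemma polys_over_closed:
  assumes "is_subring A"
  shows "p \<in> polys_over A \<Longrightarrow> q \<in> polys_over A \<Longrightarrow> p - q \<in> polys_over A"
    "p \<in> polys_over A \<Longrightarrow> q \<in> polys_over A \<Longrightarrow> p + q \<in> polys_over A"
    "p \<in> polys_over A \<Longrightarrow> q \<in> polys_over A \<Longrightarrow> p * q \<in> polys_over A"
    "a \<in> A \<Longrightarrow> p \<in> polys_over A \<Longrightarrow> Polynomial.smult a p \<in> polys_over A"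
    "a \<in> A \<Longrightarrow> Polynomial.monom a n \<in> polys_over A" "a \<in> A \<Longrightarrow> [:a:] \<in> polys_over A"
    "a \<in> A \<Longrightarrow> b \<in> A \<Longrightarrow> [:a, b:] \<in> polys_over A"
    "0 \<in> polys_over A" "1 \<in> polys_over A"
proof -
  note s = is_subringD[OF assms]
  show "p \<in> polys_over A \<Longrightarrow> q \<in> polys_over A \<Longrightarrow> p - q \<in> polys_over A"
    and "p \<in> polys_over A \<Longrightarrow> q \<in> polys_over A \<Longrightarrow> p + q \<in> polys_over A"
    and "a \<in> A \<Longrightarrow> p \<in> polys_over A \<Longrightarrow> Polynomial.smult a p \<in> polys_over A"
    by (auto simp: polys_over_def s)
  show "p \<in> polys_over A \<Longrightarrow> q \<in> polys_over A \<Longrightarrow> p * q \<in> polys_over A"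
    by (auto simp: polys_over_def coeff_mult intro!: is_subring_sum[OF assms] s)
  show "a \<in> A \<Longrightarrow> Polynomial.monom a n \<in> polys_over A" by (auto simp: polys_over_def s)
  show c: "a \<in> A \<Longrightarrow> [:a:] \<in> polys_over A" and "a \<in> A \<Longrightarrow> b \<in> A \<Longrightarrow> [:a, b:] \<in> polys_over A"
    and "0 \<in> polys_over A"
    for a b by (auto simp: polys_over_def s coeff_pCons split: nat.splits)
  show "1 \<in> polys_over A" using c[OF s(2)] by (simp add: one_pCons)
qed

lemma poly_in_subring:
  "is_subring A \<Longrightarrow> p \<in> polys_over A \<Longrightarrow> x \<in> A \<Longrightarrow> poly p x \<in> A"
  by (auto simp: poly_altdef intro!: is_subring_sum is_subringD dest: polys_overD)

lemma poly_in_ideal: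
  assumes "is_subring B" "is_ideal B N" "p \<in> polys_over N" "x \<in> B"
  shows "poly p x \<in> N"
  unfolding poly_altdef
  by (rule is_ideal_sum[OF assms(2)])
     (use assms in \<open>auto intro!: is_idealD(5)[OF assms(2)] is_subringD dest: polys_overD\<close>)

lemma adj_subring:
  assumes "is_subring A"
  shows "is_subring (adj A x)" "A \<subseteq> adj A x" "x \<in> adj A x"
proof -
  note c = polys_over_closed[OF assms]
  have "poly p x - poly q x \<in> adj A x" "poly p x * poly q x \<in> adj A x"
    if "p \<in> polys_over A" "q \<in> polys_over A" for p q
    using imageI[OF c(1)[OF that], of "\<lambda>p. poly p x"] imageI[OF c(3)[OF that], of "\<lambda>p. poly p x"]
    by (auto simp: adj_def)
  moreover have "1 \<in> adj A x" using c(9) by (auto simp: adj_def image_iff intro!: bexI[of _ 1])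
  ultimately show "is_subring (adj A x)" by (auto simp: is_subring_def adj_def)
  show "A \<subseteq> adj A x" using c(6) by (auto simp: adj_def image_iff intro!: bexI[of _ "[:a:]" for a])
  show "x \<in> adj A x" using c(7)[of 0 1] is_subringD[OF assms]
    by (auto simp: adj_def image_iff intro!: bexI[of _ "[:0, 1:]"])
qed

lemma adjI: "p \<in> polys_over A \<Longrightarrow> poly p x \<in> adj A x"
  by (simp add: adj_def)

lemma adj_least: "is_subring B \<Longrightarrow> A \<subseteq> B \<Longrightarrow> x \<in> B \<Longrightarrow> adj A x \<subseteq> B"
  using polys_over_mono[of A B] by (auto simp: adj_def intro!: poly_in_subring)

lemma adjoin_simps [simp]: "adjoin A [] = A" "adjoin A (x # xs) = adjoin (adj A x) xs"
  "adjoin A (xs @ ys) = adjoin (adjoin A xs) ys"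
  by (auto simp: adjoin_def)

lemma adjoin_subring:
  assumes "is_subring A"
  shows "is_subring (adjoin A xs)" "A \<subseteq> adjoin A xs" "set xs \<subseteq> adjoin A xs"
proof -
  have "is_subring (adjoin A xs) \<and> A \<subseteq> adjoin A xs \<and> set xs \<subseteq> adjoin A xs" using assms
  proof (induction xs arbitrary: A)
    case (Cons x xs)
    from Cons.IH[OF adj_subring(1)[OF Cons.prems, of x]] adj_subring(2,3)[OF Cons.prems, of x]
    show ?case by auto
  qed auto
  then show "is_subring (adjoin A xs)" "A \<subseteq> adjoin A xs" "set xs \<subseteq> adjoin A xs" by auto
qed

lemma adjoin_least: "is_subring B \<Longrightarrow> A \<subseteq> B \<Longrightarrow> set xs \<subseteq> B \<Longrightarrow> adjoin A xs \<subseteq> B"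
  by (induction xs arbitrary: A) (auto simp: adj_least)

lemma adjoin_induct [consumes 2, case_names base gen add mult]:
  assumes "is_subring A" "y \<in> adjoin A xs"
    and P: "\<And>a. a \<in> A \<Longrightarrow> P a" "\<And>x. x \<in> set xs \<Longrightarrow> P x"
      "\<And>a b. P a \<Longrightarrow> P b \<Longrightarrow> P (a + b)" "\<And>a b. P a \<Longrightarrow> P b \<Longrightarrow> P (a * b)"
  shows "P y"
proof -
  have "P (x - y)" if "P x" "P y" for x y
    using P(3)[OF that(1) P(4)[OF P(1)[of "-1"] that(2)]] is_subringD(2,3)[OF assms(1)] by simp
  then have "is_subring {x. P x}"
    using P is_subringD(2)[OF assms(1)] by (auto simp: is_subring_def)
  from adjoin_least[OF this, of A xs] P assms(2) show ?thesis by auto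
qed

lemma hom_on_eq_adjoin:
  assumes A: "is_subring A" and "hom_on (adjoin A xs) \<phi>" "hom_on (adjoin A xs) \<psi>"
    and "\<And>a. a \<in> A \<Longrightarrow> \<phi> a = \<psi> a" "\<And>x. x \<in> set xs \<Longrightarrow> \<phi> x = \<psi> x" and "y \<in> adjoin A xs"
  shows "\<phi> y = \<psi> y"
proof -
  note s = adjoin_subring[OF A, of xs]
  have "y \<in> adjoin A xs \<and> \<phi> y = \<psi> y"
    using A assms(6)
  proof (induction rule: adjoin_induct)
    case (add a b)
    then show ?case using s assms(2,3) by (auto simp: hom_onD is_subringD)
  next
    case (mult a b)
    then show ?case using s assms(2,3) by (auto simp: hom_onD is_subringD)
  qed (use s assms in auto)
  then show ?thesis by simp
qed

(* The library's pderiv requires a ring without zero divisors. *)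
definition pdiff :: "'r::comm_ring_1 poly \<Rightarrow> 'r poly" where
  "pdiff p = (\<Sum>i\<le>Polynomial.degree p. Polynomial.monom (of_nat (Suc i) * poly.coeff p (Suc i)) i)"

lemma coeff_pdiff: "poly.coeff (pdiff p) i = of_nat (Suc i) * poly.coeff p (Suc i)"
  by (cases "i \<le> Polynomial.degree p") (auto simp: pdiff_def coeff_sum coeff_eq_0)

lemma pdiff_closed: "is_subring A \<Longrightarrow> p \<in> polys_over A \<Longrightarrow> pdiff p \<in> polys_over A"
  by (auto simp: polys_over_def coeff_pdiff intro!: is_subringD(6,8) simp del: of_nat_Suc)

lemma pdiff_pCons: "pdiff (pCons a p) = p + pCons 0 (pdiff p)"
  by (rule poly_eqI) (auto simp: coeff_pdiff coeff_pCons algebra_simps split: nat.splits)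

lemma deriv_poly:
  assumes "is_deriv d"
  shows "d (poly p x) = poly (map_poly d p) x + poly (pdiff p) x * d x"
proof (induction p)
  case 0
  then show ?case using assms by (simp add: is_derivD pdiff_def)
next
  case (pCons a p)
  then show ?case
    by (simp add: is_derivD[OF assms] map_poly_pCons pdiff_pCons algebra_simps)
qed

subsection \<open>Extending homomorphisms to one more generator\<close>

lemma coeff_map_poly_hom:
  "is_subring A \<Longrightarrow> hom_on A \<phi> \<Longrightarrow> poly.coeff (map_poly \<phi> p) i = \<phi> (poly.coeff p i)"
  by (simp add: coeff_map_poly hom_on_more)

lemma map_poly_hom:
  assumes A: "is_subring A" "hom_on A \<phi>" and p: "p \<in> polys_over A" "q \<in> polys_over A"
  shows "map_poly \<phi> (p + q) = map_poly \<phi> p + map_poly \<phi> q"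
    "map_poly \<phi> (p - q) = map_poly \<phi> p - map_poly \<phi> q"
    "map_poly \<phi> (p * q) = map_poly \<phi> p * map_poly \<phi> q"
proof -
  note c = coeff_map_poly_hom[OF A] and D = polys_overD[OF p(1)] polys_overD[OF p(2)]
  show "map_poly \<phi> (p + q) = map_poly \<phi> p + map_poly \<phi> q"
    by (rule poly_eqI) (simp add: c hom_onD[OF A(2)] D)
  show "map_poly \<phi> (p - q) = map_poly \<phi> p - map_poly \<phi> q"
    by (rule poly_eqI) (simp add: c hom_on_more[OF A] D)
  show "map_poly \<phi> (p * q) = map_poly \<phi> p * map_poly \<phi> q"
    by (rule poly_eqI)
       (simp add: c coeff_mult hom_on_sum[OF A] hom_onD[OF A(2)] D is_subringD[OF A(1)])
qed

lemma map_poly_hom_smult: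
  assumes A: "is_subring A" "hom_on A \<phi>" and p: "p \<in> polys_over A" "a \<in> A"
  shows "map_poly \<phi> (Polynomial.smult a p) = Polynomial.smult (\<phi> a) (map_poly \<phi> p)"
  by (rule poly_eqI) (simp add: coeff_map_poly_hom[OF A] hom_onD[OF A(2)] polys_overD[OF p(1)] p)

lemma hom_on_of_nat: "is_subring A \<Longrightarrow> hom_on A \<phi> \<Longrightarrow> \<phi> (of_nat n) = of_nat n"
  by (induction n) (auto simp: hom_on_more hom_onD is_subringD)

text \<open>Two polynomials with the same value at \<open>x\<close> differ by a relation, and
  \<open>\<xi>\<close> satisfies the images of all relations modulo \<open>Q\<close>, hence also of
  those with value 0. So substituting \<open>\<xi>\<close> for \<open>x\<close> is well defined, and
  it kills what lies in \<open>Q\<close>.\<close>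

lemma hom_on_adj_extend:
  assumes A: "is_subring A" "hom_on A \<phi>" and Q: "0 \<in> Q"
    and \<xi>: "\<And>p. p \<in> polys_over A \<Longrightarrow> poly p x \<in> Q \<Longrightarrow> poly (map_poly \<phi> p) \<xi> = 0"
  shows "\<exists>\<phi>'. hom_on (adj A x) \<phi>' \<and> (\<forall>p\<in>polys_over A. \<phi>' (poly p x) = poly (map_poly \<phi> p) \<xi>) \<and>
    (\<forall>a\<in>A. \<phi>' a = \<phi> a) \<and> (\<forall>y\<in>adj A x \<inter> Q. \<phi>' y = 0)"
proof -
  define \<phi>' where "\<phi>' y = poly (map_poly \<phi> (SOME p. p \<in> polys_over A \<and> poly p x = y)) \<xi>" for y
  have val: "\<phi>' (poly p x) = poly (map_poly \<phi> p) \<xi>" if p: "p \<in> polys_over A" for p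
  proof -
    define q where "q = (SOME q. q \<in> polys_over A \<and> poly q x = poly p x)"
    have q: "q \<in> polys_over A \<and> poly q x = poly p x"
      unfolding q_def by (rule someI[of _ p]) (use p in auto)
    then have "poly (map_poly \<phi> (q - p)) \<xi> = 0"
      using \<xi>[of "q - p"] polys_over_closed(1)[OF A(1), of q p] p Q by simp
    then show ?thesis
      using map_poly_hom(2)[OF A, of q p] p q by (simp add: \<phi>'_def q_def)
  qed
  have base: "\<phi>' a = \<phi> a" if "a \<in> A" for a
    using val[of "[:a:]"] polys_over_closed(6)[OF A(1) that] hom_on_more(1)[OF A]
    by (simp add: map_poly_pCons)
  have "\<phi>' (poly p x + poly q x) = \<phi>' (poly p x) + \<phi>' (poly q x)"
      "\<phi>' (poly p x * poly q x) = \<phi>' (poly p x) * \<phi>' (poly q x)"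
    if "p \<in> polys_over A" "q \<in> polys_over A" for p q
    using val[OF polys_over_closed(2)[OF A(1) that]] val[OF polys_over_closed(3)[OF A(1) that]]
      val[OF that(1)] val[OF that(2)] map_poly_hom[OF A that] by auto
  then have "hom_on (adj A x) \<phi>'"
    using base[of 1] is_subringD[OF A(1)] hom_onD(1)[OF A(2)] by (auto simp: hom_on_def adj_def)
  moreover have "\<forall>y\<in>adj A x \<inter> Q. \<phi>' y = 0"
    using \<xi> by (auto simp: adj_def val)
  ultimately show ?thesis using val base by blast
qed

text \<open>The coefficient at \<open>e\<close> need not be invertible, hence the power of it on the
  left. The remainder is bounded by vanishing coefficients rather than by its degree, which keeps
  \<open>e = 0\<close> meaningful; the last clause bounds the degree of the quotient.\<close>

lemma pseudo_division:
  assumes A: "is_subring A" and r: "r \<in> polys_over A" "Polynomial.degree r \<le> e" and p: "p \<in> polys_over A"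
  shows "\<exists>k q s. q \<in> polys_over A \<and> s \<in> polys_over A \<and>
    Polynomial.smult (poly.coeff r e ^ k) p = q * r + s \<and> (\<forall>i\<ge>e. poly.coeff s i = 0) \<and>
    (\<forall>i. Polynomial.degree p < i + e \<longrightarrow> poly.coeff q i = 0)"
  using p
proof (induction "Polynomial.degree p" arbitrary: p rule: less_induct)
  case less
  let ?c = "poly.coeff r e"
  note cl = polys_over_closed[OF A]
  show ?case
  proof (cases "Polynomial.degree p < e")
    case True
    then show ?thesis using less.prems cl(8)
      by (intro exI[of _ 0] exI[of _ 0] exI[of _ p]) (auto intro: coeff_eq_0)
  next
    case False
    let ?d = "Polynomial.degree p"
    define m where "m = Polynomial.monom (poly.coeff p ?d) (?d - e)"
    define p' where "p' = Polynomial.smult ?c p - m * r"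
    have m: "m \<in> polys_over A" unfolding m_def using cl(5) polys_overD[OF less.prems] by blast
    have c: "?c \<in> A" using polys_overD[OF r(1)] .
    have p': "p' \<in> polys_over A"
      unfolding p'_def using cl(1,3,4) m r(1) less.prems c by blast
    have top: "poly.coeff p' ?d = 0"
      using False by (simp add: p'_def m_def coeff_monom_mult mult.commute[of "poly.coeff r e"])
    have "Polynomial.degree (m * r) \<le> (?d - e) + e"
      unfolding m_def by (rule order.trans[OF degree_mult_le add_mono[OF degree_monom_le r(2)]])
    then have "Polynomial.degree p' \<le> ?d"
      unfolding p'_def using False by (intro degree_diff_le degree_smult_le) auto
    then have p'0: "p' = 0 \<or> Polynomial.degree p' < ?d"
      using top by (metis le_neq_implies_less leading_coeff_0_iff)
    have "\<exists>k q s. q \<in> polys_over A \<and> s \<in> polys_over A \<and>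
      Polynomial.smult (?c ^ k) p' = q * r + s \<and> (\<forall>i\<ge>e. poly.coeff s i = 0) \<and>
      (\<forall>i. ?d < i + e \<longrightarrow> poly.coeff q i = 0)"
    proof (cases "p' = 0")
      case True
      then show ?thesis using cl(8) by (intro exI[of _ 0] exI[of _ 0] exI[of _ 0]) auto
    next
      case F: False
      then have l: "Polynomial.degree p' < ?d" using p'0 by simp
      show ?thesis using less.hyps[OF l p'] l by (meson less_trans)
    qed
    then obtain k q s where qs: "q \<in> polys_over A" "s \<in> polys_over A"
      "Polynomial.smult (?c ^ k) p' = q * r + s" "\<forall>i\<ge>e. poly.coeff s i = 0"
      "\<forall>i. ?d < i + e \<longrightarrow> poly.coeff q i = 0" by blast
    define q' where "q' = q + Polynomial.smult (?c ^ k) m"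
    have "Polynomial.smult (?c ^ Suc k) p = q' * r + s"
      using qs(3) by (simp add: p'_def q'_def smult_diff_right algebra_simps)
    moreover have "q' \<in> polys_over A"
      unfolding q'_def using cl(2,4) qs(1) m is_subringD(7)[OF A c] by blast
    moreover have "\<forall>i. ?d < i + e \<longrightarrow> poly.coeff q' i = 0"
      using qs(5) False by (auto simp: q'_def m_def)
    ultimately show ?thesis using qs(2,4) by blast
  qed
qed

subsection \<open>Dual numbers\<close>

text \<open>The ring of all \<open>a + b \<epsilon>\<close> with \<open>\<epsilon>\<close> of square
  zero. A homomorphism into it is a homomorphism (\<open>rpart\<close>) together with a derivation
  along it (\<open>ipart\<close>).\<close>

datatype 'a dual = Dual (rpart: 'a) (ipart: 'a)

instantiation dual :: (comm_ring_1) comm_ring_1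
begin

definition "0 = Dual 0 0"
definition "1 = Dual 1 0"
definition "x + y = Dual (rpart x + rpart y) (ipart x + ipart y)"
definition "x - y = Dual (rpart x - rpart y) (ipart x - ipart y)"
definition "- x = Dual (- rpart x) (- ipart x)"
definition "x * y = Dual (rpart x * rpart y) (rpart x * ipart y + ipart x * rpart y)"

instance
  by standard
     (auto simp: zero_dual_def one_dual_def plus_dual_def minus_dual_def uminus_dual_def times_dual_def
       dual.expand algebra_simps)

end

lemma dual_simps [simp]:
  "rpart 0 = 0" "ipart 0 = 0" "rpart 1 = 1" "ipart 1 = 0"
  "rpart (x + y) = rpart x + rpart y" "ipart (x + y) = ipart x + ipart y"
  "rpart (x * y) = rpart x * rpart y" "ipart (x * y) = rpart x * ipart y + ipart x * rpart y"
  "rpart (x - y) = rpart x - rpart y" "ipart (x - y) = ipart x - ipart y"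
  "rpart (- x) = - rpart x" "ipart (- x) = - ipart x"
  by (auto simp: zero_dual_def one_dual_def plus_dual_def minus_dual_def uminus_dual_def times_dual_def)

lemma dual_cancel:
  fixes x z :: "'a::field dual"
  assumes "rpart x \<noteq> 0" "x * z = 0"
  shows "z = 0"
proof -
  have "rpart (x * z) = 0" "ipart (x * z) = 0" using assms(2) by auto
  then show ?thesis using assms(1) by (auto simp: dual.expand)
qed

lemma rpart_poly: "rpart (poly p \<xi>) = poly (map_poly rpart p) (rpart \<xi>)"
  by (induction p) (auto simp: map_poly_pCons)

text \<open>First order Taylor expansion at the real part of \<open>\<xi>\<close>.\<close>

lemma ipart_poly:
  fixes p :: "'a::field dual poly"
  shows "ipart (poly p \<xi>) =
    poly (map_poly ipart p) (rpart \<xi>) + ipart \<xi> * poly (pderiv (map_poly rpart p)) (rpart \<xi>)"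
  by (induction p) (auto simp: map_poly_pCons pderiv_pCons rpart_poly algebra_simps)

lemma hom_on_rpart: "hom_on A \<phi> \<Longrightarrow> hom_on A (\<lambda>x. rpart (\<phi> x))"
  by (auto simp: hom_on_def)

subsection \<open>Specialising generically\<close>

text \<open>Provides a degree modulo \<open>N\<close>: the terms above the last coefficient outside
  \<open>N\<close> are cut off, which does not leave \<open>I\<close>. The final equation identifies
  the surviving top coefficient as one of \<open>q\<close>, so that its index is at most the degree
  of \<open>q\<close>.\<close>

lemma trunc_poly:
  assumes A: "is_subring A" and N: "0 \<in> N"
    and I: "\<And>u r. u \<in> I \<Longrightarrow> r \<in> polys_over A \<Longrightarrow> r \<in> polys_over N \<Longrightarrow> u - poly r x \<in> I"
    and q: "q \<in> polys_over A" "poly q x \<in> I" "poly.coeff q i \<notin> N"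
  shows "\<exists>p d. p \<in> polys_over A \<and> poly p x \<in> I \<and> Polynomial.degree p \<le> d \<and> poly.coeff p d \<notin> N \<and>
    poly.coeff q d = poly.coeff p d"
proof -
  define d where "d = (GREATEST j. poly.coeff q j \<notin> N)"
  have bd: "poly.coeff q j \<notin> N \<Longrightarrow> j \<le> Polynomial.degree q" for j
    using N by (metis le_degree)
  have d: "poly.coeff q d \<notin> N"
    unfolding d_def by (rule GreatestI_nat[where P = "\<lambda>j. poly.coeff q j \<notin> N", OF q(3) bd])
  have above: "poly.coeff q j \<in> N" if "j > d" for j
    using Greatest_le_nat[of "\<lambda>j. poly.coeff q j \<notin> N" j "Polynomial.degree q"] bd that
    unfolding d_def by fastforce
  define p where "p = poly_cutoff (Suc d) q"
  have p: "p \<in> polys_over A" using q(1) is_subringD(1)[OF A]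
    by (auto simp: p_def polys_over_def coeff_poly_cutoff)
  have deg: "Polynomial.degree p \<le> d"
    by (rule degree_le) (auto simp: p_def coeff_poly_cutoff)
  have "q - p \<in> polys_over N"
    using above N by (auto simp: polys_over_def p_def coeff_poly_cutoff)
  moreover have "q - p \<in> polys_over A" using polys_over_closed(1)[OF A q(1) p] .
  ultimately have "poly p x \<in> I" using I[OF q(2), of "q - p"] by simp
  then show ?thesis using p deg d
    by (intro exI[of _ p] exI[of _ d]) (auto simp: p_def coeff_poly_cutoff)
qed

text \<open>A relation \<open>p\<close> of least degree modulo \<open>Q\<close> controls all others:
  pseudo-division of \<open>g\<close> by \<open>p\<close> leaves a relation of smaller degree, hence
  one with coefficients in \<open>Q\<close>, which \<open>\<phi>\<close> kills. So a root of the
  image of \<open>p\<close> is a root of a multiple of the image of \<open>g\<close>, and the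
  multiplier cancels.\<close>

lemma root_relation:
  assumes A: "is_subring A" "A \<subseteq> B" and Q: "is_ideal B Q" "is_subring B" and x: "x \<in> B"
    and p: "p \<in> polys_over A" "poly p x \<in> Q" "Polynomial.degree p \<le> d"
    and small: "\<And>r i. r \<in> polys_over A \<Longrightarrow> poly r x \<in> Q \<Longrightarrow> Polynomial.degree r < d \<Longrightarrow> poly.coeff r i \<in> Q"
    and \<phi>: "hom_on A \<phi>" "\<And>y. y \<in> A \<Longrightarrow> y \<in> Q \<Longrightarrow> \<phi> y = 0"
    and root: "poly (map_poly \<phi> p) \<xi> = 0" and cancel: "\<And>z. \<phi> (poly.coeff p d) * z = 0 \<Longrightarrow> z = 0"
    and d: "0 < d" and g: "g \<in> polys_over A" "poly g x \<in> Q"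
  shows "poly (map_poly \<phi> g) \<xi> = 0"
proof -
  let ?c = "poly.coeff p d"
  obtain k q s where qs: "q \<in> polys_over A" "s \<in> polys_over A"
    "Polynomial.smult (?c ^ k) g = q * p + s" "\<forall>i\<ge>d. poly.coeff s i = 0"
    using pseudo_division[OF A(1) p(1,3) g(1)] by blast
  have c: "?c \<in> A" using polys_overD[OF p(1)] .
  have ck: "?c ^ k \<in> A" using is_subringD(7)[OF A(1) c] .
  have "poly s x = ?c ^ k * poly g x - poly q x * poly p x"
    using arg_cong[OF qs(3), of "\<lambda>p. poly p x"] by simp
  moreover have "poly q x \<in> B" using poly_in_subring[OF Q(2) _ x] polys_over_mono[OF A(2)] qs(1) by blast
  ultimately have sQ: "poly s x \<in> Q"
    using is_ideal_neg(2)[OF Q(2,1)] is_idealD(4)[OF Q(1)] g(2) p(2) ck A(2) by auto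
  have "Polynomial.degree s < d" using qs(4) d by (intro degree_lessI) auto
  then have "poly.coeff s i \<in> Q" for i using small[OF qs(2) sQ] by blast
  then have "map_poly \<phi> s = 0"
    by (intro poly_eqI) (simp add: coeff_map_poly_hom[OF A(1) \<phi>(1)] \<phi>(2) polys_overD[OF qs(2)])
  moreover have "map_poly \<phi> (Polynomial.smult (?c ^ k) g) = map_poly \<phi> q * map_poly \<phi> p + map_poly \<phi> s"
    using map_poly_hom[OF A(1) \<phi>(1)] qs p(1) polys_over_closed(3)[OF A(1)] by metis
  ultimately have "Polynomial.smult (\<phi> (?c ^ k)) (map_poly \<phi> g) = map_poly \<phi> q * map_poly \<phi> p"
    using map_poly_hom_smult[OF A(1) \<phi>(1) g(1) ck] by simp
  from arg_cong[OF this, of "\<lambda>p. poly p \<xi>"] root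
  have "\<phi> ?c ^ k * poly (map_poly \<phi> g) \<xi> = 0"
    by (simp add: hom_on_more(4)[OF A(1) \<phi>(1) c])
  then show ?thesis
  proof (induction k)
    case (Suc k)
    then show ?case using cancel[of "\<phi> ?c ^ k * poly (map_poly \<phi> g) \<xi>"] by (simp add: mult.assoc)
  qed simp
qed

text \<open>The classical fact behind this lemma: an algebraic element that is nonzero modulo the prime
  ideal divides a nonzero element of the base.\<close>

lemma algebraic_divides_base:
  assumes A: "is_subring A" "A \<subseteq> B" and Q: "is_prime B Q" "is_subring B" and x: "x \<in> B"
    and p: "p \<in> polys_over A" "poly p x \<in> Q" "Polynomial.degree p \<le> d" "poly.coeff p d \<notin> Q"
    and small: "\<And>r i. r \<in> polys_over A \<Longrightarrow> poly r x \<in> Q \<Longrightarrow> Polynomial.degree r < d \<Longrightarrow> poly.coeff r i \<in> Q"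
    and d: "0 < d" and b: "b \<in> adj A x" "b \<notin> Q"
  shows "\<exists>a\<in>A. a \<notin> Q \<and> (\<exists>g\<in>adj A x. b * g - a \<in> Q)"
proof -
  have iQ: "is_ideal B Q" using Q(1) by (simp add: is_prime_def)
  have prime: "u * v \<in> Q \<Longrightarrow> u \<in> Q \<or> v \<in> Q" if "u \<in> B" "v \<in> B" for u v
    using Q(1) that by (auto simp: is_prime_def)
  note sx = adj_subring[OF A(1), of x] and sxD = is_subringD[OF adj_subring(1)[OF A(1), of x]]
  have xB: "adj A x \<subseteq> B" using adj_least[OF Q(2) A(2) x] .
  \<comment> \<open>The multiples of \<open>b\<close> in \<open>A[x]\<close>, modulo
    \<open>Q\<close>. The goal is a constant polynomial over \<open>A\<close> with value in
    \<open>I\<close>, but outside \<open>Q\<close>.\<close>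
  define I where "I = {y \<in> adj A x. \<exists>g\<in>adj A x. b * g - y \<in> Q}"
  define Pr where "Pr e \<longleftrightarrow> (\<exists>r\<in>polys_over A. poly r x \<in> I \<and> Polynomial.degree r \<le> e \<and> poly.coeff r e \<notin> Q)" for e
  have IQ: "u - v \<in> I" if uv: "u \<in> I" "v \<in> Q" "v \<in> adj A x" for u v
  proof -
    obtain g where "g \<in> adj A x" "b * g - u \<in> Q" using uv by (auto simp: I_def)
    then have "b * g - (u - v) \<in> Q" using is_idealD(3)[OF iQ _ uv(2), of "b * g - u"] by (simp add: algebra_simps)
    then show ?thesis using uv \<open>g \<in> adj A x\<close> sxD(5) by (auto simp: I_def)
  qed
  have Imult: "y * c \<in> I" if yc: "y \<in> I" "c \<in> adj A x" for y c
  proof -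
    obtain g where "g \<in> adj A x" "b * g - y \<in> Q" using yc by (auto simp: I_def)
    then have "b * (g * c) - y * c \<in> Q" "g * c \<in> adj A x"
      using is_idealD(5)[OF iQ, of c "b * g - y"] yc(2) xB sxD(6) by (auto simp: algebra_simps)
    then show ?thesis using yc sxD(6) by (auto simp: I_def)
  qed
  have QI: "y \<in> I" if "y \<in> Q" "y \<in> adj A x" for y
    using that is_ideal_neg(1)[OF Q(2) iQ] sxD(1) by (auto simp: I_def intro!: bexI[of _ 0])
  have I_diff: "u - v \<in> I" if uv: "u \<in> I" "v \<in> I" for u v
  proof -
    obtain g h where gh: "g \<in> adj A x" "b * g - u \<in> Q" "h \<in> adj A x" "b * h - v \<in> Q"
      using uv by (auto simp: I_def)
    have "b * (g - h) - (u - v) \<in> Q"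
      using is_ideal_neg(2)[OF Q(2) iQ gh(2) gh(4)] by (simp add: algebra_simps)
    then show ?thesis using uv gh sxD(5) by (auto simp: I_def)
  qed
  have red: "\<exists>e\<le>Polynomial.degree r. Pr e" if rr: "r \<in> polys_over A" "poly r x \<in> I" "poly.coeff r i \<notin> Q" for r i
  proof -
    obtain q e where "q \<in> polys_over A \<and> poly q x \<in> I \<and> Polynomial.degree q \<le> e \<and> poly.coeff q e \<notin> Q \<and>
        poly.coeff r e = poly.coeff q e"
      using trunc_poly[OF A(1) is_idealD(2)[OF iQ], of I x r i] rr IQ poly_in_ideal[OF Q(2) iQ _ x] adjI
      by blast
    moreover from this have "e \<le> Polynomial.degree r"
      using is_idealD(2)[OF iQ] by (metis le_degree)
    ultimately show ?thesis by (auto simp: Pr_def)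
  qed
  have Pd: "Pr d" using p QI by (auto simp: Pr_def adj_def intro!: bexI[of _ p])
  obtain g0 where g0: "g0 \<in> polys_over A" "b = poly g0 x" using b(1) by (auto simp: adj_def)
  define e where "e = (LEAST e. Pr e)"
  have Pe: "Pr e" and min: "Pr j \<Longrightarrow> e \<le> j" for j
    unfolding e_def using LeastI[of Pr, OF Pd] Least_le[of Pr] by auto
  have ed: "e \<le> d" using min[OF Pd] .
  obtain r where r: "r \<in> polys_over A" "poly r x \<in> I" "Polynomial.degree r \<le> e" "poly.coeff r e \<notin> Q"
    using Pe by (auto simp: Pr_def)
  have "e = 0"
  proof (rule ccontr)
    assume e0: "e \<noteq> 0"
    \<comment> \<open>Were \<open>e = d\<close>, dividing a polynomial for \<open>b\<close> by
      \<open>p\<close> would leave a remainder in \<open>I\<close> of degree below \<open>d\<close>,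
      hence in \<open>Q\<close>; then a power of the top coefficient of \<open>p\<close> times
      \<open>b\<close> would lie in the prime ideal \<open>Q\<close>.\<close>
    have "e < d"
    proof (rule ccontr)
      assume "\<not> e < d"
      then have de: "e = d" using ed by simp
      let ?c = "poly.coeff p d"
      obtain k q s where qs: "q \<in> polys_over A" "s \<in> polys_over A"
        "Polynomial.smult (?c ^ k) g0 = q * p + s" "\<forall>i\<ge>d. poly.coeff s i = 0"
        using pseudo_division[OF A(1) p(1,3) g0(1)] by blast
      have ck: "?c ^ k \<in> A" using is_subringD(7)[OF A(1)] polys_overD[OF p(1)] by blast
      have s: "poly s x = ?c ^ k * b - poly q x * poly p x"
        using arg_cong[OF qs(3), of "\<lambda>p. poly p x"] g0 by simp
      have bI: "b \<in> I" using b(1) sxD(2) is_idealD(2)[OF iQ] by (auto simp: I_def intro!: bexI[of _ 1])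
      have px: "poly q x * poly p x \<in> Q" "poly q x * poly p x \<in> adj A x"
        using qs(1) p sxD(6) xB is_idealD(4)[OF iQ] by (auto simp: adj_def)
      have "poly s x \<in> I"
        unfolding s using Imult[OF bI, of "?c ^ k"] ck sx(2) px by (auto intro!: IQ simp: mult.commute)
      then have "poly.coeff s i \<in> Q" for i
      proof (rule_tac ccontr)
        assume "poly.coeff s i \<notin> Q"
        from red[OF qs(2) _ this] \<open>poly s x \<in> I\<close> obtain j where "j \<le> Polynomial.degree s" "Pr j" by blast
        moreover have "Polynomial.degree s < d" using qs(4) d by (intro degree_lessI) auto
        ultimately show False using min[of j] de by simp
      qed
      then have "s \<in> polys_over Q" by (simp add: polys_over_def)
      then have "poly s x \<in> Q" by (rule poly_in_ideal[OF Q(2) iQ _ x])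
      then have "?c ^ k * b \<in> Q" using s is_idealD(3)[OF iQ _ px(1), of "poly s x"] by simp
      moreover have "?c ^ k \<notin> Q"
      proof (induction k)
        case 0
        then show ?case using Q(1) by (simp add: is_prime_def)
      next
        case (Suc k)
        then show ?case using prime[of ?c "?c ^ k"] p(4) polys_overD[OF p(1)] A(2)
          is_subringD(7)[OF A(1)] by auto
      qed
      ultimately show False using prime[of "?c ^ k" b] b xB ck A(2) by auto
    qed
    let ?c = "poly.coeff r e"
    \<comment> \<open>Now divide \<open>p\<close> by the smaller \<open>r\<close>. By minimality of
      \<open>e\<close> the remainder has its coefficients in \<open>Q\<close>, so \<open>r\<close>
      or \<open>q\<close> is a relation of degree below \<open>d\<close>. This is excluded for
      \<open>r\<close>, and for \<open>q\<close> it puts a power of the top coefficient of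
      \<open>r\<close> times that of \<open>p\<close> into \<open>Q\<close>.\<close>
    obtain k q s where qs: "q \<in> polys_over A" "s \<in> polys_over A"
      "Polynomial.smult (?c ^ k) p = q * r + s" "\<forall>i\<ge>e. poly.coeff s i = 0"
      "\<forall>i. Polynomial.degree p < i + e \<longrightarrow> poly.coeff q i = 0"
      using pseudo_division[OF A(1) r(1,3) p(1)] by blast
    have c: "?c \<in> A" and ck: "?c ^ k \<in> A" using is_subringD(7)[OF A(1)] polys_overD[OF r(1)] by blast+
    have s: "poly s x = ?c ^ k * poly p x - poly r x * poly q x"
      using arg_cong[OF qs(3), of "\<lambda>p. poly p x"] by (simp add: mult.commute)
    have "?c ^ k * poly p x \<in> I"
      using p(2) ck sx(2) sxD(6) A(2) is_idealD(4)[OF iQ] adjI[OF p(1)] by (intro QI) auto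
    moreover have "poly r x * poly q x \<in> I" using qs(1) by (intro Imult r) (auto simp: adj_def)
    ultimately have sI: "poly s x \<in> I" unfolding s by (rule I_diff)
    have sQ: "poly.coeff s i \<in> Q" for i
    proof (rule ccontr)
      assume "poly.coeff s i \<notin> Q"
      from red[OF qs(2) sI this] obtain j where "j \<le> Polynomial.degree s" "Pr j" by blast
      moreover have "Polynomial.degree s < e" using qs(4) e0 by (intro degree_lessI) auto
      ultimately show False using min[of j] by simp
    qed
    then have "poly s x \<in> Q" by (intro poly_in_ideal[OF Q(2) iQ _ x]) (simp add: polys_over_def)
    moreover have "?c ^ k * poly p x \<in> Q" using is_idealD(4)[OF iQ _ p(2)] ck A(2) by blast
    ultimately have "poly r x * poly q x \<in> Q"
      using s is_ideal_neg(2)[OF Q(2) iQ, of "?c ^ k * poly p x" "poly s x"] by simp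
    then have "poly r x \<in> Q \<or> poly q x \<in> Q"
      using prime[of "poly r x" "poly q x"] r(1) qs(1) xB by (auto simp: adj_def)
    moreover have "poly r x \<notin> Q" using small[OF r(1), of e] r(3,4) \<open>e < d\<close> by auto
    moreover have "Polynomial.degree q < d"
      using qs(5) p(3) d e0 by (intro degree_lessI) auto
    ultimately have qQ: "poly.coeff q i \<in> Q" for i using small[OF qs(1)] by blast
    have "poly.coeff (q * r) i \<in> Q" for i
      unfolding coeff_mult using qQ polys_overD[OF r(1)] A(2)
      by (intro is_ideal_sum[OF iQ] is_idealD(5)[OF iQ]) auto
    then have "?c ^ k * poly.coeff p d \<in> Q"
      using arg_cong[OF qs(3), of "\<lambda>p. poly.coeff p d"] sQ[of d] is_idealD(3)[OF iQ] by auto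
    moreover have "?c ^ k \<notin> Q"
    proof (induction k)
      case 0
      then show ?case using Q(1) by (simp add: is_prime_def)
    next
      case (Suc k)
      then show ?case using prime[of ?c "?c ^ k"] r(4) c A(2) is_subringD(7)[OF A(1)] by auto
    qed
    ultimately show False using prime[of "?c ^ k" "poly.coeff p d"] p(4) polys_overD[OF p(1)] ck A(2) by auto
  qed
  then have "r = [:poly.coeff r 0:]" using r(3) by (metis coeff_pCons_0 degree_eq_zeroE le_zero_eq)
  then have "poly r x = poly.coeff r 0" by (metis poly_const_conv)
  then show ?thesis
    using r(2,4) \<open>e = 0\<close> polys_overD[OF r(1), of 0] by (auto simp: I_def)
qed

text \<open>If \<open>x\<close> is transcendental modulo \<open>Q\<close>, a coefficient of a
  polynomial for \<open>b\<close> serves as \<open>a\<close>, and the value of \<open>x\<close> is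
  chosen off the roots of that polynomial. If \<open>x\<close> is algebraic, its value is a root of
  the image of a minimal relation \<open>p\<close>; then \<open>a\<close> has to keep the top
  coefficient of \<open>p\<close>, the derivative of \<open>p\<close> at the root and the value of
  \<open>b\<close> from vanishing.\<close>

lemma extend_one:
  assumes A: "is_subring A" "A \<subseteq> B" and Q: "is_prime B Q" "is_subring B" and x: "x \<in> B"
    and tor: "\<forall>n>0. \<forall>a\<in>B. of_nat n * a \<in> Q \<longrightarrow> a \<in> Q"
    and b: "b \<in> adj A x" "b \<notin> Q"
  shows "\<exists>a\<in>A. a \<notin> Q \<and> (\<forall>\<phi> :: _ \<Rightarrow> 'w::{alg_closed_field, field_char_0} dual.
    hom_on A \<phi> \<and> (\<forall>y\<in>A \<inter> Q. \<phi> y = 0) \<and> rpart (\<phi> a) \<noteq> 0 \<longrightarrow>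
    (\<exists>\<phi>'. hom_on (adj A x) \<phi>' \<and> (\<forall>y\<in>A. \<phi>' y = \<phi> y) \<and> (\<forall>y\<in>adj A x \<inter> Q. \<phi>' y = 0) \<and> rpart (\<phi>' b) \<noteq> 0))"
proof -
  have iQ: "is_ideal B Q" using Q(1) by (simp add: is_prime_def)
  have prime: "u * v \<in> Q \<Longrightarrow> u \<in> Q \<or> v \<in> Q" if "u \<in> B" "v \<in> B" for u v
    using Q(1) that by (auto simp: is_prime_def)
  note sx = adj_subring[OF A(1), of x] and sxD = is_subringD[OF adj_subring(1)[OF A(1), of x]]
  have xB: "adj A x \<subseteq> B" using adj_least[OF Q(2) A(2) x] .
  obtain g where g: "g \<in> polys_over A" "b = poly g x" using b(1) by (auto simp: adj_def)
  have Q0: "0 \<in> Q" using is_idealD(2)[OF iQ] .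
  show ?thesis
  proof (cases "\<exists>p\<in>polys_over A. poly p x \<in> Q \<and> (\<exists>i. poly.coeff p i \<notin> Q)")
    case False
    have "\<exists>i. poly.coeff g i \<notin> Q"
    proof (rule ccontr)
      assume "\<nexists>i. poly.coeff g i \<notin> Q"
      then have "poly g x \<in> Q" by (intro poly_in_ideal[OF Q(2) iQ _ x]) (auto simp: polys_over_def)
      then show False using b g by simp
    qed
    then obtain i where i: "poly.coeff g i \<notin> Q" by blast
    show ?thesis
    proof (intro bexI[of _ "poly.coeff g i"] conjI allI impI i polys_overD[OF g(1)]; elim conjE)
      fix \<phi> :: "_ \<Rightarrow> 'w dual"
      assume \<phi>: "hom_on A \<phi>" "\<forall>y\<in>A \<inter> Q. \<phi> y = 0" "rpart (\<phi> (poly.coeff g i)) \<noteq> 0"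
      let ?G = "map_poly (\<lambda>y. rpart (\<phi> y)) g"
      have "poly.coeff ?G i \<noteq> 0"
        using \<phi>(3) coeff_map_poly_hom[OF A(1) hom_on_rpart[OF \<phi>(1)], of g i] by simp
      then have "?G \<noteq> 0" by auto
      then obtain \<xi>0 where \<xi>0: "poly ?G \<xi>0 \<noteq> 0"
        using poly_roots_finite[of ?G] infinite_UNIV_char_0[where ?'a = 'w] by (auto dest: ex_new_if_finite)
      have "poly (map_poly \<phi> p) (Dual \<xi>0 0) = 0" if p: "p \<in> polys_over A" "poly p x \<in> Q" for p
      proof -
        have "map_poly \<phi> p = 0"
          using False p \<phi>(2) polys_overD[OF p(1)]
          by (intro poly_eqI) (auto simp: coeff_map_poly_hom[OF A(1) \<phi>(1)])
        then show ?thesis by simp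
      qed
      from hom_on_adj_extend[OF A(1) \<phi>(1) Q0 this] obtain \<phi>' where
        \<phi>': "hom_on (adj A x) \<phi>'" "\<forall>p\<in>polys_over A. \<phi>' (poly p x) = poly (map_poly \<phi> p) (Dual \<xi>0 0)"
        "\<forall>a\<in>A. \<phi>' a = \<phi> a" "\<forall>y\<in>adj A x \<inter> Q. \<phi>' y = 0" by blast
      have "map_poly rpart (map_poly \<phi> g) = ?G"
        by (intro poly_eqI) (simp add: coeff_map_poly_hom[OF A(1) \<phi>(1)] coeff_map_poly
            coeff_map_poly_hom[OF A(1) hom_on_rpart[OF \<phi>(1)]])
      then have "rpart (\<phi>' b) \<noteq> 0" using \<phi>'(2) g \<xi>0 by (simp add: rpart_poly)
      then show "\<exists>\<phi>'. hom_on (adj A x) \<phi>' \<and> (\<forall>y\<in>A. \<phi>' y = \<phi> y) \<and> (\<forall>y\<in>adj A x \<inter> Q. \<phi>' y = 0) \<and> rpart (\<phi>' b) \<noteq> 0"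
        using \<phi>' by blast
    qed
  next
    case True
    define Pr where "Pr e \<longleftrightarrow> (\<exists>r\<in>polys_over A. poly r x \<in> Q \<and> Polynomial.degree r \<le> e \<and> poly.coeff r e \<notin> Q)" for e
    have red: "\<exists>e\<le>Polynomial.degree r. Pr e" if rr: "r \<in> polys_over A" "poly r x \<in> Q" "poly.coeff r i \<notin> Q" for r i
    proof -
      obtain q e where "q \<in> polys_over A \<and> poly q x \<in> Q \<and> Polynomial.degree q \<le> e \<and> poly.coeff q e \<notin> Q \<and>
          poly.coeff r e = poly.coeff q e"
        using trunc_poly[OF A(1) Q0, of Q x r i, OF _ rr] is_ideal_neg(2)[OF Q(2) iQ] poly_in_ideal[OF Q(2) iQ _ x]
      by blast
      moreover from this have "e \<le> Polynomial.degree r" using Q0 by (metis le_degree)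
      ultimately show ?thesis by (auto simp: Pr_def)
    qed
    define d where "d = (LEAST e. Pr e)"
    from True red obtain e0 where "Pr e0" by blast
    then have Pd: "Pr d" and min: "Pr j \<Longrightarrow> d \<le> j" for j
      unfolding d_def using LeastI[of Pr e0] Least_le[of Pr] by auto
    obtain p where p: "p \<in> polys_over A" "poly p x \<in> Q" "Polynomial.degree p \<le> d" "poly.coeff p d \<notin> Q"
      using Pd by (auto simp: Pr_def)
    let ?c = "poly.coeff p d"
    have c: "?c \<in> A" using polys_overD[OF p(1)] .
    have d: "0 < d"
    proof (rule ccontr)
      assume "\<not> 0 < d"
      then have "p = [:poly.coeff p 0:]" using p(3) by (metis coeff_pCons_0 degree_eq_zeroE gr0I le_zero_eq)
      then have "poly p x = poly.coeff p 0" by (metis poly_const_conv)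
      then show False using p \<open>\<not> 0 < d\<close> by simp
    qed
    have small: "poly.coeff r i \<in> Q" if "r \<in> polys_over A" "poly r x \<in> Q" "Polynomial.degree r < d" for r i
      using red[OF that(1,2), of i] that(3) min by fastforce
    let ?p' = "pdiff p"
    have p': "?p' \<in> polys_over A" using pdiff_closed[OF A(1) p(1)] .
    have p'x: "poly ?p' x \<in> adj A x" using p' by (auto simp: adj_def)
    \<comment> \<open>The derivative has smaller degree than \<open>d\<close>, so by minimality it
      is a relation only if all its coefficients lie in \<open>Q\<close>; its top coefficient is
      \<open>d\<close> times that of \<open>p\<close>, and \<open>tor\<close> excludes this.\<close>
    have "poly ?p' x \<notin> Q"
    proof
      assume "poly ?p' x \<in> Q"
      moreover have "Polynomial.degree ?p' < d"
        using p(3) d by (intro degree_lessI) (auto simp: coeff_pdiff coeff_eq_0)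
      ultimately have "poly.coeff ?p' (d - 1) \<in> Q" using small[OF p'] by blast
      then have "of_nat d * ?c \<in> Q" using d by (simp add: coeff_pdiff del: of_nat_Suc)
      then show False using tor d c A(2) p(4) by blast
    qed
    \<comment> \<open>Taking the product of \<open>b\<close> with the derivative lets a single
      element \<open>a1\<close> guard both from vanishing.\<close>
    then have b0: "b * poly ?p' x \<in> adj A x" "b * poly ?p' x \<notin> Q"
      using b p'x sxD(6) prime[of b "poly ?p' x"] xB by auto
    obtain a1 g2 where a1: "a1 \<in> A" "a1 \<notin> Q" "g2 \<in> adj A x" "b * poly ?p' x * g2 - a1 \<in> Q"
      using algebraic_divides_base[OF A Q x p small d b0] by blast
    have key: "\<phi>' b * \<phi>' (poly ?p' x) * \<phi>' g2 = \<phi> a1"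
      if "hom_on (adj A x) \<phi>'" "\<forall>a\<in>A. \<phi>' a = \<phi> a" "\<forall>y\<in>adj A x \<inter> Q. \<phi>' y = 0"
      for \<phi> \<phi>' :: "_ \<Rightarrow> 't::comm_ring_1"
    proof -
      have "\<phi>' (b * poly ?p' x * g2 - a1) = 0" using that(3) a1 sxD(5,6) b0 sx(2) by blast
      then show ?thesis
        using that a1 sx(2) b0 b p'x sxD(6)
        by (auto simp: hom_on_more(3)[OF sx(1) that(1)] hom_onD[OF that(1)])
    qed
    show ?thesis
    proof (intro bexI[of _ "?c * a1"] conjI allI impI; (elim conjE)?)
      show "?c * a1 \<in> A" using c a1 is_subringD(6)[OF A(1)] by blast
      show "?c * a1 \<notin> Q" using prime[of ?c a1] c a1 A(2) p(4) by auto
      fix \<phi> :: "_ \<Rightarrow> 'w dual"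
      assume \<phi>: "hom_on A \<phi>" "\<forall>y\<in>A \<inter> Q. \<phi> y = 0" "rpart (\<phi> (?c * a1)) \<noteq> 0"
      have nz: "rpart (\<phi> ?c) \<noteq> 0" "rpart (\<phi> a1) \<noteq> 0"
        using \<phi>(3) c a1 by (auto simp: hom_onD[OF \<phi>(1)])
      let ?\<psi> = "\<lambda>y. rpart (\<phi> y)"
      have \<psi>: "hom_on A ?\<psi>" "\<And>y. y \<in> A \<Longrightarrow> y \<in> Q \<Longrightarrow> ?\<psi> y = 0" using hom_on_rpart[OF \<phi>(1)] \<phi>(2) by auto
      let ?P = "map_poly ?\<psi> p"
      have "poly.coeff ?P d \<noteq> 0" using nz coeff_map_poly_hom[OF A(1) \<psi>(1), of p d] by simp
      then have "Polynomial.degree ?P > 0" using d le_degree[of ?P d] by linarith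
      then obtain \<xi>0 where \<xi>0: "poly ?P \<xi>0 = 0" using alg_closed_imp_poly_has_root by blast
      have "poly (map_poly ?\<psi> g) \<xi>0 = 0" if "g \<in> polys_over A" "poly g x \<in> Q" for g
        by (rule root_relation[OF A iQ Q(2) x p(1-3) small \<psi> \<xi>0 _ d that]) (use nz in auto)
      from hom_on_adj_extend[OF A(1) \<psi>(1) Q0 this] obtain \<psi>' where
        \<psi>': "hom_on (adj A x) \<psi>'" "\<forall>p\<in>polys_over A. \<psi>' (poly p x) = poly (map_poly ?\<psi> p) \<xi>0"
        "\<forall>a\<in>A. \<psi>' a = ?\<psi> a" "\<forall>y\<in>adj A x \<inter> Q. \<psi>' y = 0" by blast
      have "\<psi>' (poly ?p' x) \<noteq> 0" using key[OF \<psi>'(1,3,4)] nz(2) by auto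
      moreover have "map_poly ?\<psi> ?p' = pderiv ?P"
        by (intro poly_eqI)
           (simp add: coeff_map_poly_hom[OF A(1) \<psi>(1)] coeff_pdiff coeff_pderiv hom_onD[OF \<psi>(1)]
             hom_on_of_nat[OF A(1) \<psi>(1)] is_subringD[OF A(1)] polys_overD[OF p(1)] del: of_nat_Suc)
      ultimately have P': "poly (pderiv ?P) \<xi>0 \<noteq> 0" using \<psi>'(2) p' by auto
      have rP: "map_poly rpart (map_poly \<phi> p) = ?P"
        by (intro poly_eqI) (simp add: coeff_map_poly_hom[OF A(1) \<phi>(1)] coeff_map_poly
            coeff_map_poly_hom[OF A(1) \<psi>(1)])
      \<comment> \<open>One Newton step: \<open>\<xi>0\<close> is a simple root of the real part, so
        the infinitesimal part of a root above it solves a linear equation.\<close>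
      define \<xi> where "\<xi> = Dual \<xi>0 (- poly (map_poly ipart (map_poly \<phi> p)) \<xi>0 / poly (pderiv ?P) \<xi>0)"
      have root: "poly (map_poly \<phi> p) \<xi> = 0"
        by (rule dual.expand) (simp add: rpart_poly ipart_poly rP \<xi>_def \<xi>0 P')
      have "poly (map_poly \<phi> g) \<xi> = 0" if "g \<in> polys_over A" "poly g x \<in> Q" for g
        by (rule root_relation[OF A iQ Q(2) x p(1-3) small \<phi>(1) _ root _ d that])
           (use nz \<phi>(2) dual_cancel in auto)
      from hom_on_adj_extend[OF A(1) \<phi>(1) Q0 this] obtain \<phi>' where
        \<phi>': "hom_on (adj A x) \<phi>'" "\<forall>a\<in>A. \<phi>' a = \<phi> a" "\<forall>y\<in>adj A x \<inter> Q. \<phi>' y = 0" by blast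
      have "rpart (\<phi>' b) \<noteq> 0" using arg_cong[OF key[OF \<phi>'], of rpart] nz(2) by auto
      then show "\<exists>\<phi>'. hom_on (adj A x) \<phi>' \<and> (\<forall>y\<in>A. \<phi>' y = \<phi> y) \<and> (\<forall>y\<in>adj A x \<inter> Q. \<phi>' y = 0) \<and> rpart (\<phi>' b) \<noteq> 0"
        using \<phi>' by blast
    qed
  qed
qed

text \<open>The nonvanishing condition is pulled back from the last generator to the base; the
  homomorphism is then extended in the opposite direction.\<close>

lemma extend_many:
  assumes "is_subring A" "A \<subseteq> B" and Q: "is_prime B Q" "is_subring B" and "set xs \<subseteq> B"
    and tor: "\<forall>n>0. \<forall>a\<in>B. of_nat n * a \<in> Q \<longrightarrow> a \<in> Q"
    and "b \<in> adjoin A xs" "b \<notin> Q"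
  shows "\<exists>a\<in>A. a \<notin> Q \<and> (\<forall>\<phi> :: _ \<Rightarrow> 'w::{alg_closed_field, field_char_0} dual.
    hom_on A \<phi> \<and> (\<forall>y\<in>A \<inter> Q. \<phi> y = 0) \<and> rpart (\<phi> a) \<noteq> 0 \<longrightarrow>
    (\<exists>\<phi>'. hom_on (adjoin A xs) \<phi>' \<and> (\<forall>y\<in>A. \<phi>' y = \<phi> y) \<and> (\<forall>y\<in>adjoin A xs \<inter> Q. \<phi>' y = 0) \<and> rpart (\<phi>' b) \<noteq> 0))"
  using assms(1,2,5,7,8)
proof (induction xs arbitrary: A b)
  case Nil
  then show ?case by (intro bexI[of _ b]) auto
next
  case (Cons x xs)
  note sx = adj_subring[OF Cons.prems(1), of x]
  have xB: "adj A x \<subseteq> B" using adj_least[OF Q(2) Cons.prems(2)] Cons.prems(3) by simp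
  obtain b' where b': "b' \<in> adj A x" "b' \<notin> Q" "\<forall>\<phi> :: _ \<Rightarrow> 'w dual.
    hom_on (adj A x) \<phi> \<and> (\<forall>y\<in>adj A x \<inter> Q. \<phi> y = 0) \<and> rpart (\<phi> b') \<noteq> 0 \<longrightarrow>
    (\<exists>\<phi>'. hom_on (adjoin (adj A x) xs) \<phi>' \<and> (\<forall>y\<in>adj A x. \<phi>' y = \<phi> y) \<and>
      (\<forall>y\<in>adjoin (adj A x) xs \<inter> Q. \<phi>' y = 0) \<and> rpart (\<phi>' b) \<noteq> 0)"
    using Cons.IH[OF sx(1) xB _ _ Cons.prems(5)] Cons.prems(3,4) by auto
  obtain a where a: "a \<in> A" "a \<notin> Q" "\<forall>\<phi> :: _ \<Rightarrow> 'w dual.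
    hom_on A \<phi> \<and> (\<forall>y\<in>A \<inter> Q. \<phi> y = 0) \<and> rpart (\<phi> a) \<noteq> 0 \<longrightarrow>
    (\<exists>\<phi>'. hom_on (adj A x) \<phi>' \<and> (\<forall>y\<in>A. \<phi>' y = \<phi> y) \<and> (\<forall>y\<in>adj A x \<inter> Q. \<phi>' y = 0) \<and> rpart (\<phi>' b') \<noteq> 0)"
    using extend_one[OF Cons.prems(1,2) Q _ tor b'(1,2), where ?'w = 'w] Cons.prems(3) by auto
  show ?case
  proof (intro bexI[of _ a] conjI allI impI a(1,2))
    fix \<phi> :: "_ \<Rightarrow> 'w dual"
    assume "hom_on A \<phi> \<and> (\<forall>y\<in>A \<inter> Q. \<phi> y = 0) \<and> rpart (\<phi> a) \<noteq> 0"
    with a(3) obtain \<phi>1 where \<phi>1: "hom_on (adj A x) \<phi>1" "\<forall>y\<in>A. \<phi>1 y = \<phi> y" "\<forall>y\<in>adj A x \<inter> Q. \<phi>1 y = 0"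
      "rpart (\<phi>1 b') \<noteq> 0" by blast
    with b'(3) obtain \<phi>2 where "hom_on (adjoin (adj A x) xs) \<phi>2" "\<forall>y\<in>adj A x. \<phi>2 y = \<phi>1 y"
      "\<forall>y\<in>adjoin (adj A x) xs \<inter> Q. \<phi>2 y = 0" "rpart (\<phi>2 b) \<noteq> 0" by blast
    then show "\<exists>\<phi>'. hom_on (adjoin A (x # xs)) \<phi>' \<and> (\<forall>y\<in>A. \<phi>' y = \<phi> y) \<and>
      (\<forall>y\<in>adjoin A (x # xs) \<inter> Q. \<phi>' y = 0) \<and> rpart (\<phi>' b) \<noteq> 0"
      using \<phi>1(2) sx(2) by (intro exI[of _ \<phi>2]) auto
  qed
qed

subsection \<open>Maximal invariant ideals\<close>

definition invariant :: "('r \<Rightarrow> 'r) set \<Rightarrow> 'r set \<Rightarrow> bool" where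
  "invariant F I \<longleftrightarrow> (\<forall>f\<in>F. f ` I \<subseteq> I)"

lemma invariantD: "invariant F I \<Longrightarrow> f \<in> F \<Longrightarrow> x \<in> I \<Longrightarrow> f x \<in> I"
  by (auto simp: invariant_def)

text \<open>Zorn's lemma in a form that serves twice: without operators and with a multiplicative
  set \<open>M\<close> it leads to prime ideals, with all operators and \<open>M = {1}\<close> to
  maximal invariant ideals.\<close>

lemma maximal_ideal_exists:
  assumes N: "is_ideal A N" "invariant F N" "N \<inter> M = {}"
  shows "\<exists>Q. is_ideal A Q \<and> invariant F Q \<and> N \<subseteq> Q \<and> Q \<inter> M = {} \<and>
    (\<forall>I. is_ideal A I \<and> invariant F I \<and> Q \<subseteq> I \<and> I \<inter> M = {} \<longrightarrow> I = Q)"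
proof -
  define \<A> where "\<A> = {I. is_ideal A I \<and> invariant F I \<and> N \<subseteq> I \<and> I \<inter> M = {}}"
  have "\<Union>\<C> \<in> \<A>" if C: "\<C> \<noteq> {}" "subset.chain \<A> \<C>" for \<C>
  proof -
    have sub: "I \<in> \<A>" if "I \<in> \<C>" for I using C(2) that by (auto simp: subset_chain_def)
    have "x + y \<in> \<Union>\<C>" if xy: "x \<in> \<Union>\<C>" "y \<in> \<Union>\<C>" for x y
    proof -
      obtain I J where IJ: "I \<in> \<C>" "x \<in> I" "J \<in> \<C>" "y \<in> J" using xy by blast
      then have "I \<subseteq> J \<or> J \<subseteq> I" using C(2) by (auto simp: subset_chain_def)
      moreover have "is_ideal A I" "is_ideal A J" using IJ sub by (auto simp: \<A>_def)
      ultimately have "x + y \<in> I \<or> x + y \<in> J" using IJ is_idealD(3) by blast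
      then show ?thesis using IJ by blast
    qed
    moreover obtain I0 where I0: "I0 \<in> \<C>" using C(1) by blast
    moreover have sub': "is_ideal A I" "invariant F I" "N \<subseteq> I" "I \<inter> M = {}" if "I \<in> \<C>" for I
      using sub[OF that] by (auto simp: \<A>_def)
    ultimately have "is_ideal A (\<Union>\<C>)"
      using is_idealD(1,2,4)[OF sub'(1)] unfolding is_ideal_def by (meson UnionE UnionI subsetI)
    moreover have "invariant F (\<Union>\<C>)"
      using invariantD[OF sub'(2)] unfolding invariant_def by blast
    moreover have "N \<subseteq> \<Union>\<C>" "\<Union>\<C> \<inter> M = {}" using sub'(3)[OF I0] I0 sub'(4) by blast+
    ultimately show ?thesis by (simp add: \<A>_def)
  qed
  moreover have "\<A> \<noteq> {}" using N by (auto simp: \<A>_def)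
  ultimately obtain Q where "Q \<in> \<A>" "\<forall>Y\<in>\<A>. Q \<subseteq> Y \<longrightarrow> Y = Q"
    using subset_Zorn_nonempty[of \<A>] by blast
  then show ?thesis by (intro exI[of _ Q]) (auto simp: \<A>_def)
qed

lemma is_ideal_plus:
  assumes A: "is_subring A" and N: "is_ideal A N" and c: "c \<in> A"
  shows "is_ideal A {n + a * c |n a. n \<in> N \<and> a \<in> A}" (is "is_ideal A ?I")
    "N \<subseteq> {n + a * c |n a. n \<in> N \<and> a \<in> A}" "c \<in> {n + a * c |n a. n \<in> N \<and> a \<in> A}"
proof -
  have 1: "n + a * c \<in> ?I" if "n \<in> N" "a \<in> A" for n a using that by blast
  show "N \<subseteq> ?I" using 1[OF _ is_subringD(1)[OF A]] by auto
  show "c \<in> ?I" using 1[OF is_idealD(2)[OF N] is_subringD(2)[OF A]] by simp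
  have "(n + a * c) + (m + b * c) \<in> ?I" if "n \<in> N" "a \<in> A" "m \<in> N" "b \<in> A" for n a m b
    using 1[OF is_idealD(3)[OF N that(1,3)] is_subringD(4)[OF A that(2,4)]] by (simp add: algebra_simps)
  moreover have "r * (n + a * c) \<in> ?I" if "n \<in> N" "a \<in> A" "r \<in> A" for n a r
    using 1[OF is_idealD(4)[OF N that(3,1)] is_subringD(6)[OF A that(3,2)]] by (simp add: algebra_simps)
  moreover have "?I \<subseteq> A"
    using c is_idealD(1)[OF N] is_subringD[OF A] by auto
  ultimately show "is_ideal A ?I" using 1[OF is_idealD(2)[OF N] is_subringD(1)[OF A]]
    unfolding is_ideal_def by fastforce
qed

text \<open>An ideal maximal among those avoiding a multiplicative set is prime.\<close>

lemma prime_ideal_exists: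
  assumes A: "is_subring A" and N: "is_ideal A N" "N \<inter> M = {}"
    and M: "M \<subseteq> A" "1 \<in> M" "\<And>x y. x \<in> M \<Longrightarrow> y \<in> M \<Longrightarrow> x * y \<in> M"
  shows "\<exists>Q. is_prime A Q \<and> N \<subseteq> Q \<and> Q \<inter> M = {}"
proof -
  obtain Q where Q: "is_ideal A Q" "N \<subseteq> Q" "Q \<inter> M = {}"
    and max: "\<And>I. is_ideal A I \<Longrightarrow> Q \<subseteq> I \<Longrightarrow> I \<inter> M = {} \<Longrightarrow> I = Q"
    using maximal_ideal_exists[of A N "{}" M] N by (auto simp: invariant_def)
  have ex: "\<exists>n\<in>Q. \<exists>a\<in>A. n + a * x \<in> M" if "x \<in> A" "x \<notin> Q" for x
    using is_ideal_plus[OF A Q(1) that(1)] max[of "{n + a * x |n a. n \<in> Q \<and> a \<in> A}"] that(2) by blast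
  have "x \<in> Q \<or> y \<in> Q" if xy: "x \<in> A" "y \<in> A" "x * y \<in> Q" for x y
  proof (rule ccontr)
    assume "\<not> ?thesis"
    then obtain n a m b where "n \<in> Q" "a \<in> A" "n + a * x \<in> M" "m \<in> Q" "b \<in> A" "m + b * y \<in> M"
      using ex xy by metis
    note * = this
    then have "(n + a * x) * (m + b * y) \<in> M" using M by blast
    moreover have "(n + a * x) * (m + b * y) = (m + b * y) * n + (a * x * m + a * b * (x * y))"
      by (simp add: algebra_simps)
    moreover have "(m + b * y) * n \<in> Q" using * M(1) is_idealD(4)[OF Q(1)] by blast
    moreover have "a * x * m \<in> Q" using * xy is_idealD(4)[OF Q(1) is_subringD(6)[OF A]] by blast
    moreover have "a * b * (x * y) \<in> Q" using * xy is_idealD(4)[OF Q(1) is_subringD(6)[OF A]] by blast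
    ultimately have "(n + a * x) * (m + b * y) \<in> Q \<inter> M" using is_idealD(3)[OF Q(1)] by auto
    then show False using Q(3) by auto
  qed
  then show ?thesis using Q M by (intro exI[of _ Q]) (auto simp: is_prime_def)
qed

section \<open>Rings with commuting automorphisms and derivations\<close>

lemma hom_on_poly:
  assumes A: "is_subring A" "hom_on A \<phi>" and p: "p \<in> polys_over A" and x: "x \<in> A"
  shows "\<phi> (poly p x) = poly (map_poly \<phi> p) (\<phi> x)"
  using p
proof (induction p)
  case 0
  then show ?case using hom_on_more(1)[OF A] by simp
next
  case (pCons a p)
  have "poly.coeff (pCons a p) 0 \<in> A" "\<And>i. poly.coeff (pCons a p) (Suc i) \<in> A"
    using polys_overD[OF pCons.prems] by blast+
  then have a: "a \<in> A" and p: "p \<in> polys_over A" by (auto simp: polys_over_def)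
  then show ?case
    using pCons.IH x poly_in_subring[OF A(1) p x]
    by (simp add: map_poly_pCons hom_on_more[OF A] hom_onD[OF A(2)] is_subringD[OF A(1)])
qed

lemma poly_cong_ideal:
  assumes A: "is_subring A" "is_ideal A N" "x \<in> A" "y \<in> A" "x - y \<in> N" "p \<in> polys_over A"
  shows "poly p x - poly p y \<in> N"
  using A(6)
proof (induction p)
  case 0
  then show ?case using is_idealD(2)[OF A(2)] by simp
next
  case (pCons a p)
  have "\<And>i. poly.coeff (pCons a p) (Suc i) \<in> A"
    using polys_overD[OF pCons.prems] by blast
  then have p: "p \<in> polys_over A" by (auto simp: polys_over_def)
  have "(x - y) * poly p x + y * (poly p x - poly p y) \<in> N"
    using poly_in_subring[OF A(1) p A(3)] pCons.IH[OF p] A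
    by (intro is_idealD(3)[OF A(2)] is_idealD(4,5)[OF A(2)])
  then show ?case by (simp add: algebra_simps)
qed

text \<open>An automorphism that moves \<open>w\<close> by \<open>a\<close> acts on polynomials in
  \<open>w\<close> through the substitution of \<open>w + a\<close>. The change in the coefficient
  just below the top isolates \<open>a\<close>; this is what \<open>lead_descent\<close>
  exploits.\<close>

lemma coeff_pcompose_shift:
  fixes q :: "'r::comm_ring_1 poly"
  assumes "Polynomial.degree q \<le> d"
  shows "poly.coeff (pcompose q [:a, 1:]) d = poly.coeff q d"
    "0 < d \<Longrightarrow> poly.coeff (pcompose q [:a, 1:]) (d - 1) = poly.coeff q (d - 1) + of_nat d * a * poly.coeff q d"
    "i > d \<Longrightarrow> poly.coeff (pcompose q [:a, 1:]) i = 0"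
proof -
  have deg: "Polynomial.degree (pcompose q [:a, 1:]) \<le> Polynomial.degree q" for q :: "'r poly"
    using degree_pcompose_le[of q "[:a, 1:]"] by simp
  show "i > d \<Longrightarrow> poly.coeff (pcompose q [:a, 1:]) i = 0"
    using deg[of q] assms by (intro coeff_eq_0) linarith
  have "poly.coeff (pcompose q [:a, 1:]) d = poly.coeff q d \<and>
    (0 < d \<longrightarrow> poly.coeff (pcompose q [:a, 1:]) (d - 1) = poly.coeff q (d - 1) + of_nat d * a * poly.coeff q d)"
    using assms
  proof (induction q arbitrary: d)
    case (pCons c q)
    show ?case
    proof (cases d)
      case 0
      then have "q = 0" using pCons.prems by (cases "q = 0") auto
      then show ?thesis using 0 by (simp add: pcompose_pCons)
    next
      case (Suc m)
      then have dq: "Polynomial.degree q \<le> m" using pCons.prems by (cases "q = 0") auto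
      have z: "poly.coeff (pcompose q [:a, 1:]) (Suc m) = 0"
        using deg[of q] dq by (intro coeff_eq_0) linarith
      show ?thesis
      proof (cases m)
        case 0
        then show ?thesis using Suc z pCons.IH[OF dq] by (simp add: pcompose_pCons)
      next
        case (Suc l)
        then show ?thesis using \<open>d = Suc m\<close> z pCons.IH[OF dq]
          by (simp add: pcompose_pCons algebra_simps)
      qed
    qed
  qed simp
  then show "poly.coeff (pcompose q [:a, 1:]) d = poly.coeff q d"
    "0 < d \<Longrightarrow> poly.coeff (pcompose q [:a, 1:]) (d - 1) = poly.coeff q (d - 1) + of_nat d * a * poly.coeff q d"
    by auto
qed

lemma pcompose_polys_over:
  assumes "is_subring A" "a \<in> A"
  shows "q \<in> polys_over A \<Longrightarrow> pcompose q [:a, 1:] \<in> polys_over A"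
proof (induction q)
  case 0
  then show ?case by simp
next
  case (pCons c q)
  have "poly.coeff (pCons c q) 0 \<in> A" "\<And>i. poly.coeff (pCons c q) (Suc i) \<in> A"
    using polys_overD[OF pCons.prems] by blast+
  then show ?case
    unfolding pcompose_pCons using pCons.IH assms is_subringD(2)[OF assms(1)]
    by (intro polys_over_closed[OF assms(1)]) (auto simp: polys_over_def)
qed

text \<open>The operators are total on a ring type that receives a field through
  \<open>\<iota>\<close>; invariant subrings and ideals are studied inside it. \<open>shk\<close>
  and \<open>dlk\<close> are the matching operators on the field.\<close>

locale sd_ring =
  fixes S :: "'s set" and D :: "'d set"
    and sh :: "'s \<Rightarrow> 'r::comm_ring_1 \<Rightarrow> 'r" and dl :: "'d \<Rightarrow> 'r \<Rightarrow> 'r"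
    and \<iota> :: "'k::field_char_0 \<Rightarrow> 'r" and shk :: "'s \<Rightarrow> 'k \<Rightarrow> 'k" and dlk :: "'d \<Rightarrow> 'k \<Rightarrow> 'k"
  assumes sh_hom: "s \<in> S \<Longrightarrow> hom_on UNIV (sh s)" and dl_deriv: "d \<in> D \<Longrightarrow> is_deriv (dl d)"
    and \<iota>_hom: "hom_on UNIV \<iota>"
    and shk_hom: "s \<in> S \<Longrightarrow> hom_on UNIV (shk s)" and dlk_deriv: "d \<in> D \<Longrightarrow> is_deriv (dlk d)"
    and sh_\<iota>: "s \<in> S \<Longrightarrow> sh s (\<iota> a) = \<iota> (shk s a)" and dl_\<iota>: "d \<in> D \<Longrightarrow> dl d (\<iota> a) = \<iota> (dlk d a)"
begin

definition C :: "'k set" where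
  "C = {a. (\<forall>s\<in>S. shk s a = a) \<and> (\<forall>d\<in>D. dlk d a = 0)}"

definition stable :: "'r set \<Rightarrow> bool" where
  "stable = invariant (sh ` S \<union> dl ` D)"

text \<open>Equivalently, \<open>A/N\<close> is nonzero and has only the two trivial invariant
  ideals.\<close>

definition max_stable :: "'r set \<Rightarrow> 'r set \<Rightarrow> bool" where
  "max_stable A N \<longleftrightarrow> is_ideal A N \<and> stable N \<and> 1 \<notin> N \<and>
    (\<forall>I. is_ideal A I \<and> stable I \<and> N \<subseteq> I \<and> 1 \<notin> I \<longrightarrow> I = N)"

definition const_mod :: "'r set \<Rightarrow> 'r \<Rightarrow> bool" where
  "const_mod N c \<longleftrightarrow> (\<forall>s\<in>S. sh s c - c \<in> N) \<and> (\<forall>d\<in>D. dl d c \<in> N)"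

text \<open>\<open>const_mod N c\<close> says that the class of \<open>c\<close> is a constant; here
  the quotient \<open>A/N\<close> has no constants beyond those of the field.\<close>

definition constants_only :: "'r set \<Rightarrow> 'r set \<Rightarrow> bool" where
  "constants_only A N \<longleftrightarrow> (\<forall>c\<in>A. const_mod N c \<longrightarrow> (\<exists>l\<in>C. c - \<iota> l \<in> N))"

lemmas sh_simps = hom_onD[OF sh_hom, simplified] hom_on_more[OF is_subring_UNIV sh_hom, simplified]
lemmas dl_simps = is_derivD[OF dl_deriv]
lemmas \<iota>_simps = hom_onD[OF \<iota>_hom, simplified] hom_on_more[OF is_subring_UNIV \<iota>_hom, simplified]

lemma stableD:
  "stable I \<Longrightarrow> s \<in> S \<Longrightarrow> x \<in> I \<Longrightarrow> sh s x \<in> I" "stable I \<Longrightarrow> d \<in> D \<Longrightarrow> x \<in> I \<Longrightarrow> dl d x \<in> I"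
  by (auto simp: stable_def invariant_def)

lemma stableI:
  assumes "\<And>s x. s \<in> S \<Longrightarrow> x \<in> I \<Longrightarrow> sh s x \<in> I" "\<And>d x. d \<in> D \<Longrightarrow> x \<in> I \<Longrightarrow> dl d x \<in> I"
  shows "stable I"
  using assms by (auto simp: stable_def invariant_def)

lemma stable_Int: "stable I \<Longrightarrow> stable J \<Longrightarrow> stable (I \<inter> J)"
  unfolding stable_def invariant_def by blast

lemma \<iota>_of_nat: "\<iota> (of_nat n) = of_nat n"
  using hom_on_of_nat[OF is_subring_UNIV \<iota>_hom] .

lemma \<iota>_inverse_nat: "0 < n \<Longrightarrow> \<iota> (inverse (of_nat n)) * of_nat n = 1"
  using \<iota>_simps(3)[of "inverse (of_nat n)" "of_nat n"] by (simp add: \<iota>_of_nat \<iota>_simps(1))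

lemma of_nat_in_C: "of_nat n \<in> C"
  by (auto simp: C_def hom_on_of_nat[OF is_subring_UNIV shk_hom] is_derivD[OF dlk_deriv])

lemma inverse_nat_const:
  assumes "0 < n"
  shows "s \<in> S \<Longrightarrow> sh s (\<iota> (inverse (of_nat n))) = \<iota> (inverse (of_nat n))"
    "d \<in> D \<Longrightarrow> dl d (\<iota> (inverse (of_nat n))) = 0"
proof -
  let ?e = "inverse (of_nat n) :: 'k"
  have e: "?e * of_nat n = 1" using assms by simp
  show "sh s (\<iota> ?e) = \<iota> ?e" if s: "s \<in> S"
  proof -
    have "shk s ?e * of_nat n = 1"
      using arg_cong[OF e, of "shk s"] hom_onD[OF shk_hom[OF s]]
        hom_on_of_nat[OF is_subring_UNIV shk_hom[OF s]] by simp
    then have "shk s ?e = ?e" using assms by (simp add: field_simps)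
    then show ?thesis using sh_\<iota>[OF s] by simp
  qed
  show "dl d (\<iota> ?e) = 0" if d: "d \<in> D"
  proof -
    have "dlk d ?e * of_nat n = 0"
      using arg_cong[OF e, of "dlk d"] is_derivD[OF dlk_deriv[OF d]] by simp
    then have "dlk d ?e = 0" using assms by simp
    then show ?thesis using dl_\<iota>[OF d] \<iota>_simps by simp
  qed
qed

lemma torsion_free:
  assumes "range \<iota> \<subseteq> B" "is_ideal B Q" "0 < n" "of_nat n * a \<in> Q"
  shows "a \<in> Q"
proof -
  have "\<iota> (inverse (of_nat n)) * (of_nat n * a) \<in> Q" using assms is_idealD(4)[OF assms(2)] by blast
  then show ?thesis using \<iota>_inverse_nat[OF assms(3)] by (simp add: mult.assoc[symmetric])
qed

lemma max_stableD:
  assumes "max_stable A N"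
  shows "is_ideal A N" "stable N" "1 \<notin> N" "is_ideal A I \<Longrightarrow> stable I \<Longrightarrow> N \<subseteq> I \<Longrightarrow> 1 \<notin> I \<Longrightarrow> I = N"
  using assms unfolding max_stable_def by blast+

lemma max_stable_exists:
  assumes "is_ideal A N" "stable N" "1 \<notin> N"
  shows "\<exists>Q. max_stable A Q \<and> N \<subseteq> Q"
proof -
  obtain Q where Q: "is_ideal A Q" "stable Q" "N \<subseteq> Q" "Q \<inter> {1} = {}"
    "\<forall>I. is_ideal A I \<and> stable I \<and> Q \<subseteq> I \<and> I \<inter> {1} = {} \<longrightarrow> I = Q"
    using maximal_ideal_exists[OF assms(1), of "sh ` S \<union> dl ` D" "{1}"] assms(2,3)
    unfolding stable_def[symmetric] by auto
  have "max_stable A Q"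
    unfolding max_stable_def using Q(1,2,4) Q(5)[rule_format] by simp
  then show ?thesis using Q(3) by (intro exI[of _ Q]) simp
qed

text \<open>Together with \<open>N\<close>, an element that is constant modulo \<open>N\<close>
  generates an invariant ideal. By maximality, nonzero constants of the quotient are therefore
  units.\<close>

lemma const_unit:
  assumes A: "is_subring A" "stable A" and N: "max_stable A N" and c: "c \<in> A" "const_mod N c" "c \<notin> N"
  shows "\<exists>n\<in>N. \<exists>a\<in>A. n + a * c = 1"
proof -
  note iN = max_stableD(1)[OF N]
  let ?I = "{n + a * c |n a. n \<in> N \<and> a \<in> A}"
  note p = is_ideal_plus[OF A(1) iN c(1)]
  have "stable ?I"
  proof (rule stableI)
    fix s x assume s: "s \<in> S" and "x \<in> ?I"
    then obtain n a where x: "x = n + a * c" "n \<in> N" "a \<in> A" by blast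
    have "sh s x = (sh s n + sh s a * (sh s c - c)) + sh s a * c"
      using x s by (simp add: sh_simps algebra_simps)
    moreover have "sh s n + sh s a * (sh s c - c) \<in> N"
      using x s c(2) A stableD max_stableD(2)[OF N]
      by (intro is_idealD(3)[OF iN] is_idealD(4)[OF iN]) (auto simp: const_mod_def)
    ultimately show "sh s x \<in> ?I" using x(3) s stableD(1)[OF A(2)] by blast
  next
    fix d x assume d: "d \<in> D" and "x \<in> ?I"
    then obtain n a where x: "x = n + a * c" "n \<in> N" "a \<in> A" by blast
    have "dl d x = (dl d n + a * dl d c) + dl d a * c"
      using x d by (simp add: dl_simps algebra_simps)
    moreover have "dl d n + a * dl d c \<in> N"
      using x d c(2) A stableD max_stableD(2)[OF N]
      by (intro is_idealD(3)[OF iN] is_idealD(4)[OF iN]) (auto simp: const_mod_def)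
    ultimately show "dl d x \<in> ?I" using x(3) d stableD(2)[OF A(2)] by blast
  qed
  then have "1 \<in> ?I" using p c(3) max_stableD(4)[OF N, of ?I] by blast
  then obtain n a where "1 = n + a * c" "n \<in> N" "a \<in> A" by blast
  then show ?thesis by (intro bexI[of _ n] bexI[of _ a]) auto
qed

subsection \<open>Adjoining a sum or an integral\<close>

text \<open>The classical treatment of a sum or integral \<open>w\<close>. Maximality of
  \<open>N\<close> makes the top coefficients of nontrivial relations of least degree fill
  \<open>A\<close>, so there is a monic one. Applying an operator to it, and for an automorphism
  subtracting it again, lowers the degree and hence yields coefficients in \<open>N\<close>. The
  coefficient just below the top then shows that \<open>d * w + g\<close> is constant modulo
  \<open>N\<close>.\<close>

lemma lead_descent:
  assumes A: "is_subring A" "stable A" "range \<iota> \<subseteq> A" and N: "max_stable A N"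
    and w: "\<And>s. s \<in> S \<Longrightarrow> sh s w - w \<in> A" "\<And>d. d \<in> D \<Longrightarrow> dl d w \<in> A"
    and I: "is_ideal (adj A w) I" "stable I" "I \<inter> A = N"
    and q: "q \<in> polys_over A" "poly q w \<in> I" "poly.coeff q i \<notin> N"
  shows "\<exists>f\<in>A. const_mod N (w - f)"
proof -
  note iN = max_stableD(1)[OF N] and cl = polys_over_closed[OF A(1)]
  note sw = adj_subring[OF A(1), of w]
  have wpow: "w ^ i \<in> adj A w" for i using is_subringD(7)[OF sw(1,3)] .
  have NI: "poly r w \<in> I" if "r \<in> polys_over N" for r
    using poly_in_ideal[OF sw(1) I(1) _ sw(3), of r] that I(3) polys_over_mono[of N I] by blast
  define Pr where "Pr e \<longleftrightarrow> (\<exists>r\<in>polys_over A. poly r w \<in> I \<and> Polynomial.degree r \<le> e \<and> poly.coeff r e \<notin> N)" for e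
  have red: "\<exists>e\<le>Polynomial.degree r. Pr e" if rr: "r \<in> polys_over A" "poly r w \<in> I" "poly.coeff r i \<notin> N" for r i
  proof -
    obtain q e where "q \<in> polys_over A \<and> poly q w \<in> I \<and> Polynomial.degree q \<le> e \<and> poly.coeff q e \<notin> N \<and>
        poly.coeff r e = poly.coeff q e"
      using trunc_poly[OF A(1) is_idealD(2)[OF iN], of I w r i, OF _ rr] NI is_ideal_neg(2)[OF sw(1) I(1)] by blast
    moreover from this have "e \<le> Polynomial.degree r"
      using is_idealD(2)[OF iN] by (metis le_degree)
    ultimately show ?thesis by (auto simp: Pr_def)
  qed
  define d where "d = (LEAST e. Pr e)"
  from red[OF q] obtain e0 where "Pr e0" by blast
  then have Pd: "Pr d" and min: "Pr j \<Longrightarrow> d \<le> j" for j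
    unfolding d_def using LeastI[of Pr e0] Least_le[of Pr] by auto
  have small: "poly.coeff r i \<in> N" if "r \<in> polys_over A" "poly r w \<in> I" "\<forall>j\<ge>d. poly.coeff r j = 0" for r i
  proof (cases "d = 0")
    case True
    then show ?thesis using that(3) is_idealD(2)[OF iN] by simp
  next
    case False
    then have "Polynomial.degree r < d" using that(3) by (intro degree_lessI) auto
    then show ?thesis using red[OF that(1,2), of i] min by fastforce
  qed
  have sh_poly: "sh s (poly r w) = poly (pcompose (map_poly (sh s) r) [:sh s w - w, 1:]) w" if "s \<in> S" for s r
    using hom_on_poly[OF is_subring_UNIV sh_hom[OF that], of r w] by (simp add: polys_over_def poly_pcompose)
  have sh_over: "map_poly (sh s) r \<in> polys_over A" if "s \<in> S" "r \<in> polys_over A" for s r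
    using that stableD(1)[OF A(2)] by (auto simp: polys_over_def coeff_map_poly sh_simps)
  have sh_deg: "Polynomial.degree (map_poly (sh s) r) \<le> d" if "Polynomial.degree r \<le> d" for s r
    using map_poly_degree_leq[of "sh s" r] that by linarith
  have dl_over: "map_poly (dl e) r \<in> polys_over A" if "e \<in> D" "r \<in> polys_over A" for e r
    using that stableD(2)[OF A(2)] by (auto simp: polys_over_def coeff_map_poly dl_simps)
  have dlr: "map_poly (dl e) r + Polynomial.smult (dl e w) (pdiff r) \<in> polys_over A" if "e \<in> D" "r \<in> polys_over A" for e r
    by (rule cl(2)[OF dl_over[OF that] cl(4)[OF w(2)[OF that(1)] pdiff_closed[OF A(1) that(2)]]])
  have dl_poly: "poly (map_poly (dl e) r + Polynomial.smult (dl e w) (pdiff r)) w = dl e (poly r w)" if "e \<in> D" for e r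
    using deriv_poly[OF dl_deriv[OF that], of r w] by (simp add: mult.commute)
  \<comment> \<open>Top coefficients in degree \<open>d\<close>. Automorphisms act on them directly;
    a derivation would add a term from degree \<open>d + 1\<close>, which vanishes here.\<close>
  define J where "J = {poly.coeff r d |r. r \<in> polys_over A \<and> poly r w \<in> I \<and> Polynomial.degree r \<le> d}"
  have JI: "poly.coeff r d \<in> J" if "r \<in> polys_over A" "poly r w \<in> I" "Polynomial.degree r \<le> d" for r
    using that by (auto simp: J_def)
  have "is_ideal A J"
  proof -
    have "poly.coeff r d + poly.coeff t d \<in> J" if "r \<in> polys_over A" "poly r w \<in> I" "Polynomial.degree r \<le> d"
      "t \<in> polys_over A" "poly t w \<in> I" "Polynomial.degree t \<le> d" for r t
      using JI[OF cl(2)[OF that(1,4)] _ degree_add_le[OF that(3,6)]] is_idealD(3)[OF I(1) that(2,5)] by simp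
    moreover have "a * poly.coeff r d \<in> J" if "r \<in> polys_over A" "poly r w \<in> I" "Polynomial.degree r \<le> d" "a \<in> A" for r a
      using JI[OF cl(4)[OF that(4,1)] _ order.trans[OF degree_smult_le that(3)]] sw(2) that(4)
        is_idealD(4)[OF I(1) _ that(2), of a] by auto
    moreover have "0 \<in> J" using JI[of 0] cl(8) is_idealD(2)[OF I(1)] by simp
    ultimately show ?thesis using polys_overD[of _ A] unfolding is_ideal_def J_def by blast
  qed
  moreover have "stable J"
  proof (rule stableI)
    fix s x assume s: "s \<in> S" and "x \<in> J"
    then obtain r where r: "x = poly.coeff r d" "r \<in> polys_over A" "poly r w \<in> I" "Polynomial.degree r \<le> d"
      by (auto simp: J_def)
    note c = coeff_pcompose_shift[OF sh_deg[OF r(4), of s], where a = "sh s w - w"]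
    let ?t = "pcompose (map_poly (sh s) r) [:sh s w - w, 1:]"
    have "?t \<in> polys_over A" using pcompose_polys_over[OF A(1) w(1)[OF s] sh_over[OF s r(2)]] .
    moreover have "poly ?t w \<in> I" using stableD(1)[OF I(2) s r(3)] sh_poly[OF s, of r] by simp
    moreover have "Polynomial.degree ?t \<le> d" using c(3) by (intro degree_le) auto
    ultimately have "poly.coeff ?t d \<in> J" by (rule JI)
    then show "sh s x \<in> J" using c(1) r(1) s by (simp add: coeff_map_poly sh_simps)
  next
    fix e x assume e: "e \<in> D" and "x \<in> J"
    then obtain r where r: "x = poly.coeff r d" "r \<in> polys_over A" "poly r w \<in> I" "Polynomial.degree r \<le> d"
      by (auto simp: J_def)
    let ?t = "map_poly (dl e) r + Polynomial.smult (dl e w) (pdiff r)"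
    have co: "poly.coeff ?t i = dl e (poly.coeff r i) + dl e w * (of_nat (Suc i) * poly.coeff r (Suc i))" for i
      using e by (simp add: coeff_map_poly dl_simps coeff_pdiff del: of_nat_Suc)
    have "poly.coeff ?t i = 0" if "i > d" for i
      unfolding co using that r(4) e by (simp add: coeff_eq_0 dl_simps)
    then have "Polynomial.degree ?t \<le> d" by (intro degree_le) auto
    moreover have "poly ?t w \<in> I" using stableD(2)[OF I(2) e r(3)] dl_poly[OF e, of r] by metis
    ultimately have "poly.coeff ?t d \<in> J" using JI dlr[OF e r(2)] by blast
    then show "dl e x \<in> J" using r(1,4) co[of d] by (simp add: coeff_eq_0)
  qed
  moreover have "N \<subseteq> J"
  proof
    fix n assume n: "n \<in> N"
    then have "Polynomial.monom n d \<in> polys_over N" using is_idealD(2)[OF iN] by (auto simp: polys_over_def)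
    then have "poly (Polynomial.monom n d) w \<in> I" by (rule NI)
    moreover have "Polynomial.monom n d \<in> polys_over A" by (rule cl(5)[OF is_idealD(1)[OF iN n]])
    ultimately have "poly.coeff (Polynomial.monom n d) d \<in> J" by (intro JI) (auto simp: degree_monom_le)
    then show "n \<in> J" by simp
  qed
  moreover have "J \<noteq> N" using Pd JI unfolding Pr_def by blast
  ultimately have "1 \<in> J" using max_stableD(4)[OF N, of J] by blast
  then obtain r where r: "poly.coeff r d = 1" "r \<in> polys_over A" "poly r w \<in> I" "Polynomial.degree r \<le> d"
    by (auto simp: J_def)
  have d0: "0 < d"
  proof (rule ccontr)
    assume "\<not> 0 < d"
    then have "r = [:1:]" using r(1,4) by (metis coeff_pCons_0 degree_eq_zeroE gr0I le_zero_eq)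
    then have "1 \<in> I" using r(3) by simp
    then show False using I(3) is_subringD(2)[OF A(1)] max_stableD(3)[OF N] by blast
  qed
  define g where "g = poly.coeff r (d - 1)"
  have g: "g \<in> A" using polys_overD[OF r(2)] by (simp add: g_def)
  \<comment> \<open>The combination whose differences and derivatives are the coefficients at
    \<open>d - 1\<close> of the transformed monic relation.\<close>
  define v where "v = of_nat d * w + g"
  have v: "sh s v - v \<in> N" if s: "s \<in> S" for s
  proof -
    note c = coeff_pcompose_shift[OF sh_deg[OF r(4), of s], where a = "sh s w - w"]
    let ?t = "pcompose (map_poly (sh s) r) [:sh s w - w, 1:] - r"
    have "?t \<in> polys_over A" by (rule cl(1)[OF pcompose_polys_over[OF A(1) w(1)[OF s] sh_over[OF s r(2)]] r(2)])
    moreover have "poly ?t w \<in> I"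
      using is_ideal_neg(2)[OF sw(1) I(1) stableD(1)[OF I(2) s r(3)] r(3)] sh_poly[OF s, of r] by simp
    moreover have "poly.coeff ?t j = 0" if "j \<ge> d" for j
      using that c(1,3) r(1,4) s by (cases "j = d") (auto simp: coeff_map_poly sh_simps coeff_eq_0)
    ultimately have "poly.coeff ?t (d - 1) \<in> N" using small by blast
    then have "sh s g + of_nat d * (sh s w - w) - g \<in> N"
      using c(2)[OF d0] s r(1) by (simp add: coeff_map_poly sh_simps g_def)
    moreover have "sh s (of_nat d) = of_nat d" using hom_on_of_nat[OF is_subring_UNIV sh_hom[OF s]] .
    ultimately show ?thesis using s by (simp add: v_def sh_simps algebra_simps)
  qed
  have v': "dl e v \<in> N" if e: "e \<in> D" for e
  proof -
    let ?t = "map_poly (dl e) r + Polynomial.smult (dl e w) (pdiff r)"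
    have co: "poly.coeff ?t i = dl e (poly.coeff r i) + dl e w * (of_nat (Suc i) * poly.coeff r (Suc i))" for i
      using e by (simp add: coeff_map_poly dl_simps coeff_pdiff del: of_nat_Suc)
    have "poly.coeff ?t j = 0" if "j \<ge> d" for j
      unfolding co using that r(1,4) e by (cases "j = d") (auto simp: coeff_eq_0 dl_simps)
    moreover have "poly ?t w \<in> I" using stableD(2)[OF I(2) e r(3)] dl_poly[OF e, of r] by metis
    ultimately have "poly.coeff ?t (d - 1) \<in> N" using small[OF dlr[OF e r(2)]] by blast
    then have "dl e g + dl e w * of_nat d \<in> N" using d0 r(1) unfolding co by (simp add: g_def del: of_nat_Suc)
    then show ?thesis using e by (simp add: v_def dl_simps algebra_simps)
  qed
  \<comment> \<open>Division by the degree; the inverse of a positive integer is itself a constant,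
    so \<open>?e * v\<close> stays constant modulo \<open>N\<close>.\<close>
  let ?e = "\<iota> (inverse (of_nat d))"
  have e: "?e \<in> A" using A(3) by blast
  have f: "w - (- (?e * g)) = ?e * v"
    using \<iota>_inverse_nat[OF d0] by (simp add: v_def distrib_left mult.assoc[symmetric])
  have "const_mod N (w - (- (?e * g)))"
    unfolding f const_mod_def
  proof (intro conjI ballI)
    fix s assume s: "s \<in> S"
    then have "sh s (?e * v) - ?e * v = ?e * (sh s v - v)"
      by (simp add: sh_simps inverse_nat_const(1)[OF d0 s] algebra_simps)
    then show "sh s (?e * v) - ?e * v \<in> N" using is_idealD(4)[OF iN e v[OF s]] by simp
  next
    fix h assume h: "h \<in> D"
    then have "dl h (?e * v) = ?e * dl h v"
      by (simp add: dl_simps inverse_nat_const(2)[OF d0 h])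
    then show "dl h (?e * v) \<in> N" using is_idealD(4)[OF iN e v'[OF h]] by simp
  qed
  moreover have "- (?e * g) \<in> A" using e g is_subringD(3,6)[OF A(1)] by blast
  ultimately show ?thesis by blast
qed

text \<open>Transcendence of \<open>w\<close> over \<open>A\<close> modulo \<open>N\<close>.\<close>

definition free_mod :: "'r set \<Rightarrow> 'r set \<Rightarrow> 'r \<Rightarrow> bool" where
  "free_mod A N w \<longleftrightarrow> (\<forall>p\<in>polys_over A. poly p w \<in> N \<longrightarrow> (\<forall>i. poly.coeff p i \<in> N))"

lemma stable_adj:
  assumes A: "is_subring A" "stable A"
    and w: "\<And>s. s \<in> S \<Longrightarrow> sh s w - w \<in> A" "\<And>d. d \<in> D \<Longrightarrow> dl d w \<in> A"
  shows "stable (adj A w)"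
proof (rule stableI)
  note sw = adj_subring[OF A(1), of w]
  fix s x assume s: "s \<in> S" and "x \<in> adj A w"
  then obtain p where p: "p \<in> polys_over A" "x = poly p w" by (auto simp: adj_def)
  have "map_poly (sh s) p \<in> polys_over (adj A w)"
    using p(1) s stableD(1)[OF A(2)] sw(2) by (auto simp: polys_over_def coeff_map_poly sh_simps)
  moreover have "sh s w \<in> adj A w" using is_subringD(4)[OF sw(1), of "sh s w - w" w] w(1)[OF s] sw by auto
  ultimately show "sh s x \<in> adj A w"
    using hom_on_poly[OF is_subring_UNIV sh_hom[OF s], of p w] p(2) poly_in_subring[OF sw(1)]
    by (simp add: polys_over_def)
next
  note sw = adj_subring[OF A(1), of w]
  fix d x assume d: "d \<in> D" and "x \<in> adj A w"
  then obtain p where p: "p \<in> polys_over A" "x = poly p w" by (auto simp: adj_def)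
  have "map_poly (dl d) p \<in> polys_over A"
    using p(1) d stableD(2)[OF A(2)] by (auto simp: polys_over_def coeff_map_poly dl_simps)
  then show "dl d x \<in> adj A w"
    using deriv_poly[OF dl_deriv[OF d], of p w] p(2) adjI pdiff_closed[OF A(1) p(1)] w(2)[OF d] sw(2)
    by (auto intro!: is_subringD[OF sw(1)])
qed

text \<open>As the larger ring has no new constants, the difference \<open>w - f\<close> from
  \<open>lead_descent\<close> is congruent to a constant of the field, and \<open>w\<close> itself
  to an element of \<open>A\<close>. Maximality is inherited for the same reason: an invariant ideal
  above the contraction meets \<open>A\<close> in \<open>N' \<inter> A\<close> only, so its elements
  either reduce to elements of \<open>A\<close> or have all coefficients in
  \<open>N'\<close>.\<close>

lemma adjoin_step:
  assumes A': "is_subring A'" "is_ideal A' N'" "stable N'" "constants_only A' N'"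
    and A: "is_subring A" "stable A" "range \<iota> \<subseteq> A" "A \<subseteq> A'" and N: "max_stable A (N' \<inter> A)"
    and w: "w \<in> A'" "\<And>s. s \<in> S \<Longrightarrow> sh s w - w \<in> A" "\<And>d. d \<in> D \<Longrightarrow> dl d w \<in> A"
  shows "max_stable (adj A w) (N' \<inter> adj A w)" "(\<exists>f\<in>A. w - f \<in> N') \<or> free_mod A N' w"
proof -
  note iN = max_stableD(1)[OF N]
  note sw = adj_subring[OF A(1), of w]
  have wA': "adj A w \<subseteq> A'" using adj_least[OF A'(1) A(4) w(1)] .
  have st: "stable (adj A w)" using stable_adj[OF A(1,2) w(2,3)] .
  have iN': "is_ideal (adj A w) (N' \<inter> adj A w)" using is_ideal_Int[OF A'(2) sw(1) wA'] .
  have found: "\<exists>f\<in>A. w - f \<in> N'"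
    if I: "is_ideal (adj A w) I" "stable I" "I \<inter> A = N' \<inter> A"
      and q: "q \<in> polys_over A" "poly q w \<in> I" "poly.coeff q i \<notin> N'"
    for I q i
  proof -
    obtain f where f: "f \<in> A" "const_mod (N' \<inter> A) (w - f)"
      using lead_descent[OF A(1-3) N w(2,3) I q(1,2), of i] q(3) by blast
    then have "const_mod N' (w - f)" by (auto simp: const_mod_def)
    moreover have "w - f \<in> A'" using is_subringD(5)[OF A'(1) w(1)] f(1) A(4) by blast
    ultimately obtain l where "l \<in> C" "w - f - \<iota> l \<in> N'" using A'(4) by (auto simp: constants_only_def)
    moreover have "f + \<iota> l \<in> A" using f(1) A(3) is_subringD(4)[OF A(1)] by blast
    ultimately show ?thesis by (intro bexI[of _ "f + \<iota> l"]) (auto simp: algebra_simps)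
  qed
  show dich: "(\<exists>f\<in>A. w - f \<in> N') \<or> free_mod A N' w"
  proof (cases "free_mod A N' w")
    case False
    then obtain q i where "q \<in> polys_over A" "poly q w \<in> N'" "poly.coeff q i \<notin> N'"
      by (auto simp: free_mod_def)
    then show ?thesis
      using found[OF iN' stable_Int[OF A'(3) st], of q i] sw(2) adjI by blast
  qed simp
  have "I = N' \<inter> adj A w" if I: "is_ideal (adj A w) I" "stable I" "N' \<inter> adj A w \<subseteq> I" "1 \<notin> I" for I
  proof -
    have "is_ideal A (I \<inter> A)" using is_ideal_Int[OF I(1) A(1) sw(2)] .
    then have IA: "I \<inter> A = N' \<inter> A"
      using max_stableD(4)[OF N _ stable_Int[OF I(2) A(2)]] I(3,4) sw(2) by blast
    have "x \<in> N'" if "x \<in> I" for x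
    proof -
      obtain p where p: "p \<in> polys_over A" "x = poly p w" using is_idealD(1)[OF I(1) \<open>x \<in> I\<close>] by (auto simp: adj_def)
      show "x \<in> N'"
      proof (cases "\<exists>f\<in>A. w - f \<in> N'")
        case True
        then obtain f where f: "f \<in> A" "w - f \<in> N'" by blast
        have pA': "p \<in> polys_over A'" using p(1) polys_over_mono[OF A(4)] by blast
        have pf: "poly p f \<in> A" using poly_in_subring[OF A(1) p(1) f(1)] .
        have 1: "x - poly p f \<in> N'"
          using poly_cong_ideal[OF A'(1,2) w(1) _ f(2) pA'] f(1) A(4) p(2) by blast
        moreover have "x - poly p f \<in> adj A w" using p adjI pf sw(2) is_subringD(5)[OF sw(1)] by blast
        ultimately have "x - (x - poly p f) \<in> I" using I(3) is_ideal_neg(2)[OF sw(1) I(1) that] by blast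
        then have "poly p f \<in> N'" using pf IA by auto
        then show ?thesis using is_idealD(3)[OF A'(2) 1] by fastforce
      next
        case False
        then have "poly.coeff p i \<in> N'" for i using found[OF I(1,2) IA p(1), of i] p(2) that by blast
        then show ?thesis using poly_in_ideal[OF A'(1,2) _ w(1), of p] p(2) by (auto simp: polys_over_def)
      qed
    qed
    then show ?thesis using I(3) is_idealD(1)[OF I(1)] by blast
  qed
  then show "max_stable (adj A w) (N' \<inter> adj A w)"
    using iN' stable_Int[OF A'(3) st] max_stableD(3)[OF N] is_subringD(2)[OF A(1)]
    unfolding max_stable_def by blast
qed

text \<open>The real part is prescribed by \<open>\<phi>\<close>; only the infinitesimal part is
  extended. If \<open>w\<close> is congruent to \<open>f\<close>, its value is forced to be that of
  \<open>f\<close>; if \<open>w\<close> is transcendental, every infinitesimal part is admissible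
  and zero is taken.\<close>

lemma dual_extend_step:
  fixes \<Phi> :: "'r \<Rightarrow> 'w::comm_ring_1 dual"
  assumes A': "is_subring A'" "is_ideal A' N'" and A: "is_subring A" "A \<subseteq> A'" and w: "w \<in> A'"
    and dich: "(\<exists>f\<in>A. w - f \<in> N') \<or> free_mod A N' w"
    and \<phi>: "hom_on A' \<phi>" "\<And>y. y \<in> N' \<Longrightarrow> \<phi> y = 0"
    and \<Phi>: "hom_on A \<Phi>" "\<And>y. y \<in> A \<Longrightarrow> rpart (\<Phi> y) = \<phi> y" "\<And>y. y \<in> A \<Longrightarrow> y \<in> N' \<Longrightarrow> \<Phi> y = 0"
  shows "\<exists>\<Phi>'. hom_on (adj A w) \<Phi>' \<and> (\<forall>y\<in>adj A w. rpart (\<Phi>' y) = \<phi> y) \<and>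
    (\<forall>y\<in>adj A w. y \<in> N' \<longrightarrow> \<Phi>' y = 0) \<and> (\<forall>y\<in>A. \<Phi>' y = \<Phi> y)"
proof -
  have "\<exists>\<xi>. rpart \<xi> = \<phi> w \<and> (\<forall>p\<in>polys_over A. poly p w \<in> N' \<longrightarrow> poly (map_poly \<Phi> p) \<xi> = 0)"
    using dich
  proof
    assume "\<exists>f\<in>A. w - f \<in> N'"
    then obtain f where f: "f \<in> A" "w - f \<in> N'" by blast
    have "poly (map_poly \<Phi> p) (\<Phi> f) = 0" if p: "p \<in> polys_over A" "poly p w \<in> N'" for p
    proof -
      have "poly p w - poly p f \<in> N'"
        using poly_cong_ideal[OF A' w _ f(2), of p] f(1) A(2) polys_over_mono[OF A(2)] p(1) by blast
      then have "poly p f \<in> N'" using is_ideal_neg(2)[OF A' p(2)] by fastforce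
      then show ?thesis
        using \<Phi>(3)[OF poly_in_subring[OF A(1) p(1) f(1)]] hom_on_poly[OF A(1) \<Phi>(1) p(1) f(1)] by simp
    qed
    moreover have "rpart (\<Phi> f) = \<phi> w"
      using \<phi>(2)[OF f(2)] hom_on_more(3)[OF A'(1) \<phi>(1) w, of f] f(1) A(2) \<Phi>(2) by auto
    ultimately show ?thesis by blast
  next
    assume fr: "free_mod A N' w"
    have "poly (map_poly \<Phi> p) (Dual (\<phi> w) 0) = 0" if p: "p \<in> polys_over A" "poly p w \<in> N'" for p
    proof -
      have "map_poly \<Phi> p = 0"
        using fr p \<Phi>(3) polys_overD[OF p(1)]
        by (intro poly_eqI) (auto simp: coeff_map_poly_hom[OF A(1) \<Phi>(1)] free_mod_def)
      then show ?thesis by simp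
    qed
    then show ?thesis by (intro exI[of _ "Dual (\<phi> w) 0"]) auto
  qed
  then obtain \<xi> where \<xi>: "rpart \<xi> = \<phi> w" "\<And>p. p \<in> polys_over A \<Longrightarrow> poly p w \<in> N' \<Longrightarrow> poly (map_poly \<Phi> p) \<xi> = 0"
    by blast
  obtain \<Phi>' where \<Phi>': "hom_on (adj A w) \<Phi>'" "\<forall>p\<in>polys_over A. \<Phi>' (poly p w) = poly (map_poly \<Phi> p) \<xi>"
    "\<forall>a\<in>A. \<Phi>' a = \<Phi> a" "\<forall>y\<in>adj A w \<inter> N'. \<Phi>' y = 0"
    using hom_on_adj_extend[OF A(1) \<Phi>(1) is_idealD(2)[OF A'(2)] \<xi>(2)] by blast
  have "rpart (\<Phi>' y) = \<phi> y" if "y \<in> adj A w" for y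
  proof -
    obtain p where p: "p \<in> polys_over A" "y = poly p w" using \<open>y \<in> adj A w\<close> by (auto simp: adj_def)
    have "map_poly rpart (map_poly \<Phi> p) = map_poly \<phi> p"
      by (intro poly_eqI) (simp add: coeff_map_poly_hom[OF A(1) \<Phi>(1)] coeff_map_poly
          hom_on_more(1)[OF A'(1) \<phi>(1)] \<Phi>(2) polys_overD[OF p(1)])
    then have "rpart (\<Phi>' y) = poly (map_poly \<phi> p) (\<phi> w)" using \<Phi>'(2) p \<xi>(1) by (simp add: rpart_poly)
    then show ?thesis
      using hom_on_poly[OF A'(1) \<phi>(1) _ w, of p] polys_over_mono[OF A(2)] p by auto
  qed
  then show ?thesis using \<Phi>' by blast
qed

text \<open>For \<open>u\<close> in \<open>A\<close> outside \<open>N\<close>: the annihilator of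
  \<open>u\<close> modulo \<open>N\<close> is a prime ideal.\<close>

definition prime_ann :: "'r set \<Rightarrow> 'r set \<Rightarrow> 'r \<Rightarrow> bool" where
  "prime_ann A N u \<longleftrightarrow> (\<forall>x\<in>A. \<forall>y\<in>A. x * y * u \<in> N \<longrightarrow> x * u \<in> N \<or> y * u \<in> N)"

text \<open>If \<open>w\<close> is congruent to an element of \<open>A\<close>, then
  \<open>A[w]\<close> and \<open>A\<close> agree modulo \<open>N'\<close>. If \<open>w\<close> is
  transcendental, this is the lemma of Gauss: a prime ideal generates a prime ideal in the
  polynomial ring.\<close>

lemma prime_ann_step:
  assumes A': "is_subring A'" "is_ideal A' N'" and A: "is_subring A" "A \<subseteq> A'" and w: "w \<in> A'"
    and dich: "(\<exists>f\<in>A. w - f \<in> N') \<or> free_mod A N' w"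
    and u: "u \<in> A" "prime_ann A N' u"
  shows "prime_ann (adj A w) N' u"
  unfolding prime_ann_def
proof (intro ballI impI)
  fix x y assume "x \<in> adj A w" "y \<in> adj A w" and xy: "x * y * u \<in> N'"
  then obtain p q where p: "p \<in> polys_over A" "x = poly p w" and q: "q \<in> polys_over A" "y = poly q w"
    by (auto simp: adj_def)
  have pA': "p \<in> polys_over A'" "q \<in> polys_over A'" using p q polys_over_mono[OF A(2)] by auto
  have u': "u \<in> A'" using u A by blast
  show "x * u \<in> N' \<or> y * u \<in> N'"
    using dich
  proof
    assume "\<exists>f\<in>A. w - f \<in> N'"
    then obtain f where f: "f \<in> A" "w - f \<in> N'" by blast
    let ?x = "poly p f" and ?y = "poly q f"
    have fA: "?x \<in> A" "?y \<in> A" using poly_in_subring[OF A(1) _ f(1)] p q by auto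
    have xA': "x \<in> A'" "y \<in> A'" using poly_in_subring[OF A'(1) _ w] pA' p q by auto
    have c: "x - ?x \<in> N'" "y - ?y \<in> N'"
      using poly_cong_ideal[OF A' w _ f(2)] f(1) A(2) pA' p q by auto
    have "(y * u) * (x - ?x) \<in> N'" "(?x * u) * (y - ?y) \<in> N'"
      using c xA' fA u' A(2) is_subringD(6)[OF A'(1)] by (auto intro!: is_idealD(4)[OF A'(2)])
    then have "x * y * u - ((y * u) * (x - ?x) + (?x * u) * (y - ?y)) \<in> N'"
      by (intro is_ideal_neg(2)[OF A'] is_idealD(3)[OF A'(2)] xy)
    then have "?x * ?y * u \<in> N'" by (simp add: algebra_simps)
    then have "?x * u \<in> N' \<or> ?y * u \<in> N'" using u(2) fA by (auto simp: prime_ann_def)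
    moreover have "x * u = u * (x - ?x) + ?x * u" "y * u = u * (y - ?y) + ?y * u"
      by (auto simp: algebra_simps)
    ultimately show ?thesis using c is_idealD(3,4)[OF A'(2)] u' by metis
  next
    assume fr: "free_mod A N' w"
    note cl = polys_over_closed[OF A(1)]
    show ?thesis
    proof (rule ccontr)
      assume no: "\<not> ?thesis"
      have top: "\<exists>i. poly.coeff r i * u \<notin> N' \<and> (\<forall>j>i. poly.coeff r j * u \<in> N')"
        if r: "r \<in> polys_over A" "poly r w * u \<notin> N'" for r
      proof -
        have "\<exists>i. poly.coeff r i * u \<notin> N'"
        proof (rule ccontr)
          assume "\<nexists>i. poly.coeff r i * u \<notin> N'"
          then have "Polynomial.smult u r \<in> polys_over N'" by (auto simp: polys_over_def mult.commute)
          from poly_in_ideal[OF A' this w] r(2) show False by (simp add: mult.commute)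
        qed
        then obtain i where i: "poly.coeff r i * u \<notin> N'" by blast
        have bd: "poly.coeff r j * u \<notin> N' \<Longrightarrow> j \<le> Polynomial.degree r" for j
          using is_idealD(2)[OF A'(2)] by (metis le_degree mult_zero_left)
        show ?thesis
          using GreatestI_nat[where P = "\<lambda>j. poly.coeff r j * u \<notin> N'", OF i bd]
            Greatest_le_nat[where P = "\<lambda>j. poly.coeff r j * u \<notin> N'", OF _ bd] by (metis leD)
      qed
      \<comment> \<open>\<open>i\<close> and \<open>j\<close> are the last indices whose
        coefficients do not annihilate \<open>u\<close>; in the coefficient of the product at
        \<open>i + j\<close>, all other terms annihilate it.\<close>
      obtain i where i: "poly.coeff p i * u \<notin> N'" "\<And>k. k > i \<Longrightarrow> poly.coeff p k * u \<in> N'"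
        using top[OF p(1)] no p(2) by blast
      obtain j where j: "poly.coeff q j * u \<notin> N'" "\<And>k. k > j \<Longrightarrow> poly.coeff q k * u \<in> N'"
        using top[OF q(1)] no q(2) by blast
      have "poly (Polynomial.smult u (p * q)) w \<in> N'" using xy p q by (simp add: mult_ac)
      then have "poly.coeff (Polynomial.smult u (p * q)) (i + j) \<in> N'"
        using fr cl(4)[OF u(1) cl(3)[OF p(1) q(1)]] unfolding free_mod_def by blast
      then have *: "(\<Sum>k\<le>i + j. poly.coeff p k * poly.coeff q (i + j - k) * u) \<in> N'"
        by (simp add: coeff_mult sum_distrib_left mult_ac)
      have "(\<Sum>k\<in>{..i + j} - {i}. poly.coeff p k * poly.coeff q (i + j - k) * u) \<in> N'"
      proof (rule is_ideal_sum[OF A'(2)])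
        fix k assume k: "k \<in> {..i + j} - {i}"
        have pq: "poly.coeff p k \<in> A'" "poly.coeff q (i + j - k) \<in> A'" using polys_overD pA' by blast+
        show "poly.coeff p k * poly.coeff q (i + j - k) * u \<in> N'"
        proof (cases "k > i")
          case True
          then show ?thesis using is_idealD(4)[OF A'(2) pq(2) i(2)[OF True]] by (simp add: mult_ac)
        next
          case False
          then have "i + j - k > j" using k by auto
          then show ?thesis using is_idealD(4)[OF A'(2) pq(1) j(2)] by (simp add: mult_ac)
        qed
      qed
      from is_ideal_neg(2)[OF A' * this]
      have "poly.coeff p i * poly.coeff q j * u \<in> N'" by (simp add: sum_diff1)
      then show False
        using u(2) i(1) j(1) polys_overD[OF p(1)] polys_overD[OF q(1)] unfolding prime_ann_def by blast
    qed
  qed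
qed

end

subsection \<open>Constants of simple finitely generated rings\<close>

context sd_ring
begin

definition C_alg_closed :: bool where
  "C_alg_closed \<longleftrightarrow> (\<forall>p. 0 < Polynomial.degree p \<longrightarrow> (\<forall>i. poly.coeff p i \<in> C) \<longrightarrow> (\<exists>l\<in>C. poly p l = 0))"

lemma \<iota>_inj:
  assumes "(1::'r) \<noteq> 0"
  shows "inj \<iota>"
proof (rule injI)
  fix a b assume "\<iota> a = \<iota> b"
  then have "\<iota> (a - b) = 0" by (simp add: \<iota>_simps)
  then have "\<iota> (inverse (a - b) * (a - b)) = 0" by (simp add: \<iota>_simps)
  then show "a = b" using assms \<iota>_simps(1) by (cases "a = b") auto
qed

lemma map_poly_\<iota>:
  "map_poly \<iota> (p + q) = map_poly \<iota> p + map_poly \<iota> q" "map_poly \<iota> (p - q) = map_poly \<iota> p - map_poly \<iota> q"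
  "map_poly \<iota> (p * q) = map_poly \<iota> p * map_poly \<iota> q"
  using map_poly_hom[OF is_subring_UNIV \<iota>_hom, of p q] by (auto simp: polys_over_def)

lemma polys_over_range:
  "map_poly \<iota> f \<in> polys_over (range \<iota>)"
  "(1::'r) \<noteq> 0 \<Longrightarrow> p \<in> polys_over (range \<iota>) \<Longrightarrow> \<exists>f. p = map_poly \<iota> f"
proof -
  show "map_poly \<iota> f \<in> polys_over (range \<iota>)" by (auto simp: polys_over_def coeff_map_poly \<iota>_simps)
  assume 1: "(1::'r) \<noteq> 0" and p: "p \<in> polys_over (range \<iota>)"
  have "inv_into UNIV \<iota> 0 = 0" using inv_f_f[OF \<iota>_inj[OF 1], of 0] by (simp add: \<iota>_simps)
  then have "p = map_poly \<iota> (map_poly (inv_into UNIV \<iota>) p)"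
    using polys_overD[OF p] by (intro poly_eqI) (simp add: coeff_map_poly \<iota>_simps f_inv_into_f)
  then show "\<exists>f. p = map_poly \<iota> f" by blast
qed

lemma range_\<iota>_subring: "is_subring (range \<iota>)"
proof -
  have "\<iota> a - \<iota> b \<in> range \<iota>" "\<iota> a * \<iota> b \<in> range \<iota>" for a b
    using \<iota>_simps(3)[of a b] \<iota>_simps(6)[of a b] by (metis rangeI)+
  moreover have "1 \<in> range \<iota>" using \<iota>_simps(1) by (metis rangeI)
  ultimately show ?thesis by (auto simp: is_subring_def)
qed

lemma const_mod_diff:
  assumes "const_mod N c" "l \<in> C"
  shows "const_mod N (c - \<iota> l)"
  using assms by (auto simp: const_mod_def C_def sh_simps dl_simps sh_\<iota> dl_\<iota> \<iota>_simps)

text \<open>Take a monic polynomial of least degree over the field that vanishes at \<open>c\<close>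
  modulo \<open>N\<close>. Since \<open>c\<close> is constant, operators applied to its coefficients
  give polynomials vanishing there too, and minimality makes the coefficients constant. A root
  \<open>l\<close> in \<open>C\<close> splits off a linear factor; were \<open>c - l\<close> outside
  \<open>N\<close>, it would be a unit modulo \<open>N\<close> and the cofactor would vanish at
  \<open>c\<close>.\<close>

lemma constant_algebraic:
  assumes A: "is_subring A" "stable A" "range \<iota> \<subseteq> A" and N: "max_stable A N" and cl: C_alg_closed
    and c: "c \<in> A" "const_mod N c" and f: "f \<noteq> 0" "poly (map_poly \<iota> f) c \<in> N"
  shows "\<exists>l\<in>C. c - \<iota> l \<in> N"
proof -
  note iN = max_stableD(1)[OF N]
  define n where "n = (LEAST n. \<exists>f. f \<noteq> 0 \<and> poly (map_poly \<iota> f) c \<in> N \<and> Polynomial.degree f = n)"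
  have "\<exists>f. f \<noteq> 0 \<and> poly (map_poly \<iota> f) c \<in> N \<and> Polynomial.degree f = n"
    unfolding n_def by (rule LeastI_ex) (use f in blast)
  then obtain f0 where f0: "f0 \<noteq> 0" "poly (map_poly \<iota> f0) c \<in> N" "Polynomial.degree f0 = n" by blast
  have small: "g = 0" if "poly (map_poly \<iota> g) c \<in> N" "Polynomial.degree g < n" for g
    using not_less_Least[of "Polynomial.degree g" "\<lambda>n. \<exists>f. f \<noteq> 0 \<and> poly (map_poly \<iota> f) c \<in> N \<and> Polynomial.degree f = n"]
      that unfolding n_def by blast
  define f where "f = Polynomial.smult (inverse (Polynomial.lead_coeff f0)) f0"
  have f: "Polynomial.degree f = n" "poly.coeff f n = 1" using f0 by (auto simp: f_def)
  have "map_poly \<iota> f = Polynomial.smult (\<iota> (inverse (Polynomial.lead_coeff f0))) (map_poly \<iota> f0)"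
    by (rule poly_eqI) (simp add: f_def coeff_map_poly \<iota>_simps)
  then have fN: "poly (map_poly \<iota> f) c \<in> N" using is_idealD(4)[OF iN _ f0(2)] A(3) by auto
  have n0: "0 < n"
  proof (rule ccontr)
    assume "\<not> 0 < n"
    then have "f = 1" using f by (metis degree_eq_zeroE coeff_pCons_0 gr0I one_pCons)
    then have "map_poly \<iota> f = 1" by (simp add: \<iota>_simps)
    then show False using fN max_stableD(3)[OF N] by simp
  qed
  have over: "map_poly \<iota> g \<in> polys_over A" for g
    using polys_over_range(1) polys_over_mono[OF A(3)] by blast
  have "shk s (poly.coeff f i) = poly.coeff f i" if s: "s \<in> S" for s i
  proof -
    let ?g = "map_poly (shk s) f"
    have co: "poly.coeff ?g j = shk s (poly.coeff f j)" for j
      using coeff_map_poly_hom[OF is_subring_UNIV shk_hom[OF s]] .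
    have "map_poly (sh s) (map_poly \<iota> f) = map_poly \<iota> ?g"
      by (rule poly_eqI) (simp add: coeff_map_poly co sh_simps \<iota>_simps s sh_\<iota>)
    then have "sh s (poly (map_poly \<iota> f) c) = poly (map_poly \<iota> ?g) (sh s c)"
      using hom_on_poly[OF is_subring_UNIV sh_hom[OF s], of "map_poly \<iota> f" c] by (simp add: polys_over_def)
    then have 1: "poly (map_poly \<iota> ?g) (sh s c) \<in> N" using stableD(1)[OF max_stableD(2)[OF N] s fN] by simp
    have "poly (map_poly \<iota> ?g) (sh s c) - poly (map_poly \<iota> ?g) c \<in> N"
      using c(2) s stableD(1)[OF A(2) s c(1)] c(1) over
      by (intro poly_cong_ideal[OF A(1) iN]) (auto simp: const_mod_def)
    from is_ideal_neg(2)[OF A(1) iN 1 this] have "poly (map_poly \<iota> ?g) c \<in> N" by simp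
    then have "poly (map_poly \<iota> (?g - f)) c \<in> N"
      using is_ideal_neg(2)[OF A(1) iN _ fN] by (simp add: map_poly_\<iota>)
    moreover have "Polynomial.degree (?g - f) < n"
    proof (rule degree_lessI)
      show "\<forall>k\<ge>n. poly.coeff (?g - f) k = 0"
      proof (intro allI impI)
        fix k assume "n \<le> k"
        then show "poly.coeff (?g - f) k = 0"
          using f hom_onD(1)[OF shk_hom[OF s]] hom_on_more(1)[OF is_subring_UNIV shk_hom[OF s]]
          by (cases "k = n") (auto simp: co coeff_eq_0)
      qed
    qed (use n0 in simp)
    ultimately have "?g - f = 0" by (rule small)
    then show ?thesis using co[of i] by simp
  qed
  moreover have "dlk d (poly.coeff f i) = 0" if d: "d \<in> D" for d i
  proof -
    let ?g = "map_poly (dlk d) f"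
    have co: "poly.coeff ?g j = dlk d (poly.coeff f j)" for j
      using is_derivD(3)[OF dlk_deriv[OF d]] by (simp add: coeff_map_poly)
    have e: "map_poly (dl d) (map_poly \<iota> f) = map_poly \<iota> ?g"
      by (rule poly_eqI) (simp add: coeff_map_poly co dl_simps \<iota>_simps d dl_\<iota>)
    have "poly (pdiff (map_poly \<iota> f)) c * dl d c \<in> N"
      using c(2) d poly_in_subring[OF A(1) pdiff_closed[OF A(1) over] c(1)]
      by (intro is_idealD(4)[OF iN]) (auto simp: const_mod_def)
    from is_ideal_neg(2)[OF A(1) iN stableD(2)[OF max_stableD(2)[OF N] d fN] this]
    have "poly (map_poly \<iota> ?g) c \<in> N" using deriv_poly[OF dl_deriv[OF d], of "map_poly \<iota> f" c] e by simp
    moreover have "Polynomial.degree ?g < n"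
    proof (rule degree_lessI)
      show "\<forall>k\<ge>n. poly.coeff ?g k = 0"
      proof (intro allI impI)
        fix k assume "n \<le> k"
        then show "poly.coeff ?g k = 0"
          using f is_derivD[OF dlk_deriv[OF d]] by (cases "k = n") (auto simp: co coeff_eq_0)
      qed
    qed (use n0 in simp)
    ultimately have "?g = 0" by (rule small)
    then show ?thesis using co[of i] by simp
  qed
  ultimately have "poly.coeff f i \<in> C" for i by (auto simp: C_def)
  then obtain l where l: "l \<in> C" "poly f l = 0" using cl f(1) n0 by (auto simp: C_alg_closed_def)
  then obtain g where g: "f = [:- l, 1:] * g" by (auto simp: poly_eq_0_iff_dvd dvd_def)
  have "g \<noteq> 0" using g f n0 by auto
  then have "Polynomial.degree g < n" using g f(1) by (simp add: degree_mult_eq del: mult_pCons_left)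
  then have gN: "poly (map_poly \<iota> g) c \<notin> N" using small \<open>g \<noteq> 0\<close> by blast
  let ?c = "c - \<iota> l" and ?y = "poly (map_poly \<iota> g) c"
  have "map_poly \<iota> [:- l, 1:] = [:- \<iota> l, 1:]" by (simp add: map_poly_pCons \<iota>_simps)
  then have cy: "?c * ?y \<in> N" using fN by (simp add: g map_poly_\<iota> del: mult_pCons_left)
  have "?c \<in> A" using c(1) A(3) is_subringD(5)[OF A(1)] by blast
  show ?thesis
  proof (rule ccontr)
    assume "\<not> ?thesis"
    then have "?c \<notin> N" using l by blast
    from const_unit[OF A(1,2) N \<open>?c \<in> A\<close> const_mod_diff[OF c(2) l(1)] this]
    obtain m a where m: "m \<in> N" "a \<in> A" "m + a * ?c = 1" by blast
    have "?y \<in> A" using poly_in_subring[OF A(1) over c(1)] .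
    then have "?y * m + a * (?c * ?y) \<in> N"
      using is_idealD(3)[OF iN is_idealD(4)[OF iN _ m(1)] is_idealD(4)[OF iN m(2) cy]] by blast
    moreover have "?y * m + a * (?c * ?y) = (m + a * ?c) * ?y" by (simp add: algebra_simps)
    ultimately show False using gN m(3) by simp
  qed
qed

text \<open>A constant \<open>c\<close> that is transcendental over the field can be specialised to
  almost any value. Specialising to a constant \<open>l\<close> gives a homomorphism that kills
  \<open>N\<close> and \<open>c - l\<close>. But \<open>c - l\<close> is again constant, so outside
  \<open>N\<close> it would be a unit modulo \<open>N\<close>.\<close>

theorem constants_only_fin_gen:
  assumes A: "A = adjoin (range \<iota>) xs" "stable A" and N: "max_stable A N" and cl: C_alg_closed
  shows "constants_only A N"
  unfolding constants_only_def
proof (intro ballI impI)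
  fix c assume c: "c \<in> A" "const_mod N c"
  note kk = range_\<iota>_subring
  have sA: "is_subring A" and kA: "range \<iota> \<subseteq> A" using adjoin_subring[OF kk, of xs] A(1) by auto
  note iN = max_stableD(1)[OF N]
  have one: "(1::'r) \<noteq> 0" using max_stableD(3)[OF N] is_idealD(2)[OF iN] by metis
  note inj = \<iota>_inj[OF one]
  show "\<exists>l\<in>C. c - \<iota> l \<in> N"
  proof (cases "\<exists>f. f \<noteq> 0 \<and> poly (map_poly \<iota> f) c \<in> N")
    case True
    then show ?thesis using constant_algebraic[OF sA A(2) kA N cl c] by blast
  next
    case False
    \<comment> \<open>A prime ideal avoiding these elements keeps \<open>c\<close> transcendental
      over the field.\<close>
    let ?M = "{poly (map_poly \<iota> f) c |f. f \<noteq> 0}"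
    have over: "map_poly \<iota> g \<in> polys_over A" for g
      using polys_over_range(1) polys_over_mono[OF kA] by blast
    have "?M \<subseteq> A" using poly_in_subring[OF sA over c(1)] by blast
    moreover have "1 \<in> ?M" by (rule CollectI, rule exI[of _ 1]) (simp add: \<iota>_simps)
    moreover have "x * y \<in> ?M" if xy: "x \<in> ?M" "y \<in> ?M" for x y
    proof -
      obtain f g where "x = poly (map_poly \<iota> f) c" "f \<noteq> 0" "y = poly (map_poly \<iota> g) c" "g \<noteq> 0"
        using xy by blast
      then show ?thesis by (intro CollectI exI[of _ "f * g"]) (simp add: map_poly_\<iota>)
    qed
    moreover have "N \<inter> ?M = {}" using False by blast
    ultimately obtain Q where Q: "is_prime A Q" "N \<subseteq> Q" "Q \<inter> ?M = {}"
      using prime_ideal_exists[OF sA iN, of ?M] by blast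
    have iQ: "is_ideal A Q" using Q(1) by (simp add: is_prime_def)
    let ?B = "adj (range \<iota>) c"
    note sB = adj_subring[OF kk, of c]
    have BA: "?B \<subseteq> A" using adj_least[OF sA kA c(1)] .
    have xsA: "set xs \<subseteq> A" using adjoin_subring(3)[OF kk] A(1) by blast
    have AB: "adjoin ?B xs = A"
      using adjoin_least[OF sA BA xsA] adjoin_least[OF adjoin_subring(1)[OF sB(1)], of "range \<iota>" xs xs]
        adjoin_subring(2,3)[OF sB(1), of xs] sB(2) A(1) by blast
    have tor: "\<forall>n>0. \<forall>a\<in>A. of_nat n * a \<in> Q \<longrightarrow> a \<in> Q"
      using torsion_free[OF kA iQ] by blast
    have "1 \<in> adjoin ?B xs" "1 \<notin> Q" using AB is_subringD(2)[OF sA] Q(1) by (auto simp: is_prime_def)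
    note E = extend_many[OF sB(1) BA Q(1) sA xsA tor this, where ?'w = "'k alg_closure", unfolded AB]
    obtain a where a: "a \<in> ?B" and a': "a \<notin> Q \<and> (\<forall>\<phi> :: 'r \<Rightarrow> 'k alg_closure dual.
        hom_on ?B \<phi> \<and> (\<forall>y\<in>?B \<inter> Q. \<phi> y = 0) \<and> rpart (\<phi> a) \<noteq> 0 \<longrightarrow>
        (\<exists>\<phi>'. hom_on A \<phi>' \<and> (\<forall>y\<in>?B. \<phi>' y = \<phi> y) \<and> (\<forall>y\<in>A \<inter> Q. \<phi>' y = 0) \<and> rpart (\<phi>' 1) \<noteq> 0))"
      by (rule bexE[OF E])
    note ext = conjunct2[OF a', rule_format]
    obtain f where f: "a = poly (map_poly \<iota> f) c"
      using a polys_over_range(2)[OF one] by (auto simp: adj_def)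
    have "f \<noteq> 0" using f conjunct1[OF a'] is_idealD(2)[OF iQ] by auto
    then obtain l where l: "l \<in> C" "poly f l \<noteq> 0"
    proof -
      \<comment> \<open>The natural numbers supply infinitely many constants, so one of them is not
        a root of \<open>f\<close>.\<close>
      have "infinite (range (of_nat :: nat \<Rightarrow> 'k))" by (simp add: range_inj_infinite)
      then obtain m where "poly f (of_nat m) \<noteq> 0"
        using poly_roots_finite[OF \<open>f \<noteq> 0\<close>] by (metis (mono_tags, lifting) finite_subset mem_Collect_eq rangeE subsetI)
      then show ?thesis using that of_nat_in_C by blast
    qed
    \<comment> \<open>Only real parts matter in this argument, so infinitesimal parts are zero. The
      target is the algebraic closure because \<open>extend_many\<close> has to find roots.\<close>
    define \<phi>0 where "\<phi>0 x = Dual (to_ac (inv_into UNIV \<iota> x)) 0" for x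
    have \<phi>0: "\<phi>0 (\<iota> b) = Dual (to_ac b) 0" for b using inv_f_f[OF inj] by (simp add: \<phi>0_def)
    have \<phi>0_hom: "hom_on (range \<iota>) \<phi>0"
      unfolding hom_on_def
    proof (intro conjI ballI)
      show "\<phi>0 1 = 1" using \<phi>0[of 1] by (simp add: \<iota>_simps one_dual_def)
      fix x y assume "x \<in> range \<iota>" "y \<in> range \<iota>"
      then obtain b b' where "x = \<iota> b" "y = \<iota> b'" by blast
      then show "\<phi>0 (x + y) = \<phi>0 x + \<phi>0 y" "\<phi>0 (x * y) = \<phi>0 x * \<phi>0 y"
        using \<phi>0[of "b + b'"] \<phi>0[of "b * b'"] \<phi>0[of b] \<phi>0[of b']
        by (simp_all add: \<iota>_simps plus_dual_def times_dual_def)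
    qed
    \<comment> \<open>Only the zero polynomial is a relation of \<open>c\<close> modulo
      \<open>Q\<close>, so every value for \<open>c\<close> is admissible.\<close>
    have z: "p = 0" if p: "p \<in> polys_over (range \<iota>)" "poly p c \<in> Q" for p
    proof -
      obtain g where "p = map_poly \<iota> g" using polys_over_range(2)[OF one p(1)] by blast
      then show ?thesis using p(2) Q(3) by (cases "g = 0") auto
    qed
    have z': "poly (map_poly \<phi>0 p) (Dual (to_ac l) 0) = 0"
      if "p \<in> polys_over (range \<iota>)" "poly p c \<in> Q" for p
      using z[OF that] by simp
    obtain \<phi>1 where \<phi>1: "hom_on ?B \<phi>1"
      "\<forall>p\<in>polys_over (range \<iota>). \<phi>1 (poly p c) = poly (map_poly \<phi>0 p) (Dual (to_ac l) 0)"
      "\<forall>b\<in>range \<iota>. \<phi>1 b = \<phi>0 b" "\<forall>y\<in>?B \<inter> Q. \<phi>1 y = 0"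
      using hom_on_adj_extend[OF kk \<phi>0_hom is_idealD(2)[OF iQ] z'] by blast
    have "map_poly rpart (map_poly \<phi>0 (map_poly \<iota> f)) = map_poly to_ac f"
    proof (rule poly_eqI)
      fix i
      have "\<phi>0 0 = 0" using hom_on_more(1)[OF kk \<phi>0_hom] .
      then show "poly.coeff (map_poly rpart (map_poly \<phi>0 (map_poly \<iota> f))) i = poly.coeff (map_poly to_ac f) i"
        by (simp add: coeff_map_poly \<iota>_simps \<phi>0)
    qed
    moreover have "poly (map_poly to_ac f) (to_ac l) = to_ac (poly f l)"
      by (induction f) (simp_all add: map_poly_pCons)
    ultimately have "rpart (\<phi>1 a) = to_ac (poly f l)"
      using \<phi>1(2) polys_over_range(1)[of f] f by (simp add: rpart_poly)
    then have "rpart (\<phi>1 a) \<noteq> 0" using l(2) by simp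
    then have "hom_on ?B \<phi>1 \<and> (\<forall>y\<in>?B \<inter> Q. \<phi>1 y = 0) \<and> rpart (\<phi>1 a) \<noteq> 0" using \<phi>1(1,4) by blast
    from ext[OF this] obtain \<phi> where
      \<phi>: "hom_on A \<phi>" "\<forall>y\<in>?B. \<phi> y = \<phi>1 y" "\<forall>y\<in>A \<inter> Q. \<phi> y = 0" by blast
    have "\<phi>1 c = Dual (to_ac l) 0"
      using \<phi>1(2) polys_over_closed(7)[OF kk is_subringD(1,2)[OF kk]]
        hom_on_more(1)[OF kk \<phi>0_hom] hom_onD(1)[OF \<phi>0_hom]
      by (auto simp: map_poly_pCons dest!: bspec[of _ _ "[:0, 1:]"])
    then have \<phi>c: "\<phi> c = Dual (to_ac l) 0" using \<phi>(2) sB(3) by simp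
    have \<phi>l: "\<phi> (\<iota> l) = Dual (to_ac l) 0" using \<phi>(2) \<phi>1(3) \<phi>0 sB(2) by (metis rangeI subsetD)
    have cl: "c - \<iota> l \<in> A" using c(1) kA is_subringD(5)[OF sA] by blast
    have "\<phi> (c - \<iota> l) = \<phi> c - \<phi> (\<iota> l)" using hom_on_more(3)[OF sA \<phi>(1) c(1)] kA by blast
    then have \<phi>z: "\<phi> (c - \<iota> l) = 0" using \<phi>c \<phi>l by simp
    have "c - \<iota> l \<in> N"
    proof (rule ccontr)
      assume "c - \<iota> l \<notin> N"
      from const_unit[OF sA A(2) N cl const_mod_diff[OF c(2) l(1)] this]
      obtain m b where m: "m \<in> N" "b \<in> A" "m + b * (c - \<iota> l) = 1" by blast
      have "m \<in> A" using is_idealD(1)[OF iN m(1)] .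
      moreover have "b * (c - \<iota> l) \<in> A" using is_subringD(6)[OF sA m(2) cl] .
      ultimately have "\<phi> (m + b * (c - \<iota> l)) = \<phi> m + \<phi> b * \<phi> (c - \<iota> l)"
        using hom_onD(2,3)[OF \<phi>(1)] m(2) cl by metis
      moreover have "\<phi> m = 0" using m(1) Q(2) \<phi>(3) \<open>m \<in> A\<close> by blast
      ultimately have "\<phi> 1 = 0" using m(3) \<phi>z by simp
      then show False using hom_onD(1)[OF \<phi>(1)] dual_simps(1,3) by (metis one_neq_zero)
    qed
    then show ?thesis using l by blast
  qed
qed

end

subsection \<open>Noetherian rings\<close>

definition ideal_span :: "'r::comm_ring_1 set \<Rightarrow> 'r set \<Rightarrow> 'r set" where
  "ideal_span A G = \<Inter>{I. is_ideal A I \<and> G \<subseteq> I}"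

text \<open>The ascending chain condition in terms of sequences: some term lies in the ideal
  generated by the earlier ones.\<close>

definition noeth :: "'r::comm_ring_1 set \<Rightarrow> bool" where
  "noeth A \<longleftrightarrow> (\<forall>g :: nat \<Rightarrow> 'r. range g \<subseteq> A \<longrightarrow> (\<exists>n. g n \<in> ideal_span A (g ` {..<n})))"

lemma is_ideal_self: "is_subring A \<Longrightarrow> is_ideal A A"
  by (auto simp: is_ideal_def is_subringD)

lemma ideal_span_least: "is_ideal A I \<Longrightarrow> G \<subseteq> I \<Longrightarrow> ideal_span A G \<subseteq> I"
  by (auto simp: ideal_span_def)

lemma ideal_span_superset: "G \<subseteq> ideal_span A G"
  by (auto simp: ideal_span_def)

lemma ideal_span_ideal:
  assumes "is_subring A" "G \<subseteq> A"
  shows "is_ideal A (ideal_span A G)"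
proof -
  have "ideal_span A G \<subseteq> A" using ideal_span_least[OF is_ideal_self[OF assms(1)] assms(2)] .
  then show ?thesis
    unfolding is_ideal_def by (auto simp: ideal_span_def intro: is_idealD)
qed

text \<open>Hilbert's argument. An element of \<open>A[x]\<close> may be the value of several
  polynomials, so the degrees to be compared are those of chosen representatives of least
  degree.\<close>

theorem hilbert_basis:
  assumes A: "is_subring A" "noeth A"
  shows "noeth (adj A x)"
  unfolding noeth_def
proof (intro allI impI)
  fix h :: "nat \<Rightarrow> 'a" assume h: "range h \<subseteq> adj A x"
  note sx = adj_subring[OF A(1), of x] and cl = polys_over_closed[OF A(1)]
  let ?B = "adj A x"
  show "\<exists>n. h n \<in> ideal_span ?B (h ` {..<n})"
  proof (rule ccontr)
    assume no: "\<not> ?thesis"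
    \<comment> \<open>No term of \<open>h\<close> lies in the span of the earlier ones, so no finite
      part of \<open>I\<close> generates it; hence the choice of the polynomials \<open>p n\<close>
      below never stops.\<close>
    define I where "I = ideal_span ?B (range h)"
    have iI: "is_ideal ?B I" unfolding I_def using ideal_span_ideal[OF sx(1) h] .
    have hI: "range h \<subseteq> I" unfolding I_def by (rule ideal_span_superset)
    define J where "J p n = ideal_span ?B ((\<lambda>i. poly (p i) x) ` {..<n})" for p :: "nat \<Rightarrow> 'a poly" and n
    have hmono: "ideal_span ?B (h ` {..<m}) \<subseteq> ideal_span ?B (h ` {..<n})" if "m \<le> n" for m n
    proof (rule ideal_span_least)
      show "is_ideal ?B (ideal_span ?B (h ` {..<n}))" using h by (intro ideal_span_ideal[OF sx(1)]) auto
      show "h ` {..<m} \<subseteq> ideal_span ?B (h ` {..<n})"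
        using ideal_span_superset[of "h ` {..<n}" ?B] that by force
    qed
    have ex: "\<exists>m. y \<in> ideal_span ?B (h ` {..<m})" if "y \<in> I" for y
    proof -
      have sp: "is_ideal ?B (ideal_span ?B (h ` {..<m}))" for m
        using h by (intro ideal_span_ideal[OF sx(1)]) auto
      have "is_ideal ?B (\<Union>m. ideal_span ?B (h ` {..<m}))"
        unfolding is_ideal_def
      proof (intro conjI ballI)
        show "(\<Union>m. ideal_span ?B (h ` {..<m})) \<subseteq> ?B" using is_idealD(1)[OF sp] by blast
        show "0 \<in> (\<Union>m. ideal_span ?B (h ` {..<m}))" using is_idealD(2)[OF sp] by blast
        show "a * y \<in> (\<Union>m. ideal_span ?B (h ` {..<m}))" if "a \<in> ?B" "y \<in> (\<Union>m. ideal_span ?B (h ` {..<m}))" for a y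
          using is_idealD(4)[OF sp that(1)] that(2) by blast
        fix y z assume "y \<in> (\<Union>m. ideal_span ?B (h ` {..<m}))" "z \<in> (\<Union>m. ideal_span ?B (h ` {..<m}))"
        then obtain m n where "y \<in> ideal_span ?B (h ` {..<m})" "z \<in> ideal_span ?B (h ` {..<n})" by blast
        then have "y + z \<in> ideal_span ?B (h ` {..<max m n})"
          using hmono[of m "max m n"] hmono[of n "max m n"] is_idealD(3)[OF sp] by (meson max.cobounded1 max.cobounded2 subsetD)
        then show "y + z \<in> (\<Union>m. ideal_span ?B (h ` {..<m}))" by blast
      qed
      moreover have "range h \<subseteq> (\<Union>m. ideal_span ?B (h ` {..<m}))"
        using ideal_span_superset[of "h ` {..<Suc m}" ?B for m] by fastforce
      ultimately show ?thesis using that ideal_span_least unfolding I_def by blast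
    qed
    have not_all: "\<exists>y. y \<in> I \<and> y \<notin> J p n" if p: "\<And>i. i < n \<Longrightarrow> poly (p i) x \<in> I" for p n
    proof (rule ccontr)
      assume "\<not> ?thesis"
      then have IJ: "I \<subseteq> J p n" by blast
      obtain m where m: "\<And>i. i < n \<Longrightarrow> poly (p i) x \<in> ideal_span ?B (h ` {..<m i})" using ex[OF p] by metis
      define M where "M = (\<Sum>i<n. m i)"
      have "m i \<le> M" if "i < n" for i unfolding M_def using that by (intro member_le_sum) auto
      then have "(\<lambda>i. poly (p i) x) ` {..<n} \<subseteq> ideal_span ?B (h ` {..<M})" using m hmono by blast
      then have "J p n \<subseteq> ideal_span ?B (h ` {..<M})"
        unfolding J_def using h by (intro ideal_span_least ideal_span_ideal[OF sx(1)]) auto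
      then show False using no hI IJ by blast
    qed
    define P where "P p n r \<longleftrightarrow> r \<in> polys_over A \<and> poly r x \<in> I \<and> poly r x \<notin> J p n \<and>
      (\<forall>q\<in>polys_over A. poly q x \<in> I \<and> poly q x \<notin> J p n \<longrightarrow> Polynomial.degree r \<le> Polynomial.degree q)" for p n r
    have "\<exists>p. \<forall>n. P p n (p n)"
    proof (rule dependent_wf_choice[OF wf_less_than])
      fix p q :: "nat \<Rightarrow> 'a poly" and n r assume "\<And>z. (z, n) \<in> less_than \<Longrightarrow> p z = q z"
      then have "J p n = J q n" unfolding J_def by (intro arg_cong[of _ _ "ideal_span ?B"] image_cong) auto
      then show "P p n r = P q n r" by (simp add: P_def)
    next
      fix n and p :: "nat \<Rightarrow> 'a poly" assume "\<And>y. (y, n) \<in> less_than \<Longrightarrow> P p y (p y)"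
      then obtain y where y: "y \<in> I" "y \<notin> J p n" using not_all[of n p] by (auto simp: P_def)
      define Q where "Q q \<longleftrightarrow> q \<in> polys_over A \<and> poly q x \<in> I \<and> poly q x \<notin> J p n" for q
      obtain q where "Q q" using y is_idealD(1)[OF iI] by (auto simp: Q_def adj_def)
      then have "Q (arg_min Polynomial.degree Q) \<and> (\<forall>q. Q q \<longrightarrow> Polynomial.degree (arg_min Polynomial.degree Q) \<le> Polynomial.degree q)"
        using arg_min_nat_lemma[of Q q Polynomial.degree] by blast
      then show "\<exists>r. P p n r" unfolding P_def Q_def by blast
    qed
    then obtain p where p: "\<And>n. P p n (p n)" by blast
    let ?d = "\<lambda>n. Polynomial.degree (p n)" and ?a = "\<lambda>n. poly.coeff (p n) (Polynomial.degree (p n))"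
    have pA: "p n \<in> polys_over A" and pI: "poly (p n) x \<in> I" for n using p[of n] by (auto simp: P_def)
    have gen: "(\<lambda>i. poly (p i) x) ` {..<n} \<subseteq> ?B" for n using adjI[OF pA] by blast
    have Jmono: "J p m \<subseteq> J p n" if "m \<le> n" for m n
      unfolding J_def using ideal_span_superset[of "(\<lambda>i. poly (p i) x) ` {..<n}" ?B] that
      by (intro ideal_span_least ideal_span_ideal[OF sx(1) gen]) force
    have iJ: "is_ideal ?B (J p n)" for n unfolding J_def by (rule ideal_span_ideal[OF sx(1) gen])
    have dmono: "?d i \<le> ?d n" if "i \<le> n" for i n
      using p[of i] p[of n] Jmono[OF that] by (auto simp: P_def)
    have "range ?a \<subseteq> A" using polys_overD[OF pA] by blast
    then obtain n where n: "?a n \<in> ideal_span A (?a ` {..<n})" using A(2) unfolding noeth_def by blast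
    \<comment> \<open>Top coefficients in degree \<open>?d n\<close> of what the earlier
      \<open>p i\<close> generate. Multiplying by powers of \<open>x\<close> raises each earlier
      polynomial to this degree, so \<open>T\<close> contains all earlier leading coefficients, and
      with them that of \<open>p n\<close>.\<close>
    define T where "T = {poly.coeff q (?d n) |q. q \<in> polys_over A \<and> poly q x \<in> J p n \<and> Polynomial.degree q \<le> ?d n}"
    have TI: "poly.coeff q (?d n) \<in> T" if "q \<in> polys_over A" "poly q x \<in> J p n" "Polynomial.degree q \<le> ?d n" for q
      using that by (auto simp: T_def)
    have "is_ideal A T"
    proof -
      have "poly.coeff r (?d n) + poly.coeff t (?d n) \<in> T" if "r \<in> polys_over A" "poly r x \<in> J p n" "Polynomial.degree r \<le> ?d n"
        "t \<in> polys_over A" "poly t x \<in> J p n" "Polynomial.degree t \<le> ?d n" for r t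
        using TI[OF cl(2)[OF that(1,4)] _ degree_add_le[OF that(3,6)]] is_idealD(3)[OF iJ that(2,5)] by simp
      moreover have "a * poly.coeff r (?d n) \<in> T" if "r \<in> polys_over A" "poly r x \<in> J p n" "Polynomial.degree r \<le> ?d n" "a \<in> A" for r a
        using TI[OF cl(4)[OF that(4,1)] _ order.trans[OF degree_smult_le that(3)]] sx(2) that(4)
          is_idealD(4)[OF iJ _ that(2), of a] by auto
      moreover have "0 \<in> T" using TI[of 0] cl(8) is_idealD(2)[OF iJ] by simp
      ultimately show ?thesis using polys_overD[of _ A] unfolding is_ideal_def T_def by blast
    qed
    moreover have "?a ` {..<n} \<subseteq> T"
    proof
      fix y assume "y \<in> ?a ` {..<n}"
      then obtain i where i: "i < n" "y = ?a i" by blast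
      let ?q = "Polynomial.monom 1 (?d n - ?d i) * p i"
      have "poly (p i) x \<in> J p n"
        unfolding J_def using ideal_span_superset[of "(\<lambda>i. poly (p i) x) ` {..<n}" ?B] i by blast
      then have "poly ?q x \<in> J p n"
        using is_idealD(4)[OF iJ is_subringD(7)[OF sx(1,3)]] by (simp add: poly_monom)
      moreover have "?q \<in> polys_over A" using cl(3)[OF cl(5)[OF is_subringD(2)[OF A(1)]] pA] .
      moreover have "Polynomial.degree ?q \<le> ?d n"
        using order.trans[OF degree_mult_le add_mono[OF degree_monom_le order.refl]] dmono[of i n] i(1)
        by (metis le_add_diff_inverse2 less_imp_le)
      ultimately have "poly.coeff ?q (?d n) \<in> T" by (intro TI)
      moreover have "\<not> ?d n < ?d n - ?d i" "?d n - (?d n - ?d i) = ?d i" using dmono[of i n] i(1) by auto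
      ultimately show "y \<in> T" using i(2) by (simp only: coeff_monom_mult if_False mult_1)
    qed
    ultimately have "?a n \<in> T" using ideal_span_least n by blast
    then obtain q where q: "q \<in> polys_over A" "poly q x \<in> J p n" "Polynomial.degree q \<le> ?d n"
      "?a n = poly.coeff q (?d n)" by (auto simp: T_def)
    have JI: "J p n \<subseteq> I" unfolding J_def using pI by (intro ideal_span_least[OF iI]) auto
    \<comment> \<open>The terms in degree \<open>?d n\<close> cancel, which contradicts the
      minimality of the degree of \<open>p n\<close>.\<close>
    let ?r = "p n - q"
    have r: "?r \<in> polys_over A" using cl(1)[OF pA q(1)] .
    have rI: "poly ?r x \<in> I" using is_ideal_neg(2)[OF sx(1) iI pI] q(2) JI by auto
    have rJ: "poly ?r x \<notin> J p n"
    proof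
      assume "poly ?r x \<in> J p n"
      then have "poly ?r x + poly q x \<in> J p n" using is_idealD(3)[OF iJ] q(2) by blast
      then show False using p[of n] by (simp add: P_def)
    qed
    have co: "poly.coeff ?r k = 0" if "k \<ge> ?d n" for k
      using that q(3,4) by (cases "k = ?d n") (auto simp: coeff_eq_0)
    show False
    proof (cases "?d n = 0")
      case True
      then have "?r = 0" using co by (intro poly_eqI) simp
      then show False using rJ is_idealD(2)[OF iJ] by simp
    next
      case False
      then have "Polynomial.degree ?r < ?d n" using co by (intro degree_lessI) auto
      then show False using p[of n] r rI rJ by (auto simp: P_def)
    qed
  qed
qed

lemma noeth_adjoin: "is_subring A \<Longrightarrow> noeth A \<Longrightarrow> noeth (adjoin A xs)"
  by (induction xs arbitrary: A) (auto simp: adj_subring hilbert_basis)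

lemma noeth_field:
  assumes "is_subring A" "\<And>a. a \<in> A \<Longrightarrow> a \<noteq> 0 \<Longrightarrow> \<exists>b\<in>A. b * a = 1"
  shows "noeth A"
  unfolding noeth_def
proof (intro allI impI)
  fix g :: "nat \<Rightarrow> 'a" assume g: "range g \<subseteq> A"
  show "\<exists>n. g n \<in> ideal_span A (g ` {..<n})"
  proof (cases "g 0 = 0")
    case True
    then show ?thesis using is_idealD(2)[OF ideal_span_ideal[OF assms(1), of "{}"]] by (intro exI[of _ 0]) simp
  next
    case False
    have I: "is_ideal A (ideal_span A (g ` {..<1}))" using g by (intro ideal_span_ideal[OF assms(1)]) auto
    have g0: "g 0 \<in> ideal_span A (g ` {..<1})" using ideal_span_superset[of "g ` {..<1}" A] by auto
    obtain b where b: "b \<in> A" "b * g 0 = 1" using assms(2)[of "g 0"] g False by blast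
    have "(g 1 * b) * g 0 \<in> ideal_span A (g ` {..<1})"
      using is_idealD(4)[OF I _ g0] is_subringD(6)[OF assms(1) _ b(1)] g by blast
    then show ?thesis using b(2) by (intro exI[of _ 1]) (simp add: mult.assoc)
  qed
qed

text \<open>An annihilator that is maximal among those of elements outside \<open>N\<close> is
  prime, and the chain condition provides one.\<close>

lemma prime_annihilator_exists:
  assumes A: "is_subring A" "noeth A" and N: "is_ideal A N" "1 \<notin> N"
  shows "\<exists>u\<in>A. u \<notin> N \<and> (\<forall>x\<in>A. \<forall>y\<in>A. x * y * u \<in> N \<longrightarrow> x * u \<in> N \<or> y * u \<in> N)"
proof -
  define ann where "ann v = {x \<in> A. x * v \<in> N}" for v
  have iann: "is_ideal A (ann v)" if "v \<in> A" for v
    unfolding is_ideal_def ann_def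
    using is_idealD[OF N(1)] is_subringD[OF A(1)] by (auto simp: distrib_right mult.assoc)
  have "\<exists>v\<in>A - N. \<forall>v'\<in>A - N. ann v \<subseteq> ann v' \<longrightarrow> ann v' = ann v"
  proof (rule ccontr)
    assume "\<not> ?thesis"
    then have step: "\<exists>v'\<in>A - N. ann v \<subset> ann v'" if "v \<in> A - N" for v using that by blast
    have "\<exists>v. \<forall>n. v n \<in> A - N \<and> ann (v n) \<subset> ann (v (Suc n))"
    proof (rule dependent_nat_choice)
      show "\<exists>v. v \<in> A - N" using N(2) is_subringD(2)[OF A(1)] by blast
      show "\<exists>w. w \<in> A - N \<and> ann v \<subset> ann w" if "v \<in> A - N" for v n using step[OF that] by blast
    qed
    then obtain v where v: "\<And>n. v n \<in> A - N" "\<And>n. ann (v n) \<subset> ann (v (Suc n))" by blast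
    then have "\<forall>n. \<exists>y. y \<in> ann (v (Suc n)) \<and> y \<notin> ann (v n)" by blast
    then obtain g where g: "\<And>n. g n \<in> ann (v (Suc n))" "\<And>n. g n \<notin> ann (v n)" by metis
    have mono: "ann (v m) \<subseteq> ann (v n)" if "m \<le> n" for m n
      using lift_Suc_mono_le[of "\<lambda>n. ann (v n)" m n] v(2) that by blast
    have "range g \<subseteq> A" using g(1) by (auto simp: ann_def)
    then obtain n where n: "g n \<in> ideal_span A (g ` {..<n})" using A(2) unfolding noeth_def by blast
    have "g ` {..<n} \<subseteq> ann (v n)"
    proof
      fix y assume "y \<in> g ` {..<n}"
      then obtain i where i: "i < n" "y = g i" by blast
      then show "y \<in> ann (v n)" using g(1)[of i] mono[of "Suc i" n] by auto
    qed
    then have "ideal_span A (g ` {..<n}) \<subseteq> ann (v n)" using v(1) iann by (intro ideal_span_least) auto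
    then show False using n g(2) by blast
  qed
  then obtain u where u: "u \<in> A" "u \<notin> N" "\<And>v'. v' \<in> A \<Longrightarrow> v' \<notin> N \<Longrightarrow> ann u \<subseteq> ann v' \<Longrightarrow> ann v' = ann u" by blast
  have "x * u \<in> N \<or> y * u \<in> N" if xy: "x \<in> A" "y \<in> A" "x * y * u \<in> N" for x y
  proof (rule disjCI)
    assume "y * u \<notin> N"
    moreover have "y * u \<in> A" using is_subringD(6)[OF A(1) xy(2) u(1)] .
    moreover have "ann u \<subseteq> ann (y * u)"
      using is_idealD(4)[OF N(1) xy(2)] by (auto simp: ann_def mult.left_commute[of _ y u])
    ultimately have "ann (y * u) = ann u" by (intro u(3))
    moreover have "x \<in> ann (y * u)" using xy by (simp add: ann_def mult.assoc)
    ultimately show "x * u \<in> N" by (auto simp: ann_def)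
  qed
  then show ?thesis using u by blast
qed

section \<open>The generic differential polynomial ring\<close>

subsection \<open>Polynomials in many variables\<close>

type_synonym ('v, 'k) mpol = "('v \<Rightarrow>\<^sub>0 nat) \<Rightarrow>\<^sub>0 'k"

definition mconst :: "'k::comm_ring_1 \<Rightarrow> ('v, 'k) mpol" where
  "mconst c = Poly_Mapping.single 0 c"

definition mvar :: "'v \<Rightarrow> ('v, 'k::comm_ring_1) mpol" where
  "mvar x = Poly_Mapping.single (Poly_Mapping.single x 1) 1"

definition eval_mono :: "('v \<Rightarrow> 't::comm_ring_1) \<Rightarrow> ('v \<Rightarrow>\<^sub>0 nat) \<Rightarrow> 't" where
  "eval_mono v m = (\<Prod>x\<in>Poly_Mapping.keys m. v x ^ Poly_Mapping.lookup m x)"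

definition meval :: "('k::comm_ring_1 \<Rightarrow> 't::comm_ring_1) \<Rightarrow> ('v \<Rightarrow> 't) \<Rightarrow> ('v, 'k) mpol \<Rightarrow> 't" where
  "meval \<phi> v p = (\<Sum>m\<in>Poly_Mapping.keys p. \<phi> (Poly_Mapping.lookup p m) * eval_mono v m)"

text \<open>Serves for polynomials as sums of terms and for exponent vectors as sums of single
  powers.\<close>

lemma poly_mapping_add_induct [case_names single add]:
  fixes p :: "'a \<Rightarrow>\<^sub>0 'b::comm_monoid_add"
  assumes "\<And>m c. P (Poly_Mapping.single m c)" "\<And>p q. P p \<Longrightarrow> P q \<Longrightarrow> P (p + q)"
  shows "P p"
proof -
  have 0: "P 0" using assms(1)[of undefined 0] by simp
  have "P (\<Sum>m\<in>A. Poly_Mapping.single m (Poly_Mapping.lookup p m))" for A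
    by (induction A rule: infinite_finite_induct) (auto simp: 0 assms)
  moreover have "p = (\<Sum>m\<in>Poly_Mapping.keys p. Poly_Mapping.single m (Poly_Mapping.lookup p m))"
    by (rule poly_mapping_eqI)
       (simp add: lookup_sum lookup_single when_def in_keys_iff sum.delta)
  ultimately show ?thesis by metis
qed

lemma eval_mono_superset:
  assumes "finite A" "Poly_Mapping.keys m \<subseteq> A"
  shows "eval_mono v m = (\<Prod>x\<in>A. v x ^ Poly_Mapping.lookup m x)"
  unfolding eval_mono_def using assms
  by (intro prod.mono_neutral_left) (auto simp: in_keys_iff)

lemma eval_mono_add: "eval_mono v (m + m') = eval_mono v m * eval_mono v m'"
proof -
  let ?A = "Poly_Mapping.keys m \<union> Poly_Mapping.keys m'"
  show ?thesis
    using eval_mono_superset[of ?A "m + m'" v] eval_mono_superset[of ?A m v] eval_mono_superset[of ?A m' v]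
      Poly_Mapping.keys_add[of m m']
    by (simp add: lookup_add power_add prod.distrib)
qed

lemma meval_superset:
  assumes "finite A" "Poly_Mapping.keys p \<subseteq> A" "\<phi> 0 = 0"
  shows "meval \<phi> v p = (\<Sum>m\<in>A. \<phi> (Poly_Mapping.lookup p m) * eval_mono v m)"
  unfolding meval_def using assms
  by (intro sum.mono_neutral_left) (auto simp: in_keys_iff)

lemma meval_single: "\<phi> 0 = 0 \<Longrightarrow> meval \<phi> v (Poly_Mapping.single m c) = \<phi> c * eval_mono v m"
  using meval_superset[of "{m}" "Poly_Mapping.single m c" \<phi> v] by simp

lemma meval_add:
  assumes "hom_on UNIV \<phi>"
  shows "meval \<phi> v (p + q) = meval \<phi> v p + meval \<phi> v q"
proof -
  let ?A = "Poly_Mapping.keys p \<union> Poly_Mapping.keys q"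
  have "\<phi> 0 = 0" using hom_on_more(1)[OF is_subring_UNIV assms] .
  then show ?thesis
    using meval_superset[of ?A "p + q" \<phi> v] meval_superset[of ?A p \<phi> v] meval_superset[of ?A q \<phi> v]
      Poly_Mapping.keys_add[of p q] hom_onD(2)[OF assms]
    by (simp add: lookup_add distrib_right sum.distrib)
qed

lemma meval_hom:
  assumes \<phi>: "hom_on UNIV \<phi>"
  shows "hom_on UNIV (meval \<phi> v)"
proof -
  note z = hom_on_more(1)[OF is_subring_UNIV \<phi>]
  have 1: "meval \<phi> v (Poly_Mapping.single m c * q) = meval \<phi> v (Poly_Mapping.single m c) * meval \<phi> v q" for m c q
  proof (induction q rule: poly_mapping_add_induct)
    case (single m' c')
    then show ?case
      using hom_onD(3)[OF \<phi>] by (simp add: mult_single meval_single[of \<phi>, OF z] eval_mono_add)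
  next
    case (add f g)
    then show ?case by (simp add: distrib_left meval_add[OF \<phi>])
  qed
  have "meval \<phi> v (p * q) = meval \<phi> v p * meval \<phi> v q" for p q
  proof (induction p rule: poly_mapping_add_induct)
    case (single m c)
    then show ?case by (rule 1)
  next
    case (add f g)
    then show ?case by (simp add: distrib_right meval_add[OF \<phi>])
  qed
  moreover have "meval \<phi> v 1 = 1"
    using meval_single[of \<phi> v 0 1, OF z] hom_onD(1)[OF \<phi>] by (simp add: eval_mono_def)
  ultimately show ?thesis by (simp add: hom_on_def meval_add[OF \<phi>])
qed

lemma meval_mconst: "hom_on UNIV \<phi> \<Longrightarrow> meval \<phi> v (mconst c) = \<phi> c"
  using hom_on_more(1)[OF is_subring_UNIV, of \<phi>] by (simp add: mconst_def meval_single eval_mono_def)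

lemma meval_mvar: "hom_on UNIV \<phi> \<Longrightarrow> meval \<phi> v (mvar x) = v x"
  using hom_on_more(1)[OF is_subring_UNIV, of \<phi>] hom_onD(1)[of UNIV \<phi>]
  by (simp add: mvar_def meval_single eval_mono_def)

lemma mconst_hom: "hom_on UNIV mconst"
  by (simp add: hom_on_def mconst_def single_add mult_single)

lemma mpol_induct [case_names const var add mult]:
  fixes p :: "('v, 'k::comm_ring_1) mpol"
  assumes "\<And>c. P (mconst c)" "\<And>x. P (mvar x)" "\<And>p q. P p \<Longrightarrow> P q \<Longrightarrow> P (p + q)" "\<And>p q. P p \<Longrightarrow> P q \<Longrightarrow> P (p * q)"
  shows "P p"
proof (induction p rule: poly_mapping_add_induct)
  case (single m c)
  have "P (Poly_Mapping.single m 1)"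
  proof (induction m rule: poly_mapping_add_induct)
    case (single x i)
    show ?case
    proof (induction i)
      case 0
      then show ?case using assms(1)[of 1] by (simp add: mconst_def)
    next
      case (Suc i)
      have "Poly_Mapping.single (Poly_Mapping.single x (Suc i)) 1 =
          mvar x * Poly_Mapping.single (Poly_Mapping.single x i) (1::'k)"
        by (simp add: mvar_def mult_single single_add[symmetric])
      then show ?case using assms(2,4) Suc by metis
    qed
  next
    case (add f g)
    have "Poly_Mapping.single (f + g) 1 = Poly_Mapping.single f 1 * Poly_Mapping.single g (1::'k)"
      by (simp add: mult_single)
    then show ?case using assms(4) add by metis
  qed
  moreover have "Poly_Mapping.single m c = mconst c * Poly_Mapping.single m 1"
    by (simp add: mconst_def mult_single)
  ultimately show ?case using assms(1,4) by metis
qed (use assms(3) in blast)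

text \<open>A derivation is the infinitesimal part of a homomorphism into dual numbers whose real
  part is the identity. So the derivation that extends \<open>d\<close> and takes the values
  \<open>w\<close> on the variables comes from evaluating polynomials.\<close>

definition mderiv :: "('k::comm_ring_1 \<Rightarrow> 'k) \<Rightarrow> ('v \<Rightarrow> ('v, 'k) mpol) \<Rightarrow> ('v, 'k) mpol \<Rightarrow> ('v, 'k) mpol" where
  "mderiv d w p = ipart (meval (\<lambda>c. Dual (mconst c) (mconst (d c))) (\<lambda>x. Dual (mvar x) (w x)) p)"

lemma mderiv:
  assumes d: "is_deriv d"
  shows "is_deriv (mderiv d w)" "mderiv d w (mconst c) = mconst (d c)" "mderiv d w (mvar x) = w x"
proof -
  let ?\<phi> = "\<lambda>c. Dual (mconst c) (mconst (d c)) :: ('b, 'a) mpol dual" and ?v = "\<lambda>x. Dual (mvar x) (w x)"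
  have \<phi>: "hom_on UNIV ?\<phi>"
    by (auto simp: hom_on_def one_dual_def plus_dual_def times_dual_def add.commute is_derivD[OF d]
        hom_onD[OF mconst_hom, simplified] hom_on_more(1)[OF is_subring_UNIV mconst_hom])
  note h = hom_onD[OF meval_hom[OF \<phi>, of ?v], simplified]
  have r: "rpart (meval ?\<phi> ?v p) = p" for p
    by (induction p rule: mpol_induct) (simp_all add: meval_mconst[OF \<phi>] meval_mvar[OF \<phi>] h)
  show "is_deriv (mderiv d w)"
    by (auto simp: is_deriv_def mderiv_def h r)
  show "mderiv d w (mconst c) = mconst (d c)" "mderiv d w (mvar x) = w x"
    by (simp_all add: mderiv_def meval_mconst[OF \<phi>] meval_mvar[OF \<phi>])
qed

subsection \<open>Matrices as functions on pairs of indices\<close>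

definition mm :: "nat \<Rightarrow> (nat \<Rightarrow> nat \<Rightarrow> 'r::comm_ring_1) \<Rightarrow> (nat \<Rightarrow> nat \<Rightarrow> 'r) \<Rightarrow> nat \<Rightarrow> nat \<Rightarrow> 'r" where
  "mm n M N = (\<lambda>j k. \<Sum>l<n. M j l * N l k)"

definition unit_mat :: "nat \<Rightarrow> nat \<Rightarrow> nat \<Rightarrow> 'r::comm_ring_1" where
  "unit_mat n = (\<lambda>j k. if j = k \<and> j < n then 1 else 0)"

text \<open>With zeros outside the block, equality of matrices is equality of functions and
  \<open>unit_mat\<close> is a two-sided unit.\<close>

definition supported :: "nat \<Rightarrow> (nat \<Rightarrow> nat \<Rightarrow> 'r::comm_ring_1) \<Rightarrow> bool" where
  "supported n M \<longleftrightarrow> (\<forall>j k. \<not> (j < n \<and> k < n) \<longrightarrow> M j k = 0)"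

definition map_entries :: "('r \<Rightarrow> 't) \<Rightarrow> (nat \<Rightarrow> nat \<Rightarrow> 'r) \<Rightarrow> nat \<Rightarrow> nat \<Rightarrow> 't" where
  "map_entries f M = (\<lambda>j k. f (M j k))"

lemma mm_assoc: "mm n (mm n M N) P = mm n M (mm n N P)"
proof (intro ext)
  fix j k
  have "mm n (mm n M N) P j k = (\<Sum>l<n. \<Sum>i<n. M j i * N i l * P l k)"
    by (simp add: mm_def sum_distrib_right)
  also have "\<dots> = (\<Sum>i<n. \<Sum>l<n. M j i * N i l * P l k)" by (rule sum.swap)
  finally show "mm n (mm n M N) P j k = mm n M (mm n N P) j k"
    by (simp add: mm_def sum_distrib_left mult.assoc)
qed

lemma mm_linear:
  "mm n (\<lambda>j k. M j k + N j k) P = (\<lambda>j k. mm n M P j k + mm n N P j k)"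
  "mm n P (\<lambda>j k. M j k + N j k) = (\<lambda>j k. mm n P M j k + mm n P N j k)"
  "mm n (\<lambda>j k. M j k - N j k) P = (\<lambda>j k. mm n M P j k - mm n N P j k)"
  "mm n P (\<lambda>j k. M j k - N j k) = (\<lambda>j k. mm n P M j k - mm n P N j k)"
  "mm n (\<lambda>j k. - M j k) P = (\<lambda>j k. - mm n M P j k)"
  "mm n P (\<lambda>j k. - M j k) = (\<lambda>j k. - mm n P M j k)"
  by (auto simp: mm_def fun_eq_iff algebra_simps sum.distrib sum_subtractf sum_negf)

lemma mm_unit:
  assumes "supported n M"
  shows "mm n (unit_mat n) M = M" "mm n M (unit_mat n) = M"
proof -
  have "mm n (unit_mat n) M j k = (\<Sum>l<n. if l = j then M j k else 0)" for j k
    unfolding mm_def unit_mat_def by (intro sum.cong) auto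
  then show "mm n (unit_mat n) M = M" using assms by (auto simp: fun_eq_iff supported_def)
  have "mm n M (unit_mat n) j k = (\<Sum>l<n. if l = k then M j k else 0)" for j k
    unfolding mm_def unit_mat_def by (intro sum.cong) auto
  then show "mm n M (unit_mat n) = M" using assms by (auto simp: fun_eq_iff supported_def)
qed

lemma supported_mm: "supported n M \<Longrightarrow> supported n N \<Longrightarrow> supported n (mm n M N)"
  by (fastforce simp: supported_def mm_def)

lemma supported_unit: "supported n (unit_mat n)"
  by (auto simp: supported_def unit_mat_def)

lemma map_entries_mm:
  assumes "hom_on UNIV f"
  shows "map_entries f (mm n M N) = mm n (map_entries f M) (map_entries f N)"
  by (simp add: map_entries_def mm_def fun_eq_iff hom_on_sum[OF is_subring_UNIV assms]
      hom_onD(3)[OF assms])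

lemma map_entries_unit: "hom_on UNIV f \<Longrightarrow> map_entries f (unit_mat n) = unit_mat n"
  using hom_onD(1)[of UNIV f] hom_on_more(1)[OF is_subring_UNIV, of f]
  by (auto simp: map_entries_def unit_mat_def fun_eq_iff)

lemma map_entries_deriv_mm:
  assumes "is_deriv d"
  shows "map_entries d (mm n M N) = (\<lambda>j k. mm n (map_entries d M) N j k + mm n M (map_entries d N) j k)"
  by (simp add: map_entries_def mm_def fun_eq_iff sum.distrib is_deriv_sum[OF assms] is_derivD(2)[OF assms])

lemma map_entries_deriv_unit: "is_deriv d \<Longrightarrow> map_entries d (unit_mat n) = (\<lambda>j k. 0)"
  by (auto simp: map_entries_def unit_mat_def fun_eq_iff is_derivD)

lemma supported_map: "supported n M \<Longrightarrow> f 0 = 0 \<Longrightarrow> supported n (map_entries f M)"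
  by (auto simp: supported_def map_entries_def)

subsection \<open>The universal ring of an integrable system\<close>

text \<open>The variable \<open>(b, j, k, i)\<close> is the \<open>i\<close>-th derivative of the entry \<open>(j, k)\<close> of \<open>X\<close> if \<open>b\<close> holds and of \<open>Y\<close> otherwise.\<close>

type_synonym 'k dpol = "(bool \<times> nat \<times> nat \<times> nat, 'k) mpol"

locale linear_sys =
  fixes S :: "'s set" and D :: "'d set"
    and shk :: "'s \<Rightarrow> 'k::field_char_0 \<Rightarrow> 'k" and dlk :: "'d \<Rightarrow> 'k \<Rightarrow> 'k" and pk :: "'k \<Rightarrow> 'k"
    and n :: nat and Am Ai :: "'s \<Rightarrow> nat \<Rightarrow> nat \<Rightarrow> 'k" and Bm :: "'d \<Rightarrow> nat \<Rightarrow> nat \<Rightarrow> 'k"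
  assumes shk_hom: "s \<in> S \<Longrightarrow> hom_on UNIV (shk s)" and dlk_deriv: "d \<in> D \<Longrightarrow> is_deriv (dlk d)"
    and pk_deriv: "is_deriv pk"
    and shk_shk: "s \<in> S \<Longrightarrow> t \<in> S \<Longrightarrow> shk s (shk t c) = shk t (shk s c)"
    and shk_dlk: "s \<in> S \<Longrightarrow> d \<in> D \<Longrightarrow> shk s (dlk d c) = dlk d (shk s c)"
    and shk_pk: "s \<in> S \<Longrightarrow> shk s (pk c) = pk (shk s c)"
    and dlk_dlk: "d \<in> D \<Longrightarrow> e \<in> D \<Longrightarrow> dlk d (dlk e c) = dlk e (dlk d c)"
    and dlk_pk: "d \<in> D \<Longrightarrow> dlk d (pk c) = pk (dlk d c)"
    and supp: "s \<in> S \<Longrightarrow> supported n (Am s)" "s \<in> S \<Longrightarrow> supported n (Ai s)" "d \<in> D \<Longrightarrow> supported n (Bm d)"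
    and A_inv: "s \<in> S \<Longrightarrow> mm n (Am s) (Ai s) = unit_mat n" "s \<in> S \<Longrightarrow> mm n (Ai s) (Am s) = unit_mat n"
    and AA: "s \<in> S \<Longrightarrow> t \<in> S \<Longrightarrow>
      mm n (map_entries (shk s) (Am t)) (Am s) = mm n (map_entries (shk t) (Am s)) (Am t)"
    and AB: "s \<in> S \<Longrightarrow> d \<in> D \<Longrightarrow>
      mm n (map_entries (shk s) (Bm d)) (Am s) = (\<lambda>j k. dlk d (Am s j k) + mm n (Am s) (Bm d) j k)"
    and BB: "d \<in> D \<Longrightarrow> e \<in> D \<Longrightarrow>
      (\<lambda>j k. dlk d (Bm e j k) + mm n (Bm e) (Bm d) j k) = (\<lambda>j k. dlk e (Bm d j k) + mm n (Bm d) (Bm e) j k)"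
begin

text \<open>The two sides are the inverses of the two sides of \<open>AA\<close>. In this form the
  integrability condition acts on \<open>Y\<close>.\<close>

lemma AA_inv:
  assumes s: "s \<in> S" and t: "t \<in> S"
  shows "mm n (Ai s) (map_entries (shk s) (Ai t)) = mm n (Ai t) (map_entries (shk t) (Ai s))"
proof -
  define U where "U s t = mm n (map_entries (shk s) (Am t)) (Am s)" for s t
  define V where "V s t = mm n (Ai s) (map_entries (shk s) (Ai t))" for s t
  have z: "s \<in> S \<Longrightarrow> shk s 0 = 0" for s using hom_on_more(1)[OF is_subring_UNIV shk_hom] .
  have sup: "supported n (map_entries (shk s) (Ai t))" if "s \<in> S" "t \<in> S" for s t
    using supported_map[OF supp(2), of t "shk s"] z that by blast
  have VU: "mm n (V s t) (U s t) = unit_mat n" if "s \<in> S" "t \<in> S" for s t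
  proof -
    have "mm n (V s t) (U s t) = mm n (Ai s) (mm n (map_entries (shk s) (mm n (Ai t) (Am t))) (Am s))"
      by (simp add: V_def U_def mm_assoc map_entries_mm[OF shk_hom[OF that(1)]])
    then show ?thesis
      using that by (simp add: A_inv map_entries_unit[OF shk_hom[OF that(1)]] mm_unit supp)
  qed
  have UV: "mm n (U s t) (V s t) = unit_mat n" if "s \<in> S" "t \<in> S" for s t
  proof -
    have "mm n (U s t) (V s t) = mm n (map_entries (shk s) (Am t)) (mm n (mm n (Am s) (Ai s)) (map_entries (shk s) (Ai t)))"
      by (simp add: V_def U_def mm_assoc)
    also have "\<dots> = map_entries (shk s) (mm n (Am t) (Ai t))"
      using that(2) by (simp add: A_inv(1)[OF that(1)] mm_unit sup[OF that] map_entries_mm[OF shk_hom[OF that(1)]])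
    finally show ?thesis using that by (simp add: A_inv map_entries_unit[OF shk_hom[OF that(1)]])
  qed
  have supV: "supported n (V s t)" if "s \<in> S" "t \<in> S" for s t
    unfolding V_def using supported_mm supp(2) sup that by blast
  have "V s t = mm n (V s t) (mm n (U t s) (V t s))" using UV[OF t s] supV[OF s t] by (simp add: mm_unit)
  also have "U t s = U s t" using AA[OF s t] by (simp add: U_def)
  also have "mm n (V s t) (mm n (U s t) (V t s)) = V t s"
    using VU[OF s t] supV[OF t s] by (simp add: mm_assoc[symmetric] mm_unit)
  finally show ?thesis by (simp add: V_def)
qed

text \<open>Multiply \<open>AB\<close> by the inverse from both sides; the derivative of the inverse
  comes from differentiating \<open>Ai s\<close> times \<open>Am s\<close>. This is the form that
  acts on \<open>Y\<close>.\<close>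

lemma AB_inv:
  assumes s: "s \<in> S" and d: "d \<in> D"
  shows "mm n (Ai s) (map_entries (shk s) (Bm d)) = (\<lambda>j k. mm n (Bm d) (Ai s) j k - dlk d (Ai s j k))"
proof -
  have dz: "dlk d 0 = 0" using is_derivD(3)[OF dlk_deriv[OF d]] .
  have z: "shk s 0 = 0" using hom_on_more(1)[OF is_subring_UNIV shk_hom[OF s]] .
  let ?A = "Am s" and ?I = "Ai s" and ?B = "Bm d" and ?sB = "map_entries (shk s) (Bm d)"
  let ?dA = "map_entries (dlk d) (Am s)" and ?dI = "map_entries (dlk d) (Ai s)"
  have "(\<lambda>j k. mm n ?dI ?A j k + mm n ?I ?dA j k) = (\<lambda>j k. 0)"
    using map_entries_deriv_mm[OF dlk_deriv[OF d], of n ?I ?A] A_inv(2)[OF s]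
      map_entries_deriv_unit[OF dlk_deriv[OF d], of n] by simp
  then have 1: "mm n ?I ?dA = (\<lambda>j k. - mm n ?dI ?A j k)"
    by (auto simp: fun_eq_iff eq_neg_iff_add_eq_0 add.commute)
  have sB: "supported n ?sB" and sdI: "supported n ?dI"
    using supported_map[where f = "shk s", OF supp(3)[OF d] z] supported_map[where f = "dlk d", OF supp(2)[OF s] dz] .
  have "mm n ?I ?sB = mm n (mm n ?I (mm n ?sB ?A)) ?I"
    using A_inv(1)[OF s] sB by (simp add: mm_assoc mm_unit)
  also have "mm n ?sB ?A = (\<lambda>j k. ?dA j k + mm n ?A ?B j k)"
    using AB[OF s d] by (simp add: map_entries_def)
  also have "mm n ?I (\<lambda>j k. ?dA j k + mm n ?A ?B j k) = (\<lambda>j k. ?B j k - mm n ?dI ?A j k)"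
    using 1 A_inv(2)[OF s] supp(3)[OF d] by (simp add: mm_linear mm_assoc[symmetric] mm_unit)
  also have "mm n (\<lambda>j k. ?B j k - mm n ?dI ?A j k) ?I = (\<lambda>j k. mm n ?B ?I j k - ?dI j k)"
    using A_inv(1)[OF s] sdI by (simp add: mm_linear mm_assoc mm_unit)
  finally show ?thesis by (simp add: map_entries_def)
qed

definition par :: "'k dpol \<Rightarrow> 'k dpol" where
  "par = mderiv pk (\<lambda>(b, j, k, i). mvar (b, j, k, Suc i))"

definition Xm :: "nat \<Rightarrow> nat \<Rightarrow> 'k dpol" where
  "Xm = (\<lambda>j k. if j < n \<and> k < n then mvar (True, j, k, 0) else 0)"

definition Ym :: "nat \<Rightarrow> nat \<Rightarrow> 'k dpol" where
  "Ym = (\<lambda>j k. if j < n \<and> k < n then mvar (False, j, k, 0) else 0)"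

abbreviation cm :: "(nat \<Rightarrow> nat \<Rightarrow> 'k) \<Rightarrow> nat \<Rightarrow> nat \<Rightarrow> 'k dpol" where
  "cm \<equiv> map_entries mconst"

text \<open>\<open>X\<close> is multiplied by the system matrix from the left and \<open>Y\<close>,
  which stands for its inverse, by the inverse matrix from the right; the values on derivatives are
  forced by commutation with \<open>par\<close>.\<close>

definition sh :: "'s \<Rightarrow> 'k dpol \<Rightarrow> 'k dpol" where
  "sh s = meval (\<lambda>c. mconst (shk s c))
    (\<lambda>(b, j, k, i). (par ^^ i) (if b then mm n (cm (Am s)) Xm j k else mm n Ym (cm (Ai s)) j k))"

text \<open>The rule for \<open>Y\<close> is the one for the derivative of an inverse matrix, whence
  the sign and the order of the factors.\<close>

definition dl :: "'d \<Rightarrow> 'k dpol \<Rightarrow> 'k dpol" where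
  "dl d = mderiv (dlk d)
    (\<lambda>(b, j, k, i). (par ^^ i) (if b then mm n (cm (Bm d)) Xm j k else - mm n Ym (cm (Bm d)) j k))"

lemma supp_XY: "supported n Xm" "supported n Ym"
  by (auto simp: supported_def Xm_def Ym_def)

lemma mconst_simps:
  "mconst 0 = 0" "mconst 1 = 1" "mconst (a + b) = mconst a + mconst b" "mconst (a * b) = mconst a * mconst b"
  using hom_onD[OF mconst_hom, simplified] hom_on_more(1)[OF is_subring_UNIV mconst_hom] by auto

lemma par_deriv: "is_deriv par" and par_const: "par (mconst c) = mconst (pk c)"
  and par_var: "par (mvar (b, j, k, i)) = mvar (b, j, k, Suc i)"
  by (simp_all add: par_def mderiv[OF pk_deriv])

lemma mvar_par: "(par ^^ i) (mvar (b, j, k, 0)) = mvar (b, j, k, i)"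
  by (induction i) (simp_all add: par_var)

lemma const_shk_hom: "s \<in> S \<Longrightarrow> hom_on UNIV (\<lambda>c. mconst (shk s c))"
  using hom_onD[OF shk_hom, simplified] by (simp add: hom_on_def mconst_simps)

lemma sh_hom: "s \<in> S \<Longrightarrow> hom_on UNIV (sh s)" and sh_const: "s \<in> S \<Longrightarrow> sh s (mconst c) = mconst (shk s c)"
  and sh_var: "s \<in> S \<Longrightarrow> sh s (mvar (b, j, k, i)) =
    (par ^^ i) (if b then mm n (cm (Am s)) Xm j k else mm n Ym (cm (Ai s)) j k)"
  unfolding sh_def
  by (simp_all add: meval_hom[OF const_shk_hom] meval_mconst[OF const_shk_hom] meval_mvar[OF const_shk_hom])

lemma dl_deriv: "d \<in> D \<Longrightarrow> is_deriv (dl d)" and dl_const: "d \<in> D \<Longrightarrow> dl d (mconst c) = mconst (dlk d c)"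
  and dl_var: "d \<in> D \<Longrightarrow> dl d (mvar (b, j, k, i)) =
    (par ^^ i) (if b then mm n (cm (Bm d)) Xm j k else - mm n Ym (cm (Bm d)) j k)"
  by (simp_all add: dl_def mderiv[OF dlk_deriv])

sublocale sd_ring S D sh dl mconst shk dlk
  by unfold_locales
     (use sh_hom dl_deriv mconst_hom shk_hom dlk_deriv sh_const dl_const in auto)

lemma par_simps: "par (x + y) = par x + par y" "par (x * y) = par x * y + x * par y" "par 0 = 0"
  "par (- x) = - par x" "par (x - y) = par x - par y"
  using is_derivD[OF par_deriv] by auto

lemma sh_par: "s \<in> S \<Longrightarrow> sh s (par p) = par (sh s p)"
proof (induction p rule: mpol_induct)
  case (const c)
  then show ?case by (simp add: par_const sh_const shk_pk)
next
  case (var x)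
  obtain b j k i where "x = (b, j, k, i)" by (cases x)
  then show ?case using var by (simp add: par_var sh_var)
qed (simp_all add: par_simps sh_simps)

lemma dl_par: "d \<in> D \<Longrightarrow> dl d (par p) = par (dl d p)"
proof (induction p rule: mpol_induct)
  case (const c)
  then show ?case by (simp add: par_const dl_const dlk_pk)
next
  case (var x)
  obtain b j k i where "x = (b, j, k, i)" by (cases x)
  then show ?case using var by (simp add: par_var dl_var)
qed (simp_all add: par_simps dl_simps algebra_simps)

lemma sh_par_pow: "s \<in> S \<Longrightarrow> sh s ((par ^^ i) p) = (par ^^ i) (sh s p)"
  by (induction i) (simp_all add: sh_par)

lemma dl_par_pow: "d \<in> D \<Longrightarrow> dl d ((par ^^ i) p) = (par ^^ i) (dl d p)"
  by (induction i) (simp_all add: dl_par)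

lemma sh_cm: "s \<in> S \<Longrightarrow> map_entries (sh s) (cm M) = cm (map_entries (shk s) M)"
  and dl_cm: "d \<in> D \<Longrightarrow> map_entries (dl d) (cm M) = cm (map_entries (dlk d) M)"
  and par_cm: "map_entries par (cm M) = cm (map_entries pk M)"
  by (simp_all add: map_entries_def sh_const dl_const par_const)

lemma cm_mm: "mm n (cm M) (cm N) = cm (mm n M N)"
  using map_entries_mm[OF mconst_hom] by metis

lemma cm_supp: "supported n M \<Longrightarrow> supported n (cm M)"
  using supported_map[of n M mconst] mconst_simps(1) by blast

lemma cm_unit: "cm (unit_mat n) = unit_mat n"
  using map_entries_unit[OF mconst_hom] .

lemma sh_X: "s \<in> S \<Longrightarrow> map_entries (sh s) Xm = mm n (cm (Am s)) Xm"
  and sh_Y: "s \<in> S \<Longrightarrow> map_entries (sh s) Ym = mm n Ym (cm (Ai s))"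
  and dl_X: "d \<in> D \<Longrightarrow> map_entries (dl d) Xm = mm n (cm (Bm d)) Xm"
  and dl_Y: "d \<in> D \<Longrightarrow> map_entries (dl d) Ym = (\<lambda>j k. - mm n Ym (cm (Bm d)) j k)"
proof -
  have z: "mm n M N j k = 0" if "supported n M" "supported n N" "\<not> (j < n \<and> k < n)" for M N :: "nat \<Rightarrow> nat \<Rightarrow> 'k dpol" and j k
    using supported_mm[OF that(1,2)] that(3) by (auto simp: supported_def)
  show "map_entries (sh s) Xm = mm n (cm (Am s)) Xm" if "s \<in> S"
    using z[OF cm_supp[OF supp(1)[OF that]] supp_XY(1)] that
    by (auto simp: map_entries_def[of "sh s"] Xm_def[THEN fun_cong, THEN fun_cong] sh_var sh_simps fun_eq_iff)
  show "map_entries (sh s) Ym = mm n Ym (cm (Ai s))" if "s \<in> S"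
    using z[OF supp_XY(2) cm_supp[OF supp(2)[OF that]]] that
    by (auto simp: map_entries_def[of "sh s"] Ym_def[THEN fun_cong, THEN fun_cong] sh_var sh_simps fun_eq_iff)
  show "map_entries (dl d) Xm = mm n (cm (Bm d)) Xm" if "d \<in> D"
    using z[OF cm_supp[OF supp(3)[OF that]] supp_XY(1)] that
    by (auto simp: map_entries_def[of "dl d"] Xm_def[THEN fun_cong, THEN fun_cong] dl_var dl_simps fun_eq_iff)
  show "map_entries (dl d) Ym = (\<lambda>j k. - mm n Ym (cm (Bm d)) j k)" if "d \<in> D"
    using z[OF supp_XY(2) cm_supp[OF supp(3)[OF that]]] that
    by (auto simp: map_entries_def[of "dl d"] Ym_def[THEN fun_cong, THEN fun_cong] dl_var dl_simps fun_eq_iff)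
qed

lemma map_entries_app: "f (M j k) = map_entries f M j k"
  by (simp add: map_entries_def)

text \<open>Constants and variables determine both compositions, and commutation with
  \<open>par\<close> reduces the variables to order zero. There the claim is the integrability
  condition, as \<open>AA\<close> on \<open>X\<close> and as \<open>AA_inv\<close> on
  \<open>Y\<close>.\<close>

lemma sh_sh: "s \<in> S \<Longrightarrow> t \<in> S \<Longrightarrow> sh s (sh t p) = sh t (sh s p)"
proof (induction p rule: mpol_induct)
  case (const c)
  then show ?case by (simp add: sh_const shk_shk)
next
  case (var x)
  obtain b j k i where x: "x = (b, j, k, i)" by (cases x)
  have "sh s (if b then mm n (cm (Am t)) Xm j k else mm n Ym (cm (Ai t)) j k) =
      (if b then mm n (cm (mm n (map_entries (shk s) (Am t)) (Am s))) Xm j k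
       else mm n Ym (cm (mm n (Ai s) (map_entries (shk s) (Ai t)))) j k)" if "s \<in> S" "t \<in> S" for s t
    using that by (simp add: map_entries_app[of "sh s"] map_entries_mm[OF sh_hom] sh_cm sh_X sh_Y
        cm_mm[symmetric] mm_assoc)
  from this[OF var] this[OF var(2,1)] show ?case
    using var x sh_par_pow by (simp add: sh_var AA[of s t] AA_inv[of s t])
qed (simp_all add: sh_simps)

lemma sh_dl: "s \<in> S \<Longrightarrow> d \<in> D \<Longrightarrow> sh s (dl d p) = dl d (sh s p)"
proof (induction p rule: mpol_induct)
  case (const c)
  then show ?case by (simp add: sh_const dl_const shk_dlk)
next
  case (var x)
  obtain b j k i where x: "x = (b, j, k, i)" by (cases x)
  have 1: "map_entries (sh s) (mm n (cm (Bm d)) Xm) = mm n (cm (mm n (map_entries (shk s) (Bm d)) (Am s))) Xm"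
    "map_entries (sh s) (mm n Ym (cm (Bm d))) = mm n Ym (cm (mm n (Ai s) (map_entries (shk s) (Bm d))))"
    using var by (simp_all add: map_entries_mm[OF sh_hom] sh_cm sh_X sh_Y cm_mm[symmetric] mm_assoc)
  have 2: "map_entries (dl d) (mm n (cm (Am s)) Xm) = mm n (cm (\<lambda>j k. dlk d (Am s j k) + mm n (Am s) (Bm d) j k)) Xm"
  proof -
    have "cm (\<lambda>j k. dlk d (Am s j k) + mm n (Am s) (Bm d) j k) =
        (\<lambda>j k. cm (map_entries (dlk d) (Am s)) j k + mm n (cm (Am s)) (cm (Bm d)) j k)"
      unfolding cm_mm by (simp add: map_entries_def mconst_simps)
    then show ?thesis
      using var by (simp add: map_entries_deriv_mm[OF dl_deriv] dl_cm dl_X mm_linear mm_assoc)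
  qed
  have 3: "map_entries (dl d) (mm n Ym (cm (Ai s))) =
      (\<lambda>j k. - mm n Ym (cm (\<lambda>j k. mm n (Bm d) (Ai s) j k - dlk d (Ai s j k))) j k)"
  proof -
    have "cm (\<lambda>j k. mm n (Bm d) (Ai s) j k - dlk d (Ai s j k)) =
        (\<lambda>j k. mm n (cm (Bm d)) (cm (Ai s)) j k - cm (map_entries (dlk d) (Ai s)) j k)"
      unfolding cm_mm by (simp add: map_entries_def \<iota>_simps)
    then show ?thesis
      using var by (simp add: map_entries_deriv_mm[OF dl_deriv] dl_cm dl_Y mm_linear mm_assoc)
  qed
  show ?case
    using var x sh_par_pow dl_par_pow fun_cong[OF fun_cong[OF 1(1)], of j k]
      fun_cong[OF fun_cong[OF 1(2)], of j k] fun_cong[OF fun_cong[OF 2], of j k] fun_cong[OF fun_cong[OF 3], of j k]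
    by (simp add: sh_var dl_var sh_simps AB AB_inv map_entries_app[symmetric])
qed (simp_all add: sh_simps dl_simps)

lemma dl_dl: "d \<in> D \<Longrightarrow> e \<in> D \<Longrightarrow> dl d (dl e p) = dl e (dl d p)"
proof (induction p rule: mpol_induct)
  case (const c)
  then show ?case by (simp add: dl_const dlk_dlk)
next
  case (var x)
  obtain b j k i where x: "x = (b, j, k, i)" by (cases x)
  define P where "P d e = (\<lambda>j k. dlk d (Bm e j k) + mm n (Bm e) (Bm d) j k)" for d e
  have cP: "cm (P d e) = (\<lambda>j k. cm (map_entries (dlk d) (Bm e)) j k + mm n (cm (Bm e)) (cm (Bm d)) j k)" for d e
    unfolding cm_mm by (simp add: P_def map_entries_def mconst_simps)
  have P: "P d e = P e d" using BB[OF var] by (simp add: P_def)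
  have X: "map_entries (dl d) (mm n (cm (Bm e)) Xm) = mm n (cm (P d e)) Xm" if "d \<in> D" "e \<in> D" for d e
    unfolding cP using that by (simp add: map_entries_deriv_mm[OF dl_deriv] dl_cm dl_X mm_linear mm_assoc)
  \<comment> \<open>On \<open>Y\<close> the matrices appear in the opposite order and with a sign,
    so \<open>BB\<close> is used in a rearranged form.\<close>
  define P' where "P' d e = (\<lambda>j k. mm n (Bm d) (Bm e) j k - dlk d (Bm e j k))" for d e
  have cP': "cm (P' d e) = (\<lambda>j k. mm n (cm (Bm d)) (cm (Bm e)) j k - cm (map_entries (dlk d) (Bm e)) j k)" for d e
    unfolding cm_mm by (simp add: P'_def map_entries_def \<iota>_simps)
  have P': "P' d e = P' e d" using BB[OF var] by (auto simp: P'_def fun_eq_iff algebra_simps)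
  have Y: "map_entries (dl d) (mm n Ym (cm (Bm e))) = (\<lambda>j k. - mm n Ym (cm (P' d e)) j k)" if "d \<in> D" "e \<in> D" for d e
    unfolding cP' using that by (simp add: map_entries_deriv_mm[OF dl_deriv] dl_cm dl_Y mm_linear mm_assoc)
  have "dl d (mm n (cm (Bm e)) Xm j k) = mm n (cm (P d e)) Xm j k"
    "dl d (mm n Ym (cm (Bm e)) j k) = - mm n Ym (cm (P' d e)) j k" if "d \<in> D" "e \<in> D" for d e
    using fun_cong[OF fun_cong[OF X[OF that]], of j k] fun_cong[OF fun_cong[OF Y[OF that]], of j k]
    by (simp_all add: map_entries_app[symmetric])
  note v = this[OF var] this[OF var(2,1)]
  show ?case
    using var x dl_par_pow by (simp add: dl_var dl_simps v P P')
qed (simp_all add: dl_simps algebra_simps)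

end

section \<open>Finitely many sums and integrals at once\<close>

context sd_ring
begin

lemma stable_UN: "(\<And>i. stable (F i)) \<Longrightarrow> stable (\<Union>i. F i)"
  unfolding stable_def invariant_def by (simp add: image_UN) blast

text \<open>The differences and derivatives of all \<open>ws\<close> lie in the first ring
  \<open>A\<close>; so each one is still a sum or integral over the ring enlarged by its
  predecessors.\<close>

lemma adjoin_steps:
  assumes A': "is_subring A'" "is_ideal A' N'" "stable N'" "constants_only A' N'"
    and "is_subring A" "stable A" "range \<iota> \<subseteq> A" "A \<subseteq> A'" "max_stable A (N' \<inter> A)"
    and "\<And>w. w \<in> set ws \<Longrightarrow> w \<in> A'" "\<And>w s. w \<in> set ws \<Longrightarrow> s \<in> S \<Longrightarrow> sh s w - w \<in> A"
    "\<And>w d. w \<in> set ws \<Longrightarrow> d \<in> D \<Longrightarrow> dl d w \<in> A"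
  shows "u \<in> A \<Longrightarrow> prime_ann A N' u \<Longrightarrow> prime_ann (adjoin A ws) N' u"
    and "hom_on A' \<phi> \<Longrightarrow> (\<And>y. y \<in> N' \<Longrightarrow> \<phi> y = 0) \<Longrightarrow> hom_on A \<Phi> \<Longrightarrow> (\<And>y. y \<in> A \<Longrightarrow> rpart (\<Phi> y) = \<phi> y) \<Longrightarrow>
      (\<And>y. y \<in> A \<Longrightarrow> y \<in> N' \<Longrightarrow> \<Phi> y = 0) \<Longrightarrow>
      \<exists>\<Phi>'. hom_on (adjoin A ws) \<Phi>' \<and> (\<forall>y\<in>adjoin A ws. rpart (\<Phi>' y) = \<phi> y) \<and>
        (\<forall>y\<in>adjoin A ws. y \<in> N' \<longrightarrow> \<Phi>' y = 0) \<and> (\<forall>y\<in>A. \<Phi>' y = \<Phi> y)"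
proof -
  have "(u \<in> A \<longrightarrow> prime_ann A N' u \<longrightarrow> prime_ann (adjoin A ws) N' u) \<and>
    (hom_on A' \<phi> \<and> (\<forall>y\<in>N'. \<phi> y = 0) \<and> hom_on A \<Phi> \<and> (\<forall>y\<in>A. rpart (\<Phi> y) = \<phi> y) \<and> (\<forall>y\<in>A. y \<in> N' \<longrightarrow> \<Phi> y = 0) \<longrightarrow>
      (\<exists>\<Phi>'. hom_on (adjoin A ws) \<Phi>' \<and> (\<forall>y\<in>adjoin A ws. rpart (\<Phi>' y) = \<phi> y) \<and>
        (\<forall>y\<in>adjoin A ws. y \<in> N' \<longrightarrow> \<Phi>' y = 0) \<and> (\<forall>y\<in>A. \<Phi>' y = \<Phi> y)))"
    using assms(5-)
  proof (induction ws arbitrary: A \<Phi>)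
    case (Cons w ws)
    have w: "w \<in> A'" "\<And>s. s \<in> S \<Longrightarrow> sh s w - w \<in> A" "\<And>d. d \<in> D \<Longrightarrow> dl d w \<in> A" using Cons.prems by auto
    note sw = adj_subring[OF Cons.prems(1), of w]
    have wA': "adj A w \<subseteq> A'" using adj_least[OF A'(1) Cons.prems(4) w(1)] .
    have st: "stable (adj A w)" using stable_adj[OF Cons.prems(1,2) w(2,3)] .
    note step = adjoin_step[OF A' Cons.prems(1-5) w]
    have kA: "range \<iota> \<subseteq> adj A w" using Cons.prems(3) sw(2) by blast
    have "\<And>v. v \<in> set ws \<Longrightarrow> v \<in> A'" "\<And>v s. v \<in> set ws \<Longrightarrow> s \<in> S \<Longrightarrow> sh s v - v \<in> adj A w"
      "\<And>v d. v \<in> set ws \<Longrightarrow> d \<in> D \<Longrightarrow> dl d v \<in> adj A w"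
      using Cons.prems(6-8) sw(2) by auto
    note IH = Cons.IH[OF sw(1) st kA wA' step(1) this]
    show ?case
    proof (intro conjI impI)
      assume u: "u \<in> A" "prime_ann A N' u"
      have "prime_ann (adj A w) N' u"
        by (rule prime_ann_step[OF A'(1,2) Cons.prems(1,4) w(1) step(2) u])
      then show "prime_ann (adjoin A (w # ws)) N' u" using IH[of \<Phi>] u(1) sw(2) by auto
    next
      assume h: "hom_on A' \<phi> \<and> (\<forall>y\<in>N'. \<phi> y = 0) \<and> hom_on A \<Phi> \<and> (\<forall>y\<in>A. rpart (\<Phi> y) = \<phi> y) \<and> (\<forall>y\<in>A. y \<in> N' \<longrightarrow> \<Phi> y = 0)"
      obtain \<Phi>1 where \<Phi>1: "hom_on (adj A w) \<Phi>1" "\<forall>y\<in>adj A w. rpart (\<Phi>1 y) = \<phi> y"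
        "\<forall>y\<in>adj A w. y \<in> N' \<longrightarrow> \<Phi>1 y = 0" "\<forall>y\<in>A. \<Phi>1 y = \<Phi> y"
        using dual_extend_step[OF A'(1,2) Cons.prems(1,4) w(1) step(2), of \<phi> \<Phi>] h by blast
      then obtain \<Phi>2 where \<Phi>2: "hom_on (adjoin (adj A w) ws) \<Phi>2" "\<forall>y\<in>adjoin (adj A w) ws. rpart (\<Phi>2 y) = \<phi> y"
        "\<forall>y\<in>adjoin (adj A w) ws. y \<in> N' \<longrightarrow> \<Phi>2 y = 0" "\<forall>y\<in>adj A w. \<Phi>2 y = \<Phi>1 y"
        using IH[of \<Phi>1] h by blast
      show "\<exists>\<Phi>'. hom_on (adjoin A (w # ws)) \<Phi>' \<and> (\<forall>y\<in>adjoin A (w # ws). rpart (\<Phi>' y) = \<phi> y) \<and>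
        (\<forall>y\<in>adjoin A (w # ws). y \<in> N' \<longrightarrow> \<Phi>' y = 0) \<and> (\<forall>y\<in>A. \<Phi>' y = \<Phi> y)"
        using \<Phi>2 \<Phi>1(4) sw(2) by (intro exI[of _ \<Phi>2]) auto
    qed
  qed auto
  then show "u \<in> A \<Longrightarrow> prime_ann A N' u \<Longrightarrow> prime_ann (adjoin A ws) N' u"
    and "hom_on A' \<phi> \<Longrightarrow> (\<And>y. y \<in> N' \<Longrightarrow> \<phi> y = 0) \<Longrightarrow> hom_on A \<Phi> \<Longrightarrow> (\<And>y. y \<in> A \<Longrightarrow> rpart (\<Phi> y) = \<phi> y) \<Longrightarrow>
      (\<And>y. y \<in> A \<Longrightarrow> y \<in> N' \<Longrightarrow> \<Phi> y = 0) \<Longrightarrow>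
      \<exists>\<Phi>'. hom_on (adjoin A ws) \<Phi>' \<and> (\<forall>y\<in>adjoin A ws. rpart (\<Phi>' y) = \<phi> y) \<and>
        (\<forall>y\<in>adjoin A ws. y \<in> N' \<longrightarrow> \<Phi>' y = 0) \<and> (\<forall>y\<in>A. \<Phi>' y = \<Phi> y)"
    by blast+
qed

lemma stable_ideal_span:
  assumes A: "is_subring A" "stable A" "G \<subseteq> A"
    and G: "\<And>s g. s \<in> S \<Longrightarrow> g \<in> G \<Longrightarrow> sh s g \<in> ideal_span A G" "\<And>d g. d \<in> D \<Longrightarrow> g \<in> G \<Longrightarrow> dl d g \<in> ideal_span A G"
  shows "stable (ideal_span A G)"
proof (rule stableI)
  note I = ideal_span_ideal[OF A(1,3)]
  note GI = ideal_span_superset[of G A]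
  fix s x assume s: "s \<in> S" and x: "x \<in> ideal_span A G"
  have "is_ideal A {x \<in> A. sh s x \<in> ideal_span A G}"
    using is_idealD[OF I] is_subringD[OF A(1)] stableD(1)[OF A(2) s]
    by (auto simp: is_ideal_def sh_simps[OF s])
  from ideal_span_least[OF this] show "sh s x \<in> ideal_span A G" using G(1)[OF s] A(3) x by blast
next
  note I = ideal_span_ideal[OF A(1,3)]
  note GI = ideal_span_superset[of G A]
  fix d x assume d: "d \<in> D" and x: "x \<in> ideal_span A G"
  \<comment> \<open>Membership of \<open>x\<close> itself belongs to the condition, because the
    derivative of a multiple of \<open>x\<close> also contains \<open>x\<close>
    undifferentiated.\<close>
  have "is_ideal A {x \<in> ideal_span A G. dl d x \<in> ideal_span A G}"
    using is_idealD[OF I] is_subringD[OF A(1)] stableD(2)[OF A(2) d]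
    by (auto simp: is_ideal_def dl_simps[OF d])
  from ideal_span_least[OF this] show "dl d x \<in> ideal_span A G" using G(2)[OF d] GI x by blast
qed

end

text \<open>\<open>H\<close> and \<open>A\<close> have the same image modulo \<open>N\<close>, so a
  homomorphism on \<open>H\<close> that kills \<open>N\<close> lives on the common quotient.\<close>

lemma hom_on_extend_mod:
  assumes H: "is_subring H" "H \<subseteq> A" and A: "is_subring A" "is_ideal A N"
    and sp: "\<And>x. x \<in> A \<Longrightarrow> \<exists>h\<in>H. x - h \<in> N"
    and \<Phi>: "hom_on H \<Phi>" "\<And>y. y \<in> H \<Longrightarrow> y \<in> N \<Longrightarrow> \<Phi> y = 0"
  shows "\<exists>\<Phi>'. hom_on A \<Phi>' \<and> (\<forall>x\<in>A. \<forall>h\<in>H. x - h \<in> N \<longrightarrow> \<Phi>' x = \<Phi> h)"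
proof -
  define \<Phi>' where "\<Phi>' x = \<Phi> (SOME h. h \<in> H \<and> x - h \<in> N)" for x
  have eq: "\<Phi>' x = \<Phi> h" if x: "x \<in> A" "h \<in> H" "x - h \<in> N" for x h
  proof -
    define g where "g = (SOME h. h \<in> H \<and> x - h \<in> N)"
    have g: "g \<in> H" "x - g \<in> N" using someI[of "\<lambda>h. h \<in> H \<and> x - h \<in> N" h] x by (auto simp: g_def)
    have "h - g \<in> N" using is_ideal_neg(2)[OF A g(2) x(3)] by simp
    then have "\<Phi> (h - g) = 0" using \<Phi>(2) is_subringD(5)[OF H(1) x(2) g(1)] by blast
    then show ?thesis using hom_on_more(3)[OF H(1) \<Phi>(1) x(2) g(1)] by (simp add: \<Phi>'_def g_def)
  qed
  have "\<Phi>' (x + y) = \<Phi>' x + \<Phi>' y \<and> \<Phi>' (x * y) = \<Phi>' x * \<Phi>' y" if xy: "x \<in> A" "y \<in> A" for x y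
  proof -
    obtain h g where h: "h \<in> H" "x - h \<in> N" and g: "g \<in> H" "y - g \<in> N" using sp xy by meson
    have gA: "g \<in> A" "h \<in> A" using g h H(2) by auto
    have 1: "(x + y) - (h + g) \<in> N" using is_idealD(3)[OF A(2) h(2) g(2)] by (simp add: algebra_simps)
    have "y * (x - h) + h * (y - g) \<in> N"
      using is_idealD(3)[OF A(2) is_idealD(4)[OF A(2) xy(2) h(2)] is_idealD(4)[OF A(2) gA(2) g(2)]] .
    then have 2: "x * y - h * g \<in> N" by (simp add: algebra_simps)
    show ?thesis
      using eq[OF _ _ 1] eq[OF _ _ 2] eq[OF xy(1) h] eq[OF xy(2) g] hom_onD[OF \<Phi>(1)] h g xy
      by (simp add: is_subringD[OF A(1)] is_subringD[OF H(1)])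
  qed
  moreover have "\<Phi>' 1 = 1"
    using eq[of 1 1] is_subringD(2)[OF A(1)] is_subringD(2)[OF H(1)] is_idealD(2)[OF A(2)] hom_onD(1)[OF \<Phi>(1)] by simp
  ultimately show ?thesis using eq by (auto simp: hom_on_def)
qed

lemma mm_in_subring: "is_subring A \<Longrightarrow> (\<And>j k. M j k \<in> A) \<Longrightarrow> (\<And>j k. N j k \<in> A) \<Longrightarrow> mm n M N j k \<in> A"
  unfolding mm_def by (intro is_subring_sum is_subringD(6)) auto

lemma mm_in_ideal:
  assumes "is_ideal A I"
  shows "(\<And>j k. M j k \<in> I) \<Longrightarrow> (\<And>j k. N j k \<in> A) \<Longrightarrow> mm n M N j k \<in> I"
    "(\<And>j k. M j k \<in> A) \<Longrightarrow> (\<And>j k. N j k \<in> I) \<Longrightarrow> mm n M N j k \<in> I"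
  unfolding mm_def using is_idealD[OF assms] by (auto intro!: is_ideal_sum[OF assms])

section \<open>The filtration by order and the logarithmic derivative\<close>

locale linear_sys_closed = linear_sys +
  assumes closed: C_alg_closed
begin

definition gl :: "nat \<Rightarrow> 'c dpol list" where
  "gl i = map (\<lambda>(b, j, k). mvar (b, j, k, i)) (List.product [True, False] (List.product [0..<n] [0..<n]))"

definition Rr :: "nat \<Rightarrow> 'c dpol set" where
  "Rr i = adjoin (range mconst) (concat (map gl [0..<Suc i]))"

lemma set_gl: "set (gl i) = {mvar (b, j, k, i) |b j k. j < n \<and> k < n}"
proof -
  have e: "set (gl i) = (\<lambda>(b, j, k). mvar (b, j, k, i)) ` (UNIV \<times> {..<n} \<times> {..<n})"
    unfolding gl_def set_map set_product by (simp add: UNIV_bool insert_commute atLeast0LessThan)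
  show ?thesis unfolding e by (fastforce intro: image_eqI[of _ _ "(b, j, k)" for b j k])
qed

lemma set_gens: "set (concat (map gl [0..<Suc i])) = {mvar (b, j, k, m) |b j k m. j < n \<and> k < n \<and> m \<le> i}"
proof -
  have "set (concat (map gl [0..<Suc i])) = (\<Union>m\<le>i. set (gl m))"
    by (auto simp: less_Suc_eq_le simp del: upt_Suc)
  then show ?thesis unfolding set_gl by blast
qed

lemma Rr_subring: "is_subring (Rr i)"
  unfolding Rr_def by (rule adjoin_subring(1)[OF range_\<iota>_subring])

lemma Rr_const: "mconst c \<in> Rr i" and Rr_range: "range mconst \<subseteq> Rr i"
  using adjoin_subring(2)[OF range_\<iota>_subring, of "concat (map gl [0..<Suc i])"] unfolding Rr_def by blast+

lemma Rr_var: "j < n \<Longrightarrow> k < n \<Longrightarrow> m \<le> i \<Longrightarrow> mvar (b, j, k, m) \<in> Rr i"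
  using adjoin_subring(3)[OF range_\<iota>_subring, of "concat (map gl [0..<Suc i])"] unfolding Rr_def
  unfolding set_gens by blast

lemma Rr_Suc: "Rr (Suc i) = adjoin (Rr i) (gl (Suc i))"
  by (simp add: Rr_def)

lemma Rr_mono: "i \<le> m \<Longrightarrow> Rr i \<subseteq> Rr m"
  by (rule lift_Suc_mono_le[of Rr]) (auto simp: Rr_Suc adjoin_subring[OF Rr_subring])

lemma Rr_induct [consumes 1, case_names const var add mult]:
  assumes "x \<in> Rr i" "\<And>c. P (mconst c)" "\<And>b j k m. j < n \<Longrightarrow> k < n \<Longrightarrow> m \<le> i \<Longrightarrow> P (mvar (b, j, k, m))"
    "\<And>x y. P x \<Longrightarrow> P y \<Longrightarrow> P (x + y)" "\<And>x y. P x \<Longrightarrow> P y \<Longrightarrow> P (x * y)"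
  shows "P x"
  using range_\<iota>_subring assms(1)[unfolded Rr_def]
proof (induction rule: adjoin_induct)
  case (gen x)
  then show ?case unfolding set_gens using assms(3) by blast
qed (use assms in auto)

lemma Rr_least:
  assumes T: "is_subring T" "range mconst \<subseteq> T" "\<And>b j k m. j < n \<Longrightarrow> k < n \<Longrightarrow> m \<le> i \<Longrightarrow> mvar (b, j, k, m) \<in> T"
  shows "Rr i \<subseteq> T"
  unfolding Rr_def using T by (intro adjoin_least) (unfold set_gens, blast+)

lemma par_Rr: "x \<in> Rr i \<Longrightarrow> par x \<in> Rr (Suc i)"
proof -
  assume "x \<in> Rr i"
  then have "x \<in> Rr (Suc i) \<and> par x \<in> Rr (Suc i)"
    by (induction rule: Rr_induct)
       (auto simp: par_const par_var par_simps Rr_const Rr_var is_subringD[OF Rr_subring])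
  then show ?thesis by simp
qed

lemma par_pow_Rr: "x \<in> Rr i \<Longrightarrow> (par ^^ m) x \<in> Rr (i + m)"
  by (induction m) (auto intro: par_Rr)

lemma XY_Rr: "Xm j k \<in> Rr i" "Ym j k \<in> Rr i"
  using Rr_var is_subringD(1)[OF Rr_subring] by (auto simp: Xm_def Ym_def)

lemma cm_Rr: "cm M j k \<in> Rr i"
  by (simp add: map_entries_def Rr_const)

lemma unit_Rr: "unit_mat n j k \<in> Rr i"
  using is_subringD(1,2)[OF Rr_subring] by (auto simp: unit_mat_def)

lemma stable_Rr: "stable (Rr i)"
proof (rule stableI)
  have pw: "(par ^^ m) x \<in> Rr i" if "x \<in> Rr 0" "m \<le> i" for m x
    using par_pow_Rr[OF that(1), of m] Rr_mono[of m i] that(2) by auto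
  show "sh s x \<in> Rr i" if s: "s \<in> S" and x: "x \<in> Rr i" for s x
    using x
    by (induction rule: Rr_induct)
       (auto simp: sh_const sh_var sh_simps s Rr_const is_subringD[OF Rr_subring]
        intro!: pw mm_in_subring[OF Rr_subring] XY_Rr cm_Rr)
  show "dl d x \<in> Rr i" if d: "d \<in> D" and x: "x \<in> Rr i" for d x
  proof -
    have "x \<in> Rr i \<and> dl d x \<in> Rr i"
      using x
      by (induction rule: Rr_induct)
         (auto simp: dl_const dl_var dl_simps d Rr_const Rr_var is_subringD[OF Rr_subring]
          intro!: pw is_subringD(3)[OF Rr_subring] mm_in_subring[OF Rr_subring] XY_Rr cm_Rr)
    then show ?thesis by simp
  qed
qed

text \<open>Modulo the relations between \<open>X\<close> and \<open>Y\<close>, the logarithmic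
  derivative of \<open>X\<close>. It replaces the derivatives of \<open>X\<close> as a generator
  because the operators move it only by elements of lower order.\<close>

definition Wm :: "nat \<Rightarrow> nat \<Rightarrow> 'c dpol" where
  "Wm = mm n Ym (map_entries par Xm)"

definition Wl :: "nat \<Rightarrow> 'c dpol list" where
  "Wl i = map (\<lambda>(j, k). (par ^^ i) (Wm j k)) (List.product [0..<n] [0..<n])"

lemma set_Wl: "set (Wl i) = {(par ^^ i) (Wm j k) |j k. j < n \<and> k < n}"
proof -
  have e: "set (Wl i) = (\<lambda>(j, k). (par ^^ i) (Wm j k)) ` ({..<n} \<times> {..<n})"
    unfolding Wl_def set_map set_product by (simp add: atLeast0LessThan)
  show ?thesis unfolding e by (fastforce intro: image_eqI[of _ _ "(j, k)" for j k])
qed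

lemma Wm_Rr: "Wm j k \<in> Rr 1"
  unfolding Wm_def using par_Rr[OF XY_Rr(1)]
  by (intro mm_in_subring[OF Rr_subring] XY_Rr) (simp_all add: map_entries_def)

lemma par_pow_add: "(par ^^ m) (x + y) = (par ^^ m) x + (par ^^ m) y"
  and par_pow_diff: "(par ^^ m) (x - y) = (par ^^ m) x - (par ^^ m) y"
  and par_pow_zero: "(par ^^ m) 0 = 0"
  by (induction m) (simp_all add: par_simps)

lemma par_pow_sum: "(par ^^ m) (sum f I) = (\<Sum>i\<in>I. (par ^^ m) (f i))"
  by (induction I rule: infinite_finite_induct) (simp_all add: par_pow_add par_pow_zero)

text \<open>In the product the system matrix cancels against its inverse, except where
  \<open>par\<close> hits it; what remains contains no derivative of \<open>X\<close>.\<close>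

lemma sh_W:
  assumes s: "s \<in> S"
  shows "sh s (Wm j k) - Wm j k = mm n (mm n Ym (cm (mm n (Ai s) (map_entries pk (Am s))))) Xm j k"
proof -
  have p: "map_entries (sh s) (map_entries par Xm) = map_entries par (mm n (cm (Am s)) Xm)"
    using s by (simp add: map_entries_def sh_par sh_X[OF s, unfolded map_entries_def, symmetric])
  have sp: "supported n (map_entries par Xm)"
    using supported_map[where f = par, OF supp_XY(1)] par_simps by blast
  have "map_entries (sh s) Wm = mm n (mm n Ym (cm (Ai s))) (map_entries par (mm n (cm (Am s)) Xm))"
    by (simp add: Wm_def map_entries_mm[OF sh_hom[OF s]] sh_Y[OF s] p)
  also have "\<dots> = (\<lambda>j k. mm n (mm n Ym (cm (mm n (Ai s) (map_entries pk (Am s))))) Xm j k +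
      mm n Ym (mm n (cm (mm n (Ai s) (Am s))) (map_entries par Xm)) j k)"
    by (simp add: map_entries_deriv_mm[OF par_deriv] par_cm mm_linear mm_assoc cm_mm[symmetric])
  also have "mm n Ym (mm n (cm (mm n (Ai s) (Am s))) (map_entries par Xm)) = Wm"
    using s sp by (simp add: A_inv cm_unit mm_unit Wm_def)
  finally show ?thesis by (simp add: map_entries_app[of "sh s"])
qed

lemma dl_W:
  assumes d: "d \<in> D"
  shows "dl d (Wm j k) = mm n (mm n Ym (cm (map_entries pk (Bm d)))) Xm j k"
proof -
  have p: "map_entries (dl d) (map_entries par Xm) = map_entries par (mm n (cm (Bm d)) Xm)"
    using d by (simp add: map_entries_def dl_par dl_X[OF d, unfolded map_entries_def, symmetric])
  have "map_entries (dl d) Wm = mm n (mm n Ym (cm (map_entries pk (Bm d)))) Xm"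
    by (simp add: Wm_def map_entries_deriv_mm[OF dl_deriv[OF d]] dl_Y[OF d] p
        map_entries_deriv_mm[OF par_deriv] par_cm mm_linear mm_assoc fun_eq_iff)
  then show ?thesis by (simp add: map_entries_app[of "dl d"])
qed

text \<open>The identities for \<open>Wm\<close> differentiated \<open>i\<close> times: the
  generators have order up to \<open>i + 1\<close>, their differences and derivatives only up to
  \<open>i\<close>.\<close>

lemma Wl_props:
  assumes "w \<in> set (Wl i)"
  shows "w \<in> Rr (Suc i)" "s \<in> S \<Longrightarrow> sh s w - w \<in> Rr i" "d \<in> D \<Longrightarrow> dl d w \<in> Rr i"
proof -
  obtain j k where w: "w = (par ^^ i) (Wm j k)" "j < n" "k < n" using assms by (auto simp: set_Wl)
  have pw: "(par ^^ i) x \<in> Rr i" if "x \<in> Rr 0" for x using par_pow_Rr[OF that, of i] by simp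
  show "w \<in> Rr (Suc i)" using par_pow_Rr[OF Wm_Rr, of i] w by simp
  show "sh s w - w \<in> Rr i" if "s \<in> S"
    unfolding w(1) sh_par_pow[OF that] par_pow_diff[symmetric] sh_W[OF that]
    by (intro pw mm_in_subring[OF Rr_subring] XY_Rr cm_Rr)
  show "dl d w \<in> Rr i" if "d \<in> D"
    unfolding w(1) dl_par_pow[OF that] dl_W[OF that]
    by (intro pw mm_in_subring[OF Rr_subring] XY_Rr cm_Rr)
qed

text \<open>By the Leibniz rule only derivatives of the factors of order at most \<open>m\<close>
  occur.\<close>

lemma par_pow_mult:
  assumes T: "is_subring T"
  shows "(\<And>a. a \<le> m \<Longrightarrow> (par ^^ a) x \<in> T) \<Longrightarrow> (\<And>a. a \<le> m \<Longrightarrow> (par ^^ a) y \<in> T) \<Longrightarrow> (par ^^ m) (x * y) \<in> T"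
proof (induction m arbitrary: x y)
  case 0
  then show ?case using is_subringD(6)[OF T] by simp
next
  case (Suc m)
  have "(par ^^ a) (par x) \<in> T" "(par ^^ a) (par y) \<in> T" "(par ^^ a) x \<in> T" "(par ^^ a) y \<in> T" if "a \<le> m" for a
    using Suc.prems(1)[of "Suc a"] Suc.prems(2)[of "Suc a"] Suc.prems(1)[of a] Suc.prems(2)[of a] that
    by (simp_all add: funpow_swap1)
  then have "(par ^^ m) (par x * y) \<in> T" "(par ^^ m) (x * par y) \<in> T"
    by (intro Suc.IH; simp)+
  then have "(par ^^ m) (par (x * y)) \<in> T"
    using is_subringD(4)[OF T] by (simp add: par_simps par_pow_add)
  then show ?case by (simp add: funpow_swap1)
qed

subsection \<open>Prolonging a maximal invariant ideal\<close>

definition inverse_rels :: "'c dpol set \<Rightarrow> bool" where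
  "inverse_rels N \<longleftrightarrow> (\<forall>j k. mm n Xm Ym j k - unit_mat n j k \<in> N \<and> mm n Ym Xm j k - unit_mat n j k \<in> N)"

text \<open>The inductive invariant. At a positive index it also looks one step back: the maximal
  contraction feeds the dichotomy of \<open>adjoin_step\<close>, and the closure under
  \<open>par\<close> makes the known part of the tangent vector consistent.\<close>

definition stage :: "nat \<Rightarrow> 'c dpol set \<Rightarrow> bool" where
  "stage i N \<longleftrightarrow> max_stable (Rr i) N \<and> inverse_rels N \<and>
    (\<forall>m. i = Suc m \<longrightarrow> max_stable (Rr m) (N \<inter> Rr m) \<and> (\<forall>f\<in>N \<inter> Rr m. par f \<in> N))"

text \<open>Modulo \<open>N\<close> the derivative of \<open>X\<close> is \<open>X W\<close> and
  that of \<open>Y\<close> is \<open>- W Y\<close>. Differentiated \<open>i\<close> times, this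
  expresses the variables of order \<open>i + 1\<close> by those of lower order and by the
  derivatives of \<open>W\<close> up to order \<open>i\<close>.\<close>

lemma stage_span:
  assumes st: "stage (Suc i) N" and x: "x \<in> Rr (Suc i)"
  shows "\<exists>h\<in>adjoin (Rr i) (Wl i). x - h \<in> N"
proof -
  let ?H = "adjoin (Rr i) (Wl i)" and ?R = "Rr (Suc i)"
  have N: "max_stable ?R N" and rel: "inverse_rels N"
    and par_N: "f \<in> N \<Longrightarrow> f \<in> Rr i \<Longrightarrow> par f \<in> N" for f
    using st by (auto simp: stage_def)
  note iN = max_stableD(1)[OF N]
  note sH = adjoin_subring[OF Rr_subring[of i], of "Wl i"]
  have HR: "?H \<subseteq> ?R"
    using adjoin_least[OF Rr_subring Rr_mono[of i "Suc i"]] Wl_props(1) by auto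
  have relX: "mm n Xm Ym j k - unit_mat n j k \<in> N" and relY: "mm n Ym Xm j k - unit_mat n j k \<in> N" for j k
    using rel by (auto simp: inverse_rels_def)
  have pX: "map_entries par Xm j k \<in> ?R" and pY: "map_entries par Ym j k \<in> ?R" for j k
    using par_Rr[OF XY_Rr(1)] par_Rr[OF XY_Rr(2)] by (simp_all add: map_entries_def)
  \<comment> \<open>\<open>par_N\<close> covers only elements of order at most \<open>i\<close>, so
    the order is checked before each differentiation.\<close>
  have par_pow_N: "(par ^^ m) f \<in> N" if f: "f \<in> N" "f \<in> Rr 1" and m: "m \<le> i" for f m
    using m
  proof (induction m)
    case (Suc m)
    have "(par ^^ m) f \<in> Rr i" using par_pow_Rr[OF f(2), of m] Rr_mono[of "1 + m" i] Suc.prems by auto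
    then show ?case using Suc par_N by simp
  qed (use f in simp)
  have spX: "supported n (map_entries par Xm)" "supported n (map_entries par Ym)"
    using supported_map[where f = par, OF supp_XY(1)] supported_map[where f = par, OF supp_XY(2)] par_simps by auto
  have R1: "par (Xm j k) \<in> Rr 1" "par (Ym j k) \<in> Rr 1" "mm n Xm Wm j k \<in> Rr 1" "mm n Wm Ym j k \<in> Rr 1" for j k
    using par_Rr[OF XY_Rr(1)] par_Rr[OF XY_Rr(2)] mm_in_subring[OF Rr_subring] XY_Rr Wm_Rr by auto
  have X1: "par (Xm j k) - mm n Xm Wm j k \<in> N" for j k
  proof -
    have "mm n (\<lambda>j k. mm n Xm Ym j k - unit_mat n j k) (map_entries par Xm) j k \<in> N"
      by (intro mm_in_ideal(1)[OF iN] relX pX)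
    then have "mm n Xm Wm j k - par (Xm j k) \<in> N"
      by (simp add: mm_linear mm_unit[OF spX(1)] mm_assoc Wm_def map_entries_app[of par])
    then show ?thesis using is_ideal_neg(1)[OF Rr_subring iN] by fastforce
  qed
  \<comment> \<open>Differentiate the relation for \<open>Y X\<close>, multiply by \<open>Y\<close>
    from the right and replace \<open>X Y\<close> by the unit matrix.\<close>
  have Y1: "par (Ym j k) + mm n Wm Ym j k \<in> N" for j k
  proof -
    have "mm n Ym Xm j k - unit_mat n j k \<in> Rr i" for j k
      by (intro is_subringD(5)[OF Rr_subring] mm_in_subring[OF Rr_subring] XY_Rr unit_Rr)
    then have "par (mm n Ym Xm j k) - par (unit_mat n j k) \<in> N" for j k
      using par_N[OF relY] by (simp add: par_simps)
    then have "mm n (map_entries par Ym) Xm j k + mm n Ym (map_entries par Xm) j k \<in> N" for j k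
      using map_entries_deriv_mm[OF par_deriv, of n Ym Xm] map_entries_deriv_unit[OF par_deriv, of n]
      by (simp add: map_entries_app[of par])
    then have 1: "mm n (\<lambda>j k. mm n (map_entries par Ym) Xm j k + mm n Ym (map_entries par Xm) j k) Ym j k \<in> N" for j k
      by (intro mm_in_ideal(1)[OF iN] XY_Rr)
    have 2: "mm n (map_entries par Ym) (\<lambda>j k. mm n Xm Ym j k - unit_mat n j k) j k \<in> N" for j k
      by (intro mm_in_ideal(2)[OF iN] relX pY)
    show ?thesis
      using is_ideal_neg(2)[OF Rr_subring iN 1 2, of j k j k]
      by (simp add: mm_linear mm_assoc Wm_def mm_unit[OF spX(2)] map_entries_app[of par] algebra_simps)
  qed
  have XH: "(par ^^ a) (Xm j k) \<in> ?H" "(par ^^ a) (Ym j k) \<in> ?H" if "a \<le> i" for a j k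
    using par_pow_Rr[OF XY_Rr(1)[where i = 0 and j = j and k = k], of a]
      par_pow_Rr[OF XY_Rr(2)[where i = 0 and j = j and k = k], of a] Rr_mono[OF that] sH(2) by auto
  have WH: "(par ^^ a) (Wm j k) \<in> ?H" if "a \<le> i" "j < n" "k < n" for a j k
  \<comment> \<open>For \<open>a = i\<close> the element is one of the adjoined generators; for
    smaller \<open>a\<close> it already lies in \<open>Rr i\<close>.\<close>
  proof (cases "a = i")
    case True
    then show ?thesis using sH(3) that by (auto simp: set_Wl)
  next
    case False
    then show ?thesis using par_pow_Rr[OF Wm_Rr, of a j k] Rr_mono[of "1 + a" i] that sH(2) by auto
  qed
  have XWH: "(par ^^ i) (mm n Xm Wm j k) \<in> ?H" "(par ^^ i) (mm n Wm Ym j k) \<in> ?H" if "j < n" "k < n" for j k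
    unfolding mm_def par_pow_sum using that
    by (intro is_subring_sum[OF sH(1)] par_pow_mult[OF sH(1)] XH WH; simp)+
  define T where "T = {x \<in> ?R. \<exists>h\<in>?H. x - h \<in> N}"
  have "is_subring T"
  proof -
    have "x - y \<in> T \<and> x * y \<in> T" if xy: "x \<in> T" "y \<in> T" for x y
    proof -
      obtain h g where h: "h \<in> ?H" "x - h \<in> N" "x \<in> ?R" and g: "g \<in> ?H" "y - g \<in> N" "y \<in> ?R"
        using xy by (auto simp: T_def)
      have "(x - y) - (h - g) \<in> N" using is_ideal_neg(2)[OF Rr_subring iN h(2) g(2)] by (simp add: algebra_simps)
      moreover have "y * (x - h) + h * (y - g) \<in> N"
        using is_idealD(3)[OF iN is_idealD(4)[OF iN g(3) h(2)] is_idealD(4)[OF iN _ g(2)]] h(1) HR by blast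
      then have "x * y - h * g \<in> N" by (simp add: algebra_simps)
      ultimately show ?thesis
        using h g is_subringD(5,6)[OF sH(1)] is_subringD(5,6)[OF Rr_subring] by (auto simp: T_def)
    qed
    moreover have "1 \<in> T"
      using is_subringD(2)[OF sH(1)] is_subringD(2)[OF Rr_subring] is_idealD(2)[OF iN]
      by (auto simp: T_def intro!: bexI[of _ 1])
    ultimately show ?thesis by (auto simp: is_subring_def)
  qed
  moreover have "Rr i \<subseteq> T"
  proof
    fix x assume x: "x \<in> Rr i"
    then have "x \<in> ?R" "x \<in> ?H" "x - x \<in> N"
      using Rr_mono[of i "Suc i"] sH(2) is_idealD(2)[OF iN] by auto
    then show "x \<in> T" unfolding T_def by blast
  qed
  moreover have "set (gl (Suc i)) \<subseteq> T"
  proof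
    fix y assume "y \<in> set (gl (Suc i))"
    then obtain b j k where y: "y = mvar (b, j, k, Suc i)" "j < n" "k < n" by (auto simp: set_gl)
    have yR: "y \<in> ?R" using Rr_var y by auto
    have v: "mvar (b, j, k, Suc i) = (par ^^ i) (par (mvar (b, j, k, 0)))"
      using mvar_par[of "Suc i" b j k] by (simp only: funpow_Suc_right o_apply)
    show "y \<in> T"
    proof (cases b)
      case True
      then have "y = (par ^^ i) (par (Xm j k))" using y v by (simp add: Xm_def)
      moreover have "(par ^^ i) (par (Xm j k) - mm n Xm Wm j k) \<in> N"
        using par_pow_N[OF X1] is_subringD(5)[OF Rr_subring] R1 by blast
      ultimately show ?thesis using yR XWH(1)[OF y(2,3)] by (auto simp: T_def par_pow_diff)
    next
      case False
      then have "y = (par ^^ i) (par (Ym j k))" using y v by (simp add: Ym_def)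
      moreover have "(par ^^ i) (par (Ym j k) + mm n Wm Ym j k) \<in> N"
        using par_pow_N[OF Y1] is_subringD(4)[OF Rr_subring] R1 by blast
      ultimately show ?thesis
        using yR is_subringD(3)[OF sH(1) XWH(2)[OF y(2,3)]]
        by (auto simp: T_def par_pow_add intro!: bexI[of _ "- (par ^^ i) (mm n Wm Ym j k)"])
    qed
  qed
  ultimately have "?R \<subseteq> T" unfolding Rr_Suc by (intro adjoin_least) auto
  then show ?thesis using x by (auto simp: T_def)
qed

lemma stage_const: "stage i N \<Longrightarrow> constants_only (Rr i) N"
  using constants_only_fin_gen[OF Rr_def stable_Rr _ closed] by (auto simp: stage_def)

text \<open>A point with a tangent vector along which the field moves by its own derivation
  \<open>pk\<close>. The homomorphism on the field extends to all generators by specialisation at a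
  prime ideal above \<open>N\<close>.\<close>

lemma stage_point:
  assumes "stage i N"
  shows "\<exists>\<Phi> :: 'c dpol \<Rightarrow> 'c alg_closure dual. hom_on (Rr i) \<Phi> \<and> (\<forall>x\<in>N. \<Phi> x = 0) \<and>
    (\<forall>c. \<Phi> (mconst c) = Dual (to_ac c) (to_ac (pk c)))"
proof -
  have N: "max_stable (Rr i) N" using assms by (simp add: stage_def)
  note iN = max_stableD(1)[OF N]
  have "{1} \<subseteq> Rr i" using is_subringD(2)[OF Rr_subring] by blast
  then obtain Q where Q: "is_prime (Rr i) Q" "N \<subseteq> Q"
    using prime_ideal_exists[OF Rr_subring iN, of "{1}"] max_stableD(3)[OF N] by auto
  have iQ: "is_ideal (Rr i) Q" and Q1: "1 \<notin> Q" using Q(1) by (auto simp: is_prime_def)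
  \<comment> \<open>The coefficient at the empty monomial recovers \<open>c\<close> from
    \<open>mconst c\<close>.\<close>
  define \<phi> where "\<phi> p = Dual (to_ac (Poly_Mapping.lookup p 0)) (to_ac (pk (Poly_Mapping.lookup p 0)))"
    for p :: "'c dpol"
  have \<phi>: "\<phi> (mconst c) = Dual (to_ac c) (to_ac (pk c))" for c by (simp add: \<phi>_def mconst_def)
  have \<phi>_hom: "hom_on (range mconst) \<phi>"
    unfolding hom_on_def
  proof (intro conjI ballI)
    show "\<phi> 1 = 1" using \<phi>[of 1] by (simp add: mconst_simps one_dual_def is_derivD[OF pk_deriv])
    fix x y :: "'c dpol" assume "x \<in> range mconst" "y \<in> range mconst"
    then obtain b b' where "x = mconst b" "y = mconst b'" by blast
    then show "\<phi> (x + y) = \<phi> x + \<phi> y" "\<phi> (x * y) = \<phi> x * \<phi> y"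
      using \<phi>[of "b + b'"] \<phi>[of "b * b'"] \<phi>[of b] \<phi>[of b']
      by (simp_all add: mconst_simps plus_dual_def times_dual_def is_derivD[OF pk_deriv])
  qed
  have nz: "c = 0" if "mconst c \<in> Q" for c
  proof (rule ccontr)
    assume "c \<noteq> 0"
    then have "mconst (inverse c) * mconst c = (1 :: 'c dpol)"
      by (simp add: mconst_simps(4)[symmetric] mconst_simps(2))
    then show False using is_idealD(4)[OF iQ Rr_const that, of "inverse c"] Q1 by simp
  qed
  have tor: "\<forall>m>0. \<forall>a\<in>Rr i. of_nat m * a \<in> Q \<longrightarrow> a \<in> Q"
    using torsion_free[OF Rr_range iQ] by blast
  have gens: "set (concat (map gl [0..<Suc i])) \<subseteq> Rr i"
    unfolding Rr_def using adjoin_subring(3)[OF range_\<iota>_subring] .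
  have one: "1 \<in> adjoin (range mconst) (concat (map gl [0..<Suc i]))"
    using is_subringD(2)[OF Rr_subring] unfolding Rr_def .
  note E = extend_many[OF range_\<iota>_subring Rr_range Q(1) Rr_subring gens tor one Q1,
      where ?'w = "'c alg_closure", folded Rr_def]
  obtain a where a: "a \<in> range mconst" and a': "a \<notin> Q \<and> (\<forall>\<phi> :: 'c dpol \<Rightarrow> 'c alg_closure dual.
      hom_on (range mconst) \<phi> \<and> (\<forall>y\<in>range mconst \<inter> Q. \<phi> y = 0) \<and> rpart (\<phi> a) \<noteq> 0 \<longrightarrow>
      (\<exists>\<phi>'. hom_on (Rr i) \<phi>' \<and> (\<forall>y\<in>range mconst. \<phi>' y = \<phi> y) \<and> (\<forall>y\<in>Rr i \<inter> Q. \<phi>' y = 0) \<and> rpart (\<phi>' 1) \<noteq> 0))"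
    by (rule bexE[OF E])
  note ext = conjunct2[OF a', rule_format]
  have kill: "\<forall>y\<in>range mconst \<inter> Q. \<phi> y = 0"
  proof
    fix y assume "y \<in> range mconst \<inter> Q"
    then have "y = mconst 0" using nz by auto
    then show "\<phi> y = 0" using \<phi>[of 0] by (simp add: zero_dual_def is_derivD[OF pk_deriv])
  qed
  have "rpart (\<phi> a) \<noteq> 0"
  proof -
    obtain c where c: "a = mconst c" using a by blast
    then have "c \<noteq> 0" using conjunct1[OF a'] is_idealD(2)[OF iQ] by (auto simp: mconst_simps)
    then show ?thesis using c \<phi> by simp
  qed
  then have "hom_on (range mconst) \<phi> \<and> (\<forall>y\<in>range mconst \<inter> Q. \<phi> y = 0) \<and> rpart (\<phi> a) \<noteq> 0"
    using \<phi>_hom kill by blast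
  from ext[OF this] obtain \<Phi> where \<Phi>: "hom_on (Rr i) \<Phi>" "\<forall>y\<in>range mconst. \<Phi> y = \<phi> y" "\<forall>y\<in>Rr i \<inter> Q. \<Phi> y = 0" by blast
  moreover have "\<forall>x\<in>N. \<Phi> x = 0" using \<Phi>(3) Q(2) is_idealD(1)[OF iN] by blast
  ultimately show ?thesis using \<phi> by auto
qed

text \<open>An arbitrary tangent vector will not do: on elements of order below \<open>i\<close> it
  must agree with \<open>par\<close>, whose values there are already fixed. So the old tangent
  vector is discarded and only the point is kept; below the top order the new vector is read off
  from \<open>par\<close>, and \<open>adjoin_steps\<close> with \<open>stage_span\<close> extends it
  to the top order.\<close>

lemma stage_tangent:
  assumes st: "stage i N"
  shows "\<exists>\<Phi> :: 'c dpol \<Rightarrow> 'c alg_closure dual. hom_on (Rr i) \<Phi> \<and> (\<forall>x\<in>N. \<Phi> x = 0) \<and>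
    (\<forall>c. \<Phi> (mconst c) = Dual (to_ac c) (to_ac (pk c))) \<and>
    (\<forall>m x. i = Suc m \<longrightarrow> x \<in> Rr m \<longrightarrow> ipart (\<Phi> x) = rpart (\<Phi> (par x)))"
proof -
  obtain \<Phi>0 :: "'c dpol \<Rightarrow> 'c alg_closure dual" where \<Phi>0: "hom_on (Rr i) \<Phi>0" "\<forall>x\<in>N. \<Phi>0 x = 0"
    "\<forall>c. \<Phi>0 (mconst c) = Dual (to_ac c) (to_ac (pk c))"
    using stage_point[OF st] by blast
  show ?thesis
  proof (cases i)
    case 0
    then show ?thesis using \<Phi>0 by blast
  next
    case (Suc m)
    let ?R = "Rr (Suc m)" and ?H = "adjoin (Rr m) (Wl m)"
    have N: "max_stable ?R N" and Nm: "max_stable (Rr m) (N \<inter> Rr m)"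
      and par_N: "f \<in> N \<Longrightarrow> f \<in> Rr m \<Longrightarrow> par f \<in> N" for f
      using st Suc by (auto simp: stage_def)
    note iN = max_stableD(1)[OF N]
    define \<phi> where "\<phi> x = rpart (\<Phi>0 x)" for x
    have \<phi>z: "\<phi> y = 0" if "y \<in> N" for y
      using \<Phi>0(2) that by (simp add: \<phi>_def)
    have \<phi>_hom: "hom_on ?R \<phi>" using hom_on_rpart[OF \<Phi>0(1)] Suc by (simp add: \<phi>_def[abs_def])
    \<comment> \<open>The tangent vector that \<open>par\<close> itself defines at the point
      \<open>\<phi>\<close>; it kills \<open>N\<close> in \<open>Rr m\<close> because derivatives of
      such elements lie in \<open>N\<close>.\<close>
    define \<Phi>1 where "\<Phi>1 x = Dual (\<phi> x) (\<phi> (par x))" for x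
    have RR: "Rr m \<subseteq> ?R" using Rr_mono[of m "Suc m"] by simp
    have \<Phi>1: "hom_on (Rr m) \<Phi>1"
      unfolding hom_on_def \<Phi>1_def
      using hom_onD[OF \<phi>_hom] hom_on_more(1)[OF Rr_subring \<phi>_hom] RR par_Rr
      by (auto simp: one_dual_def plus_dual_def times_dual_def par_simps is_derivD[OF par_deriv] subset_iff
          is_subringD[OF Rr_subring])
    have \<Phi>1z: "\<Phi>1 y = 0" if "y \<in> Rr m" "y \<in> N" for y
      using that \<phi>z par_N by (simp add: \<Phi>1_def zero_dual_def)
    have "\<exists>\<Phi>'. hom_on ?H \<Phi>' \<and> (\<forall>y\<in>?H. rpart (\<Phi>' y) = \<phi> y) \<and> (\<forall>y\<in>?H. y \<in> N \<longrightarrow> \<Phi>' y = 0) \<and> (\<forall>y\<in>Rr m. \<Phi>' y = \<Phi>1 y)"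
      using stage_const[OF st] Suc
      by (intro adjoin_steps(2)[OF Rr_subring iN max_stableD(2)[OF N] _ Rr_subring stable_Rr Rr_range RR Nm]
          Wl_props \<phi>_hom \<phi>z \<Phi>1 \<Phi>1z) (auto simp: \<Phi>1_def)
    then obtain \<Phi>2 where \<Phi>2: "hom_on ?H \<Phi>2" "\<forall>y\<in>?H. rpart (\<Phi>2 y) = \<phi> y" "\<forall>y\<in>?H. y \<in> N \<longrightarrow> \<Phi>2 y = 0"
      "\<forall>y\<in>Rr m. \<Phi>2 y = \<Phi>1 y" by blast
    note sH = adjoin_subring[OF Rr_subring[of m], of "Wl m"]
    have HR: "?H \<subseteq> ?R" using adjoin_least[OF Rr_subring RR] Wl_props(1) by auto
    obtain \<Phi>3 where \<Phi>3: "hom_on ?R \<Phi>3" "\<forall>x\<in>?R. \<forall>h\<in>?H. x - h \<in> N \<longrightarrow> \<Phi>3 x = \<Phi>2 h"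
      using hom_on_extend_mod[OF sH(1) HR Rr_subring iN _ \<Phi>2(1)] stage_span[OF st[unfolded Suc]] \<Phi>2(3) by blast
    have base: "\<Phi>3 x = \<Phi>1 x" if "x \<in> Rr m" for x
    proof -
      have "x \<in> ?R" "x \<in> ?H" "x - x \<in> N" using that RR sH(2) is_idealD(2)[OF iN] by auto
      then have "\<Phi>3 x = \<Phi>2 x" using \<Phi>3(2) by blast
      then show ?thesis using \<Phi>2(4) that by simp
    qed
    have rp: "rpart (\<Phi>3 y) = \<phi> y" if y: "y \<in> ?R" for y
    proof -
      obtain h where h: "h \<in> ?H" "y - h \<in> N" using stage_span[OF st[unfolded Suc] y] by blast
      then have "\<phi> y - \<phi> h = 0" using \<phi>z[OF h(2)] hom_on_more(3)[OF Rr_subring \<phi>_hom y, of h] HR by auto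
      then show ?thesis using \<Phi>3(2) \<Phi>2(2) h y by simp
    qed
    have "\<forall>x\<in>N. \<Phi>3 x = 0"
    proof
      fix x assume "x \<in> N"
      then have "x \<in> ?R" "0 \<in> ?H" "x - 0 \<in> N" using is_idealD(1)[OF iN] is_subringD(1)[OF sH(1)] by auto
      then have "\<Phi>3 x = \<Phi>2 0" using \<Phi>3(2) by blast
      then show "\<Phi>3 x = 0" using hom_on_more(1)[OF sH(1) \<Phi>2(1)] by simp
    qed
    moreover have "\<forall>c. \<Phi>3 (mconst c) = Dual (to_ac c) (to_ac (pk c))"
      using base[OF Rr_const] \<Phi>0(3) by (simp add: \<Phi>1_def \<phi>_def par_const)
    moreover have "ipart (\<Phi>3 x) = rpart (\<Phi>3 (par x))" if "x \<in> Rr m" for x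
      using base[OF that] rp[OF par_Rr[OF that]] by (simp add: \<Phi>1_def)
    ultimately show ?thesis using \<Phi>3(1) Suc by blast
  qed
qed

text \<open>A compatible tangent vector supplies values for the variables of order
  \<open>i + 1\<close>. The resulting point of the next ring kills \<open>N\<close> and the
  derivatives of its elements, so together these generate a proper ideal.\<close>

lemma stage_step:
  assumes st: "stage i N"
  shows "\<exists>N'. stage (Suc i) N' \<and> N' \<inter> Rr i = N"
proof -
  let ?R = "Rr (Suc i)"
  have N: "max_stable (Rr i) N" and rel: "inverse_rels N" using st by (auto simp: stage_def)
  note iN = max_stableD(1)[OF N]
  have RR: "Rr i \<subseteq> ?R" using Rr_mono[of i "Suc i"] by simp
  obtain \<Phi> :: "'c dpol \<Rightarrow> 'c alg_closure dual" where \<Phi>: "hom_on (Rr i) \<Phi>" "\<forall>x\<in>N. \<Phi> x = 0"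
    "\<forall>c. \<Phi> (mconst c) = Dual (to_ac c) (to_ac (pk c))"
    "\<forall>m x. i = Suc m \<longrightarrow> x \<in> Rr m \<longrightarrow> ipart (\<Phi> x) = rpart (\<Phi> (par x))"
    using stage_tangent[OF st] by blast
  have ac: "hom_on UNIV to_ac" by (simp add: hom_on_def)
  \<comment> \<open>Up to order \<open>i\<close> the point underlying \<open>\<Phi>\<close>; in
    order \<open>i + 1\<close> the infinitesimal value of the variable one order below. Still higher
    orders do not occur in \<open>?R\<close> and receive the same value.\<close>
  define \<theta> where "\<theta> = meval to_ac (\<lambda>(b, j, k, m). if m \<le> i then rpart (\<Phi> (mvar (b, j, k, m))) else ipart (\<Phi> (mvar (b, j, k, i))))"
  have \<theta>: "hom_on UNIV \<theta>" unfolding \<theta>_def using meval_hom[OF ac] .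
  note \<theta>s = hom_onD[OF \<theta>, simplified] hom_on_more[OF is_subring_UNIV \<theta>, simplified]
  have \<theta>c: "\<theta> (mconst c) = to_ac c" for c unfolding \<theta>_def by (rule meval_mconst[OF ac])
  have \<theta>v: "\<theta> (mvar (b, j, k, m)) = (if m \<le> i then rpart (\<Phi> (mvar (b, j, k, m))) else ipart (\<Phi> (mvar (b, j, k, i))))"
    for b j k m unfolding \<theta>_def by (simp add: meval_mvar[OF ac])
  have "hom_on UNIV (\<lambda>x. Dual (\<theta> x) (\<theta> (par x)))"
    by (auto simp: hom_on_def \<theta>s par_simps is_derivD[OF par_deriv] one_dual_def plus_dual_def times_dual_def)
  then have \<Theta>: "hom_on (Rr i) (\<lambda>x. Dual (\<theta> x) (\<theta> (par x)))" using hom_on_subset by blast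
  \<comment> \<open>Both sides are homomorphisms on \<open>Rr i\<close>, so generators suffice: in
    order \<open>i\<close> the equation is the definition of \<open>\<theta>\<close>, below it is
    the compatibility of \<open>\<Phi>\<close> with \<open>par\<close>.\<close>
  have eq: "Dual (\<theta> x) (\<theta> (par x)) = \<Phi> x" if "x \<in> Rr i" for x
    using range_\<iota>_subring \<Theta>[unfolded Rr_def] \<Phi>(1)[unfolded Rr_def] _ _ that[unfolded Rr_def]
  proof (rule hom_on_eq_adjoin)
    fix a :: "'c dpol" assume "a \<in> range mconst"
    then show "Dual (\<theta> a) (\<theta> (par a)) = \<Phi> a" using \<Phi>(3) by (auto simp: \<theta>c par_const)
  next
    fix x assume "x \<in> set (concat (map gl [0..<Suc i]))"
    then obtain b j k m where x: "x = mvar (b, j, k, m)" "j < n" "k < n" "m \<le> i"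
      unfolding set_gens by blast
    show "Dual (\<theta> x) (\<theta> (par x)) = \<Phi> x"
    proof (cases "m = i")
      case True
      then show ?thesis using x by (simp add: par_var \<theta>v)
    next
      case False
      then obtain m' where m': "i = Suc m'" "m \<le> m'" using x(4) by (cases i) auto
      then have "mvar (b, j, k, m) \<in> Rr m'" using x Rr_var by blast
      then have "ipart (\<Phi> x) = rpart (\<Phi> (mvar (b, j, k, Suc m)))" using \<Phi>(4) m' x par_var by metis
      moreover have "Suc m \<le> i" using m' by simp
      ultimately show ?thesis using x by (intro dual.expand) (simp add: par_var \<theta>v)
    qed
  qed
  \<comment> \<open>The ideal generated by this set is invariant because the operators commute with
    \<open>par\<close>.\<close>
  define G where "G = N \<union> par ` N"
  have GR: "G \<subseteq> ?R" using is_idealD(1)[OF iN] RR par_Rr by (auto simp: G_def)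
  have \<theta>N: "\<theta> x = 0" "\<theta> (par x) = 0" if "x \<in> N" for x
    using eq[OF is_idealD(1)[OF iN that]] \<Phi>(2) that by (auto simp: zero_dual_def)
  have "is_ideal ?R {x \<in> ?R. \<theta> x = 0}"
    using is_subringD[OF Rr_subring] by (auto simp: is_ideal_def \<theta>s)
  moreover have "G \<subseteq> {x \<in> ?R. \<theta> x = 0}" using GR \<theta>N by (auto simp: G_def)
  ultimately have "ideal_span ?R G \<subseteq> {x \<in> ?R. \<theta> x = 0}" by (rule ideal_span_least)
  then have proper: "1 \<notin> ideal_span ?R G" using \<theta>s(1) by auto
  note GI = ideal_span_superset[of G ?R]
  have "sh s g \<in> G" if "s \<in> S" "g \<in> G" for s g
    using that stableD(1)[OF max_stableD(2)[OF N]] sh_par by (auto simp: G_def)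
  moreover have "dl d g \<in> G" if "d \<in> D" "g \<in> G" for d g
    using that stableD(2)[OF max_stableD(2)[OF N]] dl_par by (auto simp: G_def)
  ultimately have "stable (ideal_span ?R G)"
    using GI by (intro stable_ideal_span[OF Rr_subring stable_Rr GR]) auto
  then obtain N' where N': "max_stable ?R N'" "ideal_span ?R G \<subseteq> N'"
    using max_stable_exists[OF ideal_span_ideal[OF Rr_subring GR] _ proper] by blast
  have NN': "N \<subseteq> N'" "par ` N \<subseteq> N'" using N'(2) GI by (auto simp: G_def)
  \<comment> \<open>Enlarging to a maximal ideal adds nothing inside \<open>Rr i\<close>, where
    \<open>N\<close> was already maximal.\<close>
  have "N' \<inter> Rr i = N"
  proof (rule max_stableD(4)[OF N])
    show "is_ideal (Rr i) (N' \<inter> Rr i)" using is_ideal_Int[OF max_stableD(1)[OF N'(1)] Rr_subring RR] .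
    show "stable (N' \<inter> Rr i)" using stable_Int[OF max_stableD(2)[OF N'(1)] stable_Rr] .
    show "N \<subseteq> N' \<inter> Rr i" using NN' is_idealD(1)[OF iN] by blast
    show "1 \<notin> N' \<inter> Rr i" using max_stableD(3)[OF N'(1)] by blast
  qed
  then show ?thesis
    using N' N NN' rel by (intro exI[of _ N']) (auto simp: stage_def inverse_rels_def)
qed

text \<open>The operators map the relations between \<open>X\<close> and \<open>Y\<close> into the
  ideal they generate, and that ideal is proper because the relations hold when both matrices are
  the unit matrix.\<close>

lemma stage_start: "\<exists>N. stage 0 N"
proof -
  define G where "G = range (case_prod (\<lambda>j k. mm n Xm Ym j k - unit_mat n j k)) \<union> range (case_prod (\<lambda>j k. mm n Ym Xm j k - unit_mat n j k))"
  let ?R = "Rr 0" and ?P = "\<lambda>j k. mm n Xm Ym j k - unit_mat n j k" and ?Q = "\<lambda>j k. mm n Ym Xm j k - unit_mat n j k"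
  have "?P j k \<in> ?R" "?Q j k \<in> ?R" for j k
    by (intro is_subringD(5)[OF Rr_subring] mm_in_subring[OF Rr_subring] XY_Rr unit_Rr)+
  then have GR: "G \<subseteq> ?R" by (auto simp: G_def)
  note I = ideal_span_ideal[OF Rr_subring GR] and GI = ideal_span_superset[of G ?R]
  have PI: "?P j k \<in> ideal_span ?R G" and QI: "?Q j k \<in> ideal_span ?R G" for j k
    using GI by (auto simp: G_def)
  have shP: "sh s (?P j k) \<in> ideal_span ?R G" if s: "s \<in> S" for s j k
  proof -
    have "map_entries (sh s) (mm n Xm Ym) = mm n (cm (Am s)) (mm n (mm n Xm Ym) (cm (Ai s)))"
      by (simp add: map_entries_mm[OF sh_hom[OF s]] sh_X[OF s] sh_Y[OF s] mm_assoc)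
    moreover have "mm n (cm (Am s)) (mm n (unit_mat n) (cm (Ai s))) = unit_mat n"
      using s by (simp add: mm_unit cm_supp supp cm_mm A_inv cm_unit)
    ultimately have "map_entries (sh s) ?P = mm n (cm (Am s)) (mm n ?P (cm (Ai s)))"
      using map_entries_unit[OF sh_hom[OF s], of n] s
      by (simp add: map_entries_def mm_linear sh_simps fun_eq_iff)
    then have "sh s (?P j k) = mm n (cm (Am s)) (mm n ?P (cm (Ai s))) j k"
      by (simp add: map_entries_app[of "sh s" ?P])
    then show ?thesis using mm_in_ideal[OF I] PI cm_Rr by simp
  qed
  have shQ: "sh s (?Q j k) \<in> ideal_span ?R G" if s: "s \<in> S" for s j k
  proof -
    have "map_entries (sh s) (mm n Ym Xm) = mm n Ym (mm n (mm n (cm (Ai s)) (cm (Am s))) Xm)"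
      by (simp add: map_entries_mm[OF sh_hom[OF s]] sh_X[OF s] sh_Y[OF s] mm_assoc)
    then have "map_entries (sh s) (mm n Ym Xm) = mm n Ym Xm"
      using s by (simp add: cm_mm A_inv cm_unit mm_unit supp_XY)
    then have "sh s (?Q j k) = ?Q j k"
      using map_entries_unit[OF sh_hom[OF s], of n] s by (simp add: map_entries_app[of "sh s"] sh_simps)
    then show ?thesis using QI by simp
  qed
  have dlP: "dl d (?P j k) \<in> ideal_span ?R G" if d: "d \<in> D" for d j k
  proof -
    have "map_entries (dl d) (mm n Xm Ym) = (\<lambda>j k. mm n (cm (Bm d)) (mm n Xm Ym) j k - mm n (mm n Xm Ym) (cm (Bm d)) j k)"
      by (simp add: map_entries_deriv_mm[OF dl_deriv[OF d]] dl_X[OF d] dl_Y[OF d] mm_assoc mm_linear)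
    moreover have "mm n (cm (Bm d)) (unit_mat n) = cm (Bm d)" "mm n (unit_mat n) (cm (Bm d)) = cm (Bm d)"
      using d by (simp_all add: mm_unit cm_supp supp)
    ultimately have "map_entries (dl d) ?P = (\<lambda>j k. mm n (cm (Bm d)) ?P j k - mm n ?P (cm (Bm d)) j k)"
      using map_entries_deriv_unit[OF dl_deriv[OF d], of n] d
      by (simp add: map_entries_def mm_linear dl_simps fun_eq_iff)
    then have "dl d (?P j k) = mm n (cm (Bm d)) ?P j k - mm n ?P (cm (Bm d)) j k"
      by (simp add: map_entries_app[of "dl d" ?P])
    then show ?thesis using mm_in_ideal[OF I] PI cm_Rr is_ideal_neg(2)[OF Rr_subring I] by simp
  qed
  have dlQ: "dl d (?Q j k) \<in> ideal_span ?R G" if d: "d \<in> D" for d j k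
  proof -
    have "map_entries (dl d) (mm n Ym Xm) = (\<lambda>j k. 0)"
      by (simp add: map_entries_deriv_mm[OF dl_deriv[OF d]] dl_X[OF d] dl_Y[OF d] mm_assoc mm_linear)
    then have "dl d (?Q j k) = 0"
      using map_entries_deriv_unit[OF dl_deriv[OF d], of n] d by (simp add: map_entries_app[of "dl d"] dl_simps)
    then show ?thesis using is_idealD(2)[OF I] by simp
  qed
  have st: "stable (ideal_span ?R G)"
  proof (rule stable_ideal_span[OF Rr_subring stable_Rr GR])
    have GE: "\<exists>j k. g = ?P j k \<or> g = ?Q j k" if "g \<in> G" for g using that by (auto simp: G_def)
    show "sh s g \<in> ideal_span ?R G" if "s \<in> S" "g \<in> G" for s g
      using GE[OF that(2)] shP[OF that(1)] shQ[OF that(1)] by metis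
    show "dl d g \<in> ideal_span ?R G" if "d \<in> D" "g \<in> G" for d g
      using GE[OF that(2)] dlP[OF that(1)] dlQ[OF that(1)] by metis
  qed
  have idh: "hom_on UNIV (\<lambda>c::'c. c)" by (simp add: hom_on_def)
  define \<theta> where "\<theta> = meval (\<lambda>c::'c. c) (\<lambda>(b::bool, j, k, m::nat). unit_mat n j k)"
  have \<theta>: "hom_on UNIV \<theta>" unfolding \<theta>_def using meval_hom[OF idh] .
  note \<theta>s = hom_onD[OF \<theta>, simplified] hom_on_more[OF is_subring_UNIV \<theta>, simplified]
  have \<theta>v: "\<theta> (mvar (b, j, k, m)) = unit_mat n j k" for b j k m by (simp add: \<theta>_def meval_mvar[OF idh])
  have \<theta>X: "map_entries \<theta> Xm = unit_mat n" "map_entries \<theta> Ym = unit_mat n"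
    by (auto simp: map_entries_def Xm_def Ym_def \<theta>v unit_mat_def fun_eq_iff \<theta>s)
  have e: "map_entries \<theta> (mm n Xm Ym) = unit_mat n" "map_entries \<theta> (mm n Ym Xm) = unit_mat n"
    using mm_unit[OF supported_unit] by (auto simp: map_entries_mm[OF \<theta>] \<theta>X)
  have u: "map_entries \<theta> (unit_mat n) = unit_mat n" using map_entries_unit[OF \<theta>] .
  have "\<theta> (?P j k) = 0" "\<theta> (?Q j k) = 0" for j k
    using e u by (simp_all add: \<theta>s map_entries_app[of \<theta>])
  then have "G \<subseteq> {x \<in> ?R. \<theta> x = 0}" using GR by (auto simp: G_def)
  moreover have "is_ideal ?R {x \<in> ?R. \<theta> x = 0}"
    using is_subringD[OF Rr_subring] by (auto simp: is_ideal_def \<theta>s)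
  ultimately have "ideal_span ?R G \<subseteq> {x \<in> ?R. \<theta> x = 0}" using ideal_span_least by blast
  then have "1 \<notin> ideal_span ?R G" using \<theta>s(1) by auto
  then obtain N where "max_stable ?R N" "ideal_span ?R G \<subseteq> N" using max_stable_exists[OF I st] by blast
  then show ?thesis using PI QI by (intro exI[of _ N]) (auto simp: stage_def inverse_rels_def)
qed

section \<open>The union of the stages\<close>

definition RR :: "'c dpol set" where
  "RR = (\<Union>i. Rr i)"

lemma RR_common: "x \<in> RR \<Longrightarrow> y \<in> RR \<Longrightarrow> \<exists>i. x \<in> Rr i \<and> y \<in> Rr i"
proof -
  assume "x \<in> RR" "y \<in> RR"
  then obtain a b where "x \<in> Rr a" "y \<in> Rr b" by (auto simp: RR_def)
  then have "x \<in> Rr (max a b) \<and> y \<in> Rr (max a b)" using Rr_mono[of a "max a b"] Rr_mono[of b "max a b"] by auto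
  then show ?thesis by blast
qed

lemma Rr_RR: "Rr i \<subseteq> RR"
  by (auto simp: RR_def)

lemma RR_subring: "is_subring RR"
proof -
  have "x - y \<in> RR \<and> x * y \<in> RR" if xy: "x \<in> RR" "y \<in> RR" for x y
  proof -
    obtain i where "x \<in> Rr i" "y \<in> Rr i" using RR_common[OF xy] by blast
    then show ?thesis using is_subringD(5,6)[OF Rr_subring, of x i y] Rr_RR[of i] by blast
  qed
  moreover have "1 \<in> RR" using is_subringD(2)[OF Rr_subring] Rr_RR by blast
  ultimately show ?thesis by (simp add: is_subring_def)
qed

lemma stable_RR: "stable RR"
  unfolding RR_def by (rule stable_UN[OF stable_Rr])

lemma par_RR: "x \<in> RR \<Longrightarrow> par x \<in> RR"
  using par_Rr by (auto simp: RR_def)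

text \<open>The property passes through the generators in \<open>Wl i\<close> one by one, and modulo
  \<open>N\<close> these generate the whole next ring over the old one.\<close>

lemma stage_prime_ann:
  assumes st: "stage (Suc i) N" and u: "u \<in> Rr i" "prime_ann (Rr i) N u"
  shows "prime_ann (Rr (Suc i)) N u"
proof -
  let ?R = "Rr (Suc i)" and ?H = "adjoin (Rr i) (Wl i)"
  have N: "max_stable ?R N" and Ni: "max_stable (Rr i) (N \<inter> Rr i)" using st by (auto simp: stage_def)
  note iN = max_stableD(1)[OF N]
  have RR: "Rr i \<subseteq> ?R" using Rr_mono[of i "Suc i"] by simp
  have HR: "?H \<subseteq> ?R" using adjoin_least[OF Rr_subring RR] Wl_props(1) by auto
  have H: "prime_ann ?H N u"
    by (rule adjoin_steps(1)[OF Rr_subring iN max_stableD(2)[OF N] stage_const[OF st] Rr_subring stable_Rr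
          Rr_range RR Ni Wl_props u])
  show ?thesis
    unfolding prime_ann_def
  proof (intro ballI impI)
    fix x y assume x: "x \<in> ?R" and y: "y \<in> ?R" and xy: "x * y * u \<in> N"
    obtain h g where h: "h \<in> ?H" "x - h \<in> N" and g: "g \<in> ?H" "y - g \<in> N"
      using stage_span[OF st x] stage_span[OF st y] by blast
    have uR: "u \<in> ?R" "h \<in> ?R" "g \<in> ?R" using u(1) RR h g HR by auto
    have "(y * u) * (x - h) \<in> N" "(h * u) * (y - g) \<in> N"
      using is_idealD(4)[OF iN] h g is_subringD(6)[OF Rr_subring] y uR by auto
    then have "x * y * u - ((y * u) * (x - h) + (h * u) * (y - g)) \<in> N"
      using xy is_ideal_neg(2)[OF Rr_subring iN] is_idealD(3)[OF iN] by blast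
    then have "h * g * u \<in> N" by (simp add: algebra_simps)
    then have "h * u \<in> N \<or> g * u \<in> N" using H h g by (auto simp: prime_ann_def)
    moreover have "u * (x - h) \<in> N" "u * (y - g) \<in> N" using is_idealD(4)[OF iN uR(1)] h g by auto
    ultimately have "u * (x - h) + h * u \<in> N \<or> u * (y - g) + g * u \<in> N" using is_idealD(3)[OF iN] by blast
    then show "x * u \<in> N \<or> y * u \<in> N" by (simp add: algebra_simps)
  qed
qed

text \<open>Maximality and constants pass to the union because each \<open>Nf i\<close> is the
  contraction of \<open>N\<close> to its stage. The basis theorem does not reach the union, so
  \<open>u\<close> is found in \<open>Rr 0\<close>; its annihilator then stays prime from stage to
  stage.\<close>

theorem universal_ideal:
  "\<exists>N u. max_stable RR N \<and> constants_only RR N \<and> inverse_rels N \<and> (\<forall>f\<in>N. par f \<in> N) \<and>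
    u \<in> RR \<and> u \<notin> N \<and> prime_ann RR N u"
proof -
  have "\<exists>Nf. \<forall>i. stage i (Nf i) \<and> Nf (Suc i) \<inter> Rr i = Nf i"
    using stage_start stage_step by (intro dependent_nat_choice) blast+
  then obtain Nf where st: "\<And>i. stage i (Nf i)" and Nf: "\<And>i. Nf (Suc i) \<inter> Rr i = Nf i" by blast
  define N where "N = (\<Union>i. Nf i)"
  have ms: "max_stable (Rr i) (Nf i)" and rel: "inverse_rels (Nf i)" for i using st[of i] by (auto simp: stage_def)
  note iN = max_stableD(1)[OF ms]
  have mono: "i \<le> m \<Longrightarrow> Nf i \<subseteq> Nf m" for i m
    using lift_Suc_mono_le[of Nf i m] Nf by blast
  have up: "Nf m \<inter> Rr i = Nf i" if "i \<le> m" for i m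
    using that
  proof (induction m rule: dec_induct)
    case base
    then show ?case using is_idealD(1)[OF iN] by blast
  next
    case (step m)
    then show ?case using Nf[of m] Rr_mono[of i m] by blast
  qed
  have NI: "N \<inter> Rr i = Nf i" for i
  proof
    show "N \<inter> Rr i \<subseteq> Nf i"
    proof
      fix x assume "x \<in> N \<inter> Rr i"
      then obtain m where m: "x \<in> Nf m" "x \<in> Rr i" by (auto simp: N_def)
      show "x \<in> Nf i"
        using m up[of i m] mono[of m i] by (cases "i \<le> m") auto
    qed
    show "Nf i \<subseteq> N \<inter> Rr i" using is_idealD(1)[OF iN] by (auto simp: N_def)
  qed
  have NRR: "N \<subseteq> RR" unfolding N_def RR_def using is_idealD(1)[OF iN] by blast
  have com: "\<exists>i. x \<in> Rr i \<and> y \<in> Rr i" if "x \<in> RR" "y \<in> RR" for x y using RR_common[OF that] .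
  have ideal: "is_ideal RR N"
    unfolding is_ideal_def
  proof (intro conjI ballI)
    show "N \<subseteq> RR" by (rule NRR)
    show "0 \<in> N" using is_idealD(2)[OF iN] NI by blast
    show "x + y \<in> N" if xy: "x \<in> N" "y \<in> N" for x y
    proof -
      obtain i where "x \<in> Rr i" "y \<in> Rr i" using com[of x y] xy NRR by blast
      then show ?thesis using is_idealD(3)[OF iN, of x i y] xy NI[of i] by blast
    qed
    show "a * x \<in> N" if ax: "a \<in> RR" "x \<in> N" for a x
    proof -
      obtain i where "a \<in> Rr i" "x \<in> Rr i" using com[of a x] ax NRR by blast
      then show ?thesis using is_idealD(4)[OF iN, of a i x] ax NI[of i] by blast
    qed
  qed
  have stN: "stable N"
    unfolding N_def by (rule stable_UN[OF max_stableD(2)[OF ms]])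
  have "max_stable RR N"
    unfolding max_stable_def
  proof (intro conjI allI impI ideal stN)
    show "1 \<notin> N" using max_stableD(3)[OF ms] by (auto simp: N_def)
    fix I assume I: "is_ideal RR I \<and> stable I \<and> N \<subseteq> I \<and> 1 \<notin> I"
    have II: "I \<inter> Rr i = Nf i" for i
    proof (rule max_stableD(4)[OF ms])
      show "is_ideal (Rr i) (I \<inter> Rr i)" using is_ideal_Int[OF _ Rr_subring Rr_RR] I by blast
      show "stable (I \<inter> Rr i)" using stable_Int[OF _ stable_Rr] I by blast
      show "Nf i \<subseteq> I \<inter> Rr i" using I NI[of i] by blast
      show "1 \<notin> I \<inter> Rr i" using I by blast
    qed
    have "I \<subseteq> N"
    proof
      fix x assume x: "x \<in> I"
      then have "x \<in> RR" using I is_idealD(1) by blast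
      then obtain i where "x \<in> Rr i" by (auto simp: RR_def)
      then show "x \<in> N" using II[of i] x by (auto simp: N_def)
    qed
    then show "I = N" using I by blast
  qed
  moreover have "constants_only RR N"
    unfolding constants_only_def
  proof (intro ballI impI)
    fix c assume c: "c \<in> RR" "const_mod N c"
    then obtain i where i: "c \<in> Rr i" by (auto simp: RR_def)
    have "const_mod (Nf i) c"
      using c(2) stableD[OF stable_Rr _ i] i is_subringD(5)[OF Rr_subring] NI[of i]
      unfolding const_mod_def by blast
    then obtain l where "l \<in> C" "c - mconst l \<in> Nf i"
      using stage_const[OF st] i by (auto simp: constants_only_def)
    then show "\<exists>l\<in>C. c - mconst l \<in> N" by (auto simp: N_def)
  qed
  moreover have "inverse_rels N" using rel[of 0] unfolding inverse_rels_def N_def by blast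
  moreover have "par f \<in> N" if "f \<in> N" for f
  proof -
    obtain i where "f \<in> Nf i" using \<open>f \<in> N\<close> by (auto simp: N_def)
    then have "f \<in> Nf (Suc i) \<inter> Rr i" using Nf[of i] by simp
    then have "par f \<in> Nf (Suc i)" using st[of "Suc i"] by (auto simp: stage_def)
    then show ?thesis by (auto simp: N_def)
  qed
  moreover have "\<exists>u\<in>RR. u \<notin> N \<and> prime_ann RR N u"
  proof -
    have "noeth (range (mconst :: 'c \<Rightarrow> 'c dpol))"
    proof (rule noeth_field[OF range_\<iota>_subring])
      fix a :: "'c dpol" assume "a \<in> range mconst" "a \<noteq> 0"
      then obtain c where a: "a = mconst c" by blast
      then have "c \<noteq> 0" using \<open>a \<noteq> 0\<close> mconst_simps(1) by metis
      then show "\<exists>b\<in>range mconst. b * a = 1"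
        using a by (intro bexI[of _ "mconst (inverse c)"]) (simp_all add: mconst_simps(4)[symmetric] mconst_simps(2))
    qed
    then have "noeth (Rr 0)" unfolding Rr_def by (rule noeth_adjoin[OF range_\<iota>_subring])
    then obtain u where u: "u \<in> Rr 0" "u \<notin> Nf 0"
      "\<forall>x\<in>Rr 0. \<forall>y\<in>Rr 0. x * y * u \<in> Nf 0 \<longrightarrow> x * u \<in> Nf 0 \<or> y * u \<in> Nf 0"
      using prime_annihilator_exists[OF Rr_subring _ iN max_stableD(3)[OF ms]] by blast
    have ui: "u \<in> Rr i" for i using u(1) Rr_mono[of 0 i] by blast
    \<comment> \<open>Over \<open>Rr i\<close> the property depends only on the contraction to
      \<open>Rr i\<close>, so the ideal of a stage and the union may be exchanged.\<close>
    have pa: "prime_ann (Rr i) N' u \<longleftrightarrow> prime_ann (Rr i) N'' u" if "N' \<inter> Rr i = N'' \<inter> Rr i" for N' N'' i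
    proof -
      have "x \<in> N' \<longleftrightarrow> x \<in> N''" if "x \<in> Rr i" for x using \<open>x \<in> Rr i\<close> \<open>N' \<inter> Rr i = N'' \<inter> Rr i\<close> by blast
      then show ?thesis using is_subringD(6)[OF Rr_subring] ui[of i] by (simp add: prime_ann_def)
    qed
    have "prime_ann (Rr i) N u" for i
    proof (induction i)
      case 0
      have "prime_ann (Rr 0) (Nf 0) u" using u(3) by (simp add: prime_ann_def)
      then show ?case using pa[of N 0 "Nf 0"] NI[of 0] is_idealD(1)[OF iN, of _ 0] by blast
    next
      case (Suc i)
      have "prime_ann (Rr i) (Nf (Suc i)) u" using Suc pa[of N i "Nf (Suc i)"] NI[of i] Nf[of i] by simp
      then have "prime_ann (Rr (Suc i)) (Nf (Suc i)) u" by (rule stage_prime_ann[OF st ui])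
      then show ?case using pa[of N "Suc i" "Nf (Suc i)"] NI[of "Suc i"] is_idealD(1)[OF iN, of _ "Suc i"] by blast
    qed
    then have "prime_ann RR N u"
      unfolding prime_ann_def using com by meson
    moreover have "u \<notin> N" using u(1,2) NI[of 0] by blast
    ultimately show ?thesis using u(1) Rr_RR by blast
  qed
  ultimately show ?thesis by blast
qed

end

section \<open>Total fractions of a simple ring\<close>

text \<open>What the prolongation delivers, stripped of variables: a simple quotient
  \<open>B/N\<close> without new constants, commuting operators, surjective automorphisms, and an
  element with prime annihilator.\<close>

locale const_ring = sd_ring S D sh dl \<iota> shk dlk
  for S :: "'s set" and D :: "'d set"
    and sh :: "'s \<Rightarrow> 'r::comm_ring_1 \<Rightarrow> 'r" and dl :: "'d \<Rightarrow> 'r \<Rightarrow> 'r"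
    and \<iota> :: "'k::field_char_0 \<Rightarrow> 'r" and shk :: "'s \<Rightarrow> 'k \<Rightarrow> 'k" and dlk :: "'d \<Rightarrow> 'k \<Rightarrow> 'k" +
  fixes B N :: "'r set" and par :: "'r \<Rightarrow> 'r" and u :: 'r
  assumes B_sub: "is_subring B" and B_stable: "stable B" and kB: "range \<iota> \<subseteq> B"
    and N_max: "max_stable B N" and N_const: "constants_only B N"
    and sh_surj: "s \<in> S \<Longrightarrow> x \<in> B \<Longrightarrow> \<exists>y\<in>B. sh s y = x"
    and sh_sh: "s \<in> S \<Longrightarrow> t \<in> S \<Longrightarrow> sh s (sh t x) = sh t (sh s x)"
    and sh_dl: "s \<in> S \<Longrightarrow> d \<in> D \<Longrightarrow> sh s (dl d x) = dl d (sh s x)"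
    and sh_par: "s \<in> S \<Longrightarrow> sh s (par x) = par (sh s x)"
    and dl_dl: "d \<in> D \<Longrightarrow> e \<in> D \<Longrightarrow> dl d (dl e x) = dl e (dl d x)"
    and dl_par: "d \<in> D \<Longrightarrow> dl d (par x) = par (dl d x)"
    and par_deriv: "is_deriv par" and par_B: "x \<in> B \<Longrightarrow> par x \<in> B" and par_N: "x \<in> N \<Longrightarrow> par x \<in> N"
    and u: "u \<in> B" "u \<notin> N" "prime_ann B N u"
begin

lemmas B = is_subringD[OF B_sub]
lemmas N_ideal = max_stableD(1)[OF N_max]
lemmas N = is_idealD[OF max_stableD(1)[OF N_max]] is_ideal_neg[OF B_sub max_stableD(1)[OF N_max]]
lemmas N_stable = stableD[OF max_stableD(2)[OF N_max]]
lemmas B_stab = stableD[OF B_stable]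

text \<open>The preimage of \<open>N\<close> under \<open>sh s\<close> is a proper ideal above
  \<open>N\<close>, and it is invariant because the operators commute.\<close>

lemma sh_inj: "s \<in> S \<Longrightarrow> x \<in> B \<Longrightarrow> sh s x \<in> N \<Longrightarrow> x \<in> N"
proof -
  assume s: "s \<in> S" and x: "x \<in> B" "sh s x \<in> N"
  let ?I = "{x \<in> B. sh s x \<in> N}"
  have "is_ideal B ?I"
    using B N B_stab(1)[OF s] by (auto simp: is_ideal_def sh_simps[OF s])
  moreover have "stable ?I"
    using s B_stab N_stable by (intro stableI) (auto simp: sh_sh[of s] sh_dl[of s])
  moreover have "N \<subseteq> ?I" using N N_stable(1)[OF s] by auto
  moreover have "1 \<notin> ?I" using max_stableD(3)[OF N_max] sh_simps(1)[OF s] by simp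
  ultimately have "?I = N" by (rule max_stableD(4)[OF N_max])
  then show "x \<in> N" using x by blast
qed

lemma deriv_power_mult: "is_deriv d \<Longrightarrow> d (z ^ m) * z = of_nat m * z ^ m * d z"
proof (induction m)
  case (Suc m)
  have "d (z ^ Suc m) * z = d z * z ^ Suc m + z * (d (z ^ m) * z)"
    using is_derivD(2)[OF Suc.prems, of z "z ^ m"] by (simp add: algebra_simps)
  then show ?case using Suc by (simp add: algebra_simps)
qed (simp add: is_derivD)

text \<open>Let \<open>z\<close> be the derivative of \<open>x\<close>. Differentiating a power of
  \<open>x\<close> trades one factor \<open>x\<close> for \<open>z\<close>; a further factor
  \<open>z\<close> is multiplied in so that the term where the power of \<open>z\<close> is
  differentiated remains a multiple of the old element. Two factors \<open>z\<close> per step give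
  the exponent \<open>2 * k\<close>, and the integer factor is divided out in characteristic
  zero.\<close>

lemma nilpotent_deriv:
  assumes d: "d \<in> D" and x: "x \<in> B" "x ^ k \<in> N"
  shows "dl d x ^ (2 * k) \<in> N"
proof -
  let ?z = "dl d x"
  have z: "?z \<in> B" "dl d ?z \<in> B" using B_stab(2)[OF d] x(1) by auto
  have "x ^ (k - j) * ?z ^ (2 * j) \<in> N" if "j \<le> k" for j
    using that
  proof (induction j)
    case (Suc j)
    obtain i where i: "k - j = Suc i" using Suc.prems by (metis Suc_diff_Suc Suc_le_lessD)
    let ?y = "x ^ Suc i * ?z ^ (2 * j)"
    have y: "?y \<in> N" using Suc i by simp
    have "dl d ?y * ?z = of_nat (Suc i) * (x ^ i * ?z ^ (2 * Suc j)) + (of_nat (2 * j) * dl d ?z) * ?y"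
      using is_derivD(2)[OF dl_deriv[OF d], of "x ^ Suc i" "?z ^ (2 * j)"]
        is_deriv_power_Suc[OF dl_deriv[OF d], of x i] deriv_power_mult[OF dl_deriv[OF d], of ?z "2 * j"]
      by (simp add: algebra_simps)
    moreover have "dl d ?y * ?z \<in> N" using N(5)[OF z(1) N_stable(2)[OF d y]] .
    moreover have "(of_nat (2 * j) * dl d ?z) * ?y \<in> N" using N(4)[OF B(6)[OF B(8) z(2)] y] .
    ultimately have "of_nat (Suc i) * (x ^ i * ?z ^ (2 * Suc j)) \<in> N"
      using N(7)[of "dl d ?y * ?z" "(of_nat (2 * j) * dl d ?z) * ?y"] by simp
    then have "x ^ i * ?z ^ (2 * Suc j) \<in> N" using torsion_free[OF kB N_ideal, of "Suc i"] by blast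
    moreover have "k - Suc j = i" using i by simp
    ultimately show ?case by simp
  qed (use x in simp)
  from this[of k] show ?thesis by simp
qed

text \<open>The elements nilpotent modulo \<open>N\<close> form a proper invariant ideal, by
  \<open>nilpotent_deriv\<close> also under derivations; so it is \<open>N\<close>.\<close>

lemma reduced: "x \<in> B \<Longrightarrow> x * x \<in> N \<Longrightarrow> x \<in> N"
proof -
  assume x: "x \<in> B" "x * x \<in> N"
  let ?I = "{x \<in> B. \<exists>k. x ^ k \<in> N}"
  have add: "x + y \<in> ?I" if x: "x \<in> B" "x ^ k \<in> N" and y: "y \<in> B" "y ^ m \<in> N" for x y k m
  proof -
    have "of_nat ((k + m) choose i) * x ^ i * y ^ (k + m - i) \<in> N" if "i \<le> k + m" for i
    proof (cases "k \<le> i")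
      case True
      then have "x ^ i = x ^ k * x ^ (i - k)" by (simp add: power_add[symmetric])
      then have "x ^ i \<in> N" using N(5)[OF B(7)[OF x(1)] x(2)] by simp
      then show ?thesis using N(4)[OF B(8)] N(5)[OF B(7)[OF y(1)]] by blast
    next
      case False
      then have "y ^ (k + m - i) = y ^ m * y ^ (k - i)" by (simp add: power_add[symmetric] add.commute)
      then have "y ^ (k + m - i) \<in> N" using N(5)[OF B(7)[OF y(1)] y(2)] by simp
      then show ?thesis using N(4)[OF B(6)[OF B(8) B(7)[OF x(1)]]] by blast
    qed
    then have "(x + y) ^ (k + m) \<in> N"
      unfolding binomial_ring by (intro is_ideal_sum[OF N_ideal]) auto
    then show ?thesis using B(4) x y by blast
  qed
  have "is_ideal B ?I"
    unfolding is_ideal_def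
  proof (intro conjI ballI)
    show "0 \<in> ?I" using B(1) N(2) by (auto intro!: exI[of _ 1])
    show "x + y \<in> ?I" if "x \<in> ?I" "y \<in> ?I" for x y using add that by blast
    show "a * x \<in> ?I" if ax: "a \<in> B" "x \<in> ?I" for a x
    proof -
      obtain k where "x ^ k \<in> N" using ax by blast
      then have "(a * x) ^ k \<in> N" using N(4)[OF B(7)[OF ax(1)]] by (simp add: power_mult_distrib)
      then show ?thesis using ax B(6) by blast
    qed
  qed auto
  moreover have "stable ?I"
  proof (rule stableI)
    fix s x assume s: "s \<in> S" "x \<in> ?I"
    then obtain k where "x ^ k \<in> N" by blast
    then have "sh s x ^ k \<in> N" using N_stable(1)[OF s(1), of "x ^ k"] by (simp add: sh_simps[OF s(1)])
    then show "sh s x \<in> ?I" using s B_stab(1) by blast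
  next
    fix d x assume "d \<in> D" "x \<in> ?I"
    then show "dl d x \<in> ?I" using nilpotent_deriv B_stab(2) by blast
  qed
  moreover have "N \<subseteq> ?I" using N(1) by (auto intro!: exI[of _ 1])
  moreover have "1 \<notin> ?I" using max_stableD(3)[OF N_max] by simp
  ultimately have "?I = N" by (rule max_stableD(4)[OF N_max])
  moreover have "x \<in> ?I" using x by (auto intro!: exI[of _ 2] simp: power2_eq_square)
  ultimately show "x \<in> N" by blast
qed

section \<open>The orbit of an element with prime annihilator\<close>

inductive_set Orb :: "'r set" where
  base: "u \<in> Orb"
| shift: "v \<in> Orb \<Longrightarrow> s \<in> S \<Longrightarrow> sh s v \<in> Orb"

lemma Orb_props: "v \<in> Orb \<Longrightarrow> v \<in> B \<and> v \<notin> N \<and> prime_ann B N v"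
proof (induction rule: Orb.induct)
  case base
  then show ?case using u by blast
next
  case (shift v s)
  have "x * sh s v \<in> N \<or> y * sh s v \<in> N" if xy: "x \<in> B" "y \<in> B" "x * y * sh s v \<in> N" for x y
  proof -
    obtain a b where ab: "a \<in> B" "sh s a = x" "b \<in> B" "sh s b = y" using sh_surj[OF shift(2)] xy by metis
    have "sh s (a * b * v) \<in> N" using xy ab by (simp add: sh_simps[OF shift(2)])
    then have "a * b * v \<in> N" using sh_inj[OF shift(2)] ab shift B(6) by blast
    then have "a * v \<in> N \<or> b * v \<in> N" using shift ab by (auto simp: prime_ann_def)
    then show ?thesis using N_stable(1)[OF shift(2)] ab by (fastforce simp: sh_simps[OF shift(2)])
  qed
  then have "prime_ann B N (sh s v)" by (auto simp: prime_ann_def)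
  then show ?case using shift sh_inj[OF shift(2)] B_stab(1)[OF shift(2)] by blast
qed

text \<open>By the product rule the square of \<open>dl d x * v\<close> lies in \<open>N\<close>,
  and the quotient is reduced.\<close>

lemma ann_deriv:
  assumes v: "v \<in> B" and x: "x \<in> B" "x * v \<in> N" and d: "d \<in> D"
  shows "dl d x * v \<in> N"
proof -
  have m: "dl d x \<in> B" "dl d v \<in> B" using B_stab(2)[OF d] v x by auto
  have 1: "(dl d x * v) * dl d (x * v) \<in> N" using N(4)[OF B(6)[OF m(1) v] N_stable(2)[OF d x(2)]] .
  have 2: "(dl d x * dl d v) * (x * v) \<in> N" using N(4)[OF B(6)[OF m] x(2)] .
  have "(dl d x * v) * (dl d x * v) = (dl d x * v) * dl d (x * v) - (dl d x * dl d v) * (x * v)"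
    by (simp add: dl_simps[OF d] algebra_simps)
  then have "(dl d x * v) * (dl d x * v) \<in> N" using N(7)[OF 1 2] by simp
  then show ?thesis using reduced[OF B(6)[OF m(1) v]] by blast
qed

text \<open>Finitely many prime annihilators with intersection zero modulo \<open>N\<close>.\<close>

definition separating :: "'r set \<Rightarrow> bool" where
  "separating F \<longleftrightarrow> finite F \<and> F \<subseteq> Orb \<and> (\<forall>x\<in>B. (\<forall>v\<in>F. x * v \<in> N) \<longrightarrow> x \<in> N)"

text \<open>Finiteness comes from simplicity. Call \<open>y\<close> controlled if whatever
  annihilates some finite part of the orbit also annihilates \<open>y\<close>. The controlled
  elements form an invariant ideal that contains \<open>N\<close> and \<open>u\<close>, hence 1, and
  a part that controls 1 is separating.\<close>

lemma separating_exists: "\<exists>F. separating F"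
proof -
  let ?P = "\<lambda>F y. finite F \<and> F \<subseteq> Orb \<and> (\<forall>x\<in>B. (\<forall>v\<in>F. x * v \<in> N) \<longrightarrow> x * y \<in> N)"
  let ?I = "{y \<in> B. \<exists>F. ?P F y}"
  have I1: "is_ideal B ?I"
    unfolding is_ideal_def
  proof (intro conjI ballI)
    show "0 \<in> ?I" using B(1) N(2) by (auto intro!: exI[of _ "{}"])
    show "y + z \<in> ?I" if yz: "y \<in> ?I" "z \<in> ?I" for y z
    proof -
      obtain F G where "?P F y" "?P G z" using yz by blast
      then have "?P (F \<union> G) (y + z)" using N(3) by (auto simp: distrib_left)
      then show ?thesis using yz B(4) by blast
    qed
    show "a * y \<in> ?I" if ay: "a \<in> B" "y \<in> ?I" for a y
    proof -
      obtain F where "?P F y" using ay by blast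
      then have "?P F (a * y)" using N(4)[OF ay(1)] by (auto simp: mult.left_commute[of _ a])
      then show ?thesis using ay B(6) by blast
    qed
  qed auto
  have I2: "stable ?I"
  proof (rule stableI)
    fix s y assume s: "s \<in> S" and y: "y \<in> ?I"
    obtain F where F: "?P F y" using y by blast
    have "x * sh s y \<in> N" if x: "x \<in> B" "\<forall>v\<in>sh s ` F. x * v \<in> N" for x
    proof -
      obtain a where a: "a \<in> B" "sh s a = x" using sh_surj[OF s x(1)] by blast
      have "a * v \<in> N" if "v \<in> F" for v
      proof (rule sh_inj[OF s])
        show "a * v \<in> B" using a F that Orb_props B(6) by blast
        show "sh s (a * v) \<in> N" using x(2) a that by (simp add: sh_simps[OF s])
      qed
      then have "a * y \<in> N" using F a by blast
      then show ?thesis using N_stable(1)[OF s] a by (fastforce simp: sh_simps[OF s])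
    qed
    then have "?P (sh s ` F) (sh s y)" using F Orb.shift[OF _ s] by blast
    then show "sh s y \<in> ?I" using B_stab(1)[OF s] y by blast
  next
    fix d y assume d: "d \<in> D" and y: "y \<in> ?I"
    obtain F where F: "?P F y" using y by blast
    have "x * dl d y \<in> N" if x: "x \<in> B" "\<forall>v\<in>F. x * v \<in> N" for x
    proof -
      have "dl d x * v \<in> N" if "v \<in> F" for v using ann_deriv[OF _ x(1) _ d] x(2) F Orb_props that by blast
      then have "dl d x * y \<in> N" using F B_stab(2)[OF d x(1)] by blast
      moreover have "dl d (x * y) \<in> N" using N_stable(2)[OF d] F x by blast
      moreover have "x * dl d y = dl d (x * y) - dl d x * y" by (simp add: dl_simps[OF d])
      ultimately show ?thesis using N(7) by simp
    qed
    then have "?P F (dl d y)" using F by blast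
    then show "dl d y \<in> ?I" using B_stab(2)[OF d] y by blast
  qed
  have I3: "N \<subseteq> ?I"
  proof
    fix y assume y: "y \<in> N"
    then have "?P {} y" using N(4) by blast
    then show "y \<in> ?I" using N(1)[OF y] by blast
  qed
  have uI: "u \<in> ?I" using u(1) Orb.base by (auto intro!: exI[of _ "{u}"])
  have "1 \<in> ?I"
  proof (rule ccontr)
    assume "1 \<notin> ?I"
    from max_stableD(4)[OF N_max I1 I2 I3 this] uI u(2) show False by simp
  qed
  then obtain F where "?P F 1" by blast
  then show ?thesis by (intro exI[of _ F]) (simp add: separating_def)
qed

definition Fam :: "'r set" where
  "Fam = (SOME F. separating F \<and> (\<forall>G. separating G \<longrightarrow> card F \<le> card G))"

lemma Fam: "separating Fam" "separating G \<Longrightarrow> card Fam \<le> card G"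
proof -
  obtain F where "separating F" using separating_exists by blast
  then have "\<exists>F. separating F \<and> (\<forall>G. separating G \<longrightarrow> card F \<le> card G)"
    using arg_min_nat_lemma[of separating F card] by blast
  then have "separating Fam \<and> (\<forall>G. separating G \<longrightarrow> card Fam \<le> card G)"
    unfolding Fam_def by (rule someI_ex)
  then show "separating Fam" "separating G \<Longrightarrow> card Fam \<le> card G" by blast+
qed

lemma Fam_finite: "finite Fam" and Fam_B: "v \<in> Fam \<Longrightarrow> v \<in> B" and Fam_N: "v \<in> Fam \<Longrightarrow> v \<notin> N"
  and Fam_prime: "v \<in> Fam \<Longrightarrow> x \<in> B \<Longrightarrow> y \<in> B \<Longrightarrow> x * y * v \<in> N \<Longrightarrow> x * v \<in> N \<or> y * v \<in> N"
  and Fam_sep: "x \<in> B \<Longrightarrow> (\<And>v. v \<in> Fam \<Longrightarrow> x * v \<in> N) \<Longrightarrow> x \<in> N"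
  using Fam(1) Orb_props unfolding separating_def prime_ann_def by blast+

text \<open>If \<open>v * w\<close> were outside \<open>N\<close>, primality would put the
  annihilator of \<open>v\<close> inside that of \<open>w\<close>, and \<open>w\<close> could be
  dropped from the family.\<close>

lemma Fam_orth:
  assumes v: "v \<in> Fam" "w \<in> Fam" "v \<noteq> w"
  shows "v * w \<in> N"
proof (rule ccontr)
  assume no: "v * w \<notin> N"
  have sub: "x * w \<in> N" if x: "x \<in> B" "x * v \<in> N" for x
    using Fam_prime[OF v(2) x(1) Fam_B[OF v(1)]] N(5)[OF Fam_B[OF v(2)] x(2)] no by blast
  have "separating (Fam - {w})"
    unfolding separating_def
  proof (intro conjI ballI impI)
    show "finite (Fam - {w})" "Fam - {w} \<subseteq> Orb" using Fam(1) by (auto simp: separating_def)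
    fix x assume x: "x \<in> B" "\<forall>v\<in>Fam - {w}. x * v \<in> N"
    have "x * v' \<in> N" if "v' \<in> Fam" for v'
      using x v sub[OF x(1)] that by (cases "v' = w") auto
    then show "x \<in> N" using Fam_sep[OF x(1)] by blast
  qed
  from Fam(2)[OF this] card_Diff1_less[OF Fam_finite v(2)] show False by simp
qed

lemma Fam_sum:
  assumes "G \<subseteq> Fam" "v \<in> Fam"
  shows "(\<Sum>w\<in>G. w) * v - (if v \<in> G then v * v else 0) \<in> N"
proof -
  have fG: "finite G" using assms Fam_finite by (rule_tac finite_subset)
  have "(\<Sum>w\<in>G - {v}. w * v) \<in> N"
    using Fam_orth assms by (intro is_ideal_sum[OF N_ideal]) auto
  then show ?thesis
    using fG by (auto simp: sum_distrib_right sum.remove[of G v "\<lambda>w. w * v"])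
qed

lemma Fam_square: "v \<in> Fam \<Longrightarrow> v * v \<notin> N"
  using reduced Fam_B Fam_N by blast

definition Reg :: "'r set" where
  "Reg = {t \<in> B. \<forall>x\<in>B. x * t \<in> N \<longrightarrow> x \<in> N}"

lemma RegD: "t \<in> Reg \<Longrightarrow> t \<in> B" "t \<in> Reg \<Longrightarrow> x \<in> B \<Longrightarrow> x * t \<in> N \<Longrightarrow> x \<in> N"
  by (auto simp: Reg_def)

lemma RegI: "t \<in> B \<Longrightarrow> (\<And>x. x \<in> B \<Longrightarrow> x * t \<in> N \<Longrightarrow> x \<in> N) \<Longrightarrow> t \<in> Reg"
  by (auto simp: Reg_def)

lemma Reg_1: "1 \<in> Reg"
  using B(2) by (simp add: Reg_def)

lemma Reg_mult: "s \<in> Reg \<Longrightarrow> t \<in> Reg \<Longrightarrow> s * t \<in> Reg"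
proof -
  assume st: "s \<in> Reg" "t \<in> Reg"
  have stB: "s \<in> B" "t \<in> B" using st RegD(1) by auto
  show "s * t \<in> Reg"
  proof (rule RegI)
    show "s * t \<in> B" using B(6)[OF stB] .
    show "x \<in> N" if x: "x \<in> B" "x * (s * t) \<in> N" for x
      using RegD(2)[OF st(1) x(1)] RegD(2)[OF st(2) B(6)[OF x(1) stB(1)]] x(2) by (simp add: mult.assoc)
  qed
qed

lemma Reg_sh: "s \<in> S \<Longrightarrow> t \<in> Reg \<Longrightarrow> sh s t \<in> Reg"
proof -
  assume s: "s \<in> S" and t: "t \<in> Reg"
  have "x \<in> N" if x: "x \<in> B" "x * sh s t \<in> N" for x
  proof -
    obtain a where a: "a \<in> B" "sh s a = x" using sh_surj[OF s x(1)] by blast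
    then have "sh s (a * t) \<in> N" using x by (simp add: sh_simps[OF s])
    then have "a \<in> N" using sh_inj[OF s] RegD[OF t] a B(6) by blast
    then show ?thesis using N_stable(1)[OF s] a by blast
  qed
  then show ?thesis using B_stab(1)[OF s RegD(1)[OF t]] by (intro RegI)
qed

lemma Reg_not_N: "t \<in> Reg \<Longrightarrow> t \<notin> N"
  using RegD(2)[of t 1] B(2) max_stableD(3)[OF N_max] by auto

text \<open>In the ring of fractions the elements \<open>v / total\<close> are orthogonal
  idempotents with sum 1.\<close>

abbreviation total :: 'r where "total \<equiv> (\<Sum>w\<in>Fam. w)"

lemma total_B: "G \<subseteq> Fam \<Longrightarrow> (\<Sum>w\<in>G. w) \<in> B"
  using Fam_B by (intro is_subring_sum[OF B_sub]) auto

lemma total_mult: "v \<in> Fam \<Longrightarrow> total * v - v * v \<in> N"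
  using Fam_sum[of Fam v] by simp

text \<open>By orthogonality, multiplying by \<open>v\<close> turns the sum into
  \<open>v * v\<close>; primality then removes the extra factor \<open>v\<close>.\<close>

lemma total_Reg: "total \<in> Reg"
proof -
  have "x \<in> N" if x: "x \<in> B" "x * total \<in> N" for x
  proof (rule Fam_sep[OF x(1)])
    fix v assume v: "v \<in> Fam"
    have "x * total * v - x * (total * v - v * v) \<in> N"
      using N(7)[OF N(5)[OF Fam_B[OF v] x(2)] N(4)[OF x(1) total_mult[OF v]]] .
    then have "x * v * v \<in> N" by (simp add: algebra_simps)
    then show "x * v \<in> N" using Fam_prime[OF v x(1) Fam_B[OF v]] Fam_square[OF v] by (auto simp: mult.assoc)
  qed
  then show ?thesis using total_B by (intro RegI) auto
qed

text \<open>In the ring of fractions this makes the idempotent with numerator v and denominator total a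
  multiple of r whenever the product of r and v is nonzero.\<close>

lemma Reg_component:
  assumes v: "v \<in> Fam" and r: "r \<in> B" "r * v \<notin> N"
  shows "r * v + (total - v) \<in> Reg" "v * (r * v + (total - v)) - r * (v * v) \<in> N"
proof -
  let ?t = "r * v + (total - v)"
  note vB = Fam_B[OF v]
  have tv: "v * (total - v) \<in> N" using total_mult[OF v] by (simp add: algebra_simps)
  show 2: "v * ?t - r * (v * v) \<in> N" using tv by (simp add: algebra_simps)
  have "x \<in> N" if x: "x \<in> B" "x * ?t \<in> N" for x
  proof (rule Fam_sep[OF x(1)])
    fix w assume w: "w \<in> Fam"
    note wB = Fam_B[OF w]
    show "x * w \<in> N"
    \<comment> \<open>On the component of \<open>v\<close> the element \<open>?t\<close> acts as
      \<open>r * v\<close>, on every other component as \<open>total\<close>.\<close>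
    proof (cases "w = v")
      case True
      have "x * ?t * v - x * (v * ?t - r * (v * v)) \<in> N"
        using N(7)[OF N(5)[OF vB x(2)] N(4)[OF x(1) 2]] .
      then have "(x * r) * v * v \<in> N" by (simp add: algebra_simps)
      then have "x * r * v \<in> N"
        using Fam_prime[OF v B(6)[OF x(1) r(1)] vB] Fam_square[OF v] by (auto simp: mult.assoc)
      then show ?thesis using Fam_prime[OF v x(1) r(1)] r(2) True by blast
    next
      case False
      have "(x * r - x) * (v * w) \<in> N" using N(4)[OF B(5)[OF B(6)[OF x(1) r(1)] x(1)] Fam_orth[OF v w]] False by blast
      moreover have "x * (total * w - w * w) \<in> N" using N(4)[OF x(1) total_mult[OF w]] .
      ultimately have "x * ?t * w - ((x * r - x) * (v * w) + x * (total * w - w * w)) \<in> N"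
        using N(7)[OF N(5)[OF wB x(2)] N(3)] by blast
      then have "x * w * w \<in> N" by (simp add: algebra_simps)
      then show ?thesis using Fam_prime[OF w x(1) wB] Fam_square[OF w] by (auto simp: mult.assoc)
    qed
  qed
  moreover have "?t \<in> B" using B(4)[OF B(6)[OF r(1) vB] B(5)[OF total_B[OF order.refl] vB]] .
  ultimately show "?t \<in> Reg" by (intro RegI)
qed

end

text \<open>The code \<open>q (a, s)\<close> stands for the fraction \<open>a / s\<close> modulo \<open>N\<close>; only codes in the given type \<open>'a\<close> are
  available, since the extension must live in the type of \<open>K\<close>.\<close>

locale frac_ring = const_ring S D sh dl \<iota> shk dlk B N par u
  for S :: "'s set" and D :: "'d set"
    and sh :: "'s \<Rightarrow> 'r::comm_ring_1 \<Rightarrow> 'r" and dl :: "'d \<Rightarrow> 'r \<Rightarrow> 'r"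
    and \<iota> :: "'k::field_char_0 \<Rightarrow> 'r" and shk :: "'s \<Rightarrow> 'k \<Rightarrow> 'k" and dlk :: "'d \<Rightarrow> 'k \<Rightarrow> 'k"
    and B N :: "'r set" and par :: "'r \<Rightarrow> 'r" and u :: 'r +
  fixes q :: "'r \<times> 'r \<Rightarrow> 'a"
  assumes q_eq: "a \<in> B \<Longrightarrow> s \<in> Reg \<Longrightarrow> b \<in> B \<Longrightarrow> t \<in> Reg \<Longrightarrow> q (a, s) = q (b, t) \<longleftrightarrow> a * t - b * s \<in> N"
begin

definition Lc :: "'a set" where
  "Lc = q ` (B \<times> Reg)"

text \<open>A chosen numerator and denominator; each operation is then shown to be independent of
  the choice.\<close>

definition fr :: "'a \<Rightarrow> 'r \<times> 'r" where
  "fr z = (SOME p. p \<in> B \<times> Reg \<and> q p = z)"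

definition frac_op :: "('r \<Rightarrow> 'r \<Rightarrow> 'r \<times> 'r) \<Rightarrow> 'a \<Rightarrow> 'a" where
  "frac_op f z = (case fr z of (a, s) \<Rightarrow> q (f a s))"

definition frac_deriv :: "('r \<Rightarrow> 'r) \<Rightarrow> 'a \<Rightarrow> 'a" where
  "frac_deriv d = frac_op (\<lambda>a s. (d a * s - a * d s, s * s))"

definition Lr :: "('a, 's, 'd) sdp_struct" where
  "Lr = \<lparr>carrier = Lc,
    monoid.mult = (\<lambda>y z. case fr y of (a, s) \<Rightarrow> case fr z of (b, t) \<Rightarrow> q (a * b, s * t)),
    one = q (1, 1), zero = q (0, 1),
    add = (\<lambda>y z. case fr y of (a, s) \<Rightarrow> case fr z of (b, t) \<Rightarrow> q (a * t + b * s, s * t)),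
    shift = (\<lambda>s. frac_op (\<lambda>a t. (sh s a, sh s t))),
    deltad = (\<lambda>d. frac_deriv (dl d)), pard = frac_deriv par\<rparr>"

lemma q_Lc: "a \<in> B \<Longrightarrow> s \<in> Reg \<Longrightarrow> q (a, s) \<in> Lc"
  by (auto simp: Lc_def)

lemma Lc_cases:
  assumes "z \<in> Lc"
  obtains a s where "a \<in> B" "s \<in> Reg" "z = q (a, s)"
  using assms by (auto simp: Lc_def)

lemma q_eqI: "a \<in> B \<Longrightarrow> s \<in> Reg \<Longrightarrow> b \<in> B \<Longrightarrow> t \<in> Reg \<Longrightarrow> a * t = b * s \<Longrightarrow> q (a, s) = q (b, t)"
  using q_eq N(2) by simp

lemma fr: "a \<in> B \<Longrightarrow> s \<in> Reg \<Longrightarrow> \<exists>b t. fr (q (a, s)) = (b, t) \<and> b \<in> B \<and> t \<in> Reg \<and> b * s - a * t \<in> N"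
proof -
  assume as: "a \<in> B" "s \<in> Reg"
  obtain b t where bt: "fr (q (a, s)) = (b, t)" by (cases "fr (q (a, s))")
  have "fr (q (a, s)) \<in> B \<times> Reg \<and> q (fr (q (a, s))) = q (a, s)"
    unfolding fr_def by (rule someI[of _ "(a, s)"]) (use as in auto)
  then show ?thesis using bt as q_eq by auto
qed

lemma Lr_mult:
  assumes "a \<in> B" "s \<in> Reg" "b \<in> B" "t \<in> Reg"
  shows "q (a, s) \<otimes>\<^bsub>Lr\<^esub> q (b, t) = q (a * b, s * t)"
proof -
  obtain a' s' where a': "fr (q (a, s)) = (a', s')" "a' \<in> B" "s' \<in> Reg" "a' * s - a * s' \<in> N"
    using fr[OF assms(1,2)] by blast
  obtain b' t' where b': "fr (q (b, t)) = (b', t')" "b' \<in> B" "t' \<in> Reg" "b' * t - b * t' \<in> N"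
    using fr[OF assms(3,4)] by blast
  note R = RegD(1)[OF assms(2)] RegD(1)[OF assms(4)] RegD(1)[OF a'(3)] RegD(1)[OF b'(3)]
  have "(b' * t) * (a' * s - a * s') \<in> N" using N(4)[OF B(6)[OF b'(2) R(2)] a'(4)] .
  moreover have "(a * s') * (b' * t - b * t') \<in> N" using N(4)[OF B(6)[OF assms(1) R(3)] b'(4)] .
  ultimately have "(b' * t) * (a' * s - a * s') + (a * s') * (b' * t - b * t') \<in> N" by (rule N(3))
  then have "a' * b' * (s * t) - a * b * (s' * t') \<in> N" by (simp add: algebra_simps)
  then have "q (a' * b', s' * t') = q (a * b, s * t)"
    using q_eq[OF B(6)[OF a'(2) b'(2)] Reg_mult[OF a'(3) b'(3)] B(6)[OF assms(1,3)] Reg_mult[OF assms(2,4)]] by simp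
  then show ?thesis using a' b' by (simp add: Lr_def)
qed

lemma Lr_add:
  assumes "a \<in> B" "s \<in> Reg" "b \<in> B" "t \<in> Reg"
  shows "q (a, s) \<oplus>\<^bsub>Lr\<^esub> q (b, t) = q (a * t + b * s, s * t)"
proof -
  obtain a' s' where a': "fr (q (a, s)) = (a', s')" "a' \<in> B" "s' \<in> Reg" "a' * s - a * s' \<in> N"
    using fr[OF assms(1,2)] by blast
  obtain b' t' where b': "fr (q (b, t)) = (b', t')" "b' \<in> B" "t' \<in> Reg" "b' * t - b * t' \<in> N"
    using fr[OF assms(3,4)] by blast
  note R = RegD(1)[OF assms(2)] RegD(1)[OF assms(4)] RegD(1)[OF a'(3)] RegD(1)[OF b'(3)]
  have "(t * t') * (a' * s - a * s') \<in> N" using N(4)[OF B(6)[OF R(2,4)] a'(4)] .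
  moreover have "(s * s') * (b' * t - b * t') \<in> N" using N(4)[OF B(6)[OF R(1,3)] b'(4)] .
  ultimately have "(t * t') * (a' * s - a * s') + (s * s') * (b' * t - b * t') \<in> N" by (rule N(3))
  then have "(a' * t' + b' * s') * (s * t) - (a * t + b * s) * (s' * t') \<in> N" by (simp add: algebra_simps)
  then have "q (a' * t' + b' * s', s' * t') = q (a * t + b * s, s * t)"
    using q_eq[OF B(4)[OF B(6)[OF a'(2) R(4)] B(6)[OF b'(2) R(3)]] Reg_mult[OF a'(3) b'(3)]
        B(4)[OF B(6)[OF assms(1) R(2)] B(6)[OF assms(3) R(1)]] Reg_mult[OF assms(2,4)]] by simp
  then show ?thesis using a' b' by (simp add: Lr_def)
qed

lemma Lr_shift:
  assumes s: "s \<in> S" and a: "a \<in> B" "t \<in> Reg"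
  shows "shift Lr s (q (a, t)) = q (sh s a, sh s t)"
proof -
  obtain b r where b: "fr (q (a, t)) = (b, r)" "b \<in> B" "r \<in> Reg" "b * t - a * r \<in> N" using fr[OF a] by blast
  have "sh s (b * t - a * r) \<in> N" using N_stable(1)[OF s b(4)] .
  then have "q (sh s b, sh s r) = q (sh s a, sh s t)"
    using q_eq[OF B_stab(1)[OF s b(2)] Reg_sh[OF s b(3)] B_stab(1)[OF s a(1)] Reg_sh[OF s a(2)]]
    by (simp add: sh_simps[OF s])
  then show ?thesis using b by (simp add: Lr_def frac_op_def)
qed

lemma frac_deriv:
  assumes d: "is_deriv d" "\<And>x. x \<in> B \<Longrightarrow> d x \<in> B" "\<And>x. x \<in> N \<Longrightarrow> d x \<in> N" and a: "a \<in> B" "s \<in> Reg"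
  shows "frac_deriv d (q (a, s)) = q (d a * s - a * d s, s * s)"
proof -
  obtain b t where b: "fr (q (a, s)) = (b, t)" "b \<in> B" "t \<in> Reg" "b * s - a * t \<in> N" using fr[OF a] by blast
  note R = RegD(1)[OF a(2)] RegD(1)[OF b(3)]
  have mem: "d x * t - x * d t \<in> B" if "x \<in> B" "t \<in> Reg" for x t
    using B(5)[OF B(6)[OF d(2)[OF that(1)] RegD(1)[OF that(2)]] B(6)[OF that(1) d(2)[OF RegD(1)[OF that(2)]]]] .
  \<comment> \<open>The derivative of the congruence between the two fractions, corrected by a
    multiple of the congruence itself, is the difference of the two quotient rules.\<close>
  have "(s * t) * d (b * s - a * t) \<in> N" using N(4)[OF B(6)[OF R] d(3)[OF b(4)]] .
  moreover have "(t * d s + s * d t) * (b * s - a * t) \<in> N"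
    using N(4)[OF B(4)[OF B(6)[OF R(2) d(2)[OF R(1)]] B(6)[OF R(1) d(2)[OF R(2)]]] b(4)] .
  ultimately have "(s * t) * d (b * s - a * t) - (t * d s + s * d t) * (b * s - a * t) \<in> N" by (rule N(7))
  then have "(d b * t - b * d t) * (s * s) - (d a * s - a * d s) * (t * t) \<in> N"
    by (simp add: is_derivD[OF d(1)] algebra_simps)
  then have "q (d b * t - b * d t, t * t) = q (d a * s - a * d s, s * s)"
    using q_eq[OF mem[OF b(2,3)] Reg_mult[OF b(3,3)] mem[OF a] Reg_mult[OF a(2,2)]] by simp
  then show ?thesis using b by (simp add: frac_deriv_def frac_op_def)
qed

lemma Lr_deltad: "d \<in> D \<Longrightarrow> a \<in> B \<Longrightarrow> s \<in> Reg \<Longrightarrow> deltad Lr d (q (a, s)) = q (dl d a * s - a * dl d s, s * s)"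
  using frac_deriv[OF dl_deriv B_stab(2) N_stable(2)] by (simp add: Lr_def)

lemma Lr_pard: "a \<in> B \<Longrightarrow> s \<in> Reg \<Longrightarrow> pard Lr (q (a, s)) = q (par a * s - a * par s, s * s)"
  using frac_deriv[OF par_deriv par_B par_N] by (simp add: Lr_def)

lemma Lr_simps: "carrier Lr = Lc" "one Lr = q (1, 1)" "zero Lr = q (0, 1)"
  by (simp_all add: Lr_def)

lemma frac_mem: "a \<in> B \<Longrightarrow> s \<in> Reg \<Longrightarrow> is_deriv d \<Longrightarrow> (\<And>x. x \<in> B \<Longrightarrow> d x \<in> B) \<Longrightarrow> d a * s - a * d s \<in> B"
  using RegD(1) B(5,6) by blast

lemma zero_iff: "a \<in> B \<Longrightarrow> s \<in> Reg \<Longrightarrow> q (a, s) = q (0, 1) \<longleftrightarrow> a \<in> N"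
  using q_eq[of a s 0 1] B(1) Reg_1 by simp

lemma Lr_cring: "cring Lr"
proof (rule cringI)
  show "abelian_group Lr"
  proof (rule abelian_groupI)
    fix x y assume "x \<in> carrier Lr" "y \<in> carrier Lr"
    then show "x \<oplus>\<^bsub>Lr\<^esub> y \<in> carrier Lr"
      unfolding Lr_simps by (elim Lc_cases) (simp add: Lr_add q_Lc B(4,6) RegD(1) Reg_mult)
  next
    show "\<zero>\<^bsub>Lr\<^esub> \<in> carrier Lr" unfolding Lr_simps by (intro q_Lc B(1) Reg_1)
  next
    fix x y z assume "x \<in> carrier Lr" "y \<in> carrier Lr" "z \<in> carrier Lr"
    then obtain a s b t c r where abc: "a \<in> B" "s \<in> Reg" "x = q (a, s)" "b \<in> B" "t \<in> Reg" "y = q (b, t)"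
      "c \<in> B" "r \<in> Reg" "z = q (c, r)" unfolding Lr_simps by (metis Lc_cases)
    have R: "s \<in> B" "t \<in> B" "r \<in> B" using abc RegD(1) by auto
    show "(x \<oplus>\<^bsub>Lr\<^esub> y) \<oplus>\<^bsub>Lr\<^esub> z = x \<oplus>\<^bsub>Lr\<^esub> (y \<oplus>\<^bsub>Lr\<^esub> z)"
      using abc R by (simp add: Lr_add B(4,6) Reg_mult) (simp add: algebra_simps)
  next
    fix x y assume "x \<in> carrier Lr" "y \<in> carrier Lr"
    then show "x \<oplus>\<^bsub>Lr\<^esub> y = y \<oplus>\<^bsub>Lr\<^esub> x"
      unfolding Lr_simps by (elim Lc_cases) (simp add: Lr_add, simp add: algebra_simps)
  next
    fix x assume "x \<in> carrier Lr"
    then obtain a s where a: "a \<in> B" "s \<in> Reg" "x = q (a, s)" unfolding Lr_simps by (elim Lc_cases)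
    show "\<zero>\<^bsub>Lr\<^esub> \<oplus>\<^bsub>Lr\<^esub> x = x" using a by (simp add: Lr_simps Lr_add B(1) Reg_1)
    have "q (- a, s) \<oplus>\<^bsub>Lr\<^esub> q (a, s) = q (0, 1)"
      using a RegD(1)[OF a(2)] N(2) by (simp add: Lr_add B(3) zero_iff B(1) Reg_mult)
    then show "\<exists>y\<in>carrier Lr. y \<oplus>\<^bsub>Lr\<^esub> x = \<zero>\<^bsub>Lr\<^esub>"
      using a B(3) by (intro bexI[of _ "q (- a, s)"]) (auto simp: Lr_simps q_Lc)
  qed
next
  show "comm_monoid Lr"
  proof (rule comm_monoidI)
    fix x y assume "x \<in> carrier Lr" "y \<in> carrier Lr"
    then show "x \<otimes>\<^bsub>Lr\<^esub> y \<in> carrier Lr"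
      unfolding Lr_simps by (elim Lc_cases) (simp add: Lr_mult q_Lc B(6) Reg_mult)
  next
    show "\<one>\<^bsub>Lr\<^esub> \<in> carrier Lr" unfolding Lr_simps by (intro q_Lc B(2) Reg_1)
  next
    fix x y z assume "x \<in> carrier Lr" "y \<in> carrier Lr" "z \<in> carrier Lr"
    then obtain a s b t c r where abc: "a \<in> B" "s \<in> Reg" "x = q (a, s)" "b \<in> B" "t \<in> Reg" "y = q (b, t)"
      "c \<in> B" "r \<in> Reg" "z = q (c, r)" unfolding Lr_simps by (metis Lc_cases)
    show "x \<otimes>\<^bsub>Lr\<^esub> y \<otimes>\<^bsub>Lr\<^esub> z = x \<otimes>\<^bsub>Lr\<^esub> (y \<otimes>\<^bsub>Lr\<^esub> z)"
      using abc by (simp add: Lr_mult B(6) Reg_mult mult.assoc)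
  next
    fix x assume "x \<in> carrier Lr"
    then obtain a s where a: "a \<in> B" "s \<in> Reg" "x = q (a, s)" unfolding Lr_simps by (elim Lc_cases)
    show "\<one>\<^bsub>Lr\<^esub> \<otimes>\<^bsub>Lr\<^esub> x = x" using a by (simp add: Lr_simps Lr_mult B(2) Reg_1)
  next
    fix x y assume "x \<in> carrier Lr" "y \<in> carrier Lr"
    then show "x \<otimes>\<^bsub>Lr\<^esub> y = y \<otimes>\<^bsub>Lr\<^esub> x"
      unfolding Lr_simps by (elim Lc_cases) (simp add: Lr_mult mult.commute)
  qed
next
  fix x y z assume "x \<in> carrier Lr" "y \<in> carrier Lr" "z \<in> carrier Lr"
  then obtain a s b t c r where abc: "a \<in> B" "s \<in> Reg" "x = q (a, s)" "b \<in> B" "t \<in> Reg" "y = q (b, t)"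
    "c \<in> B" "r \<in> Reg" "z = q (c, r)" unfolding Lr_simps by (metis Lc_cases)
  have R: "s \<in> B" "t \<in> B" "r \<in> B" using abc RegD(1) by auto
  have "q ((a * t + b * s) * c, s * t * r) = q (a * c * (t * r) + b * c * (s * r), s * r * (t * r))"
    using abc R by (intro q_eqI B(4,6) Reg_mult) (simp_all add: algebra_simps)
  then show "(x \<oplus>\<^bsub>Lr\<^esub> y) \<otimes>\<^bsub>Lr\<^esub> z = x \<otimes>\<^bsub>Lr\<^esub> z \<oplus>\<^bsub>Lr\<^esub> y \<otimes>\<^bsub>Lr\<^esub> z"
    using abc R by (simp add: Lr_add Lr_mult B(4,6) Reg_mult)
qed

lemma q_cancel: "a \<in> B \<Longrightarrow> s \<in> Reg \<Longrightarrow> t \<in> Reg \<Longrightarrow> q (a * t, s * t) = q (a, s)"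
  by (intro q_eqI B(6) Reg_mult) (auto simp: RegD(1) algebra_simps)

lemma derivation_frac:
  assumes d: "is_deriv d" "\<And>x. x \<in> B \<Longrightarrow> d x \<in> B"
    and D: "\<And>a s. a \<in> B \<Longrightarrow> s \<in> Reg \<Longrightarrow> f (q (a, s)) = q (d a * s - a * d s, s * s)"
  shows "derivation Lr f"
  unfolding derivation_def Lr_simps
proof (intro conjI ballI)
  show "f \<in> Lc \<rightarrow> Lc"
    using D frac_mem[OF _ _ d] by (auto simp: Lc_def intro!: q_Lc[unfolded Lc_def] Reg_mult)
  fix x y assume "x \<in> Lc" "y \<in> Lc"
  then obtain a s b t where abc: "a \<in> B" "s \<in> Reg" "x = q (a, s)" "b \<in> B" "t \<in> Reg" "y = q (b, t)"
    by (metis Lc_cases)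
  note R = RegD(1)[OF abc(2)] RegD(1)[OF abc(5)]
  note m = frac_mem[OF _ _ d]
  have ab: "a * t + b * s \<in> B" "a * b \<in> B" using abc R B(4,6) by auto
  have st: "s * t \<in> Reg" "s * s \<in> Reg" "t * t \<in> Reg" using abc Reg_mult by auto
  have dm: "d a * s - a * d s \<in> B" "d b * t - b * d t \<in> B" "d (a * t + b * s) * (s * t) - (a * t + b * s) * d (s * t) \<in> B"
    "d (a * b) * (s * t) - a * b * d (s * t) \<in> B"
    using m abc ab st by auto
  have fx: "f x = q (d a * s - a * d s, s * s)" and fy: "f y = q (d b * t - b * d t, t * t)"
    unfolding abc(3,6) by (rule D[OF abc(1,2)], rule D[OF abc(4,5)])
  have "f (x \<oplus>\<^bsub>Lr\<^esub> y) = q (d (a * t + b * s) * (s * t) - (a * t + b * s) * d (s * t), s * t * (s * t))"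
    unfolding abc(3,6) Lr_add[OF abc(1,2,4,5)] by (rule D[OF ab(1) st(1)])
  also have "\<dots> = q ((d a * s - a * d s) * (t * t) + (d b * t - b * d t) * (s * s), s * s * (t * t))"
  proof (rule q_eqI[OF dm(3) Reg_mult[OF st(1,1)] _ Reg_mult[OF st(2,3)]])
    show "(d a * s - a * d s) * (t * t) + (d b * t - b * d t) * (s * s) \<in> B" by (intro B(4,6) dm(1,2) R)
  qed (simp add: is_derivD[OF d(1)] algebra_simps)
  also have "\<dots> = f x \<oplus>\<^bsub>Lr\<^esub> f y" unfolding fx fy by (rule Lr_add[OF dm(1) st(2) dm(2) st(3), symmetric])
  finally show "f (x \<oplus>\<^bsub>Lr\<^esub> y) = f x \<oplus>\<^bsub>Lr\<^esub> f y" .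
  have "f (x \<otimes>\<^bsub>Lr\<^esub> y) = q (d (a * b) * (s * t) - a * b * d (s * t), s * t * (s * t))"
    unfolding abc(3,6) Lr_mult[OF abc(1,2,4,5)] by (rule D[OF ab(2) st(1)])
  also have "\<dots> = q ((d a * s - a * d s) * b * (s * (t * t)) + a * (d b * t - b * d t) * (s * s * t), s * s * t * (s * (t * t)))"
  proof (rule q_eqI[OF dm(4) Reg_mult[OF st(1,1)] _ Reg_mult[OF Reg_mult[OF st(2) abc(5)] Reg_mult[OF abc(2) st(3)]]])
    show "(d a * s - a * d s) * b * (s * (t * t)) + a * (d b * t - b * d t) * (s * s * t) \<in> B"
      by (intro B(4,6) dm(1,2) R abc(1,4))
  qed (simp add: is_derivD[OF d(1)] algebra_simps)
  also have "\<dots> = q ((d a * s - a * d s) * b, s * s * t) \<oplus>\<^bsub>Lr\<^esub> q (a * (d b * t - b * d t), s * (t * t))"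
    by (rule Lr_add[symmetric]; intro B(6) Reg_mult dm(1,2) abc(1,2,4,5))
  also have "\<dots> = (f x \<otimes>\<^bsub>Lr\<^esub> y) \<oplus>\<^bsub>Lr\<^esub> (x \<otimes>\<^bsub>Lr\<^esub> f y)"
    unfolding fx fy unfolding abc(3,6) Lr_mult[OF dm(1) st(2) abc(4,5)] Lr_mult[OF abc(1,2) dm(2) st(3)] ..
  finally show "f (x \<otimes>\<^bsub>Lr\<^esub> y) = (f x \<otimes>\<^bsub>Lr\<^esub> y) \<oplus>\<^bsub>Lr\<^esub> (x \<otimes>\<^bsub>Lr\<^esub> f y)" .
qed

text \<open>Two applications of the quotient rule give an expression that is symmetric in the two
  derivations.\<close>

lemma frac_commute:
  assumes d: "is_deriv d" "\<And>x. x \<in> B \<Longrightarrow> d x \<in> B" and e: "is_deriv e" "\<And>x. x \<in> B \<Longrightarrow> e x \<in> B"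
    and de: "\<And>x. d (e x) = e (d x)"
    and fd: "\<And>a s. a \<in> B \<Longrightarrow> s \<in> Reg \<Longrightarrow> f (q (a, s)) = q (d a * s - a * d s, s * s)"
    and fe: "\<And>a s. a \<in> B \<Longrightarrow> s \<in> Reg \<Longrightarrow> g (q (a, s)) = q (e a * s - a * e s, s * s)"
    and z: "z \<in> Lc"
  shows "f (g z) = g (f z)"
proof -
  obtain a s where a: "a \<in> B" "s \<in> Reg" "z = q (a, s)" using Lc_cases[OF z] by metis
  have "f (g z) = q (d (e a * s - a * e s) * (s * s) - (e a * s - a * e s) * d (s * s), s * s * (s * s))"
    using a frac_mem[OF a(1,2) e] by (simp add: fd fe Reg_mult)
  also have "d (e a * s - a * e s) * (s * s) - (e a * s - a * e s) * d (s * s) =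
      e (d a * s - a * d s) * (s * s) - (d a * s - a * d s) * e (s * s)"
    by (simp add: is_derivD[OF d(1)] is_derivD[OF e(1)] de algebra_simps)
  also have "q (e (d a * s - a * d s) * (s * s) - (d a * s - a * d s) * e (s * s), s * s * (s * s)) = g (f z)"
    using a frac_mem[OF a(1,2) d] by (simp add: fd fe Reg_mult)
  finally show ?thesis .
qed

lemma Lr_sdp: "sdp_ring S D Lr"
proof -
  interpret L: cring Lr by (rule Lr_cring)
  show ?thesis
  proof unfold_locales
    fix s assume s: "s \<in> S"
    show "shift Lr s \<in> ring_iso Lr Lr"
      unfolding ring_iso_def
    proof (intro CollectI conjI)
      show "shift Lr s \<in> Ring.ring_hom Lr Lr"
      proof (rule ring_hom_memI)
        fix x y assume "x \<in> carrier Lr" "y \<in> carrier Lr"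
        then obtain a t b r where abc: "a \<in> B" "t \<in> Reg" "x = q (a, t)" "b \<in> B" "r \<in> Reg" "y = q (b, r)"
          unfolding Lr_simps by (metis Lc_cases)
        note R = RegD(1)[OF abc(2)] RegD(1)[OF abc(5)]
        show "shift Lr s x \<in> carrier Lr"
          using abc by (simp add: Lr_simps Lr_shift[OF s] q_Lc B_stab(1)[OF s] Reg_sh[OF s])
        show "shift Lr s (x \<otimes>\<^bsub>Lr\<^esub> y) = shift Lr s x \<otimes>\<^bsub>Lr\<^esub> shift Lr s y"
          using abc by (simp add: Lr_mult Lr_shift[OF s] B_stab(1)[OF s] Reg_sh[OF s] B(6) Reg_mult sh_simps[OF s])
        show "shift Lr s (x \<oplus>\<^bsub>Lr\<^esub> y) = shift Lr s x \<oplus>\<^bsub>Lr\<^esub> shift Lr s y"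
          using abc R by (simp add: Lr_add Lr_shift[OF s] B_stab(1)[OF s] Reg_sh[OF s] B(4,6) Reg_mult sh_simps[OF s])
      next
        show "shift Lr s \<one>\<^bsub>Lr\<^esub> = \<one>\<^bsub>Lr\<^esub>"
          by (simp add: Lr_simps Lr_shift[OF s] B(2) Reg_1 sh_simps[OF s])
      qed
      show "bij_betw (shift Lr s) (carrier Lr) (carrier Lr)"
        unfolding bij_betw_def Lr_simps
      proof
        show "inj_on (shift Lr s) Lc"
        proof (rule inj_onI)
          fix x y assume "x \<in> Lc" "y \<in> Lc" and eq: "shift Lr s x = shift Lr s y"
          then obtain a t b r where abc: "a \<in> B" "t \<in> Reg" "x = q (a, t)" "b \<in> B" "r \<in> Reg" "y = q (b, r)"
            by (metis Lc_cases)
          have "q (sh s a, sh s t) = q (sh s b, sh s r)" using eq abc by (simp add: Lr_shift[OF s])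
          then have N: "sh s (a * r - b * t) \<in> N"
            using q_eq[OF B_stab(1)[OF s abc(1)] Reg_sh[OF s abc(2)] B_stab(1)[OF s abc(4)] Reg_sh[OF s abc(5)]]
            by (simp add: sh_simps[OF s])
          have "a * r - b * t \<in> N"
            by (rule sh_inj[OF s _ N]) (intro B(5,6) abc(1,4) RegD(1)[OF abc(2)] RegD(1)[OF abc(5)])
          then show "x = y" unfolding abc(3,6) using q_eq[OF abc(1,2,4,5)] by blast
        qed
        show "shift Lr s ` Lc = Lc"
        proof
          show "shift Lr s ` Lc \<subseteq> Lc"
            by (auto elim!: Lc_cases simp: Lr_shift[OF s] q_Lc B_stab(1)[OF s] Reg_sh[OF s])
          show "Lc \<subseteq> shift Lr s ` Lc"
          proof
            fix x assume "x \<in> Lc"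
            then obtain a t where at: "a \<in> B" "t \<in> Reg" "x = q (a, t)" by (metis Lc_cases)
            obtain b r where b: "b \<in> B" "sh s b = a" "r \<in> B" "sh s r = t"
              using sh_surj[OF s at(1)] sh_surj[OF s RegD(1)[OF at(2)]] by blast
            \<comment> \<open>Preimages of regular elements are regular, so the preimages of
              numerator and denominator form a fraction.\<close>
            have "r \<in> Reg"
            proof (rule RegI[OF b(3)])
              fix y assume y: "y \<in> B" "y * r \<in> N"
              have "sh s y * t \<in> N" using N_stable(1)[OF s y(2)] b(4) by (simp add: sh_simps[OF s])
              then have "sh s y \<in> N" using RegD(2)[OF at(2)] B_stab(1)[OF s y(1)] by blast
              then show "y \<in> N" using sh_inj[OF s y(1)] by blast
            qed
            then show "x \<in> shift Lr s ` Lc"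
              using b at by (intro image_eqI[of _ _ "q (b, r)"]) (simp_all add: Lr_shift[OF s] q_Lc)
          qed
        qed
      qed
    qed
  next
    fix d assume "d \<in> D"
    then show "derivation Lr (deltad Lr d)"
      using derivation_frac[OF dl_deriv B_stab(2) Lr_deltad] by blast
  next
    show "derivation Lr (pard Lr)" using derivation_frac[OF par_deriv par_B Lr_pard] by blast
  next
    fix s t x assume s: "s \<in> S" "t \<in> S" and "x \<in> carrier Lr"
    then obtain a r where a: "a \<in> B" "r \<in> Reg" "x = q (a, r)" unfolding Lr_simps by (metis Lc_cases)
    show "shift Lr s (shift Lr t x) = shift Lr t (shift Lr s x)"
      using a s by (simp add: Lr_shift B_stab(1) Reg_sh sh_sh[of s t])
  next
    fix s d x assume s: "s \<in> S" "d \<in> D" and "x \<in> carrier Lr"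
    then obtain a r where a: "a \<in> B" "r \<in> Reg" "x = q (a, r)" unfolding Lr_simps by (metis Lc_cases)
    show "shift Lr s (deltad Lr d x) = deltad Lr d (shift Lr s x)"
      using a s frac_mem[OF a(1,2) dl_deriv[OF s(2)] B_stab(2)[OF s(2)]]
      by (simp add: Lr_shift Lr_deltad B_stab(1) Reg_sh Reg_mult sh_simps sh_dl)
  next
    fix s x assume s: "s \<in> S" and "x \<in> carrier Lr"
    then obtain a r where a: "a \<in> B" "r \<in> Reg" "x = q (a, r)" unfolding Lr_simps by (metis Lc_cases)
    show "shift Lr s (pard Lr x) = pard Lr (shift Lr s x)"
      using a s frac_mem[OF a(1,2) par_deriv par_B]
      by (simp add: Lr_shift Lr_pard B_stab(1) Reg_sh Reg_mult sh_simps sh_par)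
  next
    fix d e x assume d: "d \<in> D" "e \<in> D" and x: "x \<in> carrier Lr"
    show "deltad Lr d (deltad Lr e x) = deltad Lr e (deltad Lr d x)"
      by (rule frac_commute[OF dl_deriv[OF d(1)] B_stab(2)[OF d(1)] dl_deriv[OF d(2)] B_stab(2)[OF d(2)]
            dl_dl[OF d] Lr_deltad[OF d(1)] Lr_deltad[OF d(2)] x[unfolded Lr_simps]])
  next
    fix d x assume d: "d \<in> D" and x: "x \<in> carrier Lr"
    show "deltad Lr d (pard Lr x) = pard Lr (deltad Lr d x)"
      by (rule frac_commute[OF dl_deriv[OF d] B_stab(2)[OF d] par_deriv par_B dl_par[OF d]
            Lr_deltad[OF d] Lr_pard x[unfolded Lr_simps]])
  qed
qed

lemma Lr_inverse:
  assumes "t \<in> Reg" "s \<in> Reg"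
  shows "q (t, s) \<otimes>\<^bsub>Lr\<^esub> q (s, t) = \<one>\<^bsub>Lr\<^esub>" "q (t, s) \<in> Units Lr"
proof -
  have R: "t \<in> B" "s \<in> B" using assms RegD(1) by auto
  show 1: "q (t, s) \<otimes>\<^bsub>Lr\<^esub> q (s, t) = \<one>\<^bsub>Lr\<^esub>"
    using assms R by (simp add: Lr_mult Lr_simps) (intro q_eqI B(2,6) Reg_mult Reg_1; simp add: mult.commute)
  have "q (s, t) \<otimes>\<^bsub>Lr\<^esub> q (t, s) = \<one>\<^bsub>Lr\<^esub>"
    using assms R by (simp add: Lr_mult Lr_simps) (intro q_eqI B(2,6) Reg_mult Reg_1; simp add: mult.commute)
  then show "q (t, s) \<in> Units Lr" using 1 assms R q_Lc by (auto simp: Units_def Lr_simps)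
qed

lemma nonzerodivisor_unit:
  assumes "x \<in> carrier Lr" "\<forall>y\<in>carrier Lr. x \<otimes>\<^bsub>Lr\<^esub> y = \<zero>\<^bsub>Lr\<^esub> \<longrightarrow> y = \<zero>\<^bsub>Lr\<^esub>"
  shows "x \<in> Units Lr"
proof -
  obtain a s where a: "a \<in> B" "s \<in> Reg" "x = q (a, s)" using assms(1) unfolding Lr_simps by (metis Lc_cases)
  have "a \<in> Reg"
  proof (rule RegI[OF a(1)])
    fix y assume y: "y \<in> B" "y * a \<in> N"
    have "x \<otimes>\<^bsub>Lr\<^esub> q (y, 1) = \<zero>\<^bsub>Lr\<^esub>"
      using a y by (simp add: Lr_simps Lr_mult Reg_1 zero_iff B(6) mult.commute)
    then have "q (y, 1) = q (0, 1)" using assms(2) y q_Lc Reg_1 by (simp add: Lr_simps)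
    then show "y \<in> N" using zero_iff y Reg_1 by blast
  qed
  then show ?thesis using Lr_inverse(2) a by blast
qed

section \<open>Ideals of the ring of fractions\<close>

lemma ideal_mult:
  assumes "ideal I Lr" "q (a, s) \<in> I" "a \<in> B" "s \<in> Reg" "b \<in> B" "t \<in> Reg"
  shows "q (a * b, s * t) \<in> I"
  using ideal.I_r_closed[OF assms(1,2), of "q (b, t)"] assms q_Lc by (simp add: Lr_simps Lr_mult)

lemma ideal_num: "ideal I Lr \<Longrightarrow> a \<in> B \<Longrightarrow> s \<in> Reg \<Longrightarrow> q (a, s) \<in> I \<longleftrightarrow> q (a, 1) \<in> I"
proof
  assume I: "ideal I Lr" and a: "a \<in> B" "s \<in> Reg"
  show "q (a, 1) \<in> I" if "q (a, s) \<in> I"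
    using ideal_mult[OF I that a RegD(1)[OF a(2)] Reg_1] q_cancel[OF a(1) Reg_1 a(2)] by simp
  show "q (a, s) \<in> I" if "q (a, 1) \<in> I"
    using ideal_mult[OF I that a(1) Reg_1 B(2) a(2)] by simp
qed

lemma ideal_zero: "ideal I Lr \<Longrightarrow> q (0, 1) \<in> I"
  using additive_subgroup.zero_closed[OF ideal.axioms(1)] Lr_simps(3) by metis

lemma ideal_add: "ideal I Lr \<Longrightarrow> x \<in> I \<Longrightarrow> y \<in> I \<Longrightarrow> x \<oplus>\<^bsub>Lr\<^esub> y \<in> I"
  by (rule additive_subgroup.a_closed[OF ideal.axioms(1)])

text \<open>By \<open>Reg_component\<close> the ring of fractions behaves as a product of fields
  indexed by \<open>Fam\<close>. The sum of the components inside \<open>I\<close> is the generator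
  of \<open>I\<close>.\<close>

definition part :: "'a set \<Rightarrow> 'r" where
  "part I = (\<Sum>v\<in>{v \<in> Fam. q (v, 1) \<in> I}. v)"

lemma part_B: "part I \<in> B"
  unfolding part_def by (rule total_B) auto

lemma part_mem:
  assumes I: "ideal I Lr"
  shows "q (part I, 1) \<in> I"
proof -
  interpret I: ideal I Lr by (rule I)
  have "q (\<Sum>v\<in>G. v, 1) \<in> I" if "finite G" "G \<subseteq> {v \<in> Fam. q (v, 1) \<in> I}" for G
    using that
  proof (induction G rule: finite_induct)
    case empty
    then show ?case using ideal_zero[OF I] by simp
  next
    case (insert v G)
    have G: "G \<subseteq> Fam" using insert.prems by auto
    have "q (v, 1) \<oplus>\<^bsub>Lr\<^esub> q (\<Sum>v\<in>G. v, 1) \<in> I" using insert by (intro ideal_add[OF I]) auto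
    then show ?case using insert Fam_B total_B[OF G] by (simp add: Lr_add Reg_1)
  qed
  then show ?thesis unfolding part_def using Fam_finite by simp
qed

text \<open>If \<open>a * v\<close> is nonzero, then \<open>v\<close> is a multiple of
  \<open>a / s\<close> by \<open>Reg_component\<close>, so the component of \<open>v\<close> lies in
  \<open>I\<close>. Conversely, if \<open>a\<close> is annihilated by all components outside
  \<open>I\<close>, then multiplying it by \<open>total\<close> or by \<open>part I\<close> is the
  same.\<close>

lemma ideal_iff:
  assumes I: "ideal I Lr" and a: "a \<in> B" "s \<in> Reg"
  shows "q (a, s) \<in> I \<longleftrightarrow> (\<forall>v\<in>Fam. q (v, 1) \<notin> I \<longrightarrow> a * v \<in> N)"
    "q (a, s) \<in> I \<Longrightarrow> a * total - a * part I \<in> N"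
proof -
  let ?F = "{v \<in> Fam. q (v, 1) \<in> I}"
  have 1: "a * v \<in> N" if "q (a, s) \<in> I" "v \<in> Fam" "q (v, 1) \<notin> I" for v
  proof (rule ccontr)
    assume no: "a * v \<notin> N"
    note vB = Fam_B[OF that(2)] and rc = Reg_component[OF that(2) a(1) no]
    let ?t = "a * v + (total - v)"
    have tB: "?t \<in> B" using RegD(1)[OF rc(1)] .
    have "q (a, 1) \<in> I" using ideal_num[OF I a] that(1) by blast
    \<comment> \<open>As a fraction this is \<open>v\<close>, with the regular element
      \<open>?t\<close> as denominator.\<close>
    then have "q (a * (v * v), 1 * ?t) \<in> I"
      using ideal_mult[OF I _ a(1) Reg_1 B(6)[OF vB vB] rc(1)] by blast
    moreover have "q (a * (v * v), 1 * ?t) = q (v, 1)"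
      using q_eq[OF B(6)[OF a(1) B(6)[OF vB vB]] rc(1) vB Reg_1] N(6)[OF rc(2)] by simp
    ultimately show False using that(3) by simp
  qed
  have 2: "a * total - a * part I \<in> N" if h: "\<forall>v\<in>Fam. q (v, 1) \<notin> I \<longrightarrow> a * v \<in> N"
  proof -
    have t: "total = (\<Sum>v\<in>Fam - ?F. v) + part I"
      using Fam_finite sum.subset_diff[of ?F Fam "\<lambda>v. v"] by (auto simp: part_def)
    have "a * total - a * part I = (\<Sum>v\<in>Fam - ?F. a * v)"
      unfolding t sum_distrib_left[symmetric] by (simp add: algebra_simps)
    then show ?thesis using h by (auto intro!: is_ideal_sum[OF N_ideal])
  qed
  show "q (a, s) \<in> I \<longleftrightarrow> (\<forall>v\<in>Fam. q (v, 1) \<notin> I \<longrightarrow> a * v \<in> N)"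
  proof
    assume h: "\<forall>v\<in>Fam. q (v, 1) \<notin> I \<longrightarrow> a * v \<in> N"
    have "q (part I * a, 1 * (s * total)) \<in> I"
      using ideal_mult[OF I part_mem[OF I] part_B Reg_1 a(1) Reg_mult[OF a(2) total_Reg]] .
    moreover have "q (a, s) = q (part I * a, 1 * (s * total))"
    proof -
      have "s * (a * total - a * part I) \<in> N" using N(4)[OF RegD(1)[OF a(2)] 2[OF h]] .
      then have "a * (1 * (s * total)) - part I * a * s \<in> N" by (simp add: algebra_simps)
      then show ?thesis
        using q_eq[OF a B(6)[OF part_B a(1)], of "1 * (s * total)"] Reg_mult[OF a(2) total_Reg] by simp
    qed
    ultimately show "q (a, s) \<in> I" by simp
  qed (use 1 in blast)
  then show "q (a, s) \<in> I \<Longrightarrow> a * total - a * part I \<in> N" using 2 by blast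
qed

text \<open>By \<open>ideal_iff\<close> every ideal is principal, generated by the class of its
  \<open>part\<close>.\<close>

lemma Lr_noetherian: "noetherian_ring Lr"
proof -
  interpret L: cring Lr by (rule Lr_cring)
  show ?thesis
  proof (rule L.noetherian_ringI)
    fix I assume I: "ideal I Lr"
    let ?g = "q (part I, 1)"
    have g: "?g \<in> carrier Lr" using part_B q_Lc Reg_1 by (simp add: Lr_simps)
    have "I = Idl\<^bsub>Lr\<^esub> {?g}"
    proof
      show "Idl\<^bsub>Lr\<^esub> {?g} \<subseteq> I" using L.genideal_minimal[OF I] part_mem[OF I] by blast
      show "I \<subseteq> Idl\<^bsub>Lr\<^esub> {?g}"
      proof
        fix x assume x: "x \<in> I"
        then have "x \<in> Lc" using ideal.Icarr[OF I] by (simp add: Lr_simps)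
        then obtain a s where a: "a \<in> B" "s \<in> Reg" "x = q (a, s)" by (metis Lc_cases)
        have "s * (a * total - a * part I) \<in> N"
          using N(4)[OF RegD(1)[OF a(2)] ideal_iff(2)[OF I a(1,2)]] x a(3) by blast
        then have "a * (1 * (s * total)) - part I * a * s \<in> N" by (simp add: algebra_simps)
        then have "x = q (part I * a, 1 * (s * total))"
          using q_eq[OF a(1,2) B(6)[OF part_B a(1)], of "1 * (s * total)"] Reg_mult[OF a(2) total_Reg] a(3) by simp
        moreover have "?g \<in> Idl\<^bsub>Lr\<^esub> {?g}" using L.genideal_self[of "{?g}"] g by blast
        ultimately show "x \<in> Idl\<^bsub>Lr\<^esub> {?g}"
          using ideal_mult[OF L.genideal_ideal[of "{?g}"] _ part_B Reg_1 a(1) Reg_mult[OF a(2) total_Reg]] g by simp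
      qed
    qed
    then show "\<exists>A\<subseteq>carrier Lr. finite A \<and> I = Idl\<^bsub>Lr\<^esub> A" using g by (intro exI[of _ "{?g}"]) auto
  qed
qed

lemma one_nonzero: "q (1, 1) \<noteq> q (0, 1)"
  using zero_iff[OF B(2) Reg_1] max_stableD(3)[OF N_max] by simp

text \<open>\<open>N\<close> is maximal among ideals stable under automorphisms and derivations,
  whereas \<open>I\<close> is stable under automorphisms only. Stability under derivations is
  automatic: by \<open>ideal_iff\<close> membership means being annihilated by certain members of
  \<open>Fam\<close>, and \<open>ann_deriv\<close> preserves this.\<close>

lemma Lr_sigma_simple: "sigma_simple S Lr"
  unfolding sigma_simple_def
proof (intro conjI allI impI; (elim conjE)?)
  show "carrier Lr \<noteq> {\<zero>\<^bsub>Lr\<^esub>}" using one_nonzero q_Lc[OF B(2) Reg_1] by (auto simp: Lr_simps)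
  fix I assume I: "ideal I Lr" and st: "\<forall>s\<in>S. shift Lr s ` I \<subseteq> I"
  interpret I: ideal I Lr by (rule I)
  let ?J = "{r \<in> B. q (r, 1) \<in> I}"
  have J: "is_ideal B ?J"
    unfolding is_ideal_def
  proof (intro conjI ballI)
    show "0 \<in> ?J" using ideal_zero[OF I] B(1) by simp
    show "x + y \<in> ?J" if xy: "x \<in> ?J" "y \<in> ?J" for x y
    proof -
      have "q (x, 1) \<oplus>\<^bsub>Lr\<^esub> q (y, 1) \<in> I" by (rule ideal_add[OF I]) (use xy in auto)
      then show ?thesis using xy B(4) Lr_add[OF _ Reg_1 _ Reg_1, of x y] by simp
    qed
    show "a * x \<in> ?J" if ax: "a \<in> B" "x \<in> ?J" for a x
    proof -
      have "q (x * a, 1 * 1) \<in> I" by (rule ideal_mult[OF I]) (use ax Reg_1 in auto)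
      then show ?thesis using ax B(6) by (simp add: mult.commute)
    qed
  qed auto
  have "stable ?J"
  proof (rule stableI)
    fix s x assume s: "s \<in> S" and x: "x \<in> ?J"
    then have "shift Lr s (q (x, 1)) \<in> I" using st by blast
    then show "sh s x \<in> ?J" using x B_stab(1)[OF s] by (simp add: Lr_shift[OF s] Reg_1 sh_simps[OF s])
  next
    fix d x assume d: "d \<in> D" and x: "x \<in> ?J"
    have "dl d x * v \<in> N" if "v \<in> Fam" "q (v, 1) \<notin> I" for v
      using ann_deriv[OF Fam_B[OF that(1)] _ _ d, of x] x ideal_iff(1)[OF I, of x 1] Reg_1 that by blast
    then show "dl d x \<in> ?J" using x B_stab(2)[OF d] ideal_iff(1)[OF I _ Reg_1] by blast
  qed
  moreover have "N \<subseteq> ?J"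
  proof
    fix x assume x: "x \<in> N"
    then have "q (x, 1) = q (0, 1)" using zero_iff N(1) Reg_1 by blast
    then show "x \<in> ?J" using ideal_zero[OF I] N(1)[OF x] by simp
  qed
  ultimately have "?J = N \<or> 1 \<in> ?J" using max_stableD(4)[OF N_max J] by blast
  then show "I = {\<zero>\<^bsub>Lr\<^esub>} \<or> I = carrier Lr"
  proof
    assume "1 \<in> ?J"
    then have "\<one>\<^bsub>Lr\<^esub> \<in> I" by (simp add: Lr_simps)
    then show ?thesis using I.one_imp_carrier by blast
  next
    assume JN: "?J = N"
    have "x = \<zero>\<^bsub>Lr\<^esub>" if x: "x \<in> I" for x
    proof -
      have "x \<in> Lc" using I.Icarr[OF x] by (simp add: Lr_simps)
      then obtain a s where a: "a \<in> B" "s \<in> Reg" "x = q (a, s)" by (metis Lc_cases)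
      then have "a \<in> ?J" using ideal_num[OF I a(1,2)] x by blast
      then show ?thesis using JN a zero_iff by (simp add: Lr_simps)
    qed
    then have "I \<subseteq> {q (0, 1)}" unfolding Lr_simps by blast
    then show ?thesis using ideal_zero[OF I] unfolding Lr_simps by blast
  qed
qed

theorem Lr_pseudo_field: "pseudo_field S D Lr"
  unfolding pseudo_field_def
  using Lr_sdp Lr_noetherian Lr_sigma_simple nonzerodivisor_unit by blast

text \<open>The possible denominators of a constant \<open>z\<close>, that is, the elements of
  \<open>B\<close> that multiply it into \<open>B\<close>, form an invariant ideal. It contains the
  regular \<open>s\<close>, hence 1; so \<open>z\<close> comes from \<open>B\<close>, where
  \<open>N_const\<close> applies.\<close>

theorem Lr_constants: "sd_constants S D Lr = (\<lambda>c. q (\<iota> c, 1)) ` C"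
proof
  have \<iota>B: "\<iota> c \<in> B" for c using kB by blast
  show "(\<lambda>c. q (\<iota> c, 1)) ` C \<subseteq> sd_constants S D Lr"
  proof (intro image_subsetI)
    fix c assume c: "c \<in> C"
    have "shift Lr s (q (\<iota> c, 1)) = q (\<iota> c, 1)" if "s \<in> S" for s
      using that c by (simp add: Lr_shift[OF that \<iota>B Reg_1] sh_simps sh_\<iota> C_def)
    moreover have "deltad Lr d (q (\<iota> c, 1)) = q (0, 1)" if "d \<in> D" for d
      using that c by (simp add: Lr_deltad[OF that \<iota>B Reg_1] dl_simps dl_\<iota> C_def \<iota>_simps)
    ultimately show "q (\<iota> c, 1) \<in> sd_constants S D Lr"
      using q_Lc[OF \<iota>B Reg_1] by (simp add: sd_constants_def Lr_simps)
  qed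
  show "sd_constants S D Lr \<subseteq> (\<lambda>c. q (\<iota> c, 1)) ` C"
  proof
    fix z assume z: "z \<in> sd_constants S D Lr"
    then have "z \<in> Lc" by (simp add: sd_constants_def Lr_simps)
    then obtain a s where a: "a \<in> B" "s \<in> Reg" "z = q (a, s)" by (metis Lc_cases)
    note sB = RegD(1)[OF a(2)]
    have cs: "sh t a * s - a * sh t s \<in> N" if t: "t \<in> S" for t
      using z a q_eq[OF B_stab(1)[OF t a(1)] Reg_sh[OF t a(2)] a(1,2)] t by (simp add: sd_constants_def Lr_shift)
    have cd: "dl d a * s - a * dl d s \<in> N" if d: "d \<in> D" for d
      using z a zero_iff[OF frac_mem[OF a(1,2) dl_deriv[OF d] B_stab(2)[OF d]] Reg_mult[OF a(2,2)]] d
      by (simp add: sd_constants_def Lr_deltad Lr_simps)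
    let ?J = "{r \<in> B. \<exists>b\<in>B. r * a - b * s \<in> N}"
    have J: "is_ideal B ?J"
      unfolding is_ideal_def
    proof (intro conjI ballI)
      show "0 \<in> ?J" using B(1) N(2) by (auto intro!: bexI[of _ 0])
      show "x + y \<in> ?J" if xy: "x \<in> ?J" "y \<in> ?J" for x y
      proof -
        obtain b c where bc: "b \<in> B" "x * a - b * s \<in> N" "c \<in> B" "y * a - c * s \<in> N" using xy by blast
        have "(x + y) * a - (b + c) * s \<in> N" using N(3)[OF bc(2,4)] by (simp add: algebra_simps)
        then show ?thesis using xy bc B(4) by blast
      qed
      show "c * x \<in> ?J" if cx: "c \<in> B" "x \<in> ?J" for c x
      proof -
        obtain b where b: "b \<in> B" "x * a - b * s \<in> N" using cx by blast
        have "(c * x) * a - (c * b) * s \<in> N" using N(4)[OF cx(1) b(2)] by (simp add: algebra_simps)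
        then show ?thesis using cx b B(6) by blast
      qed
    qed auto
    have J_st: "stable ?J"
    proof (rule stableI)
      fix t r assume t: "t \<in> S" and r: "r \<in> ?J"
      obtain b where b: "b \<in> B" "r * a - b * s \<in> N" using r by blast
      have rB: "r \<in> B" using r by blast
      let ?r = "sh t r" and ?b = "sh t b"
      have m: "?r \<in> B" "?b \<in> B" "sh t s \<in> Reg" using B_stab(1)[OF t] rB b(1) Reg_sh[OF t a(2)] by auto
      \<comment> \<open>Constancy of \<open>z\<close> allows trading \<open>sh t a * s\<close> for
        \<open>a * sh t s\<close>; the regular factor \<open>sh t s\<close> is then
        cancelled.\<close>
      have "s * sh t (r * a - b * s) \<in> N" using N(4)[OF sB N_stable(1)[OF t b(2)]] .
      moreover have "?r * (sh t a * s - a * sh t s) \<in> N" using N(4)[OF m(1) cs[OF t]] .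
      ultimately have "s * sh t (r * a - b * s) - ?r * (sh t a * s - a * sh t s) \<in> N" by (rule N(7))
      then have "(?r * a - ?b * s) * sh t s \<in> N" by (simp add: sh_simps[OF t] algebra_simps)
      then have "?r * a - ?b * s \<in> N"
        using RegD(2)[OF m(3)] B(5)[OF B(6)[OF m(1) a(1)] B(6)[OF m(2) sB]] by blast
      then show "?r \<in> ?J" using m by blast
    next
      fix d r assume d: "d \<in> D" and r: "r \<in> ?J"
      obtain b where b: "b \<in> B" "r * a - b * s \<in> N" using r by blast
      have rB: "r \<in> B" using r by blast
      let ?r = "dl d r" and ?b = "dl d b"
      have m: "?r \<in> B" "?b \<in> B" "dl d s \<in> B" "dl d a \<in> B" using B_stab(2)[OF d] rB b(1) a(1) sB by auto
      have "s * dl d (r * a - b * s) \<in> N" using N(4)[OF sB N_stable(2)[OF d b(2)]] .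
      moreover have "r * (dl d a * s - a * dl d s) \<in> N" using N(4)[OF rB cd[OF d]] .
      ultimately have "s * dl d (r * a - b * s) - r * (dl d a * s - a * dl d s) \<in> N" by (rule N(7))
      moreover have "dl d s * (r * a - b * s) \<in> N" using N(4)[OF m(3) b(2)] .
      ultimately have "s * dl d (r * a - b * s) - r * (dl d a * s - a * dl d s) - dl d s * (r * a - b * s) \<in> N" by (rule N(7))
      then have "(?r * a - ?b * s) * s \<in> N" by (simp add: dl_simps[OF d] algebra_simps)
      then have "?r * a - ?b * s \<in> N"
        using RegD(2)[OF a(2)] B(5)[OF B(6)[OF m(1) a(1)] B(6)[OF m(2) sB]] by blast
      then show "?r \<in> ?J" using m by blast
    qed
    have NJ: "N \<subseteq> ?J"
    proof
      fix x assume x: "x \<in> N"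
      then show "x \<in> ?J" using N(1)[OF x] N(5)[OF a(1) x] B(1) by (auto intro!: bexI[of _ 0])
    qed
    have sJ: "s \<in> ?J" using sB a(1) N(2) by (auto intro!: bexI[of _ a] simp: mult.commute)
    have "1 \<in> ?J"
    proof (rule ccontr)
      assume "1 \<notin> ?J"
      from max_stableD(4)[OF N_max J J_st NJ this] show False using sJ Reg_not_N[OF a(2)] by blast
    qed
    then obtain c where c: "c \<in> B" "a - c * s \<in> N" by auto
    have zc: "z = q (c, 1)" using a c q_eq[OF a(1,2) c(1) Reg_1] by simp
    have "const_mod N c"
      using z c zc q_eq[OF B_stab(1)[OF _ c(1)] Reg_1 c(1) Reg_1] zero_iff[OF B_stab(2)[OF _ c(1)] Reg_1]
      by (auto simp: const_mod_def sd_constants_def Lr_shift Lr_deltad Lr_simps Reg_1 sh_simps dl_simps)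
    then obtain l where l: "l \<in> C" "c - \<iota> l \<in> N" using N_const c(1) by (auto simp: constants_only_def)
    have "\<iota> l \<in> B" using kB by blast
    then have "z = q (\<iota> l, 1)" using zc q_eq[OF c(1) Reg_1 _ Reg_1] l(2) by simp
    then show "z \<in> (\<lambda>c. q (\<iota> c, 1)) ` C" using l(1) by blast
  qed
qed

end

section \<open>The extension generated by a fundamental matrix\<close>

lemma is_subring_prod: "is_subring A \<Longrightarrow> (\<And>i. i \<in> I \<Longrightarrow> f i \<in> A) \<Longrightarrow> prod f I \<in> A"
  by (induction I rule: infinite_finite_induct) (auto intro: is_subringD)

lemma signof_subring: "is_subring A \<Longrightarrow> signof p \<in> A"
  using is_subringD(2,3)[of A] by (auto simp: sign_def)

lemma det_in_subring:
  assumes A: "is_subring A" and M: "M \<in> carrier_mat m m" "\<And>j k. j < m \<Longrightarrow> k < m \<Longrightarrow> M $$ (j, k) \<in> A"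
  shows "det M \<in> A"
  unfolding det_def'[OF M(1)]
proof (intro is_subring_sum[OF A] is_subringD(6)[OF A] signof_subring[OF A] is_subring_prod[OF A])
  fix p i assume "p \<in> {p. p permutes {0..<m}}" "i \<in> {0..<m}"
  then show "M $$ (i, p i) \<in> A" using M(2) permutes_in_image[of p "{0..<m}" i] by auto
qed

lemma adj_mat_in_subring:
  assumes A: "is_subring A" and M: "M \<in> carrier_mat m m" "\<And>j k. j < m \<Longrightarrow> k < m \<Longrightarrow> M $$ (j, k) \<in> A"
    and jk: "j < m" "k < m"
  shows "adj_mat M $$ (j, k) \<in> A"
proof -
  have "det (mat_delete M k j) \<in> A"
  proof (rule det_in_subring[OF A])
    show "mat_delete M k j \<in> carrier_mat (m - 1) (m - 1)" using M(1) by (auto simp: mat_delete_def)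
    show "mat_delete M k j $$ (a, b) \<in> A" if "a < m - 1" "b < m - 1" for a b
      using M that by (auto simp: mat_delete_def)
  qed
  moreover have "(- 1) ^ (k + j) \<in> A" using is_subringD(2,3,7)[OF A] by blast
  ultimately show ?thesis
    using M(1) jk is_subringD(6)[OF A] by (simp add: adj_mat_def cofactor_def)
qed

text \<open>The determinant is a polynomial in the entries, and products of congruent factors are
  compared one factor at a time.\<close>

lemma det_cong_ideal:
  assumes A: "is_subring A" and I: "is_ideal A I"
    and M: "M \<in> carrier_mat m m" "\<And>j k. j < m \<Longrightarrow> k < m \<Longrightarrow> M $$ (j, k) \<in> A"
    and N: "N \<in> carrier_mat m m" "\<And>j k. j < m \<Longrightarrow> k < m \<Longrightarrow> N $$ (j, k) \<in> A"
    and MN: "\<And>j k. j < m \<Longrightarrow> k < m \<Longrightarrow> M $$ (j, k) - N $$ (j, k) \<in> I"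
  shows "det M - det N \<in> I"
proof -
  have prd: "(\<Prod>i\<in>J. f i) - (\<Prod>i\<in>J. g i) \<in> I"
    if "finite J" "\<And>i. i \<in> J \<Longrightarrow> f i \<in> A" "\<And>i. i \<in> J \<Longrightarrow> g i \<in> A" "\<And>i. i \<in> J \<Longrightarrow> f i - g i \<in> I"
    for J and f g :: "nat \<Rightarrow> 'a"
    using that
  proof (induction J rule: finite_induct)
    case (insert x J)
    have "(f x - g x) * prod f J + g x * (prod f J - prod g J) \<in> I"
      using insert by (intro is_idealD(3,4,5)[OF I] is_subring_prod[OF A]) auto
    then show ?case using insert.hyps by (simp add: algebra_simps)
  qed (simp add: is_idealD(2)[OF I])
  have "det M - det N = (\<Sum>p\<in>{p. p permutes {0..<m}}. signof p *
      ((\<Prod>i = 0..<m. M $$ (i, p i)) - (\<Prod>i = 0..<m. N $$ (i, p i))))"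
    by (simp add: det_def'[OF M(1)] det_def'[OF N(1)] sum_subtractf right_diff_distrib)
  also have "\<dots> \<in> I"
  proof (intro is_ideal_sum[OF I] is_idealD(4)[OF I] signof_subring[OF A] prd)
    fix p i assume p: "p \<in> {p. p permutes {0..<m}}" and i: "i \<in> {0..<m}"
    then have "i < m" "p i < m" using permutes_in_image[of p "{0..<m}" i] by auto
    then show "M $$ (i, p i) \<in> A" "N $$ (i, p i) \<in> A" "M $$ (i, p i) - N $$ (i, p i) \<in> I" using M N MN by auto
  qed auto
  finally show ?thesis .
qed

context linear_sys_closed
begin

lemma RR_least:
  assumes "is_subring T" "range mconst \<subseteq> T" "\<And>b j k m. j < n \<Longrightarrow> k < n \<Longrightarrow> mvar (b, j, k, m) \<in> T"
  shows "RR \<subseteq> T"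
  unfolding RR_def using Rr_least[OF assms(1,2)] assms(3) by blast

lemma XY_RR: "Xm j k \<in> RR" "Ym j k \<in> RR" and mconst_RR: "mconst c \<in> RR"
  using XY_Rr Rr_const Rr_RR by blast+

text \<open>Pull the entries of the inverse system matrix back under \<open>shk s\<close> and
  multiply by \<open>X\<close>: applying \<open>sh s\<close> gives the inverse times the matrix
  times \<open>X\<close>, that is \<open>X\<close>. The argument for \<open>Y\<close> is symmetric,
  and derivatives follow by commutation with \<open>par\<close>.\<close>

lemma sh_RR_surj:
  assumes s: "s \<in> S" and surj: "surj (shk s)" and x: "x \<in> RR"
  shows "\<exists>y\<in>RR. sh s y = x"
proof -
  define iv where "iv M = map_entries (\<lambda>c. if c = 0 then 0 else inv_into UNIV (shk s) c) M" for M :: "nat \<Rightarrow> nat \<Rightarrow> 'c"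
  have z: "shk s 0 = 0" using hom_on_more(1)[OF is_subring_UNIV shk_hom[OF s]] .
  have iv: "map_entries (shk s) (iv M) = M" for M
    by (auto simp: iv_def map_entries_def fun_eq_iff z surj_f_inv_f[OF surj])
  have cmiv: "map_entries (sh s) (cm (iv M)) = cm M" for M by (simp add: sh_cm[OF s] iv)
  have X: "map_entries (sh s) (mm n (cm (iv (Ai s))) Xm) = Xm"
    by (simp add: map_entries_mm[OF sh_hom[OF s]] cmiv sh_X[OF s] mm_assoc[symmetric] cm_mm A_inv(2)[OF s]
        cm_unit mm_unit[OF supp_XY(1)])
  have Y: "map_entries (sh s) (mm n Ym (cm (iv (Am s)))) = Ym"
    by (simp add: map_entries_mm[OF sh_hom[OF s]] cmiv sh_Y[OF s] mm_assoc cm_mm A_inv(2)[OF s]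
        cm_unit mm_unit[OF supp_XY(2)])
  have m: "mm n (cm M) Xm j k \<in> RR" "mm n Ym (cm M) j k \<in> RR" for M j k
    by (intro mm_in_subring[OF RR_subring] XY_RR; simp add: map_entries_def mconst_RR)+
  have pow: "y \<in> RR \<Longrightarrow> (par ^^ i) y \<in> RR" for i y by (induction i) (auto intro: par_RR)
  have "RR \<subseteq> sh s ` RR"
  proof (rule RR_least)
    show "is_subring (sh s ` RR)"
      unfolding is_subring_def
    proof (intro conjI ballI)
      show "1 \<in> sh s ` RR" using is_subringD(2)[OF RR_subring] sh_simps(1)[OF s] by (metis image_eqI)
      fix x y assume "x \<in> sh s ` RR" "y \<in> sh s ` RR"
      then obtain a b where ab: "a \<in> RR" "b \<in> RR" "x = sh s a" "y = sh s b" by blast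
      show "x - y \<in> sh s ` RR" "x * y \<in> sh s ` RR"
        using ab is_subringD(5,6)[OF RR_subring]
        by (auto simp: sh_simps[OF s] intro: image_eqI[of _ _ "a - b"] image_eqI[of _ _ "a * b"])
    qed
    show "range mconst \<subseteq> sh s ` RR"
    proof
      fix x :: "'c dpol" assume "x \<in> range mconst"
      then obtain c where "x = mconst c" by blast
      then have "x = sh s (mconst (inv_into UNIV (shk s) c))" by (simp add: sh_const[OF s] surj_f_inv_f[OF surj])
      then show "x \<in> sh s ` RR" using mconst_RR by blast
    qed
    fix b j k i assume jk: "j < n" "k < n"
    let ?y = "if b then mm n (cm (iv (Ai s))) Xm j k else mm n Ym (cm (iv (Am s))) j k"
    have "sh s ?y = mvar (b, j, k, 0)"
      using fun_cong[OF fun_cong[OF X], of j k] fun_cong[OF fun_cong[OF Y], of j k] jk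
      by (simp add: map_entries_def Xm_def Ym_def)
    then have "mvar (b, j, k, i) = sh s ((par ^^ i) ?y)" by (simp add: sh_par_pow[OF s] mvar_par)
    moreover have "(par ^^ i) ?y \<in> RR" using m pow by simp
    ultimately show "mvar (b, j, k, i) \<in> sh s ` RR" by blast
  qed
  then show ?thesis using x by blast
qed

end

locale pv_construction = linear_sys_closed S D shk dlk pk n Am Ai Bm
  for S :: "'s set" and D :: "'d set"
    and shk :: "'s \<Rightarrow> 'k::field_char_0 \<Rightarrow> 'k" and dlk :: "'d \<Rightarrow> 'k \<Rightarrow> 'k" and pk :: "'k \<Rightarrow> 'k"
    and n :: nat and Am Ai :: "'s \<Rightarrow> nat \<Rightarrow> nat \<Rightarrow> 'k" and Bm :: "'d \<Rightarrow> nat \<Rightarrow> nat \<Rightarrow> 'k" +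
  fixes N :: "'k dpol set" and u :: "'k dpol" 
  assumes shk_surj: "s \<in> S \<Longrightarrow> surj (shk s)"
    and N_max: "max_stable RR N" and N_const: "constants_only RR N" and N_rels: "inverse_rels N"
    and N_par: "f \<in> N \<Longrightarrow> par f \<in> N" and u: "u \<in> RR" "u \<notin> N" "prime_ann RR N u"
begin

sublocale Q: const_ring S D sh dl mconst shk dlk RR N par u
proof unfold_locales
  show "\<exists>y\<in>RR. sh s y = x" if "s \<in> S" "x \<in> RR" for s x using sh_RR_surj shk_surj that by blast
qed (use RR_subring stable_RR mconst_RR N_max N_const N_par u sh_sh sh_dl sh_par dl_dl dl_par par_deriv par_RR in auto)

end

section \<open>The fundamental matrix in the ring of fractions\<close>

locale pv_fractions = pv_construction S D shk dlk pk n Am Ai Bm N u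
  for S :: "'s set" and D :: "'d set"
    and shk :: "'s \<Rightarrow> 'k::field_char_0 \<Rightarrow> 'k" and dlk :: "'d \<Rightarrow> 'k \<Rightarrow> 'k" and pk :: "'k \<Rightarrow> 'k"
    and n :: nat and Am Ai :: "'s \<Rightarrow> nat \<Rightarrow> nat \<Rightarrow> 'k" and Bm :: "'d \<Rightarrow> nat \<Rightarrow> nat \<Rightarrow> 'k"
    and N :: "'k dpol set" and u :: "'k dpol" +
  fixes q :: "'k dpol \<times> 'k dpol \<Rightarrow> 'a"
  assumes q_eq: "a \<in> RR \<Longrightarrow> s \<in> Q.Reg \<Longrightarrow> b \<in> RR \<Longrightarrow> t \<in> Q.Reg \<Longrightarrow> q (a, s) = q (b, t) \<longleftrightarrow> a * t - b * s \<in> N"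
begin

sublocale Q: frac_ring S D sh dl mconst shk dlk RR N par u q
  by unfold_locales (rule q_eq)

definition cl :: "'k dpol \<Rightarrow> 'a" where
  "cl a = q (a, 1)"

definition Zm :: "'a mat" where
  "Zm = mat n n (\<lambda>(j, k). cl (Xm j k))"

lemma cl_Lr: "a \<in> RR \<Longrightarrow> cl a \<in> carrier Q.Lr"
  using Q.q_Lc Q.Reg_1 by (simp add: cl_def Q.Lr_simps)

lemma cl_add: "a \<in> RR \<Longrightarrow> b \<in> RR \<Longrightarrow> cl a \<oplus>\<^bsub>Q.Lr\<^esub> cl b = cl (a + b)"
  and cl_mult: "a \<in> RR \<Longrightarrow> b \<in> RR \<Longrightarrow> cl a \<otimes>\<^bsub>Q.Lr\<^esub> cl b = cl (a * b)"
  by (simp_all add: cl_def Q.Lr_add Q.Lr_mult Q.Reg_1)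

lemma cl_01: "\<zero>\<^bsub>Q.Lr\<^esub> = cl 0" "\<one>\<^bsub>Q.Lr\<^esub> = cl 1"
  by (simp_all add: cl_def Q.Lr_simps)

lemma cl_eq: "a \<in> RR \<Longrightarrow> b \<in> RR \<Longrightarrow> cl a = cl b \<longleftrightarrow> a - b \<in> N"
  using q_eq[OF _ Q.Reg_1 _ Q.Reg_1] by (simp add: cl_def)

lemma cl_shift: "s \<in> S \<Longrightarrow> a \<in> RR \<Longrightarrow> shift Q.Lr s (cl a) = cl (sh s a)"
  by (simp add: cl_def Q.Lr_shift Q.Reg_1 sh_simps)

lemma cl_deltad: "d \<in> D \<Longrightarrow> a \<in> RR \<Longrightarrow> deltad Q.Lr d (cl a) = cl (dl d a)"
  by (simp add: cl_def Q.Lr_deltad Q.Reg_1 dl_simps)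

lemma cl_pard: "a \<in> RR \<Longrightarrow> pard Q.Lr (cl a) = cl (par a)"
  using is_derivD[OF par_deriv] by (simp add: cl_def Q.Lr_pard Q.Reg_1)

lemma cl_sum: "(\<And>k. k \<in> J \<Longrightarrow> f k \<in> RR) \<Longrightarrow> finite J \<Longrightarrow> (\<Oplus>\<^bsub>Q.Lr\<^esub>k\<in>J. cl (f k)) = cl (sum f J)"
proof -
  interpret L: cring Q.Lr by (rule Q.Lr_cring)
  assume "finite J" "\<And>k. k \<in> J \<Longrightarrow> f k \<in> RR"
  then show ?thesis
  proof (induction J rule: finite_induct)
    case (insert x J)
    then have "(\<lambda>k. cl (f k)) \<in> J \<rightarrow> carrier Q.Lr" using cl_Lr by auto
    then show ?case using insert cl_Lr by (simp add: cl_add is_subring_sum[OF RR_subring])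
  qed (simp add: cl_01)
qed

abbreviation cmat :: "(nat \<Rightarrow> nat \<Rightarrow> 'k dpol) \<Rightarrow> 'a mat" where
  "cmat M \<equiv> mat n n (\<lambda>(j, k). cl (M j k))"

lemma cmat_mult:
  assumes "\<And>j k. M j k \<in> RR" "\<And>j k. P j k \<in> RR"
  shows "cmat M \<otimes>\<^bsub>mat_ring Q.Lr n\<^esub> cmat P = cmat (mm n M P)"
proof (rule eq_matI)
  fix j k assume "j < dim_row (cmat (mm n M P))" "k < dim_col (cmat (mm n M P))"
  then have jk: "j < n" "k < n" by auto
  interpret L: cring Q.Lr by (rule Q.Lr_cring)
  have "(cmat M \<otimes>\<^bsub>mat_ring Q.Lr n\<^esub> cmat P) $$ (j, k) = (\<Oplus>\<^bsub>Q.Lr\<^esub>l\<in>{..<n}. cmat M $$ (j, l) \<otimes>\<^bsub>Q.Lr\<^esub> cmat P $$ (l, k))"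
    using jk by (simp add: mat_ring_def)
  also have "\<dots> = (\<Oplus>\<^bsub>Q.Lr\<^esub>l\<in>{..<n}. cl (M j l * P l k))"
    using jk assms by (intro L.finsum_cong') (auto simp: cl_mult intro!: cl_Lr is_subringD(6)[OF RR_subring])
  also have "\<dots> = cmat (mm n M P) $$ (j, k)"
    using jk assms is_subringD(6)[OF RR_subring] by (simp add: cl_sum mm_def)
  finally show "(cmat M \<otimes>\<^bsub>mat_ring Q.Lr n\<^esub> cmat P) $$ (j, k) = cmat (mm n M P) $$ (j, k)" .
qed (simp_all add: mat_ring_def)

lemma cmat_carrier: "(\<And>j k. M j k \<in> RR) \<Longrightarrow> cmat M \<in> carrier (mat_ring Q.Lr n)"
  using cl_Lr by (auto simp: mat_ring_def elements_mat_def)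

lemma Zm_GL: "Zm \<in> GL n Q.Lr"
proof -
  have one: "cmat (mm n M P) = \<one>\<^bsub>mat_ring Q.Lr n\<^esub>"
    if "\<And>j k. M j k \<in> RR" "\<And>j k. P j k \<in> RR" "\<And>j k. mm n M P j k - unit_mat n j k \<in> N" for M P
  proof -
    have "cl (mm n M P j k) = cl (unit_mat n j k)" for j k
      using cl_eq[OF mm_in_subring[OF RR_subring that(1,2)], of "unit_mat n j k"] that(3)
        is_subringD(1,2)[OF RR_subring] by (simp add: unit_mat_def)
    then show ?thesis by (auto simp: mat_ring_def cl_01 unit_mat_def intro!: eq_matI)
  qed
  have "cmat Ym \<otimes>\<^bsub>mat_ring Q.Lr n\<^esub> cmat Xm = \<one>\<^bsub>mat_ring Q.Lr n\<^esub>"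
    "cmat Xm \<otimes>\<^bsub>mat_ring Q.Lr n\<^esub> cmat Ym = \<one>\<^bsub>mat_ring Q.Lr n\<^esub>"
    using one[of Ym Xm] one[of Xm Ym] N_rels XY_RR by (simp_all add: cmat_mult inverse_rels_def)
  then show ?thesis
    unfolding Units_def Zm_def using cmat_carrier[of Xm] cmat_carrier[of Ym] XY_RR by blast
qed

lemma cm_RR: "cm M j k \<in> RR"
  by (simp add: map_entries_def mconst_RR)

lemma Zm_shift: "s \<in> S \<Longrightarrow> map_mat (shift Q.Lr s) Zm = cmat (cm (Am s)) \<otimes>\<^bsub>mat_ring Q.Lr n\<^esub> Zm"
proof -
  assume s: "s \<in> S"
  have "map_mat (shift Q.Lr s) Zm = cmat (map_entries (sh s) Xm)"
    unfolding Zm_def by (rule eq_matI) (auto simp: cl_shift[OF s] XY_RR map_entries_def)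
  then show ?thesis unfolding Zm_def by (simp add: sh_X[OF s] cmat_mult XY_RR cm_RR)
qed

lemma Zm_deltad: "d \<in> D \<Longrightarrow> map_mat (deltad Q.Lr d) Zm = cmat (cm (Bm d)) \<otimes>\<^bsub>mat_ring Q.Lr n\<^esub> Zm"
proof -
  assume d: "d \<in> D"
  have "map_mat (deltad Q.Lr d) Zm = cmat (map_entries (dl d) Xm)"
    unfolding Zm_def by (rule eq_matI) (auto simp: cl_deltad[OF d] XY_RR map_entries_def)
  then show ?thesis unfolding Zm_def by (simp add: dl_X[OF d] cmat_mult XY_RR cm_RR)
qed

text \<open>Modulo \<open>N\<close> the determinants of \<open>X\<close> and \<open>Y\<close> are
  inverse to each other, and Cramer's rule expresses \<open>Y\<close> by \<open>X\<close>. This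
  recovers \<open>Y\<close> in a subring known only to contain the entries of
  \<open>X\<close>.\<close>

lemma det_X:
  defines "Mx \<equiv> mat n n (\<lambda>(j, k). Xm j k)"
  shows "det Mx \<in> Q.Reg" "j < n \<Longrightarrow> k < n \<Longrightarrow> adj_mat Mx $$ (j, k) - det Mx * Ym j k \<in> N"
proof -
  define My where "My = mat n n (\<lambda>(j, k). Ym j k)"
  have X: "Mx \<in> carrier_mat n n" "\<And>j k. j < n \<Longrightarrow> k < n \<Longrightarrow> Mx $$ (j, k) = Xm j k" by (auto simp: Mx_def)
  have Y: "My \<in> carrier_mat n n" "\<And>j k. j < n \<Longrightarrow> k < n \<Longrightarrow> My $$ (j, k) = Ym j k" by (auto simp: My_def)
  have dX: "det Mx \<in> RR" and dY: "det My \<in> RR" using det_in_subring[OF RR_subring] X Y XY_RR by auto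
  have XY: "(Mx * My) $$ (j, k) = mm n Xm Ym j k" if "j < n" "k < n" for j k
    using that by (simp add: Mx_def My_def mm_def scalar_prod_def atLeast0LessThan)
  have one: "(1\<^sub>m n :: 'k dpol mat) $$ (j, k) = unit_mat n j k" if "j < n" "k < n" for j k
    using that by (simp add: unit_mat_def)
  have mmRR: "mm n Xm Ym j k \<in> RR" "(unit_mat n j k :: 'k dpol) \<in> RR" for j k
    using mm_in_subring[OF RR_subring XY_RR] is_subringD(1,2)[OF RR_subring] by (auto simp: unit_mat_def)
  have rel: "mm n Xm Ym j k - unit_mat n j k \<in> N" for j k using N_rels by (simp add: inverse_rels_def)
  have "det (Mx * My) - det (1\<^sub>m n) \<in> N"
    by (rule det_cong_ideal[OF RR_subring Q.N_ideal]) (use X(1) Y(1) XY one mmRR rel in auto)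
  then have d: "det Mx * det My - 1 \<in> N" by (simp add: det_mult[OF X(1) Y(1)])
  show "det Mx \<in> Q.Reg"
  proof (rule Q.RegI[OF dX])
    fix x assume x: "x \<in> RR" "x * det Mx \<in> N"
    have "det My * (x * det Mx) - x * (det Mx * det My - 1) \<in> N"
      by (rule Q.N(7)[OF Q.N(4)[OF dY x(2)] Q.N(4)[OF x(1) d]])
    then show "x \<in> N" by (simp add: algebra_simps)
  qed
  assume jk: "j < n" "k < n"
  define P where "P = (\<lambda>j k. adj_mat Mx $$ (j, k))"
  have adjX: "adj_mat Mx \<in> carrier_mat n n" using adj_mat(1)[OF X(1)] .
  have P: "P j l \<in> RR" if "l < n" for l
    unfolding P_def using adj_mat_in_subring[OF RR_subring X(1) _ jk(1) that] X(2) XY_RR by auto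
  have "(adj_mat Mx * Mx) * My = det Mx \<cdot>\<^sub>m My"
    unfolding adj_mat(3)[OF X(1)] using Y(1) by (simp add: mult_smult_assoc_mat[of _ n n])
  then have "(adj_mat Mx * (Mx * My)) $$ (j, k) = det Mx * Ym j k"
    using assoc_mult_mat[OF adjX X(1) Y(1)] Y jk by simp
  moreover have "(adj_mat Mx * (Mx * My)) $$ (j, k) = (\<Sum>l<n. P j l * mm n Xm Ym l k)"
    using jk X(1) Y(1) adjX XY by (simp add: scalar_prod_def P_def atLeast0LessThan)
  ultimately have "det Mx * Ym j k = (\<Sum>l<n. P j l * mm n Xm Ym l k)" by simp
  moreover have "P j k = (\<Sum>l<n. P j l * unit_mat n l k)"
    using jk by (simp add: unit_mat_def if_distrib[of "\<lambda>x. _ * x"] cong: if_cong)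
  ultimately have "det Mx * Ym j k - P j k = (\<Sum>l<n. P j l * (mm n Xm Ym l k - unit_mat n l k))"
    by (simp add: sum_subtractf right_diff_distrib)
  also have "\<dots> \<in> N" by (intro is_ideal_sum[OF Q.N_ideal] Q.N(4) P rel) auto
  finally have "- (det Mx * Ym j k - P j k) \<in> N" by (rule Q.N(6))
  then show "adj_mat Mx $$ (j, k) - det Mx * Ym j k \<in> N" by (simp add: P_def)
qed

text \<open>The cofactors of \<open>X\<close> and the inverse of its determinant give
  \<open>Y\<close>. Closure under \<open>pard\<close> adds all derivatives, hence all of
  \<open>RR\<close>; regular elements become units in the ring of fractions, so closure under
  inverses yields every fraction.\<close>

lemma generated:
  assumes T: "subring T Q.Lr" "range (\<lambda>c. cl (mconst c)) \<subseteq> T" "pard Q.Lr ` T \<subseteq> T" "elements_mat Zm \<subseteq> T"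
    "\<And>x. x \<in> T \<Longrightarrow> x \<in> Units Q.Lr \<Longrightarrow> inv\<^bsub>Q.Lr\<^esub> x \<in> T"
  shows "carrier Q.Lr \<subseteq> T"
proof -
  interpret L: cring Q.Lr by (rule Q.Lr_cring)
  note TT = subringE[OF T(1)]
  let ?T = "{a \<in> RR. cl a \<in> T}"
  have sub: "is_subring ?T"
    unfolding is_subring_def
  proof (intro conjI ballI)
    show "1 \<in> ?T" using TT(3) is_subringD(2)[OF RR_subring] by (simp add: cl_01)
    fix a b assume "a \<in> ?T" "b \<in> ?T"
    then have ab: "a \<in> RR" "b \<in> RR" "cl a \<in> T" "cl b \<in> T" by auto
    have m1: "cl (- 1) \<in> T" using T(2) mconst_simps \<iota>_simps(5)[of 1] by (metis rangeI subsetD)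
    have "- 1 \<in> RR" using is_subringD(2,3)[OF RR_subring] by blast
    then have "cl (a + (- 1) * b) \<in> T"
      using ab TT(6,7) m1 is_subringD(6)[OF RR_subring] by (metis cl_add cl_mult)
    then show "a - b \<in> ?T" using ab is_subringD(5)[OF RR_subring] by simp
    show "a * b \<in> ?T" using ab TT(6) cl_mult is_subringD(6)[OF RR_subring] by fastforce
  qed
  have par: "a \<in> ?T \<Longrightarrow> par a \<in> ?T" for a using T(3) cl_pard par_RR by fastforce
  have pow: "a \<in> ?T \<Longrightarrow> (par ^^ i) a \<in> ?T" for a i by (induction i) (use par in auto)
  have X: "Xm j k \<in> ?T" if "j < n" "k < n" for j k
  proof -
    have "cl (Xm j k) \<in> elements_mat Zm" using that by (force simp: Zm_def elements_mat_def)
    then show ?thesis using T(4) XY_RR by auto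
  qed
  have inv: "q (1, s) \<in> T" if s: "s \<in> Q.Reg" "cl s \<in> T" for s
  proof -
    have "cl s \<otimes>\<^bsub>Q.Lr\<^esub> q (1, s) = \<one>\<^bsub>Q.Lr\<^esub>" "cl s \<in> Units Q.Lr"
      using Q.Lr_inverse[OF s(1) Q.Reg_1] by (simp_all add: cl_def)
    moreover have "q (1, s) \<in> carrier Q.Lr" "cl s \<in> carrier Q.Lr"
      using Q.q_Lc[OF is_subringD(2)[OF RR_subring] s(1)] cl_Lr Q.RegD(1)[OF s(1)] by (simp_all add: Q.Lr_simps)
    ultimately show ?thesis using T(5)[OF s(2)] L.comm_inv_char by metis
  qed
  have Y: "Ym j k \<in> ?T" if jk: "j < n" "k < n" for j k
  proof -
    define M where "M = mat n n (\<lambda>(j, k). Xm j k)"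
    have M: "M \<in> carrier_mat n n" "\<And>j k. j < n \<Longrightarrow> k < n \<Longrightarrow> M $$ (j, k) \<in> ?T" using X by (auto simp: M_def)
    have d: "det M \<in> Q.Reg" "adj_mat M $$ (j, k) - det M * Ym j k \<in> N" using det_X jk by (simp_all add: M_def)
    have dT: "det M \<in> ?T" and aT: "adj_mat M $$ (j, k) \<in> ?T"
      using det_in_subring[OF sub M] adj_mat_in_subring[OF sub M jk] by auto
    have "cl (Ym j k) = q (adj_mat M $$ (j, k), det M)"
      using q_eq[of "adj_mat M $$ (j, k)" "det M" "Ym j k" 1] d aT XY_RR Q.Reg_1 by (simp add: cl_def mult.commute)
    also have "\<dots> = cl (adj_mat M $$ (j, k)) \<otimes>\<^bsub>Q.Lr\<^esub> q (1, det M)"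
      using Q.Lr_mult[OF _ Q.Reg_1 is_subringD(2)[OF RR_subring] d(1)] aT by (simp add: cl_def)
    also have "\<dots> \<in> T" using TT(6) inv d(1) dT aT by blast
    finally show ?thesis using XY_RR by simp
  qed
  have "RR \<subseteq> ?T"
  proof (rule RR_least[OF sub])
    show "range mconst \<subseteq> ?T" using T(2) mconst_RR by auto
    fix b j k i assume jk: "j < n" "k < n"
    have "mvar (b, j, k, 0) \<in> ?T" using X[OF jk] Y[OF jk] jk by (cases b) (simp_all add: Xm_def Ym_def)
    from pow[OF this, of i] show "mvar (b, j, k, i) \<in> ?T" by (simp only: mvar_par)
  qed
  then have cT: "cl a \<in> T" if "a \<in> RR" for a using that by blast
  show ?thesis
  proof
    fix x assume "x \<in> carrier Q.Lr"
    then obtain a s where a: "a \<in> RR" "s \<in> Q.Reg" "x = q (a, s)" unfolding Q.Lr_simps by (metis Q.Lc_cases)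
    have "x = cl a \<otimes>\<^bsub>Q.Lr\<^esub> q (1, s)"
      using Q.Lr_mult[OF a(1) Q.Reg_1 is_subringD(2)[OF RR_subring] a(2)] a by (simp add: cl_def)
    then show "x \<in> T" using TT(6) inv[OF a(2)] cT a Q.RegD(1) by blast
  qed
qed

end

section \<open>Fractions coded in a given type\<close>

context const_ring
begin

text \<open>Each class of fractions receives the code of a chosen member. Transitivity of the
  equivalence cancels the middle denominator, which is regular.\<close>

lemma frac_code_exists:
  assumes g: "inj (g :: 'r \<times> 'r \<Rightarrow> 'a)"
  shows "\<exists>q :: 'r \<times> 'r \<Rightarrow> 'a. \<forall>a\<in>B. \<forall>s\<in>Reg. \<forall>b\<in>B. \<forall>t\<in>Reg. q (a, s) = q (b, t) \<longleftrightarrow> a * t - b * s \<in> N"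
proof -
  define E where "E = (\<lambda>(a, s) (b, t). a * t - b * s \<in> N)"
  have sym: "E y x" if "E x y" for x y
  proof -
    obtain a s b t where [simp]: "x = (a, s)" "y = (b, t)" by (metis surj_pair)
    have "- (a * t - b * s) \<in> N" by (rule N(6)) (use \<open>E x y\<close> in \<open>simp add: E_def\<close>)
    then show ?thesis by (simp add: E_def)
  qed
  have trans: "E x z" if x: "x \<in> B \<times> Reg" and y: "y \<in> B \<times> Reg" and z: "z \<in> B \<times> Reg" and xy: "E x y" and yz: "E y z"
    for x y z
  proof -
    obtain a s b t c r where [simp]: "x = (a, s)" "y = (b, t)" "z = (c, r)" by (metis surj_pair)
    have m: "a \<in> B" "s \<in> B" "t \<in> Reg" "c \<in> B" "r \<in> B" using x y z RegD(1) by auto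
    have 1: "a * t - b * s \<in> N" and 2: "b * r - c * t \<in> N" using xy yz by (simp_all add: E_def)
    have "r * (a * t - b * s) + s * (b * r - c * t) \<in> N"
      by (rule N(3)[OF N(4)[OF m(5) 1] N(4)[OF m(2) 2]])
    then have "(a * r - c * s) * t \<in> N" by (simp add: algebra_simps)
    then show ?thesis
      using RegD(2)[OF m(3) B(5)[OF B(6)[OF m(1,5)] B(6)[OF m(4,2)]]] by (simp add: E_def)
  qed
  have refl: "E x x" for x using N(2) by (simp add: E_def split: prod.splits)
  define q where "q x = g (SOME z. z \<in> B \<times> Reg \<and> E z x)" for x
  have "q x = q y \<longleftrightarrow> E x y" if x: "x \<in> B \<times> Reg" and y: "y \<in> B \<times> Reg" for x y
  proof
    assume "E x y"
    then have "(z \<in> B \<times> Reg \<and> E z x) = (z \<in> B \<times> Reg \<and> E z y)" for z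
      using trans[of z x y] trans[of z y x] sym x y by blast
    then show "q x = q y" by (simp add: q_def)
  next
    assume eq: "q x = q y"
    have "\<exists>z. z \<in> B \<times> Reg \<and> E z w" if "w \<in> B \<times> Reg" for w using that refl by blast
    note s = someI_ex[OF this]
    from eq have "(SOME z. z \<in> B \<times> Reg \<and> E z x) = (SOME z. z \<in> B \<times> Reg \<and> E z y)"
      using g by (auto simp: q_def dest: injD)
    then obtain z where "z \<in> B \<times> Reg" "E z x" "E z y" using s[OF x] s[OF y] by metis
    then show "E x y" using trans[of x z y] sym x y by blast
  qed
  then have "\<forall>a\<in>B. \<forall>s\<in>Reg. \<forall>b\<in>B. \<forall>t\<in>Reg. q (a, s) = q (b, t) \<longleftrightarrow> a * t - b * s \<in> N"
    by (simp add: E_def)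
  then show ?thesis by blast
qed

end

text \<open>The content of \<open>picard_vessiot\<close>, with a homomorphism
  \<open>\<theta>\<close> from the field type in place of a structure \<open>K\<close>; the target
  is any type into which pairs of polynomials inject.\<close>

theorem (in linear_sys_closed) pv_exists:
  assumes surj: "\<And>s. s \<in> S \<Longrightarrow> surj (shk s)" and g: "inj (g :: 'c dpol \<times> 'c dpol \<Rightarrow> 'e)"
  shows "\<exists>(L :: ('e, 'a, 'b) sdp_struct) \<theta> Z.
    pseudo_field S D L \<and> range \<theta> \<subseteq> carrier L \<and> \<theta> 1 = \<one>\<^bsub>L\<^esub> \<and>
    (\<forall>a b. \<theta> (a + b) = \<theta> a \<oplus>\<^bsub>L\<^esub> \<theta> b \<and> \<theta> (a * b) = \<theta> a \<otimes>\<^bsub>L\<^esub> \<theta> b) \<and>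
    (\<forall>a. (\<forall>s\<in>S. \<theta> (shk s a) = shift L s (\<theta> a)) \<and> (\<forall>d\<in>D. \<theta> (dlk d a) = deltad L d (\<theta> a)) \<and>
      \<theta> (pk a) = pard L (\<theta> a)) \<and>
    Z \<in> GL n L \<and>
    (\<forall>s\<in>S. map_mat (shift L s) Z = mat n n (\<lambda>(j, k). \<theta> (Am s j k)) \<otimes>\<^bsub>mat_ring L n\<^esub> Z) \<and>
    (\<forall>d\<in>D. map_mat (deltad L d) Z = mat n n (\<lambda>(j, k). \<theta> (Bm d j k)) \<otimes>\<^bsub>mat_ring L n\<^esub> Z) \<and>
    (\<forall>T. subring T L \<longrightarrow> range \<theta> \<subseteq> T \<longrightarrow> pard L ` T \<subseteq> T \<longrightarrow> elements_mat Z \<subseteq> T \<longrightarrow>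
      (\<forall>x\<in>T \<inter> Units L. inv\<^bsub>L\<^esub> x \<in> T) \<longrightarrow> carrier L \<subseteq> T) \<and>
    sd_constants S D L = \<theta> ` C"
proof -
  obtain N u where Nu: "max_stable RR N" "constants_only RR N" "inverse_rels N" "\<forall>f\<in>N. par f \<in> N"
    "u \<in> RR" "u \<notin> N" "prime_ann RR N u"
    using universal_ideal by blast
  interpret P: pv_construction S D shk dlk pk n Am Ai Bm N u
    by unfold_locales (use Nu surj in auto)
  obtain q :: "'c dpol \<times> 'c dpol \<Rightarrow> 'e"
    where q: "\<forall>a\<in>RR. \<forall>s\<in>P.Q.Reg. \<forall>b\<in>RR. \<forall>t\<in>P.Q.Reg. q (a, s) = q (b, t) \<longleftrightarrow> a * t - b * s \<in> N"
    using P.Q.frac_code_exists[OF g] by blast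
  interpret F: pv_fractions S D shk dlk pk n Am Ai Bm N u q
    by unfold_locales (use q in blast)
  let ?\<theta> = "\<lambda>c. F.cl (mconst c)"
  have p: "range ?\<theta> \<subseteq> carrier F.Q.Lr" "?\<theta> 1 = \<one>\<^bsub>F.Q.Lr\<^esub>"
    "\<forall>a b. ?\<theta> (a + b) = ?\<theta> a \<oplus>\<^bsub>F.Q.Lr\<^esub> ?\<theta> b \<and> ?\<theta> (a * b) = ?\<theta> a \<otimes>\<^bsub>F.Q.Lr\<^esub> ?\<theta> b"
    "\<forall>a. (\<forall>s\<in>S. ?\<theta> (shk s a) = shift F.Q.Lr s (?\<theta> a)) \<and> (\<forall>d\<in>D. ?\<theta> (dlk d a) = deltad F.Q.Lr d (?\<theta> a)) \<and>
      ?\<theta> (pk a) = pard F.Q.Lr (?\<theta> a)"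
    using F.cl_Lr mconst_RR
    by (auto simp: F.cl_01 F.cl_add F.cl_mult mconst_simps F.cl_shift F.cl_deltad F.cl_pard sh_const dl_const par_const)
  have c: "F.cmat (cm M) = mat n n (\<lambda>(j, k). ?\<theta> (M j k))" for M by (simp only: map_entries_def)
  show ?thesis
  proof (rule exI[of _ F.Q.Lr], rule exI[of _ ?\<theta>], rule exI[of _ F.Zm], intro conjI)
    show "\<forall>s\<in>S. map_mat (shift F.Q.Lr s) F.Zm = mat n n (\<lambda>(j, k). ?\<theta> (Am s j k)) \<otimes>\<^bsub>mat_ring F.Q.Lr n\<^esub> F.Zm"
      unfolding c[symmetric] using F.Zm_shift by blast
    show "\<forall>d\<in>D. map_mat (deltad F.Q.Lr d) F.Zm = mat n n (\<lambda>(j, k). ?\<theta> (Bm d j k)) \<otimes>\<^bsub>mat_ring F.Q.Lr n\<^esub> F.Zm"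
      unfolding c[symmetric] using F.Zm_deltad by blast
    show "\<forall>T. subring T F.Q.Lr \<longrightarrow> range ?\<theta> \<subseteq> T \<longrightarrow> pard F.Q.Lr ` T \<subseteq> T \<longrightarrow> elements_mat F.Zm \<subseteq> T \<longrightarrow>
      (\<forall>x\<in>T \<inter> Units F.Q.Lr. inv\<^bsub>F.Q.Lr\<^esub> x \<in> T) \<longrightarrow> carrier F.Q.Lr \<subseteq> T"
    proof (intro allI impI)
      fix T assume "subring T F.Q.Lr" "range ?\<theta> \<subseteq> T" "pard F.Q.Lr ` T \<subseteq> T" "elements_mat F.Zm \<subseteq> T"
        and inv: "\<forall>x\<in>T \<inter> Units F.Q.Lr. inv\<^bsub>F.Q.Lr\<^esub> x \<in> T"
      then show "carrier F.Q.Lr \<subseteq> T" by (intro F.generated) (assumption | use inv in blast)+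
    qed
    show "sd_constants S D F.Q.Lr = ?\<theta> ` C" using F.Q.Lr_constants by (simp only: F.cl_def)
  qed (rule F.Q.Lr_pseudo_field F.Zm_GL p)+
qed

section \<open>Cardinality\<close>

text \<open>The extension has to live in the type of \<open>K\<close>, so polynomials must be coded
  by field elements. Lists are the intermediate step.\<close>

lemma inj_list:
  assumes f: "inj (f :: 'k \<times> 'k \<Rightarrow> 'k)" and i: "inj (i :: nat \<Rightarrow> 'k)" and c: "inj (c :: 'b \<Rightarrow> 'k)"
  shows "\<exists>h :: 'b list \<Rightarrow> 'k. inj h"
proof -
  \<comment> \<open>For a given length the nested pairs determine the list. The length is recorded
    separately, since the code of the empty list may also be the code of a pair.\<close>
  define e where "e l = foldr (\<lambda>x y. f (c x, y)) l (i 0)" for l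
  have e: "length l = length l' \<Longrightarrow> e l = e l' \<Longrightarrow> l = l'" for l l'
    by (induction l l' rule: list_induct2) (auto simp: e_def dest!: injD[OF f] injD[OF c])
  have "inj (\<lambda>l. f (i (length l), e l))"
    using e by (auto intro!: injI dest!: injD[OF f] injD[OF i])
  then show ?thesis by blast
qed

text \<open>A finitely supported function is determined by its graph over the support, a finite set
  that can be listed and coded.\<close>

lemma inj_poly_mapping:
  assumes f: "inj (f :: 'k \<times> 'k \<Rightarrow> 'k)" and i: "inj (i :: nat \<Rightarrow> 'k)"
    and c: "inj (c :: 'v \<Rightarrow> 'k)" and d: "inj (d :: 'b::zero \<Rightarrow> 'k)"
  shows "\<exists>h :: ('v \<Rightarrow>\<^sub>0 'b) \<Rightarrow> 'k. inj h"
proof -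
  define G where "G p = (\<lambda>x. (x, Poly_Mapping.lookup p x)) ` Poly_Mapping.keys p" for p :: "'v \<Rightarrow>\<^sub>0 'b"
  have G: "G p = G p' \<Longrightarrow> p = p'" for p p'
  proof (rule poly_mapping_eqI)
    fix x assume eq: "G p = G p'"
    have "(x, y) \<in> G p \<longleftrightarrow> y = Poly_Mapping.lookup p x \<and> y \<noteq> 0" for y p
      by (auto simp: G_def in_keys_iff)
    then show "Poly_Mapping.lookup p x = Poly_Mapping.lookup p' x" using eq by metis
  qed
  have "finite (G p)" for p by (simp add: G_def)
  then have l: "set (SOME l. set l = G p) = G p" for p using someI_ex[OF finite_list] by blast
  have "inj (\<lambda>p. SOME l. set l = G p)"
  proof (rule injI)
    fix p p' assume "(SOME l. set l = G p) = (SOME l. set l = G p')"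
    from arg_cong[OF this, of set] show "p = p'" unfolding l by (rule G)
  qed
  moreover have "inj (\<lambda>(x, y). f (c x, d y))"
    by (auto intro!: injI dest!: injD[OF f] injD[OF c] injD[OF d])
  then obtain h :: "('v \<times> 'b) list \<Rightarrow> 'k" where "inj h" using inj_list[OF f i] by blast
  ultimately have "inj (h \<circ> (\<lambda>p. SOME l. set l = G p))" by (intro inj_compose)
  then show ?thesis by blast
qed

text \<open>An infinite field has the cardinality of its square, so polynomials over it in countably
  many variables are no more numerous than its elements.\<close>

lemma inj_dpol_pair: "\<exists>g :: 'k::field_char_0 dpol \<times> 'k dpol \<Rightarrow> 'k. inj g"
proof -
  have i: "inj (of_nat :: nat \<Rightarrow> 'k)" by (simp add: inj_on_def)
  then have "infinite (UNIV :: 'k set)" using finite_subset[OF subset_UNIV] range_inj_infinite by blast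
  then have "(card_of ((UNIV :: 'k set) \<times> (UNIV :: 'k set)), card_of (UNIV :: 'k set)) \<in> ordLeq"
    using card_of_Times_same_infinite ordIso_imp_ordLeq by blast
  then obtain f :: "'k \<times> 'k \<Rightarrow> 'k" where f: "inj f" unfolding card_of_ordLeq[symmetric] by auto
  have v: "inj (\<lambda>x :: bool \<times> nat \<times> nat \<times> nat. of_nat (to_nat x) :: 'k)"
    using inj_to_nat i by (auto intro!: injI dest!: injD)
  obtain m :: "((bool \<times> nat \<times> nat \<times> nat) \<Rightarrow>\<^sub>0 nat) \<Rightarrow> 'k" where m: "inj m"
    using inj_poly_mapping[OF f i v i] by blast
  obtain p :: "'k dpol \<Rightarrow> 'k" where p: "inj p"
    using inj_poly_mapping[OF f i m, of "\<lambda>x. x"] by auto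
  have "inj (\<lambda>(x, y). f (p x, p y))" by (auto intro!: injI dest!: injD[OF f] injD[OF p])
  then show ?thesis by blast
qed

section \<open>Transfer to the given field\<close>

text \<open>\<open>e\<close> is an isomorphism from a field that is a type onto the field
  \<open>K\<close> that is given by a carrier.\<close>

locale sdp_field_copy = sdp_field S D K
  for S :: "'s set" and D :: "'d set" and K :: "('a, 's, 'd) sdp_struct" (structure) +
  fixes e :: "'k::field_char_0 \<Rightarrow> 'a"
  assumes e_bij: "bij_betw e UNIV (carrier K)" and e_1: "e 1 = \<one>"
    and e_add: "e (a + b) = e a \<oplus> e b" and e_mult: "e (a * b) = e a \<otimes> e b"
begin

definition r :: "'a \<Rightarrow> 'k" where
  "r = inv_into UNIV e"

lemma e_inj: "e a = e b \<longleftrightarrow> a = b"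
  using e_bij by (auto simp: bij_betw_def dest: injD)

lemma e_carrier [simp]: "e a \<in> carrier K"
  using e_bij by (auto simp: bij_betw_def)

lemma e_r: "x \<in> carrier K \<Longrightarrow> e (r x) = x"
  using e_bij unfolding r_def by (auto simp: bij_betw_def f_inv_into_f)

lemma r_e: "r (e a) = a"
  using e_r[OF e_carrier] e_inj by blast

lemma e_0: "e 0 = \<zero>"
  using e_add[of 0 0] add.l_cancel_one'[of "e 0" "e 0"] by simp

lemma e_sum: "finite J \<Longrightarrow> e (sum f J) = (\<Oplus>k\<in>J. e (f k))"
  by (induction J rule: finite_induct) (auto simp: e_0 e_add)

definition shk :: "'s \<Rightarrow> 'k \<Rightarrow> 'k" where "shk s a = r (shift K s (e a))"
definition dlk :: "'d \<Rightarrow> 'k \<Rightarrow> 'k" where "dlk d a = r (deltad K d (e a))"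
definition pk :: "'k \<Rightarrow> 'k" where "pk a = r (pard K (e a))"

lemma shift_hom: "s \<in> S \<Longrightarrow> shift K s \<in> Ring.ring_hom K K" and shift_bij: "s \<in> S \<Longrightarrow> bij_betw (shift K s) (carrier K) (carrier K)"
  using shift_auto by (auto simp: ring_iso_def)

lemma derivationD:
  assumes "derivation K d"
  shows "x \<in> carrier K \<Longrightarrow> d x \<in> carrier K" "x \<in> carrier K \<Longrightarrow> y \<in> carrier K \<Longrightarrow> d (x \<oplus> y) = d x \<oplus> d y"
    "x \<in> carrier K \<Longrightarrow> y \<in> carrier K \<Longrightarrow> d (x \<otimes> y) = (d x \<otimes> y) \<oplus> (x \<otimes> d y)"
  using assms by (auto simp: derivation_def)

lemma e_shk: "s \<in> S \<Longrightarrow> e (shk s a) = shift K s (e a)"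
  using ring_hom_closed[OF shift_hom] by (simp add: shk_def e_r)

lemma e_dlk: "d \<in> D \<Longrightarrow> e (dlk d a) = deltad K d (e a)"
  using derivationD(1)[OF deltad_derivation] by (simp add: dlk_def e_r)

lemma e_pk: "e (pk a) = pard K (e a)"
  using derivationD(1)[OF pard_derivation] by (simp add: pk_def e_r)

lemma shk_surj: "s \<in> S \<Longrightarrow> surj (shk s)"
proof -
  assume s: "s \<in> S"
  have "\<exists>a. shk s a = b" for b
  proof -
    have "e b \<in> shift K s ` carrier K" using shift_bij[OF s] e_carrier[of b] by (simp add: bij_betw_def)
    then obtain x where x: "x \<in> carrier K" "shift K s x = e b" by auto
    then have "e (shk s (r x)) = e b" by (simp add: e_shk[OF s] e_r)
    then show ?thesis using e_inj by blast
  qed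
  then show ?thesis by (metis surjI)
qed

lemma shk_on: "s \<in> S \<Longrightarrow> hom_on UNIV (shk s)"
  unfolding hom_on_def e_inj[symmetric]
  by (simp add: e_shk e_1 e_add e_mult ring_hom_one[OF shift_hom] ring_hom_add[OF shift_hom] ring_hom_mult[OF shift_hom])

lemma dlk_on: "d \<in> D \<Longrightarrow> is_deriv (dlk d)"
  unfolding is_deriv_def e_inj[symmetric]
  by (simp add: e_dlk e_add e_mult derivationD(2,3)[OF deltad_derivation])

lemma pk_on: "is_deriv pk"
  unfolding is_deriv_def e_inj[symmetric]
  by (simp add: e_pk e_add e_mult derivationD(2,3)[OF pard_derivation])

lemma operators_commute:
  "s \<in> S \<Longrightarrow> t \<in> S \<Longrightarrow> shk s (shk t c) = shk t (shk s c)" "s \<in> S \<Longrightarrow> d \<in> D \<Longrightarrow> shk s (dlk d c) = dlk d (shk s c)"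
  "s \<in> S \<Longrightarrow> shk s (pk c) = pk (shk s c)" "d \<in> D \<Longrightarrow> d' \<in> D \<Longrightarrow> dlk d (dlk d' c) = dlk d' (dlk d c)"
  "d \<in> D \<Longrightarrow> dlk d (pk c) = pk (dlk d c)"
  unfolding e_inj[symmetric]
  by (simp_all only: e_shk e_dlk e_pk shift_shift[OF _ _ e_carrier] shift_deltad[OF _ _ e_carrier] shift_pard[OF _ e_carrier]
      deltad_deltad[OF _ _ e_carrier] deltad_pard[OF _ e_carrier])

definition re :: "nat \<Rightarrow> 'a mat \<Rightarrow> nat \<Rightarrow> nat \<Rightarrow> 'k" where
  "re m M = (\<lambda>j k. if j < m \<and> k < m then r (M $$ (j, k)) else 0)"

lemma re_supported: "supported m (re m M)"
  by (simp add: supported_def re_def)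

lemma mat_carrier:
  assumes "M \<in> carrier (mat_ring K m)"
  shows "M \<in> carrier_mat m m" "j < m \<Longrightarrow> k < m \<Longrightarrow> M $$ (j, k) \<in> carrier K"
  using assms elements_matI[of M m m j k "M $$ (j, k)"] by (auto simp: mat_ring_def)

lemma e_re: "M \<in> carrier (mat_ring K m) \<Longrightarrow> j < m \<Longrightarrow> k < m \<Longrightarrow> e (re m M j k) = M $$ (j, k)"
  using mat_carrier(2) by (simp add: re_def e_r)

lemma re_eqI:
  assumes "supported m M" "\<And>j k. j < m \<Longrightarrow> k < m \<Longrightarrow> r (P $$ (j, k)) = M j k"
  shows "re m P = M"
  using assms by (auto simp: re_def supported_def fun_eq_iff)

lemma r_eqI: "e a = x \<Longrightarrow> r x = a"
  using r_e by blast

lemma re_mult: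
  assumes M: "M \<in> carrier (mat_ring K m)" and P: "P \<in> carrier (mat_ring K m)"
  shows "re m (M \<otimes>\<^bsub>mat_ring K m\<^esub> P) = mm m (re m M) (re m P)"
proof (rule re_eqI[OF supported_mm[OF re_supported re_supported]], rule r_eqI)
  fix j k assume jk: "j < m" "k < m"
  have "e (mm m (re m M) (re m P) j k) = (\<Oplus>l\<in>{..<m}. e (re m M j l) \<otimes> e (re m P l k))"
    by (simp add: mm_def e_sum e_mult)
  also have "\<dots> = (\<Oplus>l\<in>{..<m}. M $$ (j, l) \<otimes> P $$ (l, k))"
    using jk by (intro finsum_cong') (auto simp: e_re[OF M] e_re[OF P] mat_carrier(2)[OF M] mat_carrier(2)[OF P])
  finally show "e (mm m (re m M) (re m P) j k) = (M \<otimes>\<^bsub>mat_ring K m\<^esub> P) $$ (j, k)"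
    using jk by (simp add: mat_ring_def)
qed

lemma re_one: "re m \<one>\<^bsub>mat_ring K m\<^esub> = unit_mat m"
  by (rule re_eqI) (auto simp: mat_ring_def unit_mat_def supported_def e_0 e_1 intro!: r_eqI)

lemma re_add:
  assumes M: "M \<in> carrier (mat_ring K m)" and P: "P \<in> carrier (mat_ring K m)"
  shows "re m (M \<oplus>\<^bsub>mat_ring K m\<^esub> P) = (\<lambda>j k. re m M j k + re m P j k)"
proof (rule re_eqI)
  show "r ((M \<oplus>\<^bsub>mat_ring K m\<^esub> P) $$ (j, k)) = re m M j k + re m P j k" if "j < m" "k < m" for j k
    using that by (intro r_eqI) (simp add: e_add e_re[OF M] e_re[OF P], simp add: mat_ring_def)
qed (simp add: supported_def re_def)

lemma mult_closed: "M \<in> carrier (mat_ring K m) \<Longrightarrow> P \<in> carrier (mat_ring K m) \<Longrightarrow> M \<otimes>\<^bsub>mat_ring K m\<^esub> P \<in> carrier (mat_ring K m)"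
proof -
  assume M: "M \<in> carrier (mat_ring K m)" and P: "P \<in> carrier (mat_ring K m)"
  show ?thesis
    unfolding mat_ring_def using mat_carrier(2)[OF M] mat_carrier(2)[OF P]
    by (auto simp: elements_mat_def intro!: finsum_closed)
qed

lemma map_closed: "M \<in> carrier (mat_ring K m) \<Longrightarrow> (\<And>x. x \<in> carrier K \<Longrightarrow> f x \<in> carrier K) \<Longrightarrow> map_mat f M \<in> carrier (mat_ring K m)"
  by (auto simp: mat_ring_def)

lemma re_map:
  assumes "M \<in> carrier (mat_ring K m)" "\<And>x. x \<in> carrier K \<Longrightarrow> f x \<in> carrier K" "f \<zero> = \<zero>" "\<And>a. e (g a) = f (e a)"
  shows "re m (map_mat f M) = map_entries g (re m M)"
proof (rule re_eqI)
  have "g 0 = 0" using assms(3,4) e_0 e_inj by metis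
  then show "supported m (map_entries g (re m M))" by (simp add: supported_def map_entries_def re_def)
  show "r (map_mat f M $$ (j, k)) = map_entries g (re m M) j k" if "j < m" "k < m" for j k
    using that mat_carrier(1)[OF assms(1)] by (intro r_eqI) (simp add: map_entries_def assms(4) e_re[OF assms(1)])
qed

lemma re_shift: "s \<in> S \<Longrightarrow> M \<in> carrier (mat_ring K m) \<Longrightarrow> re m (map_mat (shift K s) M) = map_entries (shk s) (re m M)"
  using ring_hom_closed[OF shift_hom] ring_hom_zero[OF shift_hom ring_axioms ring_axioms] e_shk by (intro re_map) auto

lemma derivation_zero: "derivation K d \<Longrightarrow> d \<zero> = \<zero>"
  using derivationD(2)[of d \<zero> \<zero>] derivationD(1)[of d \<zero>] add.l_cancel_one'[of "d \<zero>" "d \<zero>"] by simp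

lemma re_deltad: "d \<in> D \<Longrightarrow> M \<in> carrier (mat_ring K m) \<Longrightarrow> re m (map_mat (deltad K d) M) = map_entries (dlk d) (re m M)"
  using derivationD(1)[OF deltad_derivation] derivation_zero[OF deltad_derivation] e_dlk by (intro re_map) auto

lemma linear_sys_copy:
  assumes sys: "linear_system S D K n A B"
  shows "\<exists>Ai. linear_sys S D shk dlk pk n (\<lambda>s. re n (A s)) Ai (\<lambda>d. re n (B d))"
proof -
  let ?M = "mat_ring K n"
  have A: "\<And>s. s \<in> S \<Longrightarrow> A s \<in> GL n K" and B: "\<And>d. d \<in> D \<Longrightarrow> B d \<in> carrier ?M"
    using sys by (auto simp: linear_system_def)
  have Ac: "A s \<in> carrier ?M" if "s \<in> S" for s using A[OF that] by (auto simp: Units_def)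
  have "\<forall>s. \<exists>P. s \<in> S \<longrightarrow> P \<in> carrier ?M \<and> P \<otimes>\<^bsub>?M\<^esub> A s = \<one>\<^bsub>?M\<^esub> \<and> A s \<otimes>\<^bsub>?M\<^esub> P = \<one>\<^bsub>?M\<^esub>"
    using A by (auto simp: Units_def)
  then obtain P where P: "\<And>s. s \<in> S \<Longrightarrow> P s \<in> carrier ?M \<and> P s \<otimes>\<^bsub>?M\<^esub> A s = \<one>\<^bsub>?M\<^esub> \<and> A s \<otimes>\<^bsub>?M\<^esub> P s = \<one>\<^bsub>?M\<^esub>"
    by metis
  have sc: "map_mat (shift K s) M \<in> carrier ?M" if "s \<in> S" "M \<in> carrier ?M" for s M
    using map_closed[OF that(2)] ring_hom_closed[OF shift_hom[OF that(1)]] by blast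
  have dc: "map_mat (deltad K d) M \<in> carrier ?M" if "d \<in> D" "M \<in> carrier ?M" for d M
    using map_closed[OF that(2)] derivationD(1)[OF deltad_derivation[OF that(1)]] by blast
  have "linear_sys S D shk dlk pk n (\<lambda>s. re n (A s)) (\<lambda>s. re n (P s)) (\<lambda>d. re n (B d))"
  proof unfold_locales
    show "mm n (re n (A s)) (re n (P s)) = unit_mat n" "mm n (re n (P s)) (re n (A s)) = unit_mat n" if "s \<in> S" for s
      using P[OF that] Ac[OF that] re_mult re_one by metis+
    show "mm n (map_entries (shk s) (re n (A t))) (re n (A s)) = mm n (map_entries (shk t) (re n (A s))) (re n (A t))"
      if "s \<in> S" "t \<in> S" for s t
    proof -
      have "map_mat (shift K s) (A t) \<otimes>\<^bsub>?M\<^esub> A s = map_mat (shift K t) (A s) \<otimes>\<^bsub>?M\<^esub> A t"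
        using sys that by (auto simp: linear_system_def)
      from arg_cong[OF this, of "re n"] show ?thesis
        using that by (simp add: re_mult sc Ac re_shift)
    qed
    show "mm n (map_entries (shk s) (re n (B d))) (re n (A s)) =
        (\<lambda>j k. dlk d (re n (A s) j k) + mm n (re n (A s)) (re n (B d)) j k)" if "s \<in> S" "d \<in> D" for s d
    proof -
      have "map_mat (shift K s) (B d) \<otimes>\<^bsub>?M\<^esub> A s = map_mat (deltad K d) (A s) \<oplus>\<^bsub>?M\<^esub> (A s \<otimes>\<^bsub>?M\<^esub> B d)"
        using sys that by (auto simp: linear_system_def)
      from arg_cong[OF this, of "re n"] show ?thesis
        using that by (simp add: re_mult re_add mult_closed sc dc Ac B re_shift re_deltad map_entries_def)
    qed
    show "(\<lambda>j k. dlk d (re n (B d') j k) + mm n (re n (B d')) (re n (B d)) j k) =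
        (\<lambda>j k. dlk d' (re n (B d) j k) + mm n (re n (B d)) (re n (B d')) j k)" if "d \<in> D" "d' \<in> D" for d d'
    proof -
      have "map_mat (deltad K d) (B d') \<oplus>\<^bsub>?M\<^esub> (B d' \<otimes>\<^bsub>?M\<^esub> B d) = map_mat (deltad K d') (B d) \<oplus>\<^bsub>?M\<^esub> (B d \<otimes>\<^bsub>?M\<^esub> B d')"
        using sys that by (auto simp: linear_system_def)
      from arg_cong[OF this, of "re n"] show ?thesis
        using that by (simp add: re_mult re_add mult_closed dc B re_deltad map_entries_def)
    qed
  qed (use shk_on dlk_on pk_on operators_commute re_supported in auto)
  then show ?thesis by blast
qed

definition Ck :: "'k set" where
  "Ck = {a. (\<forall>s\<in>S. shk s a = a) \<and> (\<forall>d\<in>D. dlk d a = 0)}"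

lemma e_Ck: "e ` Ck = sd_constants S D K"
proof -
  have "e a \<in> sd_constants S D K \<longleftrightarrow> a \<in> Ck" for a
  proof -
    have "shift K s (e a) = e a \<longleftrightarrow> shk s a = a" if "s \<in> S" for s using e_shk[OF that] e_inj by metis
    moreover have "deltad K d (e a) = \<zero> \<longleftrightarrow> dlk d a = 0" if "d \<in> D" for d using e_dlk[OF that] e_inj e_0 by metis
    ultimately show ?thesis by (simp add: sd_constants_def Ck_def)
  qed
  moreover have "sd_constants S D K \<subseteq> range e" using e_bij by (auto simp: sd_constants_def bij_betw_def)
  ultimately show ?thesis by blast
qed

text \<open>A translation between two notions of polynomial: in the carrier-based one, coefficient
  lists begin with the leading coefficient, hence the reversals. Splitting means that there are as
  many roots as the degree, so at least one.\<close>

lemma Ck_closed: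
  assumes ac: "algebraically_closed (K\<lparr>carrier := sd_constants S D K\<rparr>)"
    and p: "0 < Polynomial.degree p" "\<And>i. poly.coeff p i \<in> Ck"
  shows "\<exists>l\<in>Ck. poly p l = 0"
proof -
  let ?k = "K\<lparr>carrier := sd_constants S D K\<rparr>"
  interpret k: algebraically_closed ?k by (rule ac)
  have sim [simp]: "carrier ?k = e ` Ck" "x \<otimes>\<^bsub>?k\<^esub> y = x \<otimes> y" "x \<oplus>\<^bsub>?k\<^esub> y = x \<oplus> y" "\<one>\<^bsub>?k\<^esub> = e 1" "\<zero>\<^bsub>?k\<^esub> = e 0" for x y
    by (simp_all add: e_Ck e_0 e_1)
  have pow: "e a [^]\<^bsub>?k\<^esub> i = e (a ^ i)" for a and i :: nat
    by (induction i) (simp_all add: e_mult[symmetric] mult.commute)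
  have ev: "k.eval (map e l) (e a) = e (poly (Poly (rev l)) a)" for l a
    by (induction l) (simp_all add: pow Poly_append poly_monom e_mult e_add mult.commute a_comm)
  let ?l = "map e (rev (coeffs p))"
  have p0: "p \<noteq> 0" using p(1) by auto
  then have ne: "?l \<noteq> []" by simp
  have lc: "hd ?l = e (Polynomial.lead_coeff p)" using p0 by (simp add: hd_map hd_rev last_coeffs_eq_coeff_degree)
  have "polynomial\<^bsub>?k\<^esub> (carrier ?k) ?l"
    unfolding polynomial_def using p(2) p0 lc by (auto simp: coeffs_def e_inj)
  then have lp: "?l \<in> carrier (poly_ring ?k)" by (simp add: univ_poly_carrier)
  have "k.splitted ?l" by (rule k.roots_over_carrier[OF lp])
  moreover have "Polynomials.degree ?l = Polynomial.degree p" by (simp add: length_coeffs p0)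
  ultimately have "k.roots ?l \<noteq> {#}" using p(1) unfolding k.splitted_def by (metis less_irrefl size_empty)
  then obtain x where "x \<in># k.roots ?l" by blast
  then have "k.is_root ?l x" using k.roots_mem_iff_is_root[OF lp] by blast
  then have x: "x \<in> e ` Ck" "k.eval ?l x = \<zero>\<^bsub>?k\<^esub>" unfolding k.is_root_def by (simp_all only: sim)
  then obtain a where a: "a \<in> Ck" "x = e a" by blast
  have "e (poly p a) = e 0" using x(2) ev[of "rev (coeffs p)" a] a(2) by simp
  then show ?thesis using a(1) e_inj by blast
qed

theorem picard_vessiot_exists:
  assumes ac: "algebraically_closed (K\<lparr>carrier := sd_constants S D K\<rparr>)"
    and sys: "linear_system S D K n A B"
  shows "\<exists>(L :: ('a, 's, 'd) sdp_struct) (h :: 'a \<Rightarrow> 'a). picard_vessiot S D K n A B L h"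
proof -
  obtain Ai where Ai: "linear_sys S D shk dlk pk n (\<lambda>s. re n (A s)) Ai (\<lambda>d. re n (B d))"
    using linear_sys_copy[OF sys] by blast
  interpret E: linear_sys S D shk dlk pk n "\<lambda>s. re n (A s)" Ai "\<lambda>d. re n (B d)" by (rule Ai)
  have C: "E.C = Ck" by (simp add: E.C_def Ck_def)
  interpret E: linear_sys_closed S D shk dlk pk n "\<lambda>s. re n (A s)" Ai "\<lambda>d. re n (B d)"
    by unfold_locales (use Ck_closed[OF ac] in \<open>auto simp: E.C_alg_closed_def C\<close>)
  obtain g0 :: "'k dpol \<times> 'k dpol \<Rightarrow> 'k" where "inj g0" using inj_dpol_pair by blast
  \<comment> \<open>Codes in the field type become codes in the type of the elements of
    \<open>K\<close>, where the extension must live.\<close>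
  then have "inj (e \<circ> g0)" using e_inj by (intro inj_compose) (auto intro: injI)
  from E.pv_exists[OF shk_surj this]
  obtain L :: "('a, 's, 'd) sdp_struct" and \<theta> Z where
    L: "pseudo_field S D L" "range \<theta> \<subseteq> carrier L" "\<theta> 1 = \<one>\<^bsub>L\<^esub>"
    "\<forall>a b. \<theta> (a + b) = \<theta> a \<oplus>\<^bsub>L\<^esub> \<theta> b \<and> \<theta> (a * b) = \<theta> a \<otimes>\<^bsub>L\<^esub> \<theta> b"
    "\<forall>a. (\<forall>s\<in>S. \<theta> (shk s a) = shift L s (\<theta> a)) \<and> (\<forall>d\<in>D. \<theta> (dlk d a) = deltad L d (\<theta> a)) \<and> \<theta> (pk a) = pard L (\<theta> a)"
    "Z \<in> GL n L"
    "\<forall>s\<in>S. map_mat (shift L s) Z = mat n n (\<lambda>(j, k). \<theta> (re n (A s) j k)) \<otimes>\<^bsub>mat_ring L n\<^esub> Z"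
    "\<forall>d\<in>D. map_mat (deltad L d) Z = mat n n (\<lambda>(j, k). \<theta> (re n (B d) j k)) \<otimes>\<^bsub>mat_ring L n\<^esub> Z"
    "\<forall>T. subring T L \<longrightarrow> range \<theta> \<subseteq> T \<longrightarrow> pard L ` T \<subseteq> T \<longrightarrow> elements_mat Z \<subseteq> T \<longrightarrow>
      (\<forall>x\<in>T \<inter> Units L. inv\<^bsub>L\<^esub> x \<in> T) \<longrightarrow> carrier L \<subseteq> T"
    "sd_constants S D L = \<theta> ` E.C"
    by auto
  define h where "h = \<theta> \<circ> r"
  have he: "h (e a) = \<theta> a" for a by (simp add: h_def r_e)
  have carK: "carrier K = range e" using e_bij by (simp add: bij_betw_def)
  have hom: "h \<in> sdp_hom S D K L"
    unfolding sdp_hom_def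
  proof (intro CollectI conjI)
    show "h \<in> Ring.ring_hom K L"
      by (rule ring_hom_memI)
         (use L(2,3,4) he in \<open>auto simp: carK e_add[symmetric] e_mult[symmetric] e_1[symmetric]\<close>)
    show "\<forall>x\<in>carrier K. (\<forall>s\<in>S. h (shift K s x) = shift L s (h x)) \<and> (\<forall>d\<in>D. h (deltad K d x) = deltad L d (h x)) \<and>
        h (pard K x) = pard L (h x)"
      using L(5) he by (auto simp: carK e_shk[symmetric] e_dlk[symmetric] e_pk[symmetric])
  qed
  have mat: "mat n n (\<lambda>(j, k). \<theta> (re n M j k)) = map_mat h M" if M: "M \<in> carrier (mat_ring K n)" for M
    using mat_carrier(1)[OF M] by (intro eq_matI) (auto simp: h_def re_def)
  have A: "A s \<in> carrier (mat_ring K n)" if "s \<in> S" for s using sys that by (auto simp: linear_system_def Units_def)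
  have B: "B d \<in> carrier (mat_ring K n)" if "d \<in> D" for d using sys that by (auto simp: linear_system_def)
  have gen: "carrier L = par_generated K L h (elements_mat Z)"
  proof
    have hK: "h ` carrier K = range \<theta>" using he by (auto simp: carK image_image)
    show "carrier L \<subseteq> par_generated K L h (elements_mat Z)"
      unfolding par_generated_def hK using L(9) by auto
    interpret LL: sdp_ring S D L using L(1) by (simp add: pseudo_field_def)
    have "subring (carrier L) L" by (rule LL.carrier_is_subring)
    moreover have "pard L ` carrier L \<subseteq> carrier L" using LL.pard_derivation by (auto simp: derivation_def)
    moreover have "elements_mat Z \<subseteq> carrier L" using L(6) by (auto simp: Units_def mat_ring_def)
    ultimately show "par_generated K L h (elements_mat Z) \<subseteq> carrier L"
      unfolding par_generated_def hK using L(2) by (intro Inter_lower) auto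
  qed
  have "sd_constants S D L = h ` sd_constants S D K"
    using L(10) he unfolding C e_Ck[symmetric] by (simp add: image_image)
  moreover have "\<forall>s\<in>S. map_mat (shift L s) Z = map_mat h (A s) \<otimes>\<^bsub>mat_ring L n\<^esub> Z"
    "\<forall>d\<in>D. map_mat (deltad L d) Z = map_mat h (B d) \<otimes>\<^bsub>mat_ring L n\<^esub> Z"
    using L(7,8) mat[OF A] mat[OF B] by auto
  ultimately have "picard_vessiot S D K n A B L h"
    unfolding picard_vessiot_def using L(1,6) hom gen by blast
  then show ?thesis by blast
qed

end

text \<open>The constructions above need a field given as a type. A type cannot depend on \<open>K\<close>, so it is
  chosen once and for all as a copy of a counterexample to the theorem, if there is one.\<close>

definition counterexample :: "('a, 's, 'd) sdp_struct \<Rightarrow> bool" where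
  "counterexample K \<longleftrightarrow> (\<exists>S D n A B. sdp_field S D K \<and> char_zero K \<and>
    algebraically_closed (K\<lparr>carrier := sd_constants S D K\<rparr>) \<and> linear_system S D K n A B \<and>
    \<not> (\<exists>(L :: ('a, 's, 'd) sdp_struct) (h :: 'a \<Rightarrow> 'a). picard_vessiot S D K n A B L h))"

definition bad_field :: "('a, 's, 'd) sdp_struct" where
  "bad_field = (SOME K. counterexample K)"

text \<open>The summand \<open>rat\<close> supplies a field of characteristic zero when there is no
  counterexample, so the choice always succeeds. The dummy arguments record the types of the
  operator symbols, on which \<open>bad_field\<close> depends.\<close>

definition copy_ring :: "'s itself \<Rightarrow> 'd itself \<Rightarrow> ('a + rat) ring" where
  "copy_ring _ _ = (SOME R. field R \<and> char_zero R \<and>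
    (counterexample (bad_field :: ('a, 's, 'd) sdp_struct) \<longrightarrow> Inl \<in> ring_iso (bad_field :: ('a, 's, 'd) sdp_struct) R))"

lemma hom_add_pow:
  assumes "h \<in> Ring.ring_hom K R" "ring K" "ring R" "x \<in> carrier K"
  shows "h (add_pow K (n::nat) x) = add_pow R n (h x)"
proof -
  interpret K: ring K by fact
  interpret R: ring R by fact
  interpret h: ring_hom_ring K R h by (rule ring_hom_ringI2) (use assms in auto)
  show ?thesis
    by (induction n) (simp_all add: assms(4))
qed

lemma char_zero_iso:
  assumes h: "h \<in> ring_iso K R" and K: "ring K" "char_zero K" and R: "ring R"
  shows "char_zero R"
  unfolding char_zero_def
proof (intro allI impI notI)
  interpret K: ring K by fact
  interpret R: ring R by fact
  fix n :: nat assume n: "0 < n" and eq: "add_pow R n \<one>\<^bsub>R\<^esub> = \<zero>\<^bsub>R\<^esub>"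
  have hom: "h \<in> Ring.ring_hom K R" and inj: "inj_on h (carrier K)" using h by (auto simp: ring_iso_def bij_betw_def)
  have "h (add_pow K n \<one>\<^bsub>K\<^esub>) = h \<zero>\<^bsub>K\<^esub>"
    using hom_add_pow[OF hom K(1) R K.one_closed, of n] ring_hom_one[OF hom] ring_hom_zero[OF hom K(1) R] eq by simp
  then have "add_pow K n \<one>\<^bsub>K\<^esub> = \<zero>\<^bsub>K\<^esub>" using inj_onD[OF inj] by simp
  then show False using K(2) n by (simp add: char_zero_def)
qed

lemma rat_ring: "field (ring_of_type_algebra :: rat ring)" "char_zero (ring_of_type_algebra :: rat ring)"
proof -
  show f: "field (ring_of_type_algebra :: rat ring)" by (rule field_from_type_algebra)
  interpret field "ring_of_type_algebra :: rat ring" by (rule f)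
  have "add_pow ring_of_type_algebra n (1::rat) = of_nat n" for n :: nat
  proof (induction n)
    case 0
    then show ?case using add.nat_pow_0[of 1] by (simp add: ring_of_type_algebra_def)
  next
    case (Suc n)
    then show ?case using add.nat_pow_Suc[of n 1] by (simp add: ring_of_type_algebra_def)
  qed
  then show "char_zero (ring_of_type_algebra :: rat ring)"
    by (simp add: char_zero_def) (simp add: ring_of_type_algebra_def)
qed

text \<open>The witnesses are the image of the counterexample under \<open>Inl\<close> and, failing
  that, the image of the rationals under \<open>Inr\<close>.\<close>

lemma copy_ring:
  "field (copy_ring TYPE('s) TYPE('d) :: ('a + rat) ring)"
  "char_zero (copy_ring TYPE('s) TYPE('d) :: ('a + rat) ring)"
  "counterexample (bad_field :: ('a, 's, 'd) sdp_struct) \<Longrightarrow>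
    Inl \<in> ring_iso (bad_field :: ('a, 's, 'd) sdp_struct) (copy_ring TYPE('s) TYPE('d))"
proof -
  let ?K = "bad_field :: ('a, 's, 'd) sdp_struct"
  have "\<exists>R :: ('a + rat) ring. field R \<and> char_zero R \<and> (counterexample ?K \<longrightarrow> Inl \<in> ring_iso ?K R)"
  proof (cases "counterexample ?K")
    case True
    then have K: "field ?K" "char_zero ?K" by (auto simp: counterexample_def sdp_field_def)
    interpret K: field ?K by (rule K(1))
    let ?R = "image_ring Inl ?K :: ('a + rat) ring"
    have R: "field ?R" and iso: "Inl \<in> ring_iso ?K ?R"
      by (rule K.inj_imp_image_ring_is_field inj_imp_image_ring_iso; simp)+
    interpret R: field ?R by (rule R)
    have "char_zero ?R" by (rule char_zero_iso[OF iso K.ring_axioms K(2) R.ring_axioms])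
    then show ?thesis using R iso by blast
  next
    case False
    let ?Q = "ring_of_type_algebra :: rat ring"
    interpret Q: field ?Q by (rule rat_ring)
    let ?R = "image_ring Inr ?Q :: ('a + rat) ring"
    have R: "field ?R" and iso: "Inr \<in> ring_iso ?Q ?R"
      by (rule Q.inj_imp_image_ring_is_field inj_imp_image_ring_iso; simp)+
    interpret R: field ?R by (rule R)
    have "char_zero ?R" by (rule char_zero_iso[OF iso Q.ring_axioms rat_ring(2) R.ring_axioms])
    then show ?thesis using R False by blast
  qed
  from someI_ex[OF this]
  show "field (copy_ring TYPE('s) TYPE('d) :: ('a + rat) ring)"
    "char_zero (copy_ring TYPE('s) TYPE('d) :: ('a + rat) ring)"
    "counterexample ?K \<Longrightarrow> Inl \<in> ring_iso ?K (copy_ring TYPE('s) TYPE('d))"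
    unfolding copy_ring_def by blast+
qed

section \<open>The chosen field as a type\<close>

typedef ('a, 's, 'd) copy = "carrier (copy_ring TYPE('s) TYPE('d) :: ('a + rat) ring)"
proof -
  interpret field "copy_ring TYPE('s) TYPE('d) :: ('a + rat) ring" by (rule copy_ring(1))
  show ?thesis using zero_closed by blast
qed

instantiation copy :: (type, type, type) field
begin

definition "0 = (Abs_copy \<zero>\<^bsub>copy_ring TYPE('b) TYPE('c)\<^esub> :: ('a, 'b, 'c) copy)"
definition "1 = (Abs_copy \<one>\<^bsub>copy_ring TYPE('b) TYPE('c)\<^esub> :: ('a, 'b, 'c) copy)"
definition "x + y = (Abs_copy (Rep_copy x \<oplus>\<^bsub>copy_ring TYPE('b) TYPE('c)\<^esub> Rep_copy y) :: ('a, 'b, 'c) copy)"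
definition "x * y = (Abs_copy (Rep_copy x \<otimes>\<^bsub>copy_ring TYPE('b) TYPE('c)\<^esub> Rep_copy y) :: ('a, 'b, 'c) copy)"
definition "- x = (Abs_copy (\<ominus>\<^bsub>copy_ring TYPE('b) TYPE('c)\<^esub> Rep_copy x) :: ('a, 'b, 'c) copy)"
definition "x - y = (x + - y :: ('a, 'b, 'c) copy)"
definition "inverse x = (if x = 0 then 0 else Abs_copy (inv\<^bsub>copy_ring TYPE('b) TYPE('c)\<^esub> Rep_copy x) :: ('a, 'b, 'c) copy)"
definition "x div y = (x * inverse y :: ('a, 'b, 'c) copy)"

lemma Rep_copy_0: "Rep_copy (0 :: ('a, 'b, 'c) copy) = \<zero>\<^bsub>copy_ring TYPE('b) TYPE('c)\<^esub>"
  and Rep_copy_1: "Rep_copy (1 :: ('a, 'b, 'c) copy) = \<one>\<^bsub>copy_ring TYPE('b) TYPE('c)\<^esub>"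
  and Rep_copy_add: "Rep_copy (x + y) = Rep_copy x \<oplus>\<^bsub>copy_ring TYPE('b) TYPE('c)\<^esub> Rep_copy y"
  and Rep_copy_mult: "Rep_copy (x * y) = Rep_copy x \<otimes>\<^bsub>copy_ring TYPE('b) TYPE('c)\<^esub> Rep_copy y"
  and Rep_copy_uminus: "Rep_copy (- x) = \<ominus>\<^bsub>copy_ring TYPE('b) TYPE('c)\<^esub> Rep_copy x"
  and Rep_copy_inverse_mult: "x \<noteq> 0 \<Longrightarrow> Rep_copy (inverse x) \<otimes>\<^bsub>copy_ring TYPE('b) TYPE('c)\<^esub> Rep_copy x = \<one>\<^bsub>copy_ring TYPE('b) TYPE('c)\<^esub>"
  for x y :: "('a, 'b, 'c) copy"
proof -
  interpret F: field "copy_ring TYPE('b) TYPE('c) :: ('a + rat) ring" by (rule copy_ring(1))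
  note c = Rep_copy[where ?'a = 'a and ?'s = 'b and ?'d = 'c]
  show r0: "Rep_copy (0 :: ('a, 'b, 'c) copy) = \<zero>\<^bsub>copy_ring TYPE('b) TYPE('c)\<^esub>"
    and "Rep_copy (1 :: ('a, 'b, 'c) copy) = \<one>\<^bsub>copy_ring TYPE('b) TYPE('c)\<^esub>"
    by (simp_all add: zero_copy_def one_copy_def Abs_copy_inverse)
  show "Rep_copy (x + y) = Rep_copy x \<oplus>\<^bsub>copy_ring TYPE('b) TYPE('c)\<^esub> Rep_copy y"
    and "Rep_copy (x * y) = Rep_copy x \<otimes>\<^bsub>copy_ring TYPE('b) TYPE('c)\<^esub> Rep_copy y"
    and "Rep_copy (- x) = \<ominus>\<^bsub>copy_ring TYPE('b) TYPE('c)\<^esub> Rep_copy x"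
    using c by (simp_all add: plus_copy_def times_copy_def uminus_copy_def Abs_copy_inverse)
  assume x: "x \<noteq> 0"
  then have "Rep_copy x \<noteq> \<zero>\<^bsub>copy_ring TYPE('b) TYPE('c)\<^esub>" using r0 Rep_copy_inject by metis
  then have u: "Rep_copy x \<in> Units (copy_ring TYPE('b) TYPE('c))" using c by (simp add: F.field_Units)
  then show "Rep_copy (inverse x) \<otimes>\<^bsub>copy_ring TYPE('b) TYPE('c)\<^esub> Rep_copy x = \<one>\<^bsub>copy_ring TYPE('b) TYPE('c)\<^esub>"
    using x by (simp add: inverse_copy_def Abs_copy_inverse)
qed

lemmas Rep_copy_simps = Rep_copy_inject[symmetric] Rep_copy_0 Rep_copy_1 Rep_copy_add Rep_copy_mult Rep_copy_uminus

instance
proof -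
  interpret F: field "copy_ring TYPE('b) TYPE('c) :: ('a + rat) ring" by (rule copy_ring(1))
  have inv0: "inverse 0 = (0 :: ('a, 'b, 'c) copy)" by (simp add: inverse_copy_def)
  have inv: "Rep_copy (inverse x) \<otimes>\<^bsub>copy_ring TYPE('b) TYPE('c)\<^esub> Rep_copy x = \<one>\<^bsub>copy_ring TYPE('b) TYPE('c)\<^esub>"
    "Rep_copy x \<otimes>\<^bsub>copy_ring TYPE('b) TYPE('c)\<^esub> Rep_copy (inverse x) = \<one>\<^bsub>copy_ring TYPE('b) TYPE('c)\<^esub>"
    if "x \<noteq> 0" for x :: "('a, 'b, 'c) copy"
    using Rep_copy_inverse_mult[OF that] F.m_comm[OF Rep_copy Rep_copy, of x "inverse x"] by simp_all
  show "OFCLASS(('a, 'b, 'c) copy, field_class)"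
    by intro_classes
      (simp_all add: Rep_copy_simps inv inv0 Rep_copy minus_copy_def divide_copy_def
        F.a_assoc F.a_comm F.a_lcomm F.m_assoc F.m_comm F.m_lcomm F.l_distr F.r_distr F.l_neg F.r_neg)
qed

end

instance copy :: (type, type, type) field_char_0
proof
  interpret F: field "copy_ring TYPE('b) TYPE('c) :: ('a + rat) ring" by (rule copy_ring(1))
  have n: "Rep_copy (of_nat n :: ('a, 'b, 'c) copy) = add_pow (copy_ring TYPE('b) TYPE('c)) n \<one>\<^bsub>copy_ring TYPE('b) TYPE('c)\<^esub>" for n :: nat
    by (induction n) (simp_all add: Rep_copy_simps F.a_comm)
  have pos: "of_nat n \<noteq> (0 :: ('a, 'b, 'c) copy)" if "0 < n" for n
    using copy_ring(2) that unfolding char_zero_def Rep_copy_simps n by blast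
  have lt: "of_nat m \<noteq> (of_nat n :: ('a, 'b, 'c) copy)" if "m < n" for m n
  proof
    assume "of_nat m = (of_nat n :: ('a, 'b, 'c) copy)"
    then have "of_nat (n - m) = (0 :: ('a, 'b, 'c) copy)" using that by (simp add: of_nat_diff)
    then show False using pos[of "n - m"] that by simp
  qed
  show "inj (of_nat :: nat \<Rightarrow> ('a, 'b, 'c) copy)"
  proof (rule injI)
    fix m n assume "of_nat m = (of_nat n :: ('a, 'b, 'c) copy)"
    then show "m = n" using lt[of m n] lt[of n m] by (cases m n rule: linorder_cases) simp_all
  qed
qed

text \<open>In this case all elements of the copied ring are images under \<open>Inl\<close>, so
  \<open>projl\<close> decodes them.\<close>

lemma counterexample_copy:
  assumes cex: "counterexample (bad_field :: ('a, 's, 'd) sdp_struct)"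
  shows "\<exists>e :: ('a, 's, 'd) copy \<Rightarrow> 'a. bij_betw e UNIV (carrier (bad_field :: ('a, 's, 'd) sdp_struct)) \<and>
    e 1 = \<one>\<^bsub>bad_field :: ('a, 's, 'd) sdp_struct\<^esub> \<and>
    (\<forall>a b. e (a + b) = e a \<oplus>\<^bsub>bad_field :: ('a, 's, 'd) sdp_struct\<^esub> e b \<and>
      e (a * b) = e a \<otimes>\<^bsub>bad_field :: ('a, 's, 'd) sdp_struct\<^esub> e b)"
proof -
  let ?K = "bad_field :: ('a, 's, 'd) sdp_struct" and ?R = "copy_ring TYPE('s) TYPE('d) :: ('a + rat) ring"
  have iso: "Inl \<in> ring_iso ?K ?R" by (rule copy_ring(3)[OF cex])
  then have hom: "Inl \<in> Ring.ring_hom ?K ?R" and bij: "bij_betw Inl (carrier ?K) (carrier ?R)"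
    by (auto simp: ring_iso_def)
  interpret K: field ?K using cex by (auto simp: counterexample_def sdp_field_def)
  define e where "e = (\<lambda>x :: ('a, 's, 'd) copy. projl (Rep_copy x))"
  have e: "e x \<in> carrier ?K \<and> Inl (e x) = Rep_copy x" for x
  proof -
    have "Rep_copy x \<in> Inl ` carrier ?K" using Rep_copy[of x] bij by (simp add: bij_betw_def)
    then show ?thesis by (auto simp: e_def)
  qed
  have eqI: "e x = y" if "Rep_copy x = Inl y" for x y using that by (simp add: e_def)
  have "bij_betw e UNIV (carrier ?K)"
    unfolding bij_betw_def
  proof
    show "inj e" using e by (metis injI Rep_copy_inject)
    have "y \<in> range e" if "y \<in> carrier ?K" for y
    proof -
      have "Inl y \<in> carrier ?R" using bij that unfolding bij_betw_def by blast
      then have "e (Abs_copy (Inl y)) = y" by (intro eqI) (rule Abs_copy_inverse)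
      then show ?thesis by (metis rangeI)
    qed
    then show "range e = carrier ?K" using e by blast
  qed
  moreover have "e 1 = \<one>\<^bsub>?K\<^esub>" by (rule eqI) (simp add: Rep_copy_1 ring_hom_one[OF hom])
  moreover have "e (a + b) = e a \<oplus>\<^bsub>?K\<^esub> e b" "e (a * b) = e a \<otimes>\<^bsub>?K\<^esub> e b" for a b
    by (rule eqI; simp add: Rep_copy_add Rep_copy_mult e ring_hom_add[OF hom] ring_hom_mult[OF hom])+
  ultimately show ?thesis by blast
qed

theorem corollary10:
  fixes K :: "('a, 's, 'd) sdp_struct" and S :: "'s set" and D :: "'d set"
    and n :: nat and A :: "'s \<Rightarrow> 'a mat" and B :: "'d \<Rightarrow> 'a mat"
  assumes "S \<noteq> {} \<or> D \<noteq> {}"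
    and "sdp_field S D K"
    and "char_zero K"
    and "algebraically_closed (K\<lparr>carrier := sd_constants S D K\<rparr>)"
    and "linear_system S D K n A B"
  shows "\<exists>(L :: ('a, 's, 'd) sdp_struct) (h :: 'a \<Rightarrow> 'a). picard_vessiot S D K n A B L h"
proof (rule ccontr)
  assume "\<nexists>(L :: ('a, 's, 'd) sdp_struct) (h :: 'a \<Rightarrow> 'a). picard_vessiot S D K n A B L h"
  \<comment> \<open>The type \<open>copy\<close> depends on the types involved but not on
    \<open>K\<close>. So the failure at \<open>K\<close> is moved to \<open>bad_field\<close>,
    chosen in advance, of which that type is then a copy; its existence theorem gives the
    contradiction.\<close>
  then have "counterexample K" unfolding counterexample_def using assms(2-5) by blast
  then have cex: "counterexample (bad_field :: ('a, 's, 'd) sdp_struct)" unfolding bad_field_def by (rule someI)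
  let ?K = "bad_field :: ('a, 's, 'd) sdp_struct"
  obtain S D n A B where K: "sdp_field S D ?K" "algebraically_closed (?K\<lparr>carrier := sd_constants S D ?K\<rparr>)"
    "linear_system S D ?K n A B" "\<not> (\<exists>(L :: ('a, 's, 'd) sdp_struct) (h :: 'a \<Rightarrow> 'a). picard_vessiot S D ?K n A B L h)"
    using cex unfolding counterexample_def by blast
  obtain e :: "('a, 's, 'd) copy \<Rightarrow> 'a" where e: "bij_betw e UNIV (carrier ?K)" "e 1 = \<one>\<^bsub>?K\<^esub>"
    "\<forall>a b. e (a + b) = e a \<oplus>\<^bsub>?K\<^esub> e b \<and> e (a * b) = e a \<otimes>\<^bsub>?K\<^esub> e b"
    using counterexample_copy[OF cex] by blast
  interpret sdp_field S D ?K by (rule K(1))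
  interpret sdp_field_copy S D ?K e by unfold_locales (use e in auto)
  show False using picard_vessiot_exists[OF K(2,3)] K(4) by blast
qed

end
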